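(* The following containments hold: $$\mathcal{H}_\mu^{\mathrm{norm}}\supseteq\mathcal{H}_\mu^{\mathrm{strong}}\supseteq\mathcal{H}_\mu^{\mathrm{det}}.$$ Thus, $\mathcal{H}_\mu^{\mathrm{det}}=\mathcal{G}$ implies that $\mathcal{P}_\mu^{\mathrm{strong}}\neq\emptyset$, and $\mathcal{H}_\mu^{\mathrm{norm}}\neq\mathcal{G}$ implies that $\mathcal{P}_\mu^{\mathrm{strong}}=\emptyset$.
   Context: $\mathbb{N}=\{1,2,\dots\}$. Let $(G_k)_{k\in\mathbb{N}}$ be a sequence of compact Hausdorff groups with countable bases, with identities $e_k$, let $\phi_k:G_{k+1}\to G_k$ be a continuous homomorphism for each $k$, and let $G:=\prod_{k\in\mathbb{N}}G_k$ with the product topology. For $k<\ell$ put $\phi_k^\ell:=\phi_k\circ\phi_{k+1}\circ\cdots\circ\phi_{\ell-1}:G_\ell\to G_k$, and let $\phi_k^k$ be the identity map of $G_k$. Let $\mu=(\mu_k)_{k\in\mathbb{N}}$, where $\mu_k$ is a Borel probability measure on $G_k$. Let $X_k:G\to G_k$ be the $k$-th coordinate map and $Z_k:=\phi_k(X_{k+1})^{-1}X_k$. The set $\mathcal{P}_\mu$ of solutions of the stochastic equation associated with $\mu$ is the set of Borel probability measures $\mathbb{P}$ on $G$ such that for every $k\in\mathbb{N}$ and every bounded Borel $f:G_k\to\mathbb{R}$, the conditional expectation of $f(X_k)$ given $(X_j)_{j>k}$ under $\mathbb{P}$ equals $\int_{G_k}f(\phi_k(X_{k+1})z)\,\mu_k(dz)$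 $\mathbb{P}$-a.s.; equivalently, for every $k$, under $\mathbb{P}$ the variable $Z_k$ has distribution $\mu_k$ and is independent of $(X_j)_{j>k}$. The set $\mathcal{P}_\mu$ is convex (and compact for weak convergence), and $\mathcal{P}_\mu^{\mathrm{ex}}$ denotes its set of extreme points. Put $\mathcal{F}^Z_k:=\sigma((Z_j)_{j\ge k})$. A solution $\mathbb{P}\in\mathcal{P}_\mu$ is strong if for each $k\in\mathbb{N}$ the variable $X_k$ is $\mathcal{F}^Z_k$-measurable up to $\mathbb{P}$-null sets; $\mathcal{P}_\mu^{\mathrm{strong}}$ denotes the set of strong solutions. $\mathcal{G}$ is the set of all (continuous) unitary, finite-dimensional representations of $G$. For $k\in\mathbb{N}$, $\iota_k:G_k\to G$ sends $h$ to $(e_1,\dots,e_{k-1},h,e_{k+1},\dots)$. Define $$\mathcal{H}_\mu^{\mathrm{strong}}:=\{\rho\in\mathcal{G}:\ \exists\,\mathbb{P}\in\mathcal{P}_\mu^{\mathrm{ex}}\text{ such that }\rho\circ\iota_k(X_k)\text{ is }\mathcal{F}^Z_k\text{-measurable }\mathbb{P}\text{-a.s. for all }k\in\mathbb{N}\},$$ where measurable $\mathbb{P}$-a.s. means measurable up to $\mathbb{P}$-null sets. For $\rho\in\mathcal{G}$ and $k\le\ell$ set $R_k^\ell:=\int_{G_\ell}\rho\circ\iota_k\circ\phi_k^\ell(z)\,\mu_\ell(dz)$ (depending on $\rho$), and $$\mathcal{H}_\mu^{\mathrm{det}}:=\{\rho\in\mathcal{G}:\lim_{m\to\infty}\lim_{n\to\infty}|\det(R_k^nR_k^{n-1}\cdots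 R_k^m)|>0\ \ \forall k\in\mathbb{N}\},$$ $$\mathcal{H}_\mu^{\mathrm{norm}}:=\{\rho\in\mathcal{G}:\lim_{m\to\infty}\lim_{n\to\infty}\|R_k^nR_k^{n-1}\cdots R_k^m\|>0\ \ \forall k\in\mathbb{N}\},$$ where $\|\cdot\|$ is the $\ell^2$ operator norm. (These iterated limits always exist by monotonicity.) *)

theory Defs
  imports
    "HOL-Probability.Probability"
    "HOL-Algebra.Product_Groups"
    "Jordan_Normal_Form.Determinant"
    "Jordan_Normal_Form.Schur_Decomposition"
begin

section \<open>Topological groups and Borel structures on abstract topologies\<close>

definition topological_group :: "('a, 'b) monoid_scheme \<Rightarrow> 'a topology \<Rightarrow> bool" where
  "topological_group \<Gamma> T \<longleftrightarrow>
     group \<Gamma> \<and> topspace T = carrier \<Gamma> \<and>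
     continuous_map (prod_topology T T) T (\<lambda>(x, y). x \<otimes>\<^bsub>\<Gamma>\<^esub> y) \<and>
     continuous_map T T (\<lambda>x. inv\<^bsub>\<Gamma>\<^esub> x)"

definition borel_of :: "'a topology \<Rightarrow> 'a measure" where
  "borel_of T = sigma (topspace T) {U. openin T U}"

definition borel_prob :: "'a topology \<Rightarrow> 'a measure set" where
  "borel_prob T = {M. sets M = sets (borel_of T) \<and> prob_space M}"

section \<open>Generated and augmented sigma-algebras\<close>

definition gen_sigma :: "'w set \<Rightarrow> 'i set \<Rightarrow> ('i \<Rightarrow> 'w \<Rightarrow> 'b) \<Rightarrow> ('i \<Rightarrow> 'b measure) \<Rightarrow> 'w measure" where
  "gen_sigma \<Omega> I Y N = sigma \<Omega> (\<Union>i\<in>I. {Y i -` A \<inter> \<Omega> | A. A \<in> sets (N i)})"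

text \<open>Measurability of a random variable \<^emph>\<open>up to \<open>P\<close>-null sets\<close> with respect to \<open>F\<close> is
  measurability with respect to the sigma-algebra generated by \<open>F\<close> and the \<open>P\<close>-null sets.\<close>

definition augment :: "'w measure \<Rightarrow> 'w measure \<Rightarrow> 'w measure" where
  "augment P F = sigma (space P) (sets F \<union> null_sets P)"

section \<open>The stochastic equation\<close>

text \<open>The sequences are indexed by \<^typ>\<open>nat\<close> starting from \<open>0\<close>. The groups \<open>G k\<close> have carriers in one
  common type; \<open>T k\<close> is the topology of \<open>G k\<close>, and \<open>\<phi> k\<close> maps \<open>G (Suc k)\<close> to \<open>G k\<close>.
  A point of the sample space is \<open>x \<in> carrier (product_group UNIV G)\<close>, and the coordinate
  map \<open>X k\<close> is \<open>\<lambda>x. x k\<close>.\<close>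

abbreviation prod_top :: "(nat \<Rightarrow> 'a topology) \<Rightarrow> (nat \<Rightarrow> 'a) topology" where
  "prod_top T \<equiv> product_topology T UNIV"

definition Z_var :: "(nat \<Rightarrow> 'a monoid) \<Rightarrow> (nat \<Rightarrow> 'a \<Rightarrow> 'a) \<Rightarrow> nat \<Rightarrow> (nat \<Rightarrow> 'a) \<Rightarrow> 'a" where
  "Z_var G \<phi> k x = inv\<^bsub>G k\<^esub> (\<phi> k (x (Suc k))) \<otimes>\<^bsub>G k\<^esub> x k"

definition future_X :: "(nat \<Rightarrow> 'a topology) \<Rightarrow> nat \<Rightarrow> (nat \<Rightarrow> 'a) measure" where
  "future_X T k = gen_sigma (topspace (prod_top T)) {k<..} (\<lambda>j x. x j) (\<lambda>j. borel_of (T j))"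

definition F_Z :: "(nat \<Rightarrow> 'a monoid) \<Rightarrow> (nat \<Rightarrow> 'a topology) \<Rightarrow> (nat \<Rightarrow> 'a \<Rightarrow> 'a) \<Rightarrow> nat
    \<Rightarrow> (nat \<Rightarrow> 'a) measure" where
  "F_Z G T \<phi> k = gen_sigma (topspace (prod_top T)) {k..} (Z_var G \<phi>) (\<lambda>j. borel_of (T j))"

definition solutions :: "(nat \<Rightarrow> 'a monoid) \<Rightarrow> (nat \<Rightarrow> 'a topology) \<Rightarrow> (nat \<Rightarrow> 'a \<Rightarrow> 'a)
    \<Rightarrow> (nat \<Rightarrow> 'a measure) \<Rightarrow> (nat \<Rightarrow> 'a) measure set" where
  "solutions G T \<phi> \<mu> =
     {P \<in> borel_prob (prod_top T).
        \<forall>k. \<forall>f :: 'a \<Rightarrow> real.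
          f \<in> borel_measurable (borel_of (T k)) \<and> bounded (f ` topspace (T k)) \<longrightarrow>
          (AE x in P. real_cond_exp P (future_X T k) (\<lambda>x. f (x k)) x
                        = (\<integral>z. f (\<phi> k (x (Suc k)) \<otimes>\<^bsub>G k\<^esub> z) \<partial>\<mu> k))}"

text \<open>Measures do not form a real vector space, so the library's \<open>extreme_point_of\<close> does not apply;
  convex combinations are formed setwise.\<close>

definition extreme_measures :: "'w measure set \<Rightarrow> 'w measure set" where
  "extreme_measures \<P> =
     {P \<in> \<P>. \<forall>Q1 \<in> \<P>. \<forall>Q2 \<in> \<P>. \<forall>t :: real. 0 < t \<and> t < 1 \<and>
        (\<forall>A \<in> sets P. measure P A = (1 - t) * measure Q1 A + t * measure Q2 A)
        \<longrightarrow> Q1 = P \<and> Q2 = P}"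

definition strong_solutions :: "(nat \<Rightarrow> 'a monoid) \<Rightarrow> (nat \<Rightarrow> 'a topology) \<Rightarrow> (nat \<Rightarrow> 'a \<Rightarrow> 'a)
    \<Rightarrow> (nat \<Rightarrow> 'a measure) \<Rightarrow> (nat \<Rightarrow> 'a) measure set" where
  "strong_solutions G T \<phi> \<mu> =
     {P \<in> solutions G T \<phi> \<mu>.
        \<forall>k. (\<lambda>x. x k) \<in> augment P (F_Z G T \<phi> k) \<rightarrow>\<^sub>M borel_of (T k)}"

section \<open>Unitary representations\<close>

definition unitary_group :: "nat \<Rightarrow> complex mat monoid" where
  "unitary_group d =
     \<lparr>carrier = {A \<in> carrier_mat d d. A * mat_adjoint A = 1\<^sub>m d \<and> mat_adjoint A * A = 1\<^sub>m d},
      monoid.mult = (*), one = 1\<^sub>m d\<rparr>"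

text \<open>The degree \<open>d\<close> of a representation is positive, i.e. the representation on the zero space is
  excluded. The value of \<open>\<rho>\<close> outside the group is irrelevant.\<close>

definition unitary_reps :: "(nat \<Rightarrow> 'a monoid) \<Rightarrow> (nat \<Rightarrow> 'a topology)
    \<Rightarrow> ((nat \<Rightarrow> 'a) \<Rightarrow> complex mat) set" where
  "unitary_reps G T =
     {\<rho>. \<exists>d>0. \<rho> \<in> hom (product_group UNIV G) (unitary_group d) \<and>
        (\<forall>i<d. \<forall>j<d. continuous_map (prod_top T) euclidean (\<lambda>x. \<rho> x $$ (i, j)))}"

definition rep_dim :: "(nat \<Rightarrow> 'a monoid) \<Rightarrow> ((nat \<Rightarrow> 'a) \<Rightarrow> complex mat) \<Rightarrow> nat" where
  "rep_dim G \<rho> = dim_row (\<rho> \<one>\<^bsub>product_group UNIV G\<^esub>)"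

definition emb :: "(nat \<Rightarrow> 'a monoid) \<Rightarrow> nat \<Rightarrow> 'a \<Rightarrow> nat \<Rightarrow> 'a" where
  "emb G k h = (\<lambda>j. \<one>\<^bsub>G j\<^esub>)(k := h)"

definition H_strong :: "(nat \<Rightarrow> 'a monoid) \<Rightarrow> (nat \<Rightarrow> 'a topology) \<Rightarrow> (nat \<Rightarrow> 'a \<Rightarrow> 'a)
    \<Rightarrow> (nat \<Rightarrow> 'a measure) \<Rightarrow> ((nat \<Rightarrow> 'a) \<Rightarrow> complex mat) set" where
  "H_strong G T \<phi> \<mu> =
     {\<rho> \<in> unitary_reps G T. \<exists>P \<in> extreme_measures (solutions G T \<phi> \<mu>).
        \<forall>k. \<forall>i < rep_dim G \<rho>. \<forall>j < rep_dim G \<rho>.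
          (\<lambda>x. \<rho> (emb G k (x k)) $$ (i, j)) \<in> borel_measurable (augment P (F_Z G T \<phi> k))}"

section \<open>The matrices \<open>R\<close> and the sets they define\<close>

text \<open>\<open>\<phi> k \<circ> \<phi> (k + 1) \<circ> \<dots> \<circ> \<phi> (l - 1)\<close>, which is the identity for \<open>k = l\<close>.\<close>

definition phi_comp :: "(nat \<Rightarrow> 'a \<Rightarrow> 'a) \<Rightarrow> nat \<Rightarrow> nat \<Rightarrow> 'a \<Rightarrow> 'a" where
  "phi_comp \<phi> k l = foldr (\<circ>) (map \<phi> [k..<l]) id"

definition R_mat :: "(nat \<Rightarrow> 'a monoid) \<Rightarrow> (nat \<Rightarrow> 'a \<Rightarrow> 'a) \<Rightarrow> (nat \<Rightarrow> 'a measure)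
    \<Rightarrow> ((nat \<Rightarrow> 'a) \<Rightarrow> complex mat) \<Rightarrow> nat \<Rightarrow> nat \<Rightarrow> complex mat" where
  "R_mat G \<phi> \<mu> \<rho> k l =
     mat (rep_dim G \<rho>) (rep_dim G \<rho>)
       (\<lambda>(i, j). \<integral>z. \<rho> (emb G k (phi_comp \<phi> k l z)) $$ (i, j) \<partial>\<mu> l)"

text \<open>The descending product \<open>R\<^sub>k\<^sup>n R\<^sub>k\<^sup>n\<^sup>-\<^sup>1 \<dots> R\<^sub>k\<^sup>m\<close> with \<open>R\<^sub>k\<^sup>l = R_mat G \<phi> \<mu> \<rho> k l\<close>. Only \<open>k \<le> m \<le> n\<close> is meaningful; the other values do not
  influence the limits below.\<close>

definition R_prod :: "(nat \<Rightarrow> 'a monoid) \<Rightarrow> (nat \<Rightarrow> 'a \<Rightarrow> 'a) \<Rightarrow> (nat \<Rightarrow> 'a measure)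
    \<Rightarrow> ((nat \<Rightarrow> 'a) \<Rightarrow> complex mat) \<Rightarrow> nat \<Rightarrow> nat \<Rightarrow> nat \<Rightarrow> complex mat" where
  "R_prod G \<phi> \<mu> \<rho> k m n = foldr (*) (map (R_mat G \<phi> \<mu> \<rho> k) (rev [m..<Suc n])) (1\<^sub>m (rep_dim G \<rho>))"

definition vec_l2_norm :: "complex vec \<Rightarrow> real" where
  "vec_l2_norm v = L2_set (\<lambda>i. cmod (vec_index v i)) {..<dim_vec v}"

definition op_norm :: "complex mat \<Rightarrow> real" where
  "op_norm A = Sup {vec_l2_norm (A *\<^sub>v v) | v. v \<in> carrier_vec (dim_col A) \<and> vec_l2_norm v \<le> 1}"

definition H_det :: "(nat \<Rightarrow> 'a monoid) \<Rightarrow> (nat \<Rightarrow> 'a topology) \<Rightarrow> (nat \<Rightarrow> 'a \<Rightarrow> 'a)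
    \<Rightarrow> (nat \<Rightarrow> 'a measure) \<Rightarrow> ((nat \<Rightarrow> 'a) \<Rightarrow> complex mat) set" where
  "H_det G T \<phi> \<mu> =
     {\<rho> \<in> unitary_reps G T.
        \<forall>k. lim (\<lambda>m. lim (\<lambda>n. cmod (Determinant.det (R_prod G \<phi> \<mu> \<rho> k m n)))) > 0}"

definition H_norm :: "(nat \<Rightarrow> 'a monoid) \<Rightarrow> (nat \<Rightarrow> 'a topology) \<Rightarrow> (nat \<Rightarrow> 'a \<Rightarrow> 'a)
    \<Rightarrow> (nat \<Rightarrow> 'a measure) \<Rightarrow> ((nat \<Rightarrow> 'a) \<Rightarrow> complex mat) set" where
  "H_norm G T \<phi> \<mu> =
     {\<rho> \<in> unitary_reps G T.
        \<forall>k. lim (\<lambda>m. lim (\<lambda>n. op_norm (R_prod G \<phi> \<mu> \<rho> k m n))) > 0}"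

end

theory Submission
  imports Defs "HOL-Library.Diagonal_Subsequence"
begin

text \<open>
  Write \<open>Z l\<close> for \<open>Z_var G \<phi> l\<close>, and for a representation \<open>\<rho>\<close> of degree \<open>d\<close> and a level \<open>k\<close> put
  \<open>U l h = \<rho> (emb G k (phi_comp \<phi> k l h))\<close>, a unitary matrix for \<open>h\<close> in the group with index \<open>l \<ge> k\<close>.
  The recursion \<open>x l = \<phi> l (x (l + 1)) \<cdot> Z l x\<close> turns into the matrix identity
  \<open>U m (x m) = U n (x n) * V m n x\<close>, where \<open>V m n\<close> is the descending product of the matrices
  \<open>U l (Z l)\<close> for \<open>m \<le> l < n\<close>. A measure solves the equation iff each \<open>Z l\<close> has law \<open>\<mu> l\<close> and is
  independent of the coordinates beyond \<open>l\<close> (\<open>solutions_iff\<close>), so the mean of \<open>V m n\<close> is the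
  product of the matrices \<open>R_mat\<close> (\<open>expectation_V\<close>). These matrices are averages of unitary ones,
  hence contractions, and all the limits in the statement are monotone.

  Norms (\<open>strong_imp_norm_pos\<close>). If the limit of the norms vanished, the mean of \<open>U m (x m)\<close>, being the mean of
  \<open>U n (x n)\<close> times a product of norm close to \<open>0\<close>, would be zero for every \<open>m \<ge> k\<close>. Splitting off the independent
  factors one at a time, the coefficients of \<open>U k (x k)\<close> would be orthogonal to every bounded function of
  \<open>Z k, Z (k + 1), \<dots>\<close>. If they are themselves measurable with respect to these variables, they vanish almost surely,
  which is impossible for the entries of a unitary matrix.

  Determinants (\<open>det_pos_imp_strong\<close>). If the determinants stay away from \<open>0\<close>, a subsequence of the products
  converges to an invertible matrix, so the products between two late times are close to the identity.
  A unitary matrix whose mean is close to the identity is close to it in mean square. Hence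
  \<open>V m n\<close> converges along a subsequence of \<open>n\<close>, almost surely, to a function of the \<open>Z l\<close>, and therefore
  \<open>U n (x n)\<close> converges as well. Its limit depends only on the tail of the sequence of coordinates. An extreme solution has a trivial
  tail, since conditioning on a tail event yields again a solution (\<open>extreme_tail_trivial\<close>). So the limit is a constant matrix, and \<open>U m (x m)\<close> is a function of the \<open>Z l\<close>.
  Extreme solutions exist by a compactness argument (\<open>ex_extreme_solution\<close>).

  The two remaining claims pass from coefficients of representations to the coordinates \<open>x k\<close>. A strong solution makes all
  coefficients of all representations measurable, so all norm limits are positive. If all determinant limits are positive, one extreme solution serves all
  representations at once, and the matrix coefficients of a compact group separate its points
  (\<open>representations_separate_points\<close>, the theorem of Peter and Weyl), so that the \<open>\<sigma>\<close>-algebra which they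
  generate contains all open sets.
\<close>

section \<open>Borel structures and continuous functions\<close>

lemma space_borel_of [simp]: "space (borel_of T) = topspace T"
  by (simp add: borel_of_def space_measure_of_conv)

lemma sets_borel_of: "sets (borel_of T) = sigma_sets (topspace T) {U. openin T U}"
  unfolding borel_of_def by (rule sets_measure_of) (auto dest: openin_subset)

lemma openin_imp_borel_of: "openin T U \<Longrightarrow> U \<in> sets (borel_of T)"
  by (simp add: sets_borel_of sigma_sets.Basic)

lemma measurable_into_borel_of:
  assumes "\<And>x. x \<in> space M \<Longrightarrow> f x \<in> topspace T"
    and "\<And>U. openin T U \<Longrightarrow> f -` U \<inter> space M \<in> sets M"
  shows "f \<in> M \<rightarrow>\<^sub>M borel_of T"
  unfolding borel_of_def by (rule measurable_measure_of) (use assms in \<open>auto dest: openin_subset\<close>)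

lemma continuous_map_borel_of:
  assumes "continuous_map S T f" shows "f \<in> borel_of S \<rightarrow>\<^sub>M borel_of T"
proof (rule measurable_into_borel_of)
  show "\<And>x. x \<in> space (borel_of S) \<Longrightarrow> f x \<in> topspace T"
    using assms by (auto simp: continuous_map_def)
  fix U assume "openin T U"
  then have "openin S {x \<in> topspace S. f x \<in> U}" using assms by (auto simp: continuous_map_def)
  moreover have "f -` U \<inter> space (borel_of S) = {x \<in> topspace S. f x \<in> U}" by auto
  ultimately show "f -` U \<inter> space (borel_of S) \<in> sets (borel_of S)" by (simp add: openin_imp_borel_of)
qed

lemma sets_borel_of_euclidean: "sets (borel_of euclidean) = sets borel"
  by (simp add: sets_borel_of borel_def)

lemma continuous_map_borel_measurable:
  assumes "continuous_map S euclidean f" shows "f \<in> borel_measurable (borel_of S)"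
  using continuous_map_borel_of[OF assms] measurable_cong_sets[OF refl sets_borel_of_euclidean] by blast

text \<open>
  A countable base in the form of a sequence; repetitions and the empty set are permitted, which makes a finite base
  a special case.
\<close>

definition enum_base :: "'a topology \<Rightarrow> (nat \<Rightarrow> 'a set) \<Rightarrow> bool" where
  "enum_base T B \<longleftrightarrow> (\<forall>n. openin T (B n)) \<and> (\<forall>U x. openin T U \<longrightarrow> x \<in> U \<longrightarrow> (\<exists>n. x \<in> B n \<and> B n \<subseteq> U))"

lemma enum_baseD:
  assumes "enum_base T B"
  shows "openin T (B n)" "openin T U \<Longrightarrow> x \<in> U \<Longrightarrow> \<exists>n. x \<in> B n \<and> B n \<subseteq> U"
  using assms by (auto simp: enum_base_def)

lemma ex_enum_base:
  assumes "second_countable T" shows "\<exists>B. enum_base T B"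
proof -
  obtain \<B> where \<B>: "countable \<B>" "\<And>V. V \<in> \<B> \<Longrightarrow> openin T V"
    "\<And>U x. openin T U \<and> x \<in> U \<longrightarrow> (\<exists>V \<in> \<B>. x \<in> V \<and> V \<subseteq> U)"
    using assms by (auto simp: second_countable_def)
  let ?B = "from_nat_into (insert {} \<B>)"
  have r: "range ?B = insert {} \<B>" using \<B>(1) by (intro range_from_nat_into) auto
  have "openin T (?B n)" for n using r \<B>(2) by (metis insert_iff openin_empty rangeI)
  moreover have "\<exists>n. x \<in> ?B n \<and> ?B n \<subseteq> U" if "openin T U" "x \<in> U" for U x
  proof -
    obtain V where V: "V \<in> \<B>" "x \<in> V" "V \<subseteq> U" using \<B>(3) \<open>openin T U\<close> \<open>x \<in> U\<close> by metis
    then have "V \<in> range ?B" using r by auto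
    then show ?thesis using V by auto
  qed
  ultimately show ?thesis unfolding enum_base_def by blast
qed

text \<open>
  The Borel structure of a product topology is in general finer than the product of the Borel structures. Countable bases
  make them agree because an open set is a countable union of rectangles.
\<close>

lemma openin_prod_imp_pair_borel:
  assumes S: "second_countable S" and T: "second_countable T" and U: "openin (prod_topology S T) U"
  shows "U \<in> sets (borel_of S \<Otimes>\<^sub>M borel_of T)"
proof -
  obtain B where "enum_base S B" using ex_enum_base[OF S] ..
  note B = enum_baseD[OF this]
  obtain C where "enum_base T C" using ex_enum_base[OF T] ..
  note C = enum_baseD[OF this]
  have "U = (\<Union>p\<in>{(m,n). B m \<times> C n \<subseteq> U}. B (fst p) \<times> C (snd p))" (is "_ = ?V")
  proof
    show "U \<subseteq> ?V"
    proof clarify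
      fix x y assume xy: "(x,y) \<in> U"
      obtain V W where VW: "openin S V" "openin T W" "x \<in> V" "y \<in> W" "V \<times> W \<subseteq> U"
        using U xy unfolding openin_prod_topology_alt by meson
      obtain m n where "x \<in> B m" "B m \<subseteq> V" "y \<in> C n" "C n \<subseteq> W" using B(2) C(2) VW by metis
      then show "(x,y) \<in> ?V" using VW by (intro UN_I[of "(m,n)"]) auto
    qed
  qed auto
  also have "\<dots> \<in> sets (borel_of S \<Otimes>\<^sub>M borel_of T)"
    by (intro sets.countable_UN') (auto intro!: pair_measureI openin_imp_borel_of B(1) C(1))
  finally show ?thesis .
qed

lemma continuous_map_pair_borel:
  assumes "second_countable S" "second_countable T" "continuous_map (prod_topology S T) W f"
  shows "f \<in> (borel_of S \<Otimes>\<^sub>M borel_of T) \<rightarrow>\<^sub>M borel_of W"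
proof (rule measurable_into_borel_of)
  show "\<And>x. x \<in> space (borel_of S \<Otimes>\<^sub>M borel_of T) \<Longrightarrow> f x \<in> topspace W"
    using assms(3) by (auto simp: continuous_map_def space_pair_measure)
  fix U assume "openin W U"
  then have "openin (prod_topology S T) {x \<in> topspace (prod_topology S T). f x \<in> U}"
    using assms(3) by (auto simp: continuous_map_def)
  from openin_prod_imp_pair_borel[OF assms(1,2) this]
  show "f -` U \<inter> space (borel_of S \<Otimes>\<^sub>M borel_of T) \<in> sets (borel_of S \<Otimes>\<^sub>M borel_of T)"
    by (simp add: space_pair_measure vimage_def Int_def conj_commute)
qed

text \<open>
  Base sets of the product are given by finitely many conditions that a coordinate lies in a member of the base of its factor,
  that is, by finite sets of pairs of indices; there are countably many of these.
\<close>

lemma second_countable_product_topology: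
  fixes T :: "nat \<Rightarrow> 'a topology"
  assumes "\<And>i. second_countable (T i)"
  shows "second_countable (product_topology T UNIV)"
proof -
  have "\<forall>i. \<exists>B. enum_base (T i) B" using ex_enum_base assms by blast
  then obtain B where "\<forall>i. enum_base (T i) (B i)" by (rule choice[THEN exE])
  then have B: "openin (T i) (B i n)" "openin (T i) U \<Longrightarrow> y \<in> U \<Longrightarrow> \<exists>n. y \<in> B i n \<and> B i n \<subseteq> U" for i n U y
    using enum_baseD(1)[of "T i" "B i"] enum_baseD(2)[of "T i" "B i" U y] by auto
  let ?\<Omega> = "topspace (product_topology T UNIV)"
  define W where "W F = {x \<in> ?\<Omega>. \<forall>(i,n)\<in>F. x i \<in> B i n}" for F :: "(nat \<times> nat) set"
  show ?thesis unfolding second_countable_def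
  proof (intro exI conjI)
    show "countable (W ` {F. finite F})" by (intro countable_image countable_Collect_finite)
    show "\<forall>V\<in>W ` {F. finite F}. openin (product_topology T UNIV) V"
    proof clarify
      fix F :: "(nat \<times> nat) set" assume "finite F"
      have W: "W F = (\<Inter>p\<in>F. {x \<in> ?\<Omega>. x (fst p) \<in> B (fst p) (snd p)}) \<inter> ?\<Omega>"
        by (force simp: W_def)
      have "openin (product_topology T UNIV) {x \<in> ?\<Omega>. x (fst p) \<in> B (fst p) (snd p)}" for p
        by (intro openin_continuous_map_preimage[of _ "T (fst p)"] continuous_map_product_projection B) auto
      then show "openin (product_topology T UNIV) (W F)"
        unfolding W using \<open>finite F\<close> openin_topspace[of "product_topology T UNIV"]
        by (cases "F = {}") (simp, intro openin_Int openin_Inter, auto)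
    qed
    show "\<forall>U x. openin (product_topology T UNIV) U \<and> x \<in> U \<longrightarrow> (\<exists>V\<in>W ` {F. finite F}. x \<in> V \<and> V \<subseteq> U)"
    proof clarify
      fix U x assume U: "openin (product_topology T UNIV) U" and x: "x \<in> U"
      then obtain V where V: "finite {i. V i \<noteq> topspace (T i)}" "\<And>i. openin (T i) (V i)"
        "x \<in> Pi\<^sub>E UNIV V" "Pi\<^sub>E UNIV V \<subseteq> U"
        unfolding openin_product_topology_alt by force
      have "\<forall>i. \<exists>n. x i \<in> B i n \<and> B i n \<subseteq> V i" using B(2) V by (meson PiE_E UNIV_I)
      then obtain n where n: "\<And>i. x i \<in> B i (n i) \<and> B i (n i) \<subseteq> V i" by metis
      let ?F = "(\<lambda>i. (i, n i)) ` {i. V i \<noteq> topspace (T i)}"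
      have "x \<in> W ?F" using n openin_subset[OF U] x by (auto simp: W_def)
      moreover have "W ?F \<subseteq> U"
      proof
        fix y assume y: "y \<in> W ?F"
        have "y i \<in> V i" for i using y n[of i] by (cases "V i = topspace (T i)") (simp_all add: W_def PiE_iff, blast)
        then show "y \<in> U" using V(4) by auto
      qed
      ultimately show "\<exists>V\<in>W ` {F. finite F}. x \<in> V \<and> V \<subseteq> U" using V(1) by blast
    qed
  qed
qed

section \<open>Borel probability measures on a compact space with a countable base\<close>

lemma borel_probD:
  assumes "P \<in> borel_prob T"
  shows "prob_space P" "sets P = sets (borel_of T)" "space P = topspace T"
  using assms sets_eq_imp_space_eq[of P "borel_of T"] by (auto simp: borel_prob_def)

locale compact_sc =
  fixes T :: "'a topology"
  assumes compact: "compact_space T" and Hausdorff: "Hausdorff_space T" and second_countable: "second_countable T"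
begin

lemma continuous_bounded:
  fixes f :: "'a \<Rightarrow> 'b :: real_normed_vector"
  assumes "continuous_map T euclidean f"
  obtains b where "\<And>x. x \<in> topspace T \<Longrightarrow> norm (f x) \<le> b" "b > 0"
proof -
  have "compactin euclidean (f ` topspace T)"
    using compact assms image_compactin compact_space_def by blast
  then have "bounded (f ` topspace T)" by (simp add: compact_imp_bounded)
  then show ?thesis using that unfolding bounded_pos by auto
qed

lemma continuous_integrable:
  fixes f :: "'a \<Rightarrow> 'b :: {banach, second_countable_topology}"
  assumes "P \<in> borel_prob T" "continuous_map T euclidean f"
  shows "integrable P f"
proof -
  interpret prob_space P using assms(1) by (simp add: borel_prob_def)
  note sp = borel_probD(3,2)[OF assms(1)]
  obtain b where "\<And>x. x \<in> topspace T \<Longrightarrow> norm (f x) \<le> b" using continuous_bounded assms(2) by blast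
  moreover have "f \<in> borel_measurable P"
    using continuous_map_borel_measurable[OF assms(2)] measurable_cong_sets[OF sp(2) refl] by blast
  ultimately show ?thesis by (intro integrable_const_bound[of f b] AE_I2) (auto simp: sp)
qed

lemma regular_base:
  assumes "openin T U" "x \<in> U"
  obtains V where "openin T V" "x \<in> V" "Abstract_Topology.closure_of T V \<subseteq> U"
proof -
  have "regular_space T" by (simp add: compact Hausdorff compact_Hausdorff_imp_regular_space)
  then have "neighbourhood_base_of (closedin T) T" by (simp add: neighbourhood_base_of_closedin)
  then obtain V C where "openin T V" "closedin T C" "x \<in> V" "V \<subseteq> C" "C \<subseteq> U"
    using assms unfolding neighbourhood_base_of by metis
  then show ?thesis using that by (meson closure_of_minimal order_trans)
qed

text \<open>
  Integrals of continuous functions determine the measure of open sets only in the limit. For every base set \<open>B i\<close>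
  whose closure lies in \<open>U\<close>, Urysohn's lemma gives a function \<open>h i\<close> that is \<open>1\<close> on \<open>B i\<close> and vanishes off \<open>U\<close>;
  then \<open>u n = 1 - (\<Prod>i\<le>n. 1 - h i)\<close> reaches the value \<open>1\<close> at each point of \<open>U\<close> once \<open>n\<close> is large.
\<close>

lemma open_indicator_approx:
  assumes U: "openin T U"
  obtains u :: "nat \<Rightarrow> 'a \<Rightarrow> real" where "\<And>n. continuous_map T euclideanreal (u n)"
    "\<And>n x. x \<in> topspace T \<Longrightarrow> 0 \<le> u n x \<and> u n x \<le> 1"
    "\<And>n x. x \<in> topspace T \<Longrightarrow> x \<notin> U \<Longrightarrow> u n x = 0"
    "\<And>x. x \<in> topspace T \<Longrightarrow> (\<lambda>n. u n x) \<longlonglongrightarrow> indicator U x"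
proof -
  obtain B where "enum_base T B" using ex_enum_base[OF second_countable] ..
  note B = enum_baseD[OF this]
  have nrm: "normal_space T"
    by (simp add: compact Hausdorff compact_Hausdorff_or_regular_imp_normal_space)
  have "\<exists>h. continuous_map T euclideanreal h \<and> (\<forall>x\<in>topspace T. 0 \<le> h x \<and> h x \<le> 1 \<and> (x \<notin> U \<longrightarrow> h x = 0) \<and>
     (Abstract_Topology.closure_of T (B n) \<subseteq> U \<and> x \<in> B n \<longrightarrow> h x = 1))" for n
  proof (cases "Abstract_Topology.closure_of T (B n) \<subseteq> U")
    case True
    have "disjnt (topspace T - U) (Abstract_Topology.closure_of T (B n))" using True by (auto simp: disjnt_def)
    then obtain f where f: "continuous_map T (top_of_set {0..1}) f" "f ` (topspace T - U) \<subseteq> {0}"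
        "f ` (Abstract_Topology.closure_of T (B n)) \<subseteq> {1::real}"
      using Urysohn_lemma[OF nrm, of "topspace T - U" "Abstract_Topology.closure_of T (B n)" 0 1] U by auto
    have "continuous_map T euclideanreal f" "\<And>x. x \<in> topspace T \<Longrightarrow> f x \<in> {0..1}"
      using f(1) by (auto simp: continuous_map_in_subtopology)
    moreover have "x \<in> Abstract_Topology.closure_of T (B n)" if "x \<in> B n" for x
      using that closure_of_subset[OF openin_subset[OF B(1)]] by auto
    ultimately show ?thesis using f(2,3) by (intro exI[of _ f]) (auto simp: image_subset_iff)
  next
    case False
    then show ?thesis by (intro exI[of _ "\<lambda>x. 0"]) auto
  qed
  then obtain h where h: "\<And>n. continuous_map T euclideanreal (h n)"
    "\<And>n x. x \<in> topspace T \<Longrightarrow> 0 \<le> h n x \<and> h n x \<le> 1 \<and> (x \<notin> U \<longrightarrow> h n x = 0) \<and>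
     (Abstract_Topology.closure_of T (B n) \<subseteq> U \<and> x \<in> B n \<longrightarrow> h n x = 1)" by metis
  define u where "u n x = 1 - (\<Prod>i\<le>n. 1 - h i x)" for n x
  show ?thesis
  proof
    show "continuous_map T euclideanreal (u n)" for n
      unfolding u_def by (intro continuous_map_diff continuous_map_prod h) auto
    show "0 \<le> u n x \<and> u n x \<le> 1" if "x \<in> topspace T" for n x
      unfolding u_def using h(2)[OF that] by (auto intro!: prod_le_1 prod_nonneg)
    show *: "u n x = 0" if "x \<in> topspace T" "x \<notin> U" for n x
      using h(2)[OF that(1)] that(2) by (simp add: u_def)
    show "(\<lambda>n. u n x) \<longlonglongrightarrow> indicator U x" if x: "x \<in> topspace T" for x
    proof (cases "x \<in> U")
      case True
      obtain V where V: "openin T V" "x \<in> V" "Abstract_Topology.closure_of T V \<subseteq> U" using regular_base U True by metis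
      obtain m where m: "x \<in> B m" "B m \<subseteq> V" using B(2) V by metis
      then have "Abstract_Topology.closure_of T (B m) \<subseteq> U" using V(3) closure_of_mono by blast
      then have "h m x = 1" using h(2)[OF x] m by blast
      then have "u n x = 1" if "n \<ge> m" for n
        unfolding u_def using that by (auto intro: bexI[of _ m])
      then have "eventually (\<lambda>n. u n x = 1) sequentially" by (auto simp: eventually_sequentially)
      then show ?thesis using True by (simp add: tendsto_eventually)
    next
      case False then show ?thesis using * x by simp
    qed
  qed
qed

text \<open>
  Finite intersections of base sets form a countable generator of the Borel sets that is closed under intersection, so
  a probability measure is determined by its values on them, hence by the integrals of the countably many
  functions that approximate their indicators.
\<close>

lemma ex_determining_functions:
  "\<exists>f :: nat \<Rightarrow> 'a \<Rightarrow> real. (\<forall>i. continuous_map T euclideanreal (f i)) \<and> (\<forall>i. \<forall>x\<in>topspace T. 0 \<le> f i x \<and> f i x \<le> 1) \<and>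
     (\<forall>P\<in>borel_prob T. \<forall>Q\<in>borel_prob T. (\<forall>i. (\<integral>x. f i x \<partial>P) = (\<integral>x. f i x \<partial>Q)) \<longrightarrow> P = Q)"
proof -
  obtain B where "enum_base T B" using ex_enum_base[OF second_countable] ..
  note B = enum_baseD[OF this]
  define W where "W F = topspace T \<inter> \<Inter> (B ` F)" for F
  have opW: "openin T (W F)" if "finite F" for F
    using that B(1) openin_topspace[of T] unfolding W_def by (cases "F = {}") (simp, intro openin_Int openin_Inter, auto)
  have "\<forall>F. \<exists>u :: nat \<Rightarrow> 'a \<Rightarrow> real. finite F \<longrightarrow> (\<forall>n. continuous_map T euclideanreal (u n)) \<and>
    (\<forall>n. \<forall>x\<in>topspace T. 0 \<le> u n x \<and> u n x \<le> 1) \<and> (\<forall>x\<in>topspace T. (\<lambda>n. u n x) \<longlonglongrightarrow> indicator (W F) x)"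
  proof
    fix F
    show "\<exists>u :: nat \<Rightarrow> 'a \<Rightarrow> real. finite F \<longrightarrow> (\<forall>n. continuous_map T euclideanreal (u n)) \<and>
    (\<forall>n. \<forall>x\<in>topspace T. 0 \<le> u n x \<and> u n x \<le> 1) \<and> (\<forall>x\<in>topspace T. (\<lambda>n. u n x) \<longlonglongrightarrow> indicator (W F) x)"
    proof (cases "finite F")
      case True
      show ?thesis by (rule open_indicator_approx[OF opW[OF True]]) blast
    qed auto
  qed
  from choice[OF this] obtain u :: "nat set \<Rightarrow> nat \<Rightarrow> 'a \<Rightarrow> real" where
    "\<forall>F. finite F \<longrightarrow> (\<forall>n. continuous_map T euclideanreal (u F n)) \<and>
    (\<forall>n. \<forall>x\<in>topspace T. 0 \<le> u F n x \<and> u F n x \<le> 1) \<and> (\<forall>x\<in>topspace T. (\<lambda>n. u F n x) \<longlonglongrightarrow> indicator (W F) x)" ..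
  then have u: "\<And>F n. finite F \<Longrightarrow> continuous_map T euclideanreal (u F n)"
    "\<And>F n x. finite F \<Longrightarrow> x \<in> topspace T \<Longrightarrow> 0 \<le> u F n x \<and> u F n x \<le> 1"
    "\<And>F x. finite F \<Longrightarrow> x \<in> topspace T \<Longrightarrow> (\<lambda>n. u F n x) \<longlonglongrightarrow> indicator (W F) x" by blast+
  define I where "I = {F :: nat set. finite F} \<times> (UNIV :: nat set)"
  have I: "countable I" "I \<noteq> {}" by (auto simp: I_def countable_Collect_finite)
  define f where "f i = (case from_nat_into I i of (F, n) \<Rightarrow> u F n)" for i
  have f: "\<exists>F n. finite F \<and> f i = u F n" for i
    using from_nat_into[OF I(2), of i] unfolding f_def I_def by (auto split: prod.splits)
  have f': "\<exists>i. f i = u F n" if "finite F" for F n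
    using from_nat_into_to_nat_on[OF I(1), of "(F,n)"] that by (intro exI[of _ "to_nat_on I (F,n)"]) (simp add: f_def I_def)
  show ?thesis
  proof (intro exI conjI allI ballI impI)
    show "continuous_map T euclideanreal (f i)" for i using f[of i] u(1) by auto
    show "0 \<le> f i x" "f i x \<le> 1" if "x \<in> topspace T" for i x using f[of i] u(2) that by auto
    fix P Q assume PQ: "P \<in> borel_prob T" "Q \<in> borel_prob T" and eq: "\<forall>i. (\<integral>x. f i x \<partial>P) = (\<integral>x. f i x \<partial>Q)"
    interpret P: prob_space P by (rule borel_probD[OF PQ(1)])
    interpret Q: prob_space Q by (rule borel_probD[OF PQ(2)])
    have lim: "(\<lambda>n. \<integral>x. u F n x \<partial>M) \<longlonglongrightarrow> measure M (W F)" if F: "finite F" and M: "M \<in> borel_prob T" for F M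
    proof -
      note sM = borel_probD(2,3)[OF M]
      interpret M: prob_space M by (rule borel_probD[OF M])
      have W: "W F \<in> sets M" using opW[OF F] sM by (simp add: openin_imp_borel_of)
      have "(\<lambda>n. \<integral>x. u F n x \<partial>M) \<longlonglongrightarrow> (\<integral>x. indicator (W F) x \<partial>M)"
      proof (rule integral_dominated_convergence[where w = "\<lambda>_. 1"])
        show "u F n \<in> borel_measurable M" for n using continuous_integrable[OF M u(1)[OF F]] by auto
      qed (use W u(2,3)[OF F] sM in auto)
      then show ?thesis using W by simp
    qed
    have W: "measure P (W F) = measure Q (W F)" if F: "finite F" for F
    proof -
      have "(\<integral>x. u F n x \<partial>P) = (\<integral>x. u F n x \<partial>Q)" for n using f'[OF F, of n] eq by metis
      then show ?thesis using lim[OF F PQ(1)] lim[OF F PQ(2)] LIMSEQ_unique by simp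
    qed
    have gen: "sigma_sets (topspace T) (W ` {F. finite F}) = sets (borel_of T)"
    proof
      show "sigma_sets (topspace T) (W ` {F. finite F}) \<subseteq> sets (borel_of T)"
        using opW openin_imp_borel_of sets.sigma_sets_subset[of "W ` {F. finite F}" "borel_of T"] by auto
      show "sets (borel_of T) \<subseteq> sigma_sets (topspace T) (W ` {F. finite F})"
        unfolding sets_borel_of
      proof (intro sigma_sets_mono subsetI)
        fix U assume "U \<in> {U. openin T U}"
        then have U: "openin T U" by simp
        have "U = (\<Union>n\<in>{n. B n \<subseteq> U}. W {n})"
          using B(2)[OF U] openin_subset[OF U] by (fastforce simp: W_def)
        also have "\<dots> \<in> sigma_sets (topspace T) (W ` {F. finite F})"
          by (rule sigma_sets_UNION) auto
        finally show "U \<in> sigma_sets (topspace T) (W ` {F. finite F})" .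
      qed
    qed
    show "P = Q"
    proof (rule measure_eqI_generator_eq[where A = "\<lambda>_. topspace T"])
      show "Int_stable (W ` {F. finite F})"
      proof (rule Int_stableI)
        fix a b assume "a \<in> W ` {F. finite F}" "b \<in> W ` {F. finite F}"
        then obtain F F' where "finite F" "finite F'" "a = W F" "b = W F'" by auto
        then have "a \<inter> b = W (F \<union> F')" "finite (F \<union> F')" by (auto simp: W_def)
        then show "a \<inter> b \<in> W ` {F. finite F}" by blast
      qed
      show "W ` {F. finite F} \<subseteq> Pow (topspace T)" by (auto simp: W_def)
      show "\<And>X. X \<in> W ` {F. finite F} \<Longrightarrow> emeasure P X = emeasure Q X"
        using W by (auto simp: P.emeasure_eq_measure Q.emeasure_eq_measure)
      have "W {} = topspace T" by (simp add: W_def)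
      then show "range (\<lambda>_. topspace T) \<subseteq> W ` {F. finite F}" by auto
    qed (use borel_probD(2)[OF PQ(1)] borel_probD(2)[OF PQ(2)] gen in auto)
  qed
qed

text \<open>
  A measurable map to the line under which every continuous function becomes uniformly continuous. It is
  \<open>e x = (\<Sum>i. (1/3)^i * indicator (B i) x)\<close> for a base \<open>B\<close>: if \<open>B i\<close> contains \<open>x\<close> but not \<open>y\<close>, the first index at which the two
  expansions differ is at most \<open>i\<close>, and in base three the remaining terms compensate for at most half of the difference there.
  So points with close codes lie in the same members of any given finite part of the base.
\<close>

lemma ex_code:
  assumes ne: "topspace T \<noteq> {}"
  shows "\<exists>e :: 'a \<Rightarrow> real. e \<in> borel_measurable (borel_of T) \<and> (\<forall>x. 0 \<le> e x \<and> e x \<le> 2) \<and>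
     (\<forall>f :: 'a \<Rightarrow> real. continuous_map T euclideanreal f \<longrightarrow> (\<forall>\<epsilon>>0. \<exists>\<delta>>0. \<forall>x\<in>topspace T. \<forall>y\<in>topspace T.
        \<bar>e x - e y\<bar> < \<delta> \<longrightarrow> \<bar>f x - f y\<bar> < \<epsilon>))"
proof -
  obtain B where "enum_base T B" using ex_enum_base[OF second_countable] ..
  note B = enum_baseD[OF this]
  define e :: "'a \<Rightarrow> real" where "e x = (\<Sum>i. (1/3)^i * indicator (B i) x)" for x
  have sm: "summable (\<lambda>i. (1/3)^i * indicator (B i) x :: real)" for x
    by (rule summable_comparison_test'[of "\<lambda>i. (1/3)^i"]) (auto simp: indicator_def)
  have e0: "0 \<le> e x" for x unfolding e_def by (intro suminf_nonneg sm) auto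
  have "e x \<le> (\<Sum>i. (1/3::real)^i)" for x unfolding e_def
    by (intro suminf_le sm) (auto simp: indicator_def)
  moreover have "(\<Sum>i. (1/3::real)^i) = 3/2" using suminf_geometric[of "1/3::real"] by simp
  ultimately have e2: "e x \<le> 2" for x using order_trans[of "e x" "3/2" 2] by simp
  have sep: "\<bar>e x - e y\<bar> \<ge> (1/3)^i / 2" if "x \<in> B i" "y \<notin> B i" for x y i
  proof -
    define j where "j = (LEAST j. (x \<in> B j) \<noteq> (y \<in> B j))"
    have j: "(x \<in> B j) \<noteq> (y \<in> B j)" unfolding j_def by (rule LeastI[of _ i]) (use that in auto)
    have ji: "j \<le> i" unfolding j_def by (rule Least_le) (use that in auto)
    have lt: "(x \<in> B l) = (y \<in> B l)" if "l < j" for l using not_less_Least[OF that[unfolded j_def]] by auto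
    define d where "d l = (1/3)^l * (indicator (B l) x - indicator (B l) y :: real)" for l
    have sd: "summable d" unfolding d_def right_diff_distrib by (intro summable_diff sm)
    have "e x - e y = suminf d" unfolding e_def d_def right_diff_distrib by (rule suminf_diff[OF sm sm])
    also have "\<dots> = (\<Sum>l. d (l + Suc j)) + sum d {..<Suc j}" using suminf_split_initial_segment[OF sd] by blast
    also have "sum d {..<Suc j} = d j" using lt by (simp add: d_def indicator_def)
    finally have eq: "e x - e y = (\<Sum>l. d (l + Suc j)) + d j" .
    have "norm (\<Sum>l. d (l + Suc j)) \<le> (\<Sum>l. (1/3)^Suc j * (1/3::real)^l)"
    proof (rule norm_suminf_le)
      show "norm (d (l + Suc j)) \<le> (1/3)^Suc j * (1/3)^l" for l
        by (auto simp: d_def indicator_def power_add)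
      show "summable (\<lambda>l. (1/3)^Suc j * (1/3::real)^l)" by (intro summable_mult summable_geometric) auto
    qed
    also have "\<dots> = (1/3)^Suc j * (3/2)"
      by (subst suminf_mult) (auto simp: suminf_geometric)
    finally have "\<bar>\<Sum>l. d (l + Suc j)\<bar> \<le> (1/3)^j / 2" by simp
    moreover have "\<bar>d j\<bar> = (1/3)^j" using j by (auto simp: d_def indicator_def)
    ultimately have "\<bar>e x - e y\<bar> \<ge> (1/3)^j / 2" using eq by linarith
    moreover have "(1/3::real)^i \<le> (1/3)^j" using ji by (intro power_decreasing) auto
    ultimately show ?thesis by linarith
  qed
  have em: "e \<in> borel_measurable (borel_of T)" unfolding e_def
    using openin_imp_borel_of[OF B(1)] by measurable
  show ?thesis
  proof (rule exI[of _ e], intro conjI allI impI)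
    fix f :: "'a \<Rightarrow> real" and \<epsilon> :: real assume f: "continuous_map T euclideanreal f" and \<epsilon>: "\<epsilon> > 0"
    have "\<exists>i. x \<in> B i \<and> (\<forall>y\<in>B i. \<bar>f y - f x\<bar> < \<epsilon>/2)" if xT: "x \<in> topspace T" for x
    proof -
      have "openin T {y\<in>topspace T. f y \<in> {f x - \<epsilon>/2<..<f x + \<epsilon>/2}}"
        by (rule openin_continuous_map_preimage[OF f]) auto
      from B(2)[OF this, of x] obtain n where n: "x \<in> B n" "B n \<subseteq> {y\<in>topspace T. f y \<in> {f x - \<epsilon>/2<..<f x + \<epsilon>/2}}"
        using xT \<epsilon> by auto
      have "\<bar>f y - f x\<bar> < \<epsilon>/2" if "y \<in> B n" for y
        using subsetD[OF n(2) that] by (simp only: mem_Collect_eq greaterThanLessThan_iff abs_less_iff) linarith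
      then show ?thesis using n(1) by blast
    qed
    then obtain i where i: "\<And>x. x \<in> topspace T \<Longrightarrow> x \<in> B (i x)"
       "\<And>x y. x \<in> topspace T \<Longrightarrow> y \<in> B (i x) \<Longrightarrow> \<bar>f y - f x\<bar> < \<epsilon>/2" by metis
    obtain \<F> where \<F>: "finite \<F>" "\<F> \<subseteq> (\<lambda>x. B (i x)) ` topspace T" "topspace T \<subseteq> \<Union>\<F>"
    proof -
      have "\<forall>V\<in>(\<lambda>x. B (i x)) ` topspace T. openin T V" "topspace T \<subseteq> \<Union> ((\<lambda>x. B (i x)) ` topspace T)"
        using B(1) i(1) by auto
      then show ?thesis using that compact unfolding compact_space_def compactin_def by meson
    qed
    then obtain S where S: "finite S" "S \<subseteq> topspace T" "\<F> = (\<lambda>x. B (i x)) ` S"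
      by (meson finite_subset_image)
    have Sne: "S \<noteq> {}" using \<F>(3) S(3) ne by auto
    define \<delta> :: real where "\<delta> = Min ((\<lambda>x. (1/3)^(i x) / 2) ` S)"
    have \<delta>: "\<delta> > 0" "\<And>x. x \<in> S \<Longrightarrow> \<delta> \<le> (1/3)^(i x) / 2"
      using S(1) Sne unfolding \<delta>_def by (simp, intro Min_le, auto)
    show "\<exists>\<delta>>0. \<forall>x\<in>topspace T. \<forall>y\<in>topspace T. \<bar>e x - e y\<bar> < \<delta> \<longrightarrow> \<bar>f x - f y\<bar> < \<epsilon>"
    proof (intro exI[of _ \<delta>] conjI ballI impI \<delta>)
      fix x y assume x: "x \<in> topspace T" and y: "y \<in> topspace T" and d: "\<bar>e x - e y\<bar> < \<delta>"
      obtain z where z: "z \<in> S" "x \<in> B (i z)" using x \<F>(3) S(3) by auto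
      then have "y \<in> B (i z)" using sep[of x "i z" y] \<delta>(2)[of z] d by force
      then have "\<bar>f y - f z\<bar> < \<epsilon>/2" "\<bar>f x - f z\<bar> < \<epsilon>/2" using i(2)[of z] z S(2) by auto
      then show "\<bar>f x - f y\<bar> < \<epsilon>" by linarith
    qed
  qed (use e0 e2 em in auto)
qed

text \<open>
  Proved by transport to the real line, where Helly's selection theorem applies. A code \<open>e\<close> as above identifies continuous functions
  on the space with continuous functions on the closure \<open>D\<close> of its range. The laws of \<open>e\<close> subconverge to a law
  \<open>\<nu>\<close> carried by \<open>D\<close>, and compactness provides for each \<open>t\<close> in \<open>D\<close> a point \<open>s t\<close> at which every
  continuous function takes the value that its counterpart on the line has at \<open>t\<close>. The limit measure is the image of \<open>\<nu>\<close> under \<open>s\<close>.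
\<close>

theorem weak_sequential_compactness:
  assumes P: "\<And>n :: nat. P n \<in> borel_prob T"
  obtains r M where "strict_mono (r :: nat \<Rightarrow> nat)" "M \<in> borel_prob T"
    "\<And>f :: 'a \<Rightarrow> real. continuous_map T euclideanreal f \<Longrightarrow> (\<lambda>n. \<integral>x. f x \<partial>P (r n)) \<longlonglongrightarrow> (\<integral>x. f x \<partial>M)"
proof -
  interpret P: prob_space "P n" for n by (rule borel_probD[OF P])
  note sP = borel_probD(2,3)[OF P]
  have ne: "topspace T \<noteq> {}" using P.not_empty[of 0] sP by auto
  then obtain x0 where x0: "x0 \<in> topspace T" by blast
  obtain e :: "'a \<Rightarrow> real" where em: "e \<in> borel_measurable (borel_of T)" and e02: "\<And>x. 0 \<le> e x \<and> e x \<le> 2"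
    and eu: "\<And>f \<epsilon>. continuous_map T euclideanreal f \<Longrightarrow> \<epsilon> > 0 \<Longrightarrow> \<exists>\<delta>>0. \<forall>x\<in>topspace T. \<forall>y\<in>topspace T.
        \<bar>e x - e y\<bar> < \<delta> \<longrightarrow> \<bar>f x - f y\<bar> < (\<epsilon>::real)"
  proof -
    from ex_code[OF ne] obtain e' :: "'a \<Rightarrow> real" where "e' \<in> borel_measurable (borel_of T)" "\<forall>x. 0 \<le> e' x \<and> e' x \<le> 2"
     "\<forall>f :: 'a \<Rightarrow> real. continuous_map T euclideanreal f \<longrightarrow> (\<forall>\<epsilon>>0. \<exists>\<delta>>0. \<forall>x\<in>topspace T. \<forall>y\<in>topspace T.
        \<bar>e' x - e' y\<bar> < \<delta> \<longrightarrow> \<bar>f x - f y\<bar> < \<epsilon>)" by (elim exE conjE)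
    then show thesis by (intro that[of e']) blast+
  qed
  have eP: "e \<in> borel_measurable (P n)" for n using em sP(1) measurable_cong_sets by blast
  define D where "D = closure (e ` topspace T)"
  \<comment> \<open>Each continuous \<open>f\<close> factors through the code: it is uniformly continuous on the range of \<open>e\<close>, extends to the closure \<open>D\<close>,
    and then to the whole line by Tietze's theorem.\<close>
  have "\<exists>g :: real \<Rightarrow> real. continuous_on UNIV g \<and> (\<forall>x\<in>topspace T. g (e x) = f x) \<and> (\<exists>b. \<forall>t. norm (g t) \<le> b)"
    if f: "continuous_map T euclideanreal f" for f
  proof -
    obtain b where b: "\<And>x. x \<in> topspace T \<Longrightarrow> norm (f x) \<le> b" "b > 0" using continuous_bounded[OF f] by metis
    define f' where "f' = (\<lambda>t. f (SOME x. x \<in> topspace T \<and> e x = t))"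
    have f': "f' (e x) = f x" if x: "x \<in> topspace T" for x
    proof -
      define y where "y = (SOME y. y \<in> topspace T \<and> e y = e x)"
      have y: "y \<in> topspace T" "e y = e x" unfolding y_def using someI[of "\<lambda>y. y \<in> topspace T \<and> e y = e x" x] x by auto
      have "\<bar>f y - f x\<bar> < \<epsilon>" if "\<epsilon> > 0" for \<epsilon> using eu[OF f that] y x by force
      then have "f y = f x" using zero_less_abs_iff[of "f y - f x"] by (meson eq_iff_diff_eq_0 less_irrefl)
      then show ?thesis by (simp add: f'_def y_def)
    qed
    have uc: "uniformly_continuous_on (e ` topspace T) f'"
      unfolding uniformly_continuous_on_def dist_real_def
    proof (intro allI impI)
      fix \<epsilon> :: real assume "0 < \<epsilon>"
      from eu[OF f this] obtain \<delta> where \<delta>: "\<delta> > 0" "\<And>x y. x\<in>topspace T \<Longrightarrow> y\<in>topspace T \<Longrightarrow>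
        \<bar>e x - e y\<bar> < \<delta> \<Longrightarrow> \<bar>f x - f y\<bar> < \<epsilon>" by blast
      show "\<exists>d>0. \<forall>x\<in>e ` topspace T. \<forall>x'\<in>e ` topspace T. \<bar>x' - x\<bar> < d \<longrightarrow> \<bar>f' x' - f' x\<bar> < \<epsilon>"
        using \<delta> by (intro exI[of _ \<delta>]) (auto simp: f')
    qed
    obtain g where g: "uniformly_continuous_on D g" "\<And>t. t \<in> e ` topspace T \<Longrightarrow> f' t = g t"
      using uniformly_continuous_on_extension_on_closure[OF uc] unfolding D_def by metis
    have gb: "norm (g t) \<le> b" if "t \<in> D" for t
    proof -
      have cg: "continuous_on D g" using g(1) uniformly_continuous_imp_continuous by blast
      have "closedin (top_of_set D) (D \<inter> g -` cball 0 b)"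
        by (intro continuous_closedin_preimage cg) auto
      then have "closed (D \<inter> g -` cball 0 b)" using D_def closedin_closed_trans closed_closure by blast
      moreover have "e ` topspace T \<subseteq> D \<inter> g -` cball 0 b"
      proof
        fix t assume t: "t \<in> e ` topspace T"
        then obtain x where x: "x \<in> topspace T" "t = e x" by auto
        have "g t = f x" using g(2)[OF t] f'[OF x(1)] x(2) by simp
        then show "t \<in> D \<inter> g -` cball 0 b" using b(1)[OF x(1)] subsetD[OF closure_subset t] by (auto simp: D_def)
      qed
      ultimately have "D \<subseteq> D \<inter> g -` cball 0 b" unfolding D_def by (rule closure_minimal[rotated])
      then show ?thesis using that by auto
    qed
    obtain h where h: "continuous_on UNIV h" "\<And>t. t \<in> D \<Longrightarrow> h t = g t" "\<And>t. norm (h t) \<le> b"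
    proof (rule Tietze[of D g UNIV b])
      show "continuous_on D g" by (rule uniformly_continuous_imp_continuous[OF g(1)])
      show "closedin (top_of_set UNIV) D" by (simp add: D_def)
    qed (use gb b(2) in auto)
    have "h (e x) = f x" if "x \<in> topspace T" for x
      using h(2)[of "e x"] g(2)[of "e x"] f'[OF that] closure_subset[of "e ` topspace T"] that by (auto simp: D_def)
    then show ?thesis using h(1,3) by blast
  qed
  then have "\<forall>f. \<exists>g :: real \<Rightarrow> real. continuous_map T euclideanreal f \<longrightarrow>
     continuous_on UNIV g \<and> (\<forall>x\<in>topspace T. g (e x) = f x) \<and> (\<exists>b. \<forall>t. norm (g t) \<le> b)" by (intro allI) (metis (no_types))
  from choice[OF this] obtain G :: "('a \<Rightarrow> real) \<Rightarrow> real \<Rightarrow> real" where "\<forall>f. continuous_map T euclideanreal f \<longrightarrow>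
     continuous_on UNIV (G f) \<and> (\<forall>x\<in>topspace T. G f (e x) = f x) \<and> (\<exists>b. \<forall>t. norm (G f t) \<le> b)" ..
  then have G: "\<And>f. continuous_map T euclideanreal f \<Longrightarrow> continuous_on UNIV (G f)"
     "\<And>f x. continuous_map T euclideanreal f \<Longrightarrow> x \<in> topspace T \<Longrightarrow> G f (e x) = f x"
     "\<And>f. continuous_map T euclideanreal f \<Longrightarrow> \<exists>b. \<forall>t. norm (G f t) \<le> b" by simp_all
  define N where "N n = distr (P n) borel e" for n
  have rN: "real_distribution (N n)" for n
    unfolding N_def real_distribution_def real_distribution_axioms_def
    using P.prob_space_distr[OF eP] by simp
  have "tight N"
    unfolding tight_def
  proof (intro conjI allI impI rN)
    fix \<epsilon> :: real assume "0 < \<epsilon>"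
    have "measure (N n) {-1<..3} = 1" for n
    proof -
      have "e x \<in> {-1<..3}" for x using e02[of x] by simp
      then have "e -` {-1<..3} \<inter> space (P n) = space (P n)" by blast
      then show ?thesis unfolding N_def by (subst measure_distr[OF eP]) (auto simp: P.prob_space)
    qed
    then show "\<exists>a b. a < b \<and> (\<forall>n. 1 - \<epsilon> < measure (N n) {a<..b})"
      using \<open>0 < \<epsilon>\<close> by (intro exI[of _ "-1"] exI[of _ 3]) auto
  qed
  from tight_imp_convergent_subsubsequence[OF this strict_mono_id] obtain r \<nu> where r: "strict_mono (r :: nat \<Rightarrow> nat)"
    and \<nu>: "real_distribution \<nu>" and conv: "weak_conv_m (N \<circ> id \<circ> r) \<nu>" by (elim exE conjE)
  have conv: "weak_conv_m (N \<circ> r) \<nu>" using conv by simp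
  have s\<nu>: "sets \<nu> = sets borel" "space \<nu> = UNIV" "prob_space \<nu>"
    using \<nu> sets_eq_imp_space_eq[of \<nu> borel] unfolding real_distribution_def real_distribution_axioms_def by auto
  interpret \<nu>: prob_space \<nu> by (rule s\<nu>(3))
  have conv': "(\<lambda>n. \<integral>x. g (e x) \<partial>P (r n)) \<longlonglongrightarrow> (\<integral>t. g t \<partial>\<nu>)"
    if g: "continuous_on UNIV g" "\<And>t. norm (g t) \<le> b" for g :: "real \<Rightarrow> real" and b
  proof -
    have "(\<lambda>n. integral\<^sup>L ((N \<circ> r) n) g) \<longlonglongrightarrow> integral\<^sup>L \<nu> g"
      by (rule weak_conv_imp_integral_bdd_continuous_conv[OF _ \<nu> conv, of g b])
        (use rN g in \<open>simp_all add: continuous_on_eq_continuous_at\<close>)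
    moreover have "integral\<^sup>L ((N \<circ> r) n) g = (\<integral>x. g (e x) \<partial>P (r n))" for n
      unfolding N_def comp_def by (intro integral_distr eP borel_measurable_continuous_onI g)
    ultimately show ?thesis by simp
  qed
  have De: "e x \<in> D" if "x \<in> topspace T" for x using that closure_subset[of "e ` topspace T"] by (auto simp: D_def)
  have cD: "closed D" "D \<noteq> {}" using ne by (auto simp: D_def)
  \<comment> \<open>The function \<open>min 1 (infdist t D)\<close> vanishes on the range of \<open>e\<close>, so its integral under the limit law is \<open>0\<close>.\<close>
  have AED: "AE t in \<nu>. t \<in> D"
  proof -
    define h where "h t = min 1 (infdist t D)" for t
    have ch: "continuous_on UNIV h" unfolding h_def by (intro continuous_intros)
    have hb: "norm (h t) \<le> 1" for t by (simp add: h_def infdist_nonneg)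
    have "(\<integral>x. h (e x) \<partial>P (r n)) = 0" for n
      by (rule integral_eq_zero_AE, rule AE_I2) (use sP De in \<open>auto simp: h_def\<close>)
    then have "(\<integral>t. h t \<partial>\<nu>) = 0" using conv'[OF ch hb] by (simp add: LIMSEQ_const_iff)
    moreover have "integrable \<nu> h"
      using hb borel_measurable_continuous_onI[OF ch] by (intro \<nu>.integrable_const_bound[of h 1]) (simp_all add: measurable_cong_sets[OF s\<nu>(1) refl])
    moreover have "h t \<ge> 0" for t by (simp add: h_def infdist_nonneg)
    ultimately have "AE t in \<nu>. h t = 0" by (simp add: integral_nonneg_eq_0_iff_AE)
    then show ?thesis
      by eventually_elim (use cD in \<open>auto simp: h_def min_def in_closed_iff_infdist_zero split: if_splits\<close>)
  qed
  \<comment> \<open>The closures of the sets of points with code close to \<open>t\<close> are nested and nonempty, so they have a common point.\<close>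
  have "\<exists>x\<in>topspace T. \<forall>f. continuous_map T euclideanreal f \<longrightarrow> f x = G f t" if t: "t \<in> D" for t
  proof -
    define C where "C n = Abstract_Topology.closure_of T {y\<in>topspace T. \<bar>e y - t\<bar> < 1 / real (Suc n)}" for n :: nat
    have "C n \<noteq> {}" for n
    proof -
      obtain s where s: "s \<in> e ` topspace T" "dist s t < 1 / real (Suc n)"
        using t[unfolded D_def closure_approachable, rule_format, of "1 / real (Suc n)"] by auto
      then obtain y where "y \<in> topspace T" "\<bar>e y - t\<bar> < 1 / real (Suc n)" by (auto simp: dist_real_def)
      then show ?thesis
        unfolding C_def using closure_of_subset[of "{y\<in>topspace T. \<bar>e y - t\<bar> < 1 / real (Suc n)}" T] by blast
    qed
    moreover have "decseq C"
    proof (rule decseq_SucI)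
      fix n
      have "1 / real (Suc (Suc n)) \<le> 1 / real (Suc n)" by (simp add: frac_le)
      then have "{y\<in>topspace T. \<bar>e y - t\<bar> < 1 / real (Suc (Suc n))} \<subseteq> {y\<in>topspace T. \<bar>e y - t\<bar> < 1 / real (Suc n)}"
        by (intro Collect_mono impI conjI) (elim conjE, assumption, elim conjE, erule less_le_trans, assumption)
      then show "C (Suc n) \<subseteq> C n" unfolding C_def by (rule closure_of_mono)
    qed
    moreover have "closedin T (C n)" for n by (simp add: C_def)
    ultimately have "(\<Inter>n. C n) \<noteq> {}" by (intro compact_space_imp_nest[OF compact, of C])
    then obtain x where x: "\<And>n. x \<in> C n" by auto
    have xT: "x \<in> topspace T" using x[of 0] by (simp add: C_def in_closure_of)
    have "f x = G f t" if f: "continuous_map T euclideanreal f" for f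
    proof (rule ccontr)
      assume "f x \<noteq> G f t"
      define \<epsilon> where "\<epsilon> = \<bar>f x - G f t\<bar> / 2"
      have \<epsilon>: "\<epsilon> > 0" using \<open>f x \<noteq> G f t\<close> by (simp add: \<epsilon>_def)
      have "isCont (G f) t" using G(1)[OF f] by (simp add: continuous_on_eq_continuous_at)
      then have "\<exists>d>0. \<forall>s. dist s t < d \<longrightarrow> dist (G f s) (G f t) < \<epsilon>"
        using \<epsilon> unfolding continuous_at_eps_delta by simp
      then obtain d where d: "d > 0" "\<And>s. \<bar>s - t\<bar> < d \<Longrightarrow> \<bar>G f s - G f t\<bar> < \<epsilon>"
        unfolding dist_real_def by (elim exE conjE) (rule that, assumption, erule allE, erule mp, assumption)
      obtain n where n: "1 / real (Suc n) < d" using nat_approx_posE[OF d(1)] .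
      have "openin T {y\<in>topspace T. f y \<in> {f x - \<epsilon><..<f x + \<epsilon>}}"
        by (rule openin_continuous_map_preimage[OF f]) auto
      then obtain y where y: "y \<in> topspace T" "\<bar>e y - t\<bar> < 1 / real (Suc n)" "f y \<in> {f x - \<epsilon><..<f x + \<epsilon>}"
      proof -
        let ?V = "{y\<in>topspace T. f y \<in> {f x - \<epsilon><..<f x + \<epsilon>}}"
        have "x \<in> ?V" using xT \<epsilon> by simp
        then obtain y where "y \<in> ?V" "y \<in> {y\<in>topspace T. \<bar>e y - t\<bar> < 1 / real (Suc n)}"
        proof -
          have "\<forall>W. x \<in> W \<and> openin T W \<longrightarrow> (\<exists>y. y \<in> {y\<in>topspace T. \<bar>e y - t\<bar> < 1 / real (Suc n)} \<and> y \<in> W)"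
            using x[of n] unfolding C_def in_closure_of by (rule conjunct2)
          from this[rule_format, OF conjI, OF \<open>x \<in> ?V\<close> \<open>openin T ?V\<close>] show thesis
            by (elim exE conjE, intro that)
        qed
        then show thesis by (intro that[of y]) simp_all
      qed
      have "\<bar>f y - G f t\<bar> < \<epsilon>" using d(2)[of "e y"] y(2) n G(2)[OF f y(1)] by simp
      moreover have "\<bar>f y - f x\<bar> < \<epsilon>" using y(3) by (simp only: greaterThanLessThan_iff abs_less_iff) linarith
      moreover have "\<bar>f x - G f t\<bar> = 2 * \<epsilon>" by (simp add: \<epsilon>_def)
      ultimately show False by linarith
    qed
    then show ?thesis using xT by (intro bexI[of _ x]) simp_all
  qed
  then have "\<forall>t\<in>D. \<exists>x. x \<in> topspace T \<and> (\<forall>f. continuous_map T euclideanreal f \<longrightarrow> f x = G f t)"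
    unfolding Bex_def by (intro ballI)
  from bchoice[OF this] obtain s where
    "\<forall>t\<in>D. s t \<in> topspace T \<and> (\<forall>f. continuous_map T euclideanreal f \<longrightarrow> f (s t) = G f t)" ..
  then have s: "\<And>t. t \<in> D \<Longrightarrow> s t \<in> topspace T"
    "\<And>t f. t \<in> D \<Longrightarrow> continuous_map T euclideanreal f \<Longrightarrow> f (s t) = G f t" by simp_all
  define s' where "s' t = (if t \<in> D then s t else x0)" for t
  have sm: "s' \<in> borel \<rightarrow>\<^sub>M borel_of T"
  proof (rule measurable_into_borel_of)
    show "\<And>t. t \<in> space borel \<Longrightarrow> s' t \<in> topspace T" using s(1) x0 by (simp add: s'_def)
    fix U assume U: "openin T U"
    obtain u :: "nat \<Rightarrow> 'a \<Rightarrow> real" where u: "\<And>n. continuous_map T euclideanreal (u n)"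
      "\<And>n x. x \<in> topspace T \<Longrightarrow> 0 \<le> u n x \<and> u n x \<le> 1"
      "\<And>n x. x \<in> topspace T \<Longrightarrow> x \<notin> U \<Longrightarrow> u n x = 0"
      "\<And>x. x \<in> topspace T \<Longrightarrow> (\<lambda>n. u n x) \<longlonglongrightarrow> indicator U x" by (rule open_indicator_approx[OF U], rule that)
    have *: "s t \<in> U \<longleftrightarrow> (\<exists>n. G (u n) t > 0)" if t: "t \<in> D" for t
    proof
      assume sU: "s t \<in> U"
      have "(\<lambda>n. u n (s t)) \<longlonglongrightarrow> 1" using u(4)[OF s(1)[OF t]] sU by simp
      then have "eventually (\<lambda>n. u n (s t) > 0) sequentially" by (rule order_tendstoD) simp
      then show "\<exists>n. G (u n) t > 0" unfolding s(2)[OF t u(1)] by (auto dest: eventually_happens'[OF sequentially_bot])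
    next
      assume "\<exists>n. G (u n) t > 0"
      then obtain n where "u n (s t) > 0" unfolding s(2)[OF t u(1), symmetric] ..
      then show "s t \<in> U" using u(3)[OF s(1)[OF t], of n] by (cases "s t \<in> U") simp_all
    qed
    have Db: "D \<in> sets borel" using cD by simp
    have Gb: "{t. G (u n) t > 0} \<in> sets borel" for n
      using borel_measurable_continuous_onI[OF G(1)[OF u(1)[of n]]] by measurable
    have "t \<in> s' -` U \<longleftrightarrow> t \<in> D \<inter> (\<Union>n. {t. G (u n) t > 0}) \<union> (if x0 \<in> U then - D else {})" for t
      by (cases "t \<in> D") (simp_all add: * s'_def)
    then have "s' -` U \<inter> space borel = D \<inter> (\<Union>n. {t. G (u n) t > 0}) \<union> (if x0 \<in> U then - D else {})"
      by auto
    also have "\<dots> \<in> sets borel" using Db Gb by auto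
    finally show "s' -` U \<inter> space borel \<in> sets borel" .
  qed
  then have sm': "s' \<in> \<nu> \<rightarrow>\<^sub>M borel_of T" by (simp add: measurable_cong_sets[OF s\<nu>(1) refl])
  define M where "M = distr \<nu> (borel_of T) s'"
  have "M \<in> borel_prob T" unfolding M_def borel_prob_def using \<nu>.prob_space_distr[OF sm'] by simp
  moreover have "(\<lambda>n. \<integral>x. f x \<partial>P (r n)) \<longlonglongrightarrow> (\<integral>x. f x \<partial>M)" if f: "continuous_map T euclideanreal f" for f :: "'a \<Rightarrow> real"
  proof -
    obtain b where b: "\<And>t. norm (G f t) \<le> b" using G(3)[OF f] by auto
    have "(\<integral>x. G f (e x) \<partial>P (r n)) = (\<integral>x. f x \<partial>P (r n))" for n
      by (rule Bochner_Integration.integral_cong) (use sP G(2)[OF f] in auto)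
    moreover have "(\<integral>x. f x \<partial>M) = (\<integral>t. f (s' t) \<partial>\<nu>)"
      unfolding M_def by (rule integral_distr[OF sm' continuous_map_borel_measurable[OF f]])
    moreover have "(\<integral>t. f (s' t) \<partial>\<nu>) = (\<integral>t. G f t \<partial>\<nu>)"
    proof (rule integral_cong_AE)
      show "(\<lambda>t. f (s' t)) \<in> borel_measurable \<nu>"
        using measurable_compose[OF sm' continuous_map_borel_measurable[OF f]] .
      show "G f \<in> borel_measurable \<nu>" using borel_measurable_continuous_onI[OF G(1)[OF f]] by (simp add: measurable_cong_sets[OF s\<nu>(1) refl])
      show "AE t in \<nu>. f (s' t) = G f t" using AED by eventually_elim (simp add: s'_def s(2)[OF _ f])
    qed
    ultimately show ?thesis using conv'[OF G(1)[OF f] b] by simp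
  qed
  ultimately show ?thesis by (intro that[OF r])
qed

end

section \<open>Solutions of the stochastic equation and independence\<close>

lemma space_gen_sigma [simp]: "space (gen_sigma \<Omega> I Y N) = \<Omega>"
  unfolding gen_sigma_def by (rule space_measure_of) auto

lemma sets_gen_sigma: "sets (gen_sigma \<Omega> I Y N) = sigma_sets \<Omega> (\<Union>i\<in>I. {Y i -` A \<inter> \<Omega> | A. A \<in> sets (N i)})"
  unfolding gen_sigma_def by (rule sets_measure_of) auto

lemma measurable_gen_sigma:
  assumes "i \<in> I" "\<And>x. x \<in> \<Omega> \<Longrightarrow> Y i x \<in> space (N i)"
  shows "Y i \<in> gen_sigma \<Omega> I Y N \<rightarrow>\<^sub>M N i"
  using assms by (intro measurableI) (auto simp: sets_gen_sigma intro!: sigma_sets.Basic)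

lemma sets_gen_sigma_subset:
  assumes "space M = \<Omega>" "\<And>i. i \<in> I \<Longrightarrow> Y i \<in> M \<rightarrow>\<^sub>M N i"
  shows "sets (gen_sigma \<Omega> I Y N) \<subseteq> sets M"
  unfolding sets_gen_sigma assms(1)[symmetric]
  by (rule sets.sigma_sets_subset) (auto intro: measurable_sets[OF assms(2)])

text \<open>
  Conditions on finitely many of the variables \<open>Y j\<close>: a generator, closed under intersections, of the \<open>\<sigma>\<close>-algebra that these
  variables generate.
\<close>

definition cylinders :: "'w set \<Rightarrow> 'i set \<Rightarrow> ('i \<Rightarrow> 'w \<Rightarrow> 'b) \<Rightarrow> ('i \<Rightarrow> 'b topology) \<Rightarrow> 'w set set" where
  "cylinders \<Omega> I Y T = {{x \<in> \<Omega>. \<forall>j\<in>J. Y j x \<in> U j} | J U. finite J \<and> J \<subseteq> I \<and> (\<forall>j\<in>J. openin (T j) (U j))}"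

lemma Int_stable_cylinders:
  assumes Y: "\<And>i x. i \<in> I \<Longrightarrow> x \<in> \<Omega> \<Longrightarrow> Y i x \<in> topspace (T i)"
  shows "Int_stable (cylinders \<Omega> I Y T)"
proof (rule Int_stableI)
  fix a b assume "a \<in> cylinders \<Omega> I Y T" "b \<in> cylinders \<Omega> I Y T"
  then obtain J U K V where
    J: "a = {x \<in> \<Omega>. \<forall>j\<in>J. Y j x \<in> U j}" "finite J" "J \<subseteq> I" "\<forall>j\<in>J. openin (T j) (U j)" and
    K: "b = {x \<in> \<Omega>. \<forall>j\<in>K. Y j x \<in> V j}" "finite K" "K \<subseteq> I" "\<forall>j\<in>K. openin (T j) (V j)"
    unfolding cylinders_def by (elim CollectE exE conjE)
  define W where "W j = (if j \<in> J then U j else topspace (T j)) \<inter> (if j \<in> K then V j else topspace (T j))" for j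
  have "a \<inter> b = {x \<in> \<Omega>. \<forall>j\<in>J \<union> K. Y j x \<in> W j}"
    unfolding J(1) K(1) W_def using Y J(3) K(3) by auto
  moreover have "\<forall>j\<in>J \<union> K. openin (T j) (W j)" using J(4) K(4) by (auto simp: W_def)
  ultimately show "a \<inter> b \<in> cylinders \<Omega> I Y T"
    unfolding cylinders_def using J(2,3) K(2,3) by (intro CollectI exI[of _ "J \<union> K"] exI[of _ W]) auto
qed

lemma sets_gen_sigma_cylinders:
  assumes Y: "\<And>i x. i \<in> I \<Longrightarrow> x \<in> \<Omega> \<Longrightarrow> Y i x \<in> topspace (T i)"
  shows "sets (gen_sigma \<Omega> I Y (\<lambda>j. borel_of (T j))) = sigma_sets \<Omega> (cylinders \<Omega> I Y T)"
proof
  have cyl: "cylinders \<Omega> I Y T \<subseteq> Pow \<Omega>" by (auto simp: cylinders_def)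
  let ?S = "sigma \<Omega> (cylinders \<Omega> I Y T)"
  have "sets (gen_sigma \<Omega> I Y (\<lambda>j. borel_of (T j))) \<subseteq> sets ?S"
  proof (rule sets_gen_sigma_subset)
    show "space ?S = \<Omega>" by (rule space_measure_of[OF cyl])
    fix i assume i: "i \<in> I"
    show "Y i \<in> ?S \<rightarrow>\<^sub>M borel_of (T i)"
    proof (rule measurable_into_borel_of)
      show "\<And>x. x \<in> space ?S \<Longrightarrow> Y i x \<in> topspace (T i)" using Y[OF i] by (simp add: space_measure_of[OF cyl])
      fix U assume "openin (T i) U"
      then have "{x \<in> \<Omega>. \<forall>j\<in>{i}. Y j x \<in> U} \<in> cylinders \<Omega> I Y T"
        unfolding cylinders_def using i by (intro CollectI exI[of _ "{i}"] exI[of _ "\<lambda>_. U"]) auto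
      moreover have "Y i -` U \<inter> space ?S = {x \<in> \<Omega>. \<forall>j\<in>{i}. Y j x \<in> U}" by (auto simp: space_measure_of[OF cyl])
      ultimately show "Y i -` U \<inter> space ?S \<in> sets ?S" by (simp add: sets_measure_of[OF cyl] sigma_sets.Basic)
    qed
  qed
  then show "sets (gen_sigma \<Omega> I Y (\<lambda>j. borel_of (T j))) \<subseteq> sigma_sets \<Omega> (cylinders \<Omega> I Y T)"
    by (simp add: sets_measure_of[OF cyl])
  show "sigma_sets \<Omega> (cylinders \<Omega> I Y T) \<subseteq> sets (gen_sigma \<Omega> I Y (\<lambda>j. borel_of (T j)))"
  proof -
    let ?G = "gen_sigma \<Omega> I Y (\<lambda>j. borel_of (T j))"
    have "a \<in> sets ?G" if "a \<in> cylinders \<Omega> I Y T" for a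
    proof -
      from that obtain J U where J: "a = {x \<in> \<Omega>. \<forall>j\<in>J. Y j x \<in> U j}" "finite J" "J \<subseteq> I" "\<forall>j\<in>J. openin (T j) (U j)"
        unfolding cylinders_def by (elim CollectE exE conjE)
      have m: "Y j \<in> ?G \<rightarrow>\<^sub>M borel_of (T j)" if "j \<in> J" for j
        using that J(3) Y by (intro measurable_gen_sigma) auto
      have "a = \<Omega> \<inter> (\<Inter>j\<in>J. Y j -` U j \<inter> space ?G)" unfolding J(1) by auto
      also have "\<dots> \<in> sets ?G"
      proof (cases "J = {}")
        case True then show ?thesis using sets.top[of ?G] by simp
      next
        case False
        have "Y j -` U j \<inter> space ?G \<in> sets ?G" if "j \<in> J" for j
          by (rule measurable_sets[OF m[OF that] openin_imp_borel_of]) (use J(4) that in blast)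
        then have "(\<Inter>j\<in>J. Y j -` U j \<inter> space ?G) \<in> sets ?G"
          using J(2) False by (intro sets.finite_INT)
        then show ?thesis using sets.top[of ?G] by auto
      qed
      finally show ?thesis .
    qed
    then have "cylinders \<Omega> I Y T \<subseteq> sets ?G" by blast
    from sets.sigma_sets_subset[OF this] show ?thesis by simp
  qed
qed

lemma measure_pair_eqI:
  assumes "sets M = sets (A \<Otimes>\<^sub>M B)" "sets N = sets (A \<Otimes>\<^sub>M B)" "finite_measure M"
    and eq: "\<And>a b. a \<in> sets A \<Longrightarrow> b \<in> sets B \<Longrightarrow> emeasure M (a \<times> b) = emeasure N (a \<times> b)"
  shows "M = N"
proof (rule measure_eqI_generator_eq[where A = "\<lambda>_. space A \<times> space B"])
  show "Int_stable {a \<times> b |a b. a \<in> sets A \<and> b \<in> sets B}" by (rule Int_stable_pair_measure_generator)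
  show "{a \<times> b |a b. a \<in> sets A \<and> b \<in> sets B} \<subseteq> Pow (space A \<times> space B)" by (rule pair_measure_closed)
  show "sets M = sigma_sets (space A \<times> space B) {a \<times> b |a b. a \<in> sets A \<and> b \<in> sets B}"
    "sets N = sigma_sets (space A \<times> space B) {a \<times> b |a b. a \<in> sets A \<and> b \<in> sets B}"
    using assms(1,2) by (simp_all add: sets_pair_measure)
  show "\<And>X. X \<in> {a \<times> b |a b. a \<in> sets A \<and> b \<in> sets B} \<Longrightarrow> emeasure M X = emeasure N X" using eq by auto
  show "range (\<lambda>_. space A \<times> space B) \<subseteq> {a \<times> b |a b. a \<in> sets A \<and> b \<in> sets B}" by auto
  show "emeasure M (space A \<times> space B) \<noteq> \<infinity>" using finite_measure.emeasure_finite[OF assms(3)] by simp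
qed auto

lemma integrable_bounded_prob:
  fixes f :: "'a \<Rightarrow> 'b :: {banach, second_countable_topology}"
  assumes "prob_space P" "f \<in> borel_measurable P" "\<And>x. x \<in> space P \<Longrightarrow> norm (f x) \<le> b"
  shows "integrable P f"
proof -
  interpret prob_space P by fact
  show ?thesis using assms(2,3) by (intro integrable_const_bound[of f b] AE_I2)
qed

lemma compact_sc_prod_top:
  assumes "\<And>k. compact_sc (T k)" shows "compact_sc (prod_top T)"
  using assms unfolding compact_sc_def
  by (auto simp: compact_space_product_topology Hausdorff_space_product_topology intro!: second_countable_product_topology)

locale group_chain =
  fixes G :: "nat \<Rightarrow> 'a monoid" and T :: "nat \<Rightarrow> 'a topology" and \<phi> :: "nat \<Rightarrow> 'a \<Rightarrow> 'a" and \<mu> :: "nat \<Rightarrow> 'a measure"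
  assumes tg: "\<And>k. topological_group (G k) (T k)"
    and csc: "\<And>k. compact_sc (T k)"
    and hom: "\<And>k. \<phi> k \<in> hom (G (Suc k)) (G k)"
    and cont_phi: "\<And>k. continuous_map (T (Suc k)) (T k) (\<phi> k)"
    and mu: "\<And>k. \<mu> k \<in> borel_prob (T k)"
begin

abbreviation "\<Omega> \<equiv> topspace (prod_top T)"
abbreviation "\<B> \<equiv> borel_of (prod_top T)"

lemma grp: "group (G k)" and carr: "carrier (G k) = topspace (T k)"
  using tg by (simp_all add: topological_group_def)

lemma cont_mult: "continuous_map (prod_topology (T k) (T k)) (T k) (\<lambda>(x, y). x \<otimes>\<^bsub>G k\<^esub> y)"
  and cont_inv: "continuous_map (T k) (T k) (\<lambda>x. inv\<^bsub>G k\<^esub> x)"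
  using tg by (simp_all add: topological_group_def)

lemma cont_mult': "continuous_map S (T k) f \<Longrightarrow> continuous_map S (T k) g \<Longrightarrow> continuous_map S (T k) (\<lambda>x. f x \<otimes>\<^bsub>G k\<^esub> g x)"
  using continuous_map_compose[OF continuous_map_pairedI cont_mult, of S k f g] by (simp add: comp_def)

lemma cont_inv': "continuous_map S (T k) f \<Longrightarrow> continuous_map S (T k) (\<lambda>x. inv\<^bsub>G k\<^esub> (f x))"
  using continuous_map_compose[OF _ cont_inv, of S k f] by (simp add: comp_def)

lemma cont_phi': "continuous_map S (T (Suc k)) f \<Longrightarrow> continuous_map S (T k) (\<lambda>x. \<phi> k (f x))"
  using continuous_map_compose[OF _ cont_phi, of S k f] by (simp add: comp_def)

lemma cont_coord: "continuous_map (prod_top T) (T k) (\<lambda>x. x k)"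
  by (rule continuous_map_product_projection) simp

lemma cont_Z: "continuous_map (prod_top T) (T k) (Z_var G \<phi> k)"
  unfolding Z_var_def by (intro cont_mult' cont_inv' cont_phi' cont_coord)

lemma coord_in: "x \<in> \<Omega> \<Longrightarrow> x k \<in> topspace (T k)" by auto

lemma Z_in: "x \<in> \<Omega> \<Longrightarrow> Z_var G \<phi> k x \<in> topspace (T k)"
  using cont_Z[of k] by (simp add: continuous_map_def Pi_def)

lemma phi_in: "y \<in> topspace (T (Suc k)) \<Longrightarrow> \<phi> k y \<in> topspace (T k)"
  using cont_phi[of k] by (simp add: continuous_map_def Pi_def)

lemma mult_measurable:
  assumes "f \<in> M \<rightarrow>\<^sub>M borel_of (T k)" "g \<in> M \<rightarrow>\<^sub>M borel_of (T k)"
  shows "(\<lambda>x. f x \<otimes>\<^bsub>G k\<^esub> g x) \<in> M \<rightarrow>\<^sub>M borel_of (T k)"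
proof -
  have "(\<lambda>(x, y). x \<otimes>\<^bsub>G k\<^esub> y) \<in> borel_of (T k) \<Otimes>\<^sub>M borel_of (T k) \<rightarrow>\<^sub>M borel_of (T k)"
    using csc by (intro continuous_map_pair_borel cont_mult) (simp_all add: compact_sc_def)
  from measurable_compose[OF measurable_Pair[OF assms] this] show ?thesis by simp
qed

lemma inv_measurable: "f \<in> M \<rightarrow>\<^sub>M borel_of (T k) \<Longrightarrow> (\<lambda>x. inv\<^bsub>G k\<^esub> (f x)) \<in> M \<rightarrow>\<^sub>M borel_of (T k)"
  using measurable_compose[OF _ continuous_map_borel_of[OF cont_inv]] by blast

lemma phi_measurable: "f \<in> M \<rightarrow>\<^sub>M borel_of (T (Suc k)) \<Longrightarrow> (\<lambda>x. \<phi> k (f x)) \<in> M \<rightarrow>\<^sub>M borel_of (T k)"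
  using measurable_compose[OF _ continuous_map_borel_of[OF cont_phi]] by blast

lemma coord_measurable: "(\<lambda>x. x k) \<in> \<B> \<rightarrow>\<^sub>M borel_of (T k)"
  by (rule continuous_map_borel_of[OF cont_coord])

lemma Z_measurable: "Z_var G \<phi> k \<in> \<B> \<rightarrow>\<^sub>M borel_of (T k)"
  by (rule continuous_map_borel_of[OF cont_Z])

lemma space_future [simp]: "space (future_X T k) = \<Omega>" by (simp add: future_X_def)

lemma future_subset: "sets (future_X T k) \<subseteq> sets \<B>"
  unfolding future_X_def by (rule sets_gen_sigma_subset) (auto intro: coord_measurable)

lemma coord_future: "k < j \<Longrightarrow> (\<lambda>x. x j) \<in> future_X T k \<rightarrow>\<^sub>M borel_of (T j)"
  unfolding future_X_def by (rule measurable_gen_sigma) auto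

lemma Z_future: "k < j \<Longrightarrow> Z_var G \<phi> j \<in> future_X T k \<rightarrow>\<^sub>M borel_of (T j)"
  unfolding Z_var_def by (intro mult_measurable inv_measurable phi_measurable coord_future) auto

lemma future_mono:
  assumes "k \<le> l" shows "sets (future_X T l) \<subseteq> sets (future_X T k)"
proof -
  have "sets (gen_sigma \<Omega> {l<..} (\<lambda>j x. x j) (\<lambda>j. borel_of (T j))) \<subseteq> sets (future_X T k)"
    by (rule sets_gen_sigma_subset) (use assms in \<open>auto intro: coord_future\<close>)
  then show ?thesis by (simp add: future_X_def)
qed

lemma measurable_future_all: "f \<in> future_X T l \<rightarrow>\<^sub>M N \<Longrightarrow> f \<in> \<B> \<rightarrow>\<^sub>M N"
  using future_subset[of l] by (auto simp: measurable_def)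

lemma phi_Z: "x \<in> \<Omega> \<Longrightarrow> \<phi> k (x (Suc k)) \<otimes>\<^bsub>G k\<^esub> Z_var G \<phi> k x = x k"
  using group.inv_solve_left[OF grp[of k], of "Z_var G \<phi> k x" "\<phi> k (x (Suc k))" "x k"]
    coord_in[of x k] phi_in[OF coord_in[of x "Suc k"]] Z_in[of x k]
  by (simp add: carr Z_var_def)

lemma inv_phi_mult: "x \<in> \<Omega> \<Longrightarrow> z \<in> topspace (T k) \<Longrightarrow> inv\<^bsub>G k\<^esub> \<phi> k (x (Suc k)) \<otimes>\<^bsub>G k\<^esub> (\<phi> k (x (Suc k)) \<otimes>\<^bsub>G k\<^esub> z) = z"
proof -
  assume x: "x \<in> \<Omega>" and z: "z \<in> topspace (T k)"
  interpret group "G k" by (rule grp)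
  have "\<phi> k (x (Suc k)) \<in> carrier (G k)" "z \<in> carrier (G k)" using phi_in[OF coord_in[OF x]] z by (simp_all add: carr)
  then show ?thesis by (simp add: m_assoc[symmetric])
qed

text \<open>
  The solution property at level \<open>k\<close>. Taking \<open>B = \<Omega>\<close> gives that \<open>Z k\<close> has law \<open>\<mu> k\<close>, and then the equation
  says that it is independent of the coordinates beyond \<open>k\<close>.
\<close>

definition ind_at :: "(nat \<Rightarrow> 'a) measure \<Rightarrow> nat \<Rightarrow> bool" where
  "ind_at P k \<longleftrightarrow> (\<forall>C\<in>sets (borel_of (T k)). \<forall>B\<in>sets (future_X T k).
     measure P ({x\<in>\<Omega>. Z_var G \<phi> k x \<in> C} \<inter> B) = measure (\<mu> k) C * measure P B)"

abbreviation "Nk k \<equiv> borel_of (T k) \<Otimes>\<^sub>M future_X T k"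

text \<open>
  Both sides compare two measures on rectangles. The second component is the whole point \<open>x\<close>, but it is observed only through
  the \<open>\<sigma>\<close>-algebra of its coordinates beyond \<open>k\<close>.
\<close>

lemma ind_at_iff:
  assumes P: "P \<in> borel_prob (prod_top T)"
  shows "ind_at P k \<longleftrightarrow> distr P (Nk k) (\<lambda>x. (Z_var G \<phi> k x, x)) = \<mu> k \<Otimes>\<^sub>M distr P (future_X T k) (\<lambda>x. x)"
proof -
  interpret P: prob_space P by (rule borel_probD[OF P])
  interpret mu: prob_space "\<mu> k" by (rule borel_probD[OF mu])
  note sP = borel_probD(2,3)[OF P] and sm = borel_probD(2,3)[OF mu, of k]
  have idm: "(\<lambda>x. x) \<in> P \<rightarrow>\<^sub>M future_X T k"
    using future_subset[of k] sP by (auto simp: measurable_def)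
  have Zm: "Z_var G \<phi> k \<in> P \<rightarrow>\<^sub>M borel_of (T k)" using Z_measurable[of k] measurable_cong_sets[OF sP(1) refl] by blast
  have pm: "(\<lambda>x. (Z_var G \<phi> k x, x)) \<in> P \<rightarrow>\<^sub>M Nk k" by (rule measurable_Pair[OF Zm idm])
  interpret F: prob_space "distr P (future_X T k) (\<lambda>x. x)" by (rule P.prob_space_distr[OF idm])
  have rect: "emeasure (distr P (Nk k) (\<lambda>x. (Z_var G \<phi> k x, x))) (C \<times> B) = measure P ({x\<in>\<Omega>. Z_var G \<phi> k x \<in> C} \<inter> B)"
    "emeasure (\<mu> k \<Otimes>\<^sub>M distr P (future_X T k) (\<lambda>x. x)) (C \<times> B) = ennreal (measure (\<mu> k) C * measure P B)"
    if C: "C \<in> sets (borel_of (T k))" and B: "B \<in> sets (future_X T k)" for C B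
  proof -
    have BO: "B \<subseteq> \<Omega>" using sets.sets_into_space[OF B] by simp
    have "emeasure (distr P (Nk k) (\<lambda>x. (Z_var G \<phi> k x, x))) (C \<times> B) = emeasure P ((\<lambda>x. (Z_var G \<phi> k x, x)) -` (C \<times> B) \<inter> space P)"
      by (rule emeasure_distr[OF pm]) (intro pair_measureI C B)
    also have "(\<lambda>x. (Z_var G \<phi> k x, x)) -` (C \<times> B) \<inter> space P = {x\<in>\<Omega>. Z_var G \<phi> k x \<in> C} \<inter> B"
      using BO by (auto simp: sP simp del: topspace_product_topology)
    finally show "emeasure (distr P (Nk k) (\<lambda>x. (Z_var G \<phi> k x, x))) (C \<times> B) = measure P ({x\<in>\<Omega>. Z_var G \<phi> k x \<in> C} \<inter> B)"
      by (simp add: P.emeasure_eq_measure)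
    have "emeasure (\<mu> k \<Otimes>\<^sub>M distr P (future_X T k) (\<lambda>x. x)) (C \<times> B) = emeasure (\<mu> k) C * emeasure (distr P (future_X T k) (\<lambda>x. x)) B"
      by (rule F.emeasure_pair_measure_Times) (use C B sm in simp_all)
    also have "emeasure (distr P (future_X T k) (\<lambda>x. x)) B = emeasure P B"
      by (subst emeasure_distr[OF idm B]) (use BO sP in \<open>auto simp: Int_absorb2 simp del: topspace_product_topology\<close>)
    finally show "emeasure (\<mu> k \<Otimes>\<^sub>M distr P (future_X T k) (\<lambda>x. x)) (C \<times> B) = ennreal (measure (\<mu> k) C * measure P B)"
      by (simp add: P.emeasure_eq_measure mu.emeasure_eq_measure ennreal_mult)
  qed
  have s2: "sets (\<mu> k \<Otimes>\<^sub>M distr P (future_X T k) (\<lambda>x. x)) = sets (Nk k)"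
    by (rule sets_pair_measure_cong) (simp_all add: sm)
  show ?thesis
  proof
    assume i: "ind_at P k"
    show "distr P (Nk k) (\<lambda>x. (Z_var G \<phi> k x, x)) = \<mu> k \<Otimes>\<^sub>M distr P (future_X T k) (\<lambda>x. x)"
      by (rule measure_pair_eqI[OF _ s2]) (use i in \<open>simp_all add: rect ind_at_def P.finite_measure_distr[OF pm]\<close>)
  next
    assume eq: "distr P (Nk k) (\<lambda>x. (Z_var G \<phi> k x, x)) = \<mu> k \<Otimes>\<^sub>M distr P (future_X T k) (\<lambda>x. x)"
    show "ind_at P k" unfolding ind_at_def
    proof (intro ballI)
      fix C B assume CB: "C \<in> sets (borel_of (T k))" "B \<in> sets (future_X T k)"
      have "ennreal (measure P ({x\<in>\<Omega>. Z_var G \<phi> k x \<in> C} \<inter> B)) = ennreal (measure (\<mu> k) C * measure P B)"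
        unfolding rect[OF CB, symmetric] eq ..
      then show "measure P ({x\<in>\<Omega>. Z_var G \<phi> k x \<in> C} \<inter> B) = measure (\<mu> k) C * measure P B"
        by (simp add: ennreal_inj)
    qed
  qed
qed

lemma pair_integral:
  fixes F :: "'a \<times> (nat \<Rightarrow> 'a) \<Rightarrow> 'b :: {banach, second_countable_topology}"
  assumes P: "P \<in> borel_prob (prod_top T)"
    and F: "F \<in> borel_measurable (Nk k)" and b: "\<And>z x. z \<in> topspace (T k) \<Longrightarrow> x \<in> \<Omega> \<Longrightarrow> norm (F (z, x)) \<le> b"
  shows "(\<integral>p. F p \<partial>(\<mu> k \<Otimes>\<^sub>M distr P (future_X T k) (\<lambda>x. x))) = (\<integral>x. (\<integral>z. F (z, x) \<partial>\<mu> k) \<partial>P)"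
    "(\<lambda>x. (\<integral>z. F (z, x) \<partial>\<mu> k)) \<in> borel_measurable (future_X T k)"
proof -
  interpret P: prob_space P by (rule borel_probD[OF P])
  interpret mu: prob_space "\<mu> k" by (rule borel_probD[OF mu])
  note sP = borel_probD(2,3)[OF P] and sm = borel_probD(2,3)[OF mu, of k]
  have idm: "(\<lambda>x. x) \<in> P \<rightarrow>\<^sub>M future_X T k"
    using future_subset[of k] sP by (auto simp: measurable_def)
  let ?F = "distr P (future_X T k) (\<lambda>x. x)"
  interpret F: prob_space ?F by (rule P.prob_space_distr[OF idm])
  interpret muF: pair_prob_space "\<mu> k" ?F ..
  have s2: "sets (\<mu> k \<Otimes>\<^sub>M ?F) = sets (Nk k)" by (rule sets_pair_measure_cong) (simp_all add: sm)
  have F': "F \<in> borel_measurable (\<mu> k \<Otimes>\<^sub>M ?F)" using F measurable_cong_sets[OF s2 refl] by blast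
  have int: "integrable (\<mu> k \<Otimes>\<^sub>M ?F) F"
    by (rule integrable_bounded_prob[OF muF.prob_space_axioms F', of b])
      (use b sm in \<open>auto simp: space_pair_measure simp del: topspace_product_topology\<close>)
  have sw: "(\<lambda>(x, z). F (z, x)) \<in> borel_measurable (future_X T k \<Otimes>\<^sub>M \<mu> k)"
  proof -
    have "(\<lambda>(x, z). (z, x)) \<in> future_X T k \<Otimes>\<^sub>M \<mu> k \<rightarrow>\<^sub>M \<mu> k \<Otimes>\<^sub>M future_X T k" by (rule measurable_pair_swap')
    moreover have "F \<in> borel_measurable (\<mu> k \<Otimes>\<^sub>M future_X T k)"
      using F measurable_cong_sets[OF sets_pair_measure_cong[OF sm(1) refl] refl] by blast
    ultimately show ?thesis using measurable_compose[of "\<lambda>(x, z). (z, x)" "future_X T k \<Otimes>\<^sub>M \<mu> k" "\<mu> k \<Otimes>\<^sub>M future_X T k" F borel]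
      by (simp add: case_prod_unfold)
  qed
  show inner: "(\<lambda>x. (\<integral>z. F (z, x) \<partial>\<mu> k)) \<in> borel_measurable (future_X T k)"
    using mu.borel_measurable_lebesgue_integral[OF sw] by simp
  have "(\<integral>p. F p \<partial>(\<mu> k \<Otimes>\<^sub>M ?F)) = (\<integral>x. (\<integral>z. F (z, x) \<partial>\<mu> k) \<partial>?F)"
    using muF.integral_snd[of "\<lambda>z x. F (z, x)"] int by simp
  also have "\<dots> = (\<integral>x. (\<integral>z. F (z, x) \<partial>\<mu> k) \<partial>P)" by (rule integral_distr[OF idm inner])
  finally show "(\<integral>p. F p \<partial>(\<mu> k \<Otimes>\<^sub>M ?F)) = (\<integral>x. (\<integral>z. F (z, x) \<partial>\<mu> k) \<partial>P)" .
qed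

lemma ind_at_integral:
  fixes F :: "'a \<times> (nat \<Rightarrow> 'a) \<Rightarrow> 'b :: {banach, second_countable_topology}"
  assumes P: "P \<in> borel_prob (prod_top T)" and i: "ind_at P k"
    and F: "F \<in> borel_measurable (Nk k)" and b: "\<And>z x. z \<in> topspace (T k) \<Longrightarrow> x \<in> \<Omega> \<Longrightarrow> norm (F (z, x)) \<le> b"
  shows "(\<integral>x. F (Z_var G \<phi> k x, x) \<partial>P) = (\<integral>x. (\<integral>z. F (z, x) \<partial>\<mu> k) \<partial>P)"
proof -
  note sP = borel_probD(2,3)[OF P]
  have idm: "(\<lambda>x. x) \<in> P \<rightarrow>\<^sub>M future_X T k"
    using future_subset[of k] sP by (auto simp: measurable_def)
  have Zm: "Z_var G \<phi> k \<in> P \<rightarrow>\<^sub>M borel_of (T k)" using Z_measurable[of k] measurable_cong_sets[OF sP(1) refl] by blast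
  have pm: "(\<lambda>x. (Z_var G \<phi> k x, x)) \<in> P \<rightarrow>\<^sub>M Nk k" by (rule measurable_Pair[OF Zm idm])
  have "(\<integral>x. F (Z_var G \<phi> k x, x) \<partial>P) = (\<integral>p. F p \<partial>distr P (Nk k) (\<lambda>x. (Z_var G \<phi> k x, x)))"
    by (rule integral_distr[OF pm F, symmetric])
  then show ?thesis using i[unfolded ind_at_iff[OF P]] pair_integral(1)[OF P F b] by simp
qed

lemma ind_at_product:
  fixes f :: "'a \<Rightarrow> 'b :: {real_normed_field, banach, second_countable_topology}"
  assumes P: "P \<in> borel_prob (prod_top T)" and i: "ind_at P k"
    and f: "f \<in> borel_measurable (borel_of (T k))" "\<And>z. z \<in> topspace (T k) \<Longrightarrow> norm (f z) \<le> b"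
    and H: "H \<in> borel_measurable (future_X T k)" "\<And>x. x \<in> \<Omega> \<Longrightarrow> norm (H x) \<le> c"
  shows "(\<integral>x. H x * f (Z_var G \<phi> k x) \<partial>P) = (\<integral>x. H x \<partial>P) * (\<integral>z. f z \<partial>\<mu> k)"
proof -
  let ?F = "\<lambda>p. H (snd p) * f (fst p)"
  have F: "?F \<in> borel_measurable (Nk k)"
    using measurable_compose[OF measurable_snd H(1)] measurable_compose[OF measurable_fst f(1)] by (intro borel_measurable_times)
  have "norm (?F (z, x)) \<le> c * b" if "z \<in> topspace (T k)" "x \<in> \<Omega>" for z x
    using f(2)[OF that(1)] H(2)[OF that(2)] by (simp add: norm_mult mult_mono' order_trans[OF norm_ge_zero])
  from ind_at_integral(1)[OF P i F this] show ?thesis by simp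
qed

text \<open>
  The conditional expectation prescribes the joint law of \<open>x k\<close> and the later coordinates: it is that of
  \<open>\<phi> k (x (k + 1)) \<cdot> z\<close> and the later coordinates, where \<open>z\<close> is drawn from \<open>\<mu> k\<close> independently. The measurable shear
  \<open>(y, x) \<mapsto> (\<phi> k (x (k + 1))\<inverse> \<cdot> y, x)\<close> maps the first law to that of \<open>(Z k x, x)\<close> and the second to the product measure.
\<close>

lemma solution_imp_ind_at:
  assumes P: "P \<in> solutions G T \<phi> \<mu>" shows "ind_at P k"
proof -
  have Pb: "P \<in> borel_prob (prod_top T)" using P by (simp add: solutions_def)
  interpret P: prob_space P by (rule borel_probD[OF Pb])
  interpret mu: prob_space "\<mu> k" by (rule borel_probD[OF mu])
  note sP = borel_probD(2,3)[OF Pb] and sm = borel_probD(2,3)[OF mu, of k]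
  have idm: "(\<lambda>x. x) \<in> P \<rightarrow>\<^sub>M future_X T k"
    using future_subset[of k] sP by (auto simp: measurable_def)
  let ?F = "distr P (future_X T k) (\<lambda>x. x)"
  interpret F: prob_space ?F by (rule P.prob_space_distr[OF idm])
  interpret muF: pair_prob_space "\<mu> k" ?F ..
  interpret S: finite_measure_subalgebra P "future_X T k"
    by unfold_locales (use sP future_subset[of k] in \<open>simp add: subalgebra_def del: topspace_product_topology\<close>)
  have s2: "sets (\<mu> k \<Otimes>\<^sub>M ?F) = sets (Nk k)" by (rule sets_pair_measure_cong) (simp_all add: sm)
  have Xm: "(\<lambda>x. x k) \<in> P \<rightarrow>\<^sub>M borel_of (T k)" using coord_measurable[of k] measurable_cong_sets[OF sP(1) refl] by blast
  have pm: "(\<lambda>x. (x k, x)) \<in> P \<rightarrow>\<^sub>M Nk k" by (rule measurable_Pair[OF Xm idm])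
  have phim: "(\<lambda>p. \<phi> k (snd p (Suc k))) \<in> Nk k \<rightarrow>\<^sub>M borel_of (T k)"
    by (intro phi_measurable measurable_compose[OF measurable_snd coord_future]) simp
  have fm: "(\<lambda>p. \<phi> k (snd p (Suc k)) \<otimes>\<^bsub>G k\<^esub> fst p) \<in> Nk k \<rightarrow>\<^sub>M borel_of (T k)"
    by (intro mult_measurable phim measurable_fst)
  have \<Phi>: "(\<lambda>p. (\<phi> k (snd p (Suc k)) \<otimes>\<^bsub>G k\<^esub> fst p, snd p)) \<in> Nk k \<rightarrow>\<^sub>M Nk k"
    by (intro measurable_Pair fm measurable_snd)
  have \<Phi>': "(\<lambda>p. (\<phi> k (snd p (Suc k)) \<otimes>\<^bsub>G k\<^esub> fst p, snd p)) \<in> \<mu> k \<Otimes>\<^sub>M ?F \<rightarrow>\<^sub>M Nk k"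
    using \<Phi> measurable_cong_sets[OF s2 refl] by blast
  have \<Psi>: "(\<lambda>p. (inv\<^bsub>G k\<^esub> \<phi> k (snd p (Suc k)) \<otimes>\<^bsub>G k\<^esub> fst p, snd p)) \<in> Nk k \<rightarrow>\<^sub>M Nk k"
    by (intro measurable_Pair mult_measurable inv_measurable phim measurable_fst measurable_snd)
  let ?D1 = "distr P (Nk k) (\<lambda>x. (x k, x))"
  let ?D2 = "distr (\<mu> k \<Otimes>\<^sub>M ?F) (Nk k) (\<lambda>p. (\<phi> k (snd p (Suc k)) \<otimes>\<^bsub>G k\<^esub> fst p, snd p))"
  interpret D2: prob_space ?D2 by (rule muF.prob_space_distr[OF \<Phi>'])
  \<comment> \<open>\<open>?D1\<close> is the law of \<open>x k\<close> together with the later coordinates, \<open>?D2\<close> its description by the conditional expectation.\<close>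
  have "?D1 = ?D2"
  proof (rule measure_pair_eqI)
    fix a b assume a: "a \<in> sets (borel_of (T k))" and b: "b \<in> sets (future_X T k)"
    have b': "b \<in> sets P" using b future_subset sP by blast
    have bO: "b \<subseteq> \<Omega>" using sets.sets_into_space[OF b] by simp
    let ?f = "indicator a :: 'a \<Rightarrow> real"
    have fb: "?f \<in> borel_measurable (borel_of (T k))" using a by simp
    have "bounded (?f ` topspace (T k))" by (rule boundedI[of _ 1]) auto
    then have AE: "AE x in P. real_cond_exp P (future_X T k) (\<lambda>x. ?f (x k)) x
                        = (\<integral>z. ?f (\<phi> k (x (Suc k)) \<otimes>\<^bsub>G k\<^esub> z) \<partial>\<mu> k)"
      using P fb unfolding solutions_def by simp
    have ab: "{x\<in>\<Omega>. x k \<in> a} \<inter> b \<in> sets P"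
    proof -
      have "{x\<in>\<Omega>. x k \<in> a} = (\<lambda>x. x k) -` a \<inter> space P" by (auto simp: sP simp del: topspace_product_topology)
      then show ?thesis using measurable_sets[OF Xm a] b' by (metis sets.Int)
    qed
    have "emeasure ?D1 (a \<times> b) = emeasure P ({x\<in>\<Omega>. x k \<in> a} \<inter> b)"
      by (subst emeasure_distr[OF pm]) (use a b bO in \<open>auto intro!: arg_cong[where f = "emeasure P"] simp: sP simp del: topspace_product_topology\<close>)
    also have "\<dots> = ennreal (measure P ({x\<in>\<Omega>. x k \<in> a} \<inter> b))" by (simp add: P.emeasure_eq_measure)
    also have "measure P ({x\<in>\<Omega>. x k \<in> a} \<inter> b) = (\<integral>x. indicator ({x\<in>\<Omega>. x k \<in> a} \<inter> b) x \<partial>P)" using ab by simp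
    also have "\<dots> = (\<integral>x\<in>b. ?f (x k) \<partial>P)"
      unfolding set_lebesgue_integral_def
      by (rule Bochner_Integration.integral_cong[OF refl]) (use sP in \<open>auto simp: indicator_def simp del: topspace_product_topology\<close>)
    also have "\<dots> = (\<integral>x\<in>b. real_cond_exp P (future_X T k) (\<lambda>x. ?f (x k)) x \<partial>P)"
      by (rule S.real_cond_exp_intA[OF _ b])
        (rule integrable_bounded_prob[OF P.prob_space_axioms measurable_compose[OF Xm fb], of 1], simp)
    also have "\<dots> = (\<integral>x. (\<integral>z. indicator b x * ?f (\<phi> k (x (Suc k)) \<otimes>\<^bsub>G k\<^esub> z) \<partial>\<mu> k) \<partial>P)"
    proof -
      let ?g = "\<lambda>p. indicator b (snd p) * ?f (\<phi> k (snd p (Suc k)) \<otimes>\<^bsub>G k\<^esub> fst p)"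
      have g: "?g \<in> borel_measurable (Nk k)"
        by (intro borel_measurable_times measurable_compose[OF fm fb] measurable_compose[OF measurable_snd]) (use b in simp)
      have "(\<lambda>x. (\<integral>z. ?g (z, x) \<partial>\<mu> k)) \<in> borel_measurable (future_X T k)"
        by (rule pair_integral(2)[OF Pb g, of 1]) (simp add: indicator_def)
      then have gm: "(\<lambda>x. (\<integral>z. ?g (z, x) \<partial>\<mu> k)) \<in> borel_measurable P"
        using measurable_future_all measurable_cong_sets[OF sP(1) refl] by blast
      show ?thesis unfolding set_lebesgue_integral_def
        by (rule integral_cong_AE) (use gm AE b' in \<open>auto intro!: borel_measurable_indicator\<close>)
    qed
    also have "\<dots> = (\<integral>p. indicator b (snd p) * ?f (\<phi> k (snd p (Suc k)) \<otimes>\<^bsub>G k\<^esub> fst p) \<partial>(\<mu> k \<Otimes>\<^sub>M ?F))"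
    proof (subst pair_integral(1)[OF Pb, where b = 1])
      show "(\<lambda>p. indicator b (snd p) * ?f (\<phi> k (snd p (Suc k)) \<otimes>\<^bsub>G k\<^esub> fst p)) \<in> borel_measurable (Nk k)"
        by (intro borel_measurable_times measurable_compose[OF fm fb] measurable_compose[OF measurable_snd]) (use b in simp)
    qed (simp_all add: indicator_def del: topspace_product_topology)
    also have "\<dots> = (\<integral>p. indicator (a \<times> b) (\<phi> k (snd p (Suc k)) \<otimes>\<^bsub>G k\<^esub> fst p, snd p) \<partial>(\<mu> k \<Otimes>\<^sub>M ?F))"
      by (rule Bochner_Integration.integral_cong[OF refl]) (auto simp: indicator_def)
    also have "\<dots> = (\<integral>p. indicator (a \<times> b) p \<partial>?D2)"
      by (rule integral_distr[OF \<Phi>', symmetric]) (use a b in simp)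
    also have "\<dots> = measure ?D2 (a \<times> b)" using a b by simp
    also have "ennreal \<dots> = emeasure ?D2 (a \<times> b)" by (simp add: D2.emeasure_eq_measure)
    finally show "emeasure ?D1 (a \<times> b) = emeasure ?D2 (a \<times> b)" .
  qed (simp_all add: P.finite_measure_distr[OF pm])
  then have "distr ?D1 (Nk k) (\<lambda>p. (inv\<^bsub>G k\<^esub> \<phi> k (snd p (Suc k)) \<otimes>\<^bsub>G k\<^esub> fst p, snd p)) =
     distr ?D2 (Nk k) (\<lambda>p. (inv\<^bsub>G k\<^esub> \<phi> k (snd p (Suc k)) \<otimes>\<^bsub>G k\<^esub> fst p, snd p))" by simp
  also have "distr ?D1 (Nk k) (\<lambda>p. (inv\<^bsub>G k\<^esub> \<phi> k (snd p (Suc k)) \<otimes>\<^bsub>G k\<^esub> fst p, snd p)) = distr P (Nk k) (\<lambda>x. (Z_var G \<phi> k x, x))"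
    by (subst distr_distr[OF \<Psi> pm]) (simp add: comp_def Z_var_def)
  also have "distr ?D2 (Nk k) (\<lambda>p. (inv\<^bsub>G k\<^esub> \<phi> k (snd p (Suc k)) \<otimes>\<^bsub>G k\<^esub> fst p, snd p)) = distr (\<mu> k \<Otimes>\<^sub>M ?F) (\<mu> k \<Otimes>\<^sub>M ?F) (\<lambda>p. p)"
    unfolding distr_distr[OF \<Psi> \<Phi>']
    by (rule distr_cong[OF refl])
      (use sm inv_phi_mult in \<open>auto simp: s2 space_pair_measure simp del: topspace_product_topology\<close>)
  finally show ?thesis unfolding ind_at_iff[OF Pb] by (simp add: distr_id2)
qed

text \<open>
  On an event \<open>B\<close> of the later coordinates, replace \<open>x k\<close> by \<open>\<phi> k (x (k + 1)) \<cdot> Z k x\<close> and integrate out the independent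
  factor \<open>Z k\<close>; this is the defining property of the conditional expectation.
\<close>

lemma ind_at_imp_solution:
  assumes P: "P \<in> borel_prob (prod_top T)" and i: "\<And>k. ind_at P k"
  shows "P \<in> solutions G T \<phi> \<mu>"
  unfolding solutions_def
proof (intro CollectI conjI P allI impI, elim conjE)
  fix k and f :: "'a \<Rightarrow> real"
  assume f: "f \<in> borel_measurable (borel_of (T k))" and bf: "bounded (f ` topspace (T k))"
  obtain b where b: "\<And>z. z \<in> topspace (T k) \<Longrightarrow> \<bar>f z\<bar> \<le> b" using bf unfolding bounded_iff by auto
  interpret P: prob_space P by (rule borel_probD[OF P])
  interpret mu: prob_space "\<mu> k" by (rule borel_probD[OF mu])
  note sP = borel_probD(2,3)[OF P] and sm = borel_probD(2,3)[OF mu, of k]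
  interpret S: finite_measure_subalgebra P "future_X T k"
    by unfold_locales (use sP future_subset[of k] in \<open>simp add: subalgebra_def del: topspace_product_topology\<close>)
  have phim: "(\<lambda>p. \<phi> k (snd p (Suc k))) \<in> Nk k \<rightarrow>\<^sub>M borel_of (T k)"
    by (intro phi_measurable measurable_compose[OF measurable_snd coord_future]) simp
  have fm: "(\<lambda>p. \<phi> k (snd p (Suc k)) \<otimes>\<^bsub>G k\<^esub> fst p) \<in> Nk k \<rightarrow>\<^sub>M borel_of (T k)"
    by (intro mult_measurable phim measurable_fst)
  have in_k: "\<phi> k (x (Suc k)) \<otimes>\<^bsub>G k\<^esub> z \<in> topspace (T k)" if "x \<in> \<Omega>" "z \<in> topspace (T k)" for x z
    using phi_in[OF coord_in[OF that(1), of "Suc k"]] that(2) monoid.m_closed[OF group.is_monoid[OF grp[of k]]] by (simp add: carr)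
  have Xm: "(\<lambda>x. x k) \<in> P \<rightarrow>\<^sub>M borel_of (T k)" using coord_measurable[of k] measurable_cong_sets[OF sP(1) refl] by blast
  let ?h = "\<lambda>x. \<integral>z. f (\<phi> k (x (Suc k)) \<otimes>\<^bsub>G k\<^esub> z) \<partial>\<mu> k"
  have hm: "?h \<in> borel_measurable (future_X T k)"
    using pair_integral(2)[OF P measurable_compose[OF fm f], of b] in_k b by simp
  then have hP: "?h \<in> borel_measurable P" using measurable_future_all measurable_cong_sets[OF sP(1) refl] by blast
  have b0: "0 \<le> b" using b[OF coord_in] P.not_empty sP by (metis abs_ge_zero order_trans ex_in_conv)
  have hb: "\<bar>?h x\<bar> \<le> b" if "x \<in> \<Omega>" for x
  proof -
    have m: "(\<lambda>z. f (\<phi> k (x (Suc k)) \<otimes>\<^bsub>G k\<^esub> z)) \<in> borel_measurable (\<mu> k)"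
    proof -
      have "(\<lambda>z. (z, x)) \<in> borel_of (T k) \<rightarrow>\<^sub>M Nk k" by (rule measurable_Pair) (use that in \<open>simp_all del: topspace_product_topology\<close>)
      from measurable_compose[OF measurable_compose[OF this fm] f] show ?thesis
        unfolding measurable_cong_sets[OF sm(1) refl, of borel] by simp
    qed
    have bb: "norm (f (\<phi> k (x (Suc k)) \<otimes>\<^bsub>G k\<^esub> z)) \<le> b" if "z \<in> space (\<mu> k)" for z
      using b[OF in_k] \<open>x \<in> \<Omega>\<close> that sm by simp
    have i: "integrable (\<mu> k) (\<lambda>z. f (\<phi> k (x (Suc k)) \<otimes>\<^bsub>G k\<^esub> z))"
      by (rule integrable_bounded_prob[OF mu.prob_space_axioms m bb])
    have "?h x \<le> b" by (rule mu.integral_le_const[OF i], rule AE_I2) (use bb in force)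
    moreover have "- b \<le> ?h x" by (rule mu.integral_ge_const[OF i], rule AE_I2) (use bb in force)
    ultimately show ?thesis by linarith
  qed
  show "AE x in P. real_cond_exp P (future_X T k) (\<lambda>x. f (x k)) x = ?h x"
  proof (rule S.real_cond_exp_charact)
    show "integrable P (\<lambda>x. f (x k))"
      by (rule integrable_bounded_prob[OF P.prob_space_axioms measurable_compose[OF Xm f], of b])
        (use b coord_in sP in \<open>auto simp del: topspace_product_topology\<close>)
    show "integrable P ?h"
      by (rule integrable_bounded_prob[OF P.prob_space_axioms hP, of b]) (use hb sP in \<open>auto simp del: topspace_product_topology\<close>)
    fix B assume B: "B \<in> sets (future_X T k)"
    let ?g = "\<lambda>p. indicator B (snd p) *\<^sub>R f (\<phi> k (snd p (Suc k)) \<otimes>\<^bsub>G k\<^esub> fst p)"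
    have g: "?g \<in> borel_measurable (Nk k)"
      by (intro borel_measurable_scaleR measurable_compose[OF fm f] measurable_compose[OF measurable_snd]) (use B in simp)
    have "(\<integral>x. ?g (Z_var G \<phi> k x, x) \<partial>P) = (\<integral>x. (\<integral>z. ?g (z, x) \<partial>\<mu> k) \<partial>P)"
      by (rule ind_at_integral[OF P i g, of b]) (use b in_k b0 in \<open>auto simp: indicator_def simp del: topspace_product_topology\<close>)
    moreover have "(\<integral>x. ?g (Z_var G \<phi> k x, x) \<partial>P) = (\<integral>x. indicator B x *\<^sub>R f (x k) \<partial>P)"
      by (rule Bochner_Integration.integral_cong[OF refl]) (use phi_Z sP in \<open>simp del: topspace_product_topology\<close>)
    ultimately show "(\<integral>x\<in>B. f (x k) \<partial>P) = (\<integral>x\<in>B. ?h x \<partial>P)"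
      unfolding set_lebesgue_integral_def by simp
  qed (rule hm)
qed

lemma solutions_iff: "P \<in> solutions G T \<phi> \<mu> \<longleftrightarrow> P \<in> borel_prob (prod_top T) \<and> (\<forall>k. ind_at P k)"
  using solution_imp_ind_at ind_at_imp_solution by (auto simp: solutions_def)

end

section \<open>Mixtures of probability measures\<close>

lemma mixture:
  fixes p :: "'i pmf" and Q :: "'i \<Rightarrow> 'a measure" and f :: "'a \<Rightarrow> real"
  assumes Q: "\<And>i. Q i \<in> borel_prob T"
  defines "M \<equiv> measure_pmf p \<bind> Q"
  shows "M \<in> borel_prob T"
    "A \<in> sets (borel_of T) \<Longrightarrow> measure M A = (\<integral>i. measure (Q i) A \<partial>measure_pmf p)"
    "f \<in> borel_measurable (borel_of T) \<Longrightarrow> (\<And>x. x \<in> topspace T \<Longrightarrow> \<bar>f x\<bar> \<le> b) \<Longrightarrow>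
       (\<integral>x. f x \<partial>M) = (\<integral>i. (\<integral>x. f x \<partial>Q i) \<partial>measure_pmf p)"
proof -
  interpret Q: prob_space "Q i" for i by (rule borel_probD[OF Q])
  note sQ = borel_probD(2,3)[OF Q]
  have Qs: "Q i \<in> space (subprob_algebra (borel_of T))" for i
    using sQ Q.prob_space_axioms by (auto simp: space_subprob_algebra prob_space_imp_subprob_space)
  have m: "Q \<in> measure_pmf p \<rightarrow>\<^sub>M subprob_algebra (borel_of T)" using Qs by simp
  have sM: "sets M = sets (borel_of T)" unfolding M_def by (rule sets_bind) (use sQ in auto)
  have pM: "prob_space M" unfolding M_def
    by (rule prob_space.prob_space_bind[OF measure_pmf.prob_space_axioms _ m]) (simp add: Q.prob_space_axioms)
  show "M \<in> borel_prob T" using sM pM by (simp add: borel_prob_def)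
  interpret M: prob_space M by fact
  show "measure M A = (\<integral>i. measure (Q i) A \<partial>measure_pmf p)" if A: "A \<in> sets (borel_of T)"
    unfolding M_def by (rule subprob_space.measure_bind[OF _ m A]) (rule prob_space_imp_subprob_space[OF measure_pmf.prob_space_axioms])
  show "(\<integral>x. f x \<partial>M) = (\<integral>i. (\<integral>x. f x \<partial>Q i) \<partial>measure_pmf p)"
    if f: "f \<in> borel_measurable (borel_of T)" and b: "\<And>x. x \<in> topspace T \<Longrightarrow> \<bar>f x\<bar> \<le> b"
    unfolding M_def
    by (rule integral_bind[where K = "borel_of T" and B = b and B' = 1])
      (use f b m Q.emeasure_space_1 measure_pmf.finite_measure_axioms in auto)
qed

text \<open>
  The hypothesis says that \<open>P\<close> is the mixture of \<open>Q1\<close> and \<open>Q2\<close> under a Bernoulli choice of the index.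
\<close>

lemma integral_convex_combination:
  assumes P: "P \<in> borel_prob T" and Q1: "Q1 \<in> borel_prob T" and Q2: "Q2 \<in> borel_prob T"
    and t: "0 < t" "t < 1" and eq: "\<And>A. A \<in> sets P \<Longrightarrow> measure P A = (1 - t) * measure Q1 A + t * measure Q2 A"
    and f: "f \<in> borel_measurable (borel_of T)" "\<And>x. x \<in> topspace T \<Longrightarrow> \<bar>f x\<bar> \<le> b"
  shows "(\<integral>x. f x \<partial>P) = (1 - t) * (\<integral>x. f x \<partial>Q1) + t * (\<integral>x. f x \<partial>Q2)"
proof -
  let ?Q = "\<lambda>i. if i then Q2 else Q1"
  let ?M = "measure_pmf (bernoulli_pmf t) \<bind> ?Q"
  have Q: "?Q i \<in> borel_prob T" for i using Q1 Q2 by simp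
  note mix = mixture[where Q = ?Q and p = "bernoulli_pmf t", OF Q]
  interpret P: prob_space P by (rule borel_probD[OF P])
  interpret M: prob_space ?M by (rule borel_probD[OF mix(1)])
  have "P = ?M"
  proof (rule measure_eqI)
    show "sets P = sets ?M" using borel_probD(2)[OF P] borel_probD(2)[OF mix(1)] by simp
    fix A assume A: "A \<in> sets P"
    then have "measure ?M A = (\<integral>i. measure (?Q i) A \<partial>measure_pmf (bernoulli_pmf t))"
      using borel_probD(2)[OF P] by (intro mix(2)) simp
    also have "\<dots> = measure P A" unfolding eq[OF A] using t by simp
    finally show "emeasure P A = emeasure ?M A" by (simp add: P.emeasure_eq_measure M.emeasure_eq_measure)
  qed
  then have "(\<integral>x. f x \<partial>P) = (\<integral>x. f x \<partial>?M)" by simp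
  also have "\<dots> = (\<integral>i. (\<integral>x. f x \<partial>?Q i) \<partial>measure_pmf (bernoulli_pmf t))" by (rule mix(3)[OF f])
  also have "\<dots> = (1 - t) * (\<integral>x. f x \<partial>Q1) + t * (\<integral>x. f x \<partial>Q2)" using t by simp
  finally show ?thesis .
qed

section \<open>Existence of extreme solutions\<close>

lemma (in compact_sc) integral_dominated_open:
  assumes "P \<in> borel_prob T" "\<And>n. continuous_map T euclideanreal (u n)" "\<And>n x. x \<in> topspace T \<Longrightarrow> 0 \<le> u n x \<and> u n x \<le> 1"
    "\<And>x. x \<in> topspace T \<Longrightarrow> (\<lambda>n. u n x) \<longlonglongrightarrow> indicator A x" "A \<in> sets (borel_of T)"
  shows "(\<lambda>n. \<integral>x. u n x \<partial>P) \<longlonglongrightarrow> measure P A"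
proof -
  note sM = borel_probD(2,3)[OF assms(1)]
  interpret M: prob_space P by (rule borel_probD[OF assms(1)])
  have "(\<lambda>n. \<integral>x. u n x \<partial>P) \<longlonglongrightarrow> (\<integral>x. indicator A x \<partial>P)"
  proof (rule integral_dominated_convergence[where w = "\<lambda>_. 1"])
    show "u n \<in> borel_measurable P" for n using continuous_integrable[OF assms(1,2)] by auto
  qed (use assms sM in auto)
  moreover have "A \<inter> space P = A" using sets.sets_into_space[OF assms(5)] sM by auto
  ultimately show ?thesis by simp
qed

context group_chain
begin

lemma csc_prod: "compact_sc (prod_top T)" by (rule compact_sc_prod_top[OF csc])

text \<open>
  Independence and the law both extend from generators closed under intersections to the generated \<open>\<sigma>\<close>-algebras.
\<close>

lemma ind_at_generator:
  assumes P: "P \<in> borel_prob (prod_top T)"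
    and eq: "\<And>C B. openin (T k) C \<Longrightarrow> B \<in> cylinders \<Omega> {k<..} (\<lambda>j x. x j) T \<Longrightarrow>
       measure P ({x\<in>\<Omega>. Z_var G \<phi> k x \<in> C} \<inter> B) = measure (\<mu> k) C * measure P B"
  shows "ind_at P k"
proof -
  interpret P: prob_space P by (rule borel_probD[OF P])
  interpret mu: prob_space "\<mu> k" by (rule borel_probD[OF mu])
  note sP = borel_probD(2,3)[OF P] and sm = borel_probD(2,3)[OF mu, of k]
  have Zm: "Z_var G \<phi> k \<in> P \<rightarrow>\<^sub>M borel_of (T k)" using Z_measurable[of k] measurable_cong_sets[OF sP(1) refl] by blast
  let ?cyl = "cylinders \<Omega> {k<..} (\<lambda>j x. x j) T"
  let ?A = "{{x\<in>\<Omega>. Z_var G \<phi> k x \<in> C} | C. openin (T k) C}"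
  have top: "\<Omega> \<in> ?cyl" unfolding cylinders_def by (intro CollectI exI[of _ "{}"]) (simp del: topspace_product_topology)
  have fut: "sets (future_X T k) = sigma_sets \<Omega> ?cyl"
    unfolding future_X_def by (rule sets_gen_sigma_cylinders) auto
  then have cylF: "?cyl \<subseteq> sets (future_X T k)" by auto
  then have cylP: "?cyl \<subseteq> sets P" using future_subset[of k] sP by blast
  have Zset: "{x\<in>\<Omega>. Z_var G \<phi> k x \<in> C} = Z_var G \<phi> k -` C \<inter> space P" for C by (auto simp: sP simp del: topspace_product_topology)
  have AP: "?A \<subseteq> sets P" using measurable_sets[OF Zm openin_imp_borel_of] unfolding Zset by blast
  have law: "measure P {x\<in>\<Omega>. Z_var G \<phi> k x \<in> C} = measure (\<mu> k) C" if C: "openin (T k) C" for C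
  proof -
    have "{x\<in>\<Omega>. Z_var G \<phi> k x \<in> C} \<inter> \<Omega> = {x\<in>\<Omega>. Z_var G \<phi> k x \<in> C}" by blast
    then show ?thesis using eq[OF C top] P.prob_space sP by simp
  qed
  have "P.indep_set ?A ?cyl"
    by (rule P.indep_setI[OF AP cylP]) (use law eq in \<open>auto simp del: topspace_product_topology\<close>)
  moreover have "Int_stable ?A"
  proof (rule Int_stableI)
    fix a b assume "a \<in> ?A" "b \<in> ?A"
    then obtain C D where "a = {x\<in>\<Omega>. Z_var G \<phi> k x \<in> C}" "b = {x\<in>\<Omega>. Z_var G \<phi> k x \<in> D}" "openin (T k) C" "openin (T k) D" by blast
    then have "a \<inter> b = {x\<in>\<Omega>. Z_var G \<phi> k x \<in> C \<inter> D}" "openin (T k) (C \<inter> D)"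
      using openin_Int[of "T k" C D] by blast+
    then show "a \<inter> b \<in> ?A" by blast
  qed
  moreover have "Int_stable ?cyl" by (rule Int_stable_cylinders) auto
  ultimately have "P.indep_set (sigma_sets (space P) ?A) (sigma_sets (space P) ?cyl)"
    by (rule P.indep_set_sigma_sets)
  then have ind: "P.indep_set (sigma_sets \<Omega> ?A) (sigma_sets \<Omega> ?cyl)" unfolding sP(2) .
  have ZA: "{x\<in>\<Omega>. Z_var G \<phi> k x \<in> C} \<in> sigma_sets \<Omega> ?A" if C: "C \<in> sets (borel_of (T k))" for C
  proof -
    have A: "?A \<subseteq> Pow \<Omega>" by blast
    have "Z_var G \<phi> k \<in> sigma \<Omega> ?A \<rightarrow>\<^sub>M borel_of (T k)"
    proof (rule measurable_into_borel_of)
      show "\<And>x. x \<in> space (sigma \<Omega> ?A) \<Longrightarrow> Z_var G \<phi> k x \<in> topspace (T k)"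
        using Z_in by (simp add: space_measure_of[OF A] del: topspace_product_topology)
      fix U assume "openin (T k) U"
      then have "{x\<in>\<Omega>. Z_var G \<phi> k x \<in> U} \<in> ?A" by blast
      moreover have "Z_var G \<phi> k -` U \<inter> space (sigma \<Omega> ?A) = {x\<in>\<Omega>. Z_var G \<phi> k x \<in> U}"
        unfolding space_measure_of[OF A] by blast
      ultimately show "Z_var G \<phi> k -` U \<inter> space (sigma \<Omega> ?A) \<in> sets (sigma \<Omega> ?A)"
        unfolding sets_measure_of[OF A] by (simp add: sigma_sets.Basic del: topspace_product_topology)
    qed
    from measurable_sets[OF this C] have "Z_var G \<phi> k -` C \<inter> \<Omega> \<in> sigma_sets \<Omega> ?A"
      unfolding sets_measure_of[OF A] space_measure_of[OF A] .
    moreover have "Z_var G \<phi> k -` C \<inter> \<Omega> = {x\<in>\<Omega>. Z_var G \<phi> k x \<in> C}" by blast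
    ultimately show ?thesis by simp
  qed
  have "distr P (borel_of (T k)) (Z_var G \<phi> k) = \<mu> k"
  proof (rule measure_eqI_generator_eq[where A = "\<lambda>_. topspace (T k)"])
    show "Int_stable {U. openin (T k) U}" by (rule Int_stableI) auto
    show "{U. openin (T k) U} \<subseteq> Pow (topspace (T k))" by (auto dest: openin_subset)
    show "emeasure (distr P (borel_of (T k)) (Z_var G \<phi> k)) X = emeasure (\<mu> k) X" if "X \<in> {U. openin (T k) U}" for X
      using that law[of X] unfolding Zset
      by (subst emeasure_distr[OF Zm]) (auto simp: openin_imp_borel_of P.emeasure_eq_measure mu.emeasure_eq_measure)
    show "emeasure (distr P (borel_of (T k)) (Z_var G \<phi> k)) (topspace (T k)) \<noteq> \<infinity>"
      using finite_measure.emeasure_finite[OF P.finite_measure_distr[OF Zm]] by simp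
  qed (use sm in \<open>auto simp: sets_borel_of\<close>)
  then have lawB: "measure P {x\<in>\<Omega>. Z_var G \<phi> k x \<in> C} = measure (\<mu> k) C" if "C \<in> sets (borel_of (T k))" for C
    unfolding Zset using measure_distr[OF Zm that] by simp
  show ?thesis unfolding ind_at_def
  proof (intro ballI)
    fix C B assume C: "C \<in> sets (borel_of (T k))" and B: "B \<in> sets (future_X T k)"
    show "measure P ({x\<in>\<Omega>. Z_var G \<phi> k x \<in> C} \<inter> B) = measure (\<mu> k) C * measure P B"
      using P.indep_setD[OF ind ZA[OF C], of B] B fut lawB[OF C] by simp
  qed
qed

text \<open>
  Weak convergence carries over equations between integrals of continuous functions. By \<open>ind_at_generator\<close> it is enough to
  treat open sets, whose indicators are limits of continuous functions; these stay continuous after composition with \<open>Z k\<close> and with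
  the coordinates.
\<close>

lemma ind_at_weak_limit:
  assumes Pn: "\<And>n :: nat. P n \<in> borel_prob (prod_top T)" and Q: "Q \<in> borel_prob (prod_top T)"
    and lim: "\<And>f :: (nat \<Rightarrow> 'a) \<Rightarrow> real. continuous_map (prod_top T) euclideanreal f \<Longrightarrow> (\<lambda>n. \<integral>x. f x \<partial>P n) \<longlonglongrightarrow> (\<integral>x. f x \<partial>Q)"
    and ev: "eventually (\<lambda>n. ind_at (P n) k) sequentially"
  shows "ind_at Q k"
proof (rule ind_at_generator[OF Q])
  interpret K: compact_sc "prod_top T" by (rule csc_prod)
  interpret Tk: compact_sc "T j" for j by (rule csc)
  fix C B assume C: "openin (T k) C" and B: "B \<in> cylinders \<Omega> {k<..} (\<lambda>j x. x j) T"
  from B obtain J U where J: "B = {x \<in> \<Omega>. \<forall>j\<in>J. x j \<in> U j}" "finite J" "J \<subseteq> {k<..}" "\<forall>j\<in>J. openin (T j) (U j)"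
    unfolding cylinders_def by (elim CollectE exE conjE)
  obtain u :: "nat \<Rightarrow> 'a \<Rightarrow> real" where u: "\<And>n. continuous_map (T k) euclideanreal (u n)"
      "\<And>n x. x \<in> topspace (T k) \<Longrightarrow> 0 \<le> u n x \<and> u n x \<le> 1"
      "\<And>n x. x \<in> topspace (T k) \<Longrightarrow> x \<notin> C \<Longrightarrow> u n x = 0"
      "\<And>x. x \<in> topspace (T k) \<Longrightarrow> (\<lambda>n. u n x) \<longlonglongrightarrow> indicator C x"
    by (rule Tk.open_indicator_approx[OF C], rule that)
  have "\<forall>j\<in>J. \<exists>v :: nat \<Rightarrow> 'a \<Rightarrow> real. (\<forall>n. continuous_map (T j) euclideanreal (v n)) \<and>
      (\<forall>n. \<forall>x\<in>topspace (T j). 0 \<le> v n x \<and> v n x \<le> 1) \<and> (\<forall>x\<in>topspace (T j). (\<lambda>n. v n x) \<longlonglongrightarrow> indicator (U j) x)"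
  proof
    fix j assume "j \<in> J"
    then have "openin (T j) (U j)" using J(4) by blast
    then show "\<exists>v :: nat \<Rightarrow> 'a \<Rightarrow> real. (\<forall>n. continuous_map (T j) euclideanreal (v n)) \<and>
      (\<forall>n. \<forall>x\<in>topspace (T j). 0 \<le> v n x \<and> v n x \<le> 1) \<and> (\<forall>x\<in>topspace (T j). (\<lambda>n. v n x) \<longlonglongrightarrow> indicator (U j) x)"
      by (rule Tk.open_indicator_approx) blast
  qed
  from bchoice[OF this] obtain v :: "nat \<Rightarrow> nat \<Rightarrow> 'a \<Rightarrow> real" where "\<forall>j\<in>J. (\<forall>n. continuous_map (T j) euclideanreal (v j n)) \<and>
      (\<forall>n. \<forall>x\<in>topspace (T j). 0 \<le> v j n x \<and> v j n x \<le> 1) \<and> (\<forall>x\<in>topspace (T j). (\<lambda>n. v j n x) \<longlonglongrightarrow> indicator (U j) x)" ..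
  then have v: "\<And>j n. j \<in> J \<Longrightarrow> continuous_map (T j) euclideanreal (v j n)"
      "\<And>j n x. j \<in> J \<Longrightarrow> x \<in> topspace (T j) \<Longrightarrow> 0 \<le> v j n x \<and> v j n x \<le> 1"
      "\<And>j x. j \<in> J \<Longrightarrow> x \<in> topspace (T j) \<Longrightarrow> (\<lambda>n. v j n x) \<longlonglongrightarrow> indicator (U j) x" by simp_all
  define g where "g n x = (\<Prod>j\<in>J. v j n (x j))" for n and x :: "nat \<Rightarrow> 'a"
  have cv: "continuous_map (prod_top T) euclideanreal (\<lambda>x. v j n (x j))" if "j \<in> J" for j n
    using continuous_map_compose[OF cont_coord v(1)[OF that]] by (simp add: comp_def)
  have cg: "continuous_map (prod_top T) euclideanreal (g n)" for n
    unfolding g_def by (intro continuous_map_prod J(2) cv)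
  have g01: "0 \<le> g n x \<and> g n x \<le> 1" if "x \<in> \<Omega>" for n x
    unfolding g_def using v(2) coord_in[OF that] by (auto intro!: prod_nonneg prod_le_1 simp del: topspace_product_topology)
  have glim: "(\<lambda>n. g n x) \<longlonglongrightarrow> indicator B x" if x: "x \<in> \<Omega>" for x
  proof -
    have "(\<lambda>n. g n x) \<longlonglongrightarrow> (\<Prod>j\<in>J. indicator (U j) (x j))"
      unfolding g_def by (intro tendsto_prod v(3) coord_in[OF x])
    also have "(\<Prod>j\<in>J. indicator (U j) (x j)) = (indicator B x :: real)"
      using x J(2) unfolding J(1) by (auto simp: indicator_def prod_eq_1_iff simp del: topspace_product_topology)
    finally show ?thesis .
  qed
  have cu: "continuous_map (prod_top T) euclideanreal (\<lambda>x. u n (Z_var G \<phi> k x))" for n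
    using continuous_map_compose[OF cont_Z u(1)] by (simp add: comp_def)
  have gfut: "g n \<in> borel_measurable (future_X T k)" for n
    unfolding g_def
    by (intro borel_measurable_prod measurable_compose[OF coord_future continuous_map_borel_measurable[OF v(1)]]) (use J(3) in auto)
  have step: "(\<integral>x. g n x * u n (Z_var G \<phi> k x) \<partial>Q) = (\<integral>x. g n x \<partial>Q) * (\<integral>z. u n z \<partial>\<mu> k)" for n
  proof (rule LIMSEQ_unique)
    show "(\<lambda>m. \<integral>x. g n x * u n (Z_var G \<phi> k x) \<partial>P m) \<longlonglongrightarrow> (\<integral>x. g n x * u n (Z_var G \<phi> k x) \<partial>Q)"
      by (intro lim continuous_map_real_mult cg cu)
    have "(\<lambda>m. (\<integral>x. g n x \<partial>P m) * (\<integral>z. u n z \<partial>\<mu> k)) \<longlonglongrightarrow> (\<integral>x. g n x \<partial>Q) * (\<integral>z. u n z \<partial>\<mu> k)"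
      by (intro tendsto_mult lim cg tendsto_const)
    moreover have "eventually (\<lambda>m. (\<integral>x. g n x \<partial>P m) * (\<integral>z. u n z \<partial>\<mu> k) = (\<integral>x. g n x * u n (Z_var G \<phi> k x) \<partial>P m)) sequentially"
      using ev
    proof eventually_elim
      case (elim m)
      show ?case
        by (rule ind_at_product[OF Pn elim continuous_map_borel_measurable[OF u(1)] _ gfut, of n 1 n 1, symmetric])
          (use u(2) g01 in \<open>auto simp del: topspace_product_topology\<close>)
    qed
    ultimately show "(\<lambda>m. \<integral>x. g n x * u n (Z_var G \<phi> k x) \<partial>P m) \<longlonglongrightarrow> (\<integral>x. g n x \<partial>Q) * (\<integral>z. u n z \<partial>\<mu> k)"
      by (rule Lim_transform_eventually)
  qed
  have Zset: "{x\<in>\<Omega>. Z_var G \<phi> k x \<in> C} = Z_var G \<phi> k -` C \<inter> space \<B>" by auto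
  have Bb: "B \<in> sets \<B>"
    using B sets_gen_sigma_cylinders[of "{k<..}" \<Omega> "\<lambda>j x. x j" T] future_subset[of k] unfolding future_X_def by auto
  have ZCB: "{x\<in>\<Omega>. Z_var G \<phi> k x \<in> C} \<inter> B \<in> sets \<B>"
    unfolding Zset using measurable_sets[OF Z_measurable openin_imp_borel_of[OF C]] Bb by (rule sets.Int)
  have 1: "(\<lambda>n. \<integral>x. g n x * u n (Z_var G \<phi> k x) \<partial>Q) \<longlonglongrightarrow> measure Q ({x\<in>\<Omega>. Z_var G \<phi> k x \<in> C} \<inter> B)"
  proof (rule K.integral_dominated_open[OF Q _ _ _ ZCB])
    show "continuous_map (prod_top T) euclideanreal (\<lambda>x. g n x * u n (Z_var G \<phi> k x))" for n
      by (intro continuous_map_real_mult cg cu)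
    show "0 \<le> g n x * u n (Z_var G \<phi> k x) \<and> g n x * u n (Z_var G \<phi> k x) \<le> 1" if "x \<in> \<Omega>" for n x
      using g01[OF that, of n] u(2)[OF Z_in[OF that], of n] by (simp add: mult_le_one)
    show "(\<lambda>n. g n x * u n (Z_var G \<phi> k x)) \<longlonglongrightarrow> indicator ({x\<in>\<Omega>. Z_var G \<phi> k x \<in> C} \<inter> B) x" if x: "x \<in> \<Omega>" for x
    proof -
      have "(\<lambda>n. g n x * u n (Z_var G \<phi> k x)) \<longlonglongrightarrow> indicator B x * indicator C (Z_var G \<phi> k x)"
        by (intro tendsto_mult glim u(4) x Z_in)
      also have "indicator B x * indicator C (Z_var G \<phi> k x) = (indicator ({x\<in>\<Omega>. Z_var G \<phi> k x \<in> C} \<inter> B) x :: real)"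
        using x by (auto simp: indicator_def simp del: topspace_product_topology)
      finally show ?thesis .
    qed
  qed
  have 2: "(\<lambda>n. (\<integral>x. g n x \<partial>Q) * (\<integral>z. u n z \<partial>\<mu> k)) \<longlonglongrightarrow> measure Q B * measure (\<mu> k) C"
    by (intro tendsto_mult K.integral_dominated_open[OF Q cg g01 glim Bb] Tk.integral_dominated_open[OF mu u(1,2,4)] openin_imp_borel_of C)
  show "measure Q ({x\<in>\<Omega>. Z_var G \<phi> k x \<in> C} \<inter> B) = measure (\<mu> k) C * measure Q B"
    using LIMSEQ_unique[OF 1] 2 step by (simp add: mult.commute)
qed

end

context group_chain
begin

text \<open>
  Membership in \<open>\<Omega>\<close> is used as an atomic fact from here on.
\<close>

declare topspace_product_topology [simp del]

lemma future_depends: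
  assumes B: "B \<in> sets (future_X T k)" and x: "x \<in> \<Omega>" "y \<in> \<Omega>" and eq: "\<And>j. j > k \<Longrightarrow> x j = y j"
  shows "x \<in> B \<longleftrightarrow> y \<in> B"
  using B unfolding future_X_def sets_gen_sigma
proof (induction rule: sigma_sets.induct)
  case (Basic a) then show ?case using x eq by auto
next
  case (Compl a) then show ?case using x by auto
qed auto

text \<open>
  The coordinate \<open>k\<close> is replaced by the value that the recursion prescribes for a fresh \<open>z\<close> drawn from \<open>\<mu> k\<close>; all other
  coordinates are kept.
\<close>

definition resample :: "nat \<Rightarrow> (nat \<Rightarrow> 'a) measure \<Rightarrow> (nat \<Rightarrow> 'a) measure" where
  "resample k P = distr (\<mu> k \<Otimes>\<^sub>M P) \<B> (\<lambda>p. (snd p)(k := \<phi> k (snd p (Suc k)) \<otimes>\<^bsub>G k\<^esub> fst p))"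

text \<open>
  After resampling, \<open>Z k\<close> equals the fresh variable \<open>z\<close>, and the coordinates beyond \<open>k\<close> are untouched. Levels above \<open>k\<close> involve only those
  coordinates, so their solution property survives; at levels below \<open>k\<close> it may be destroyed.
\<close>

lemma resample:
  assumes P: "P \<in> borel_prob (prod_top T)"
  shows "resample k P \<in> borel_prob (prod_top T)" "ind_at (resample k P) k"
    "k < j \<Longrightarrow> ind_at P j \<Longrightarrow> ind_at (resample k P) j"
proof -
  interpret P: prob_space P by (rule borel_probD[OF P])
  interpret mu: prob_space "\<mu> k" by (rule borel_probD[OF mu])
  interpret muP: pair_prob_space "\<mu> k" P ..
  note sP = borel_probD(2,3)[OF P] and sm = borel_probD(2,3)[OF mu, of k]
  define s where "s = (\<lambda>p. (snd p)(k := \<phi> k (snd p (Suc k)) \<otimes>\<^bsub>G k\<^esub> fst p) :: nat \<Rightarrow> 'a)"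
  have cs: "continuous_map (prod_topology (T k) (prod_top T)) (prod_top T) s"
    unfolding continuous_map_componentwise_UNIV
  proof
    fix i
    have snd: "continuous_map (prod_topology (T k) (prod_top T)) (T j) (\<lambda>p. snd p j)" for j
      using continuous_map_compose[OF continuous_map_snd cont_coord] by (simp add: comp_def)
    show "continuous_map (prod_topology (T k) (prod_top T)) (T i) (\<lambda>p. s p i)"
    proof (cases "i = k")
      case True
      then show ?thesis unfolding s_def by (simp add: cont_mult' cont_phi' snd continuous_map_fst)
    next
      case False
      then show ?thesis unfolding s_def by (simp add: snd)
    qed
  qed
  have "s \<in> borel_of (T k) \<Otimes>\<^sub>M \<B> \<rightarrow>\<^sub>M \<B>"
    using csc[of k] csc_prod by (intro continuous_map_pair_borel cs) (simp_all add: compact_sc_def)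
  then have s: "s \<in> \<mu> k \<Otimes>\<^sub>M P \<rightarrow>\<^sub>M \<B>"
    using measurable_cong_sets[OF sets_pair_measure_cong[OF sm(1) sP(1)] refl] by blast
  have R: "resample k P = distr (\<mu> k \<Otimes>\<^sub>M P) \<B> s" by (simp add: resample_def s_def)
  show R1: "resample k P \<in> borel_prob (prod_top T)"
    unfolding R borel_prob_def using muP.prob_space_distr[OF s] by simp
  have sO: "s (z, x) \<in> \<Omega>" if "z \<in> topspace (T k)" "x \<in> \<Omega>" for z x
    using cs that by (auto simp: continuous_map_def)
  have sj: "s (z, x) j = x j" if "j > k" for z x j using that by (simp add: s_def)
  have Zk: "Z_var G \<phi> k (s (z, x)) = z" if "z \<in> topspace (T k)" "x \<in> \<Omega>" for z x
    using inv_phi_mult[OF that(2,1)] by (simp add: Z_var_def s_def)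
  have meas: "measure (resample k P) A = measure (\<mu> k \<Otimes>\<^sub>M P) (s -` A \<inter> (topspace (T k) \<times> \<Omega>))" if "A \<in> sets \<B>" for A
    unfolding R by (subst measure_distr[OF s that]) (simp add: space_pair_measure sP sm)
  have rect: "measure (\<mu> k \<Otimes>\<^sub>M P) (C \<times> B) = measure (\<mu> k) C * measure P B" if "C \<in> sets (borel_of (T k))" "B \<in> sets \<B>" for C B
  proof -
    have "emeasure (\<mu> k \<Otimes>\<^sub>M P) (C \<times> B) = emeasure (\<mu> k) C * emeasure P B"
      by (rule P.emeasure_pair_measure_Times) (use that sm sP in simp_all)
    then show ?thesis by (simp add: measure_def enn2real_mult)
  qed
  have Tk: "topspace (T k) \<in> sets (borel_of (T k))" "measure (\<mu> k) (topspace (T k)) = 1"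
    using sets.top[of "borel_of (T k)"] mu.prob_space sm by simp_all
  have fut: "measure (resample k P) B = measure P B" if B: "B \<in> sets (future_X T k)" for B
  proof -
    have BO: "B \<subseteq> \<Omega>" "B \<in> sets \<B>" using sets.sets_into_space[OF B] B future_subset by auto
    have "s -` B \<inter> (topspace (T k) \<times> \<Omega>) = topspace (T k) \<times> B"
      using future_depends[OF B sO] sj BO by auto
    then show ?thesis using meas[OF BO(2)] rect[OF Tk(1) BO(2)] Tk(2) by simp
  qed
  show "ind_at (resample k P) k" unfolding ind_at_def
  proof (intro ballI)
    fix C B assume C: "C \<in> sets (borel_of (T k))" and B: "B \<in> sets (future_X T k)"
    have BO: "B \<subseteq> \<Omega>" "B \<in> sets \<B>" using sets.sets_into_space[OF B] B future_subset by auto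
    have CT: "C \<subseteq> topspace (T k)" using sets.sets_into_space[OF C] by simp
    have "Z_var G \<phi> k -` C \<inter> space \<B> \<inter> B \<in> sets \<B>" by (intro sets.Int BO measurable_sets[OF Z_measurable C])
    moreover have "Z_var G \<phi> k -` C \<inter> space \<B> \<inter> B = {x \<in> \<Omega>. Z_var G \<phi> k x \<in> C} \<inter> B" by auto
    ultimately have ZCB: "{x \<in> \<Omega>. Z_var G \<phi> k x \<in> C} \<inter> B \<in> sets \<B>" by simp
    have "s -` ({x \<in> \<Omega>. Z_var G \<phi> k x \<in> C} \<inter> B) \<inter> (topspace (T k) \<times> \<Omega>) = C \<times> B"
    proof (rule Set.set_eqI)
      fix p :: "'a \<times> (nat \<Rightarrow> 'a)" obtain z x where p: "p = (z, x)" by (cases p)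
      show "p \<in> s -` ({x \<in> \<Omega>. Z_var G \<phi> k x \<in> C} \<inter> B) \<inter> (topspace (T k) \<times> \<Omega>) \<longleftrightarrow> p \<in> C \<times> B"
      proof (cases "z \<in> topspace (T k) \<and> x \<in> \<Omega>")
        case True
        then show ?thesis unfolding p using future_depends[OF B sO, of z x x] sj sO[of z x] Zk[of z x] by simp
      next
        case False
        then show ?thesis unfolding p using BO(1) CT by blast
      qed
    qed
    then show "measure (resample k P) ({x \<in> \<Omega>. Z_var G \<phi> k x \<in> C} \<inter> B) = measure (\<mu> k) C * measure (resample k P) B"
      using meas[OF ZCB] rect[OF C BO(2)] fut[OF B] by simp
  qed
  show "ind_at (resample k P) j" if j: "k < j" and i: "ind_at P j"
    unfolding ind_at_def
  proof (intro ballI)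
    fix C B assume C: "C \<in> sets (borel_of (T j))" and B: "B \<in> sets (future_X T j)"
    have Bk: "B \<in> sets (future_X T k)" using B future_mono[of k j] j by auto
    have "Z_var G \<phi> j -` C \<inter> space (future_X T k) \<inter> B \<in> sets (future_X T k)"
      by (intro sets.Int Bk measurable_sets[OF Z_future[OF j] C])
    moreover have "Z_var G \<phi> j -` C \<inter> space (future_X T k) \<inter> B = {x \<in> \<Omega>. Z_var G \<phi> j x \<in> C} \<inter> B" by auto
    ultimately have ZCB: "{x \<in> \<Omega>. Z_var G \<phi> j x \<in> C} \<inter> B \<in> sets (future_X T k)" by simp
    show "measure (resample k P) ({x \<in> \<Omega>. Z_var G \<phi> j x \<in> C} \<inter> B) = measure (\<mu> j) C * measure (resample k P) B"
      unfolding fut[OF ZCB] fut[OF Bk] using i C B by (simp add: ind_at_def)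
  qed
qed

text \<open>
  Start from any measure and resample the levels \<open>n - 1, \<dots>, 1, 0\<close> in this order: each step
  preserves what has been achieved at the higher levels.
\<close>

lemma ex_partial_solution: "\<exists>P\<in>borel_prob (prod_top T). \<forall>k<n. ind_at P k"
proof -
  define e where "e = (\<lambda>k. \<one>\<^bsub>G k\<^esub>)"
  have e: "e \<in> \<Omega>"
    using monoid.one_closed[OF group.is_monoid[OF grp]] by (auto simp: e_def topspace_product_topology carr)
  define D where "D = return \<B> e"
  have D: "D \<in> borel_prob (prod_top T)" unfolding D_def borel_prob_def using prob_space_return[of e \<B>] e by simp
  have R: "foldr resample xs D \<in> borel_prob (prod_top T)" for xs by (induction xs) (simp_all add: D resample(1))
  have "m \<le> k \<Longrightarrow> k < m + d \<Longrightarrow> ind_at (foldr resample [m..<m+d] D) k" for m d k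
  proof (induction d arbitrary: m)
    case (Suc d)
    have l: "[m..<m + Suc d] = m # [Suc m..<Suc m + d]" by (simp add: upt_conv_Cons)
    show ?case
    proof (cases "k = m")
      case True then show ?thesis unfolding l using resample(2)[OF R] by simp
    next
      case False
      then have "ind_at (foldr resample [Suc m..<Suc m + d] D) k" using Suc by (intro Suc.IH) auto
      then show ?thesis unfolding l using resample(3)[OF R, of m k] False Suc.prems by (simp del: upt_Suc)
    qed
  qed simp
  from this[of 0] R show ?thesis by (metis add_0 le0)
qed

text \<open>
  The solution property at a fixed level is closed under weak limits, so a limit point of measures which solve the equation at
  more and more levels solves it at every level.
\<close>

lemma ex_solution: "solutions G T \<phi> \<mu> \<noteq> {}"
proof -
  interpret K: compact_sc "prod_top T" by (rule csc_prod)
  have "\<forall>n. \<exists>P. P \<in> borel_prob (prod_top T) \<and> (\<forall>k<n. ind_at P k)" using ex_partial_solution by blast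
  from choice[OF this] obtain P where P: "\<And>n. P n \<in> borel_prob (prod_top T)" "\<And>n k. k < n \<Longrightarrow> ind_at (P n) k" by blast
  obtain r M where r: "strict_mono (r :: nat \<Rightarrow> nat)" and M: "M \<in> borel_prob (prod_top T)" and
    lim: "\<And>f :: (nat \<Rightarrow> 'a) \<Rightarrow> real. continuous_map (prod_top T) euclideanreal f \<Longrightarrow> (\<lambda>n. \<integral>x. f x \<partial>P (r n)) \<longlonglongrightarrow> (\<integral>x. f x \<partial>M)"
    by (rule K.weak_sequential_compactness[of P, OF P(1)], rule that)
  have "ind_at M k" for k
  proof (rule ind_at_weak_limit[of "\<lambda>n. P (r n)", OF P(1) M lim])
    show "eventually (\<lambda>n. ind_at (P (r n)) k) sequentially"
      using P(2) seq_suble[OF r] unfolding eventually_sequentially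
      by (intro exI[of _ "Suc k"]) (auto simp: Suc_le_eq intro: less_le_trans)
  qed
  then show ?thesis using solutions_iff M by blast
qed

text \<open>
  In place of the Krein-Milman theorem: the functional \<open>F P\<close>, a weighted sum over \<open>i\<close> of the squares \<open>(\<integral>x. f i x \<partial>P)\<^sup>2\<close>
  for a determining sequence \<open>f\<close>, is weakly continuous and strictly convex. By compactness it attains its maximum on the set of
  solutions, and a maximum of a strictly convex functional is an extreme point. The weights are those of a geometric
  distribution: positive, with finite sum.
\<close>

lemma ex_extreme_solution: "extreme_measures (solutions G T \<phi> \<mu>) \<noteq> {}"
proof -
  interpret K: compact_sc "prod_top T" by (rule csc_prod)
  let ?S = "solutions G T \<phi> \<mu>"
  have S: "P \<in> borel_prob (prod_top T)" if "P \<in> ?S" for P using that solutions_iff by blast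
  obtain f :: "nat \<Rightarrow> (nat \<Rightarrow> 'a) \<Rightarrow> real" where f: "\<forall>i. continuous_map (prod_top T) euclideanreal (f i)"
    "\<forall>i. \<forall>x\<in>\<Omega>. 0 \<le> f i x \<and> f i x \<le> 1"
    "\<forall>P\<in>borel_prob (prod_top T). \<forall>Q\<in>borel_prob (prod_top T). (\<forall>i. (\<integral>x. f i x \<partial>P) = (\<integral>x. f i x \<partial>Q)) \<longrightarrow> P = Q"
    using K.ex_determining_functions by (elim exE conjE)
  let ?g = "measure_pmf (geometric_pmf (1/2))"
  define F where "F P = (\<integral>i. (\<integral>x. f i x \<partial>P)\<^sup>2 \<partial>?g)" for P
  have m01: "0 \<le> (\<integral>x. f i x \<partial>P) \<and> (\<integral>x. f i x \<partial>P) \<le> 1" if P: "P \<in> borel_prob (prod_top T)" for i P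
  proof -
    interpret P: prob_space P by (rule borel_probD[OF P])
    have fi: "integrable P (f i)" using f(1) by (intro K.continuous_integrable[OF P]) simp
    have "(\<integral>x. f i x \<partial>P) \<le> (\<integral>x. 1 \<partial>P)"
      by (rule integral_mono[OF fi]) (use f(2) borel_probD(3)[OF P] in auto)
    moreover have "0 \<le> (\<integral>x. f i x \<partial>P)" by (rule integral_nonneg_AE, rule AE_I2) (use f(2) borel_probD(3)[OF P] in auto)
    ultimately show ?thesis by (simp add: P.prob_space)
  qed
  have sq01: "0 \<le> (\<integral>x. f i x \<partial>P)\<^sup>2 \<and> (\<integral>x. f i x \<partial>P)\<^sup>2 \<le> 1" if P: "P \<in> borel_prob (prod_top T)" for i P
    using m01[OF P, of i] by (simp add: power_le_one)
  have int: "integrable ?g h" if "\<And>i. \<bar>h i\<bar> \<le> b" for h :: "nat \<Rightarrow> real" and b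
    by (rule integrable_bounded_prob[OF measure_pmf.prob_space_axioms, of _ _ b]) (use that in auto)
  have intsq: "integrable ?g (\<lambda>i. (\<integral>x. f i x \<partial>P)\<^sup>2)" if "P \<in> borel_prob (prod_top T)" for P
    by (rule int[of _ 1]) (use sq01[OF that] in simp)
  have F1: "F P \<le> 1" if "P \<in> ?S" for P
  proof -
    have "F P \<le> (\<integral>i. 1 \<partial>?g)" unfolding F_def
      by (rule integral_mono[OF intsq[OF S[OF that]]]) (use sq01[OF S[OF that]] in auto)
    then show ?thesis by simp
  qed
  have bdd: "bdd_above (F ` ?S)" using F1 by (intro bdd_aboveI[of _ 1]) auto
  define s where "s = Sup (F ` ?S)"
  have "\<forall>n. \<exists>P. P \<in> ?S \<and> F P > s - 1 / real (Suc n)"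
  proof
    fix n
    have "s - 1 / real (Suc n) < Sup (F ` ?S)" by (simp add: s_def)
    then show "\<exists>P. P \<in> ?S \<and> F P > s - 1 / real (Suc n)"
      using less_cSup_iff[OF _ bdd] ex_solution by auto
  qed
  from choice[OF this] obtain P where P: "\<And>n :: nat. P n \<in> ?S" "\<And>n. F (P n) > s - 1 / real (Suc n)" by blast
  obtain r M where r: "strict_mono (r :: nat \<Rightarrow> nat)" and M: "M \<in> borel_prob (prod_top T)" and
    lim: "\<And>f :: (nat \<Rightarrow> 'a) \<Rightarrow> real. continuous_map (prod_top T) euclideanreal f \<Longrightarrow> (\<lambda>n. \<integral>x. f x \<partial>P (r n)) \<longlonglongrightarrow> (\<integral>x. f x \<partial>M)"
    by (rule K.weak_sequential_compactness[of P, OF S[OF P(1)]], rule that)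
  have "ind_at M k" for k
    by (rule ind_at_weak_limit[of "\<lambda>n. P (r n)", OF S[OF P(1)] M lim]) (use P(1) solution_imp_ind_at in auto)
  then have MS: "M \<in> ?S" using solutions_iff M by blast
  have "(\<lambda>n. F (P (r n))) \<longlonglongrightarrow> F M" unfolding F_def
  proof (rule integral_dominated_convergence[where w = "\<lambda>_. 1"])
    show "AE i in ?g. (\<lambda>n. (\<integral>x. f i x \<partial>P (r n))\<^sup>2) \<longlonglongrightarrow> (\<integral>x. f i x \<partial>M)\<^sup>2"
      by (rule AE_I2) (intro tendsto_power lim, use f(1) in simp)
    show "AE i in ?g. norm ((\<integral>x. f i x \<partial>P (r n))\<^sup>2) \<le> 1" for n
      by (rule AE_I2) (use sq01[OF S[OF P(1)]] in simp)
  qed auto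
  moreover have "(\<lambda>n. F (P (r n))) \<longlonglongrightarrow> s"
  proof (rule tendsto_sandwich)
    show "eventually (\<lambda>n. s - 1 / real (Suc n) \<le> F (P (r n))) sequentially"
    proof (intro always_eventually allI)
      fix n
      have "1 / real (Suc (r n)) \<le> 1 / real (Suc n)" using seq_suble[OF r, of n] by (intro divide_left_mono) auto
      then show "s - 1 / real (Suc n) \<le> F (P (r n))" using P(2)[of "r n"] by linarith
    qed
    show "eventually (\<lambda>n. F (P (r n)) \<le> s) sequentially"
      unfolding s_def by (intro always_eventually allI cSup_upper bdd) (use P(1) in auto)
    have "(\<lambda>n. s - 1 / real (Suc n)) \<longlonglongrightarrow> s - 0" by (intro tendsto_diff tendsto_const LIMSEQ_Suc[OF lim_1_over_n])
    then show "(\<lambda>n. s - 1 / real (Suc n)) \<longlonglongrightarrow> s" by simp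
  qed simp
  ultimately have FM: "F M = s" by (rule LIMSEQ_unique)
  have "M \<in> extreme_measures ?S" unfolding extreme_measures_def
  proof (intro CollectI conjI MS ballI allI impI)
    fix Q1 Q2 and t :: real assume Q: "Q1 \<in> ?S" "Q2 \<in> ?S"
      and t: "0 < t \<and> t < 1 \<and> (\<forall>A\<in>sets M. measure M A = (1 - t) * measure Q1 A + t * measure Q2 A)"
    have comb: "(\<integral>x. f i x \<partial>M) = (1 - t) * (\<integral>x. f i x \<partial>Q1) + t * (\<integral>x. f i x \<partial>Q2)" for i
      by (rule integral_convex_combination[OF M S[OF Q(1)] S[OF Q(2)], of t _ 1])
        (use t f(1,2) in \<open>auto intro: continuous_map_borel_measurable\<close>)
    define a b where "a i = (\<integral>x. f i x \<partial>Q1)" and "b i = (\<integral>x. f i x \<partial>Q2)" for i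
    have ab01: "0 \<le> a i \<and> a i \<le> 1" "0 \<le> b i \<and> b i \<le> 1" for i using m01[OF S[OF Q(1)]] m01[OF S[OF Q(2)]] by (simp_all add: a_def b_def)
    have abd: "\<bar>(a i - b i)\<^sup>2\<bar> \<le> 1" for i using ab01[of i] by (simp add: abs_square_le_1 abs_le_iff)
    have i1: "integrable ?g (\<lambda>i. (a i)\<^sup>2)" "integrable ?g (\<lambda>i. (b i)\<^sup>2)" "integrable ?g (\<lambda>i. (a i - b i)\<^sup>2)"
      using intsq[OF S[OF Q(1)]] intsq[OF S[OF Q(2)]] int[OF abd] by (simp_all add: a_def b_def)
    \<comment> \<open>Strict convexity of the square, with the exact deficit \<open>t * (1 - t) * (a i - b i)\<^sup>2\<close>.\<close>
    have "F M = (\<integral>i. (1 - t) * (a i)\<^sup>2 + t * (b i)\<^sup>2 - t * (1 - t) * (a i - b i)\<^sup>2 \<partial>?g)"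
      unfolding F_def comb a_def[symmetric] b_def[symmetric]
      by (rule Bochner_Integration.integral_cong[OF refl]) (simp add: power2_eq_square algebra_simps)
    also have "\<dots> = (1 - t) * F Q1 + t * F Q2 - t * (1 - t) * (\<integral>i. (a i - b i)\<^sup>2 \<partial>?g)"
      using i1 by (simp add: F_def a_def[symmetric] b_def[symmetric])
    finally have "F M = (1 - t) * F Q1 + t * F Q2 - t * (1 - t) * (\<integral>i. (a i - b i)\<^sup>2 \<partial>?g)" .
    moreover have "F Q1 \<le> s" "F Q2 \<le> s" unfolding s_def using Q by (auto intro: cSup_upper bdd)
    then have "(1 - t) * F Q1 + t * F Q2 \<le> (1 - t) * s + t * s" using t by (intro add_mono mult_left_mono) auto
    ultimately have "t * (1 - t) * (\<integral>i. (a i - b i)\<^sup>2 \<partial>?g) \<le> 0" using FM by (simp add: algebra_simps)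
    moreover have "t * (1 - t) > 0" using t by simp
    ultimately have "(\<integral>i. (a i - b i)\<^sup>2 \<partial>?g) \<le> 0" by (meson mult_pos_pos not_le)
    moreover have "0 \<le> (\<integral>i. (a i - b i)\<^sup>2 \<partial>?g)" by (rule integral_nonneg_AE) simp
    ultimately have "(\<integral>i. (a i - b i)\<^sup>2 \<partial>?g) = 0" by simp
    then have "AE i in ?g. (a i - b i)\<^sup>2 = 0" using integral_nonneg_eq_0_iff_AE[OF i1(3)] by simp
    then have ab: "a i = b i" for i by (simp add: AE_measure_pmf_iff set_pmf_geometric)
    have "Q1 = Q2" using f(3) S[OF Q(1)] S[OF Q(2)] ab unfolding a_def b_def by blast
    moreover have "(\<integral>x. f i x \<partial>M) = (\<integral>x. f i x \<partial>Q1)" for i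
      using comb[of i] ab[of i] unfolding a_def b_def by (simp add: algebra_simps)
    then have "M = Q1" using f(3) S[OF Q(1)] M by blast
    ultimately show "Q1 = M" "Q2 = M" by simp_all
  qed
  then show ?thesis by blast
qed

text \<open>
  Conditioning a solution on a tail event \<open>A\<close> of positive probability gives a solution, since \<open>Z k\<close> is independent of
  \<open>A \<inter> B\<close> for every event \<open>B\<close> of the coordinates beyond \<open>k\<close>. If \<open>A\<close> had probability strictly between \<open>0\<close> and \<open>1\<close>, conditioning on it and on its
  complement would exhibit \<open>P\<close> as a proper convex combination.
\<close>

lemma extreme_tail_trivial:
  assumes P: "P \<in> extreme_measures (solutions G T \<phi> \<mu>)" and A: "\<And>k. A \<in> sets (future_X T k)"
  shows "measure P A = 0 \<or> measure P A = 1"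
proof (rule ccontr)
  assume "\<not> ?thesis"
  then have ne: "measure P A \<noteq> 0" "measure P A \<noteq> 1" by auto
  have PS: "P \<in> solutions G T \<phi> \<mu>" using P by (simp add: extreme_measures_def)
  then have Pb: "P \<in> borel_prob (prod_top T)" by (simp add: solutions_iff)
  interpret P: prob_space P by (rule borel_probD[OF Pb])
  note sP = borel_probD(2,3)[OF Pb]
  have AP: "A \<in> sets P" using A[of 0] future_subset sP by auto
  have cond: "uniform_measure P C \<in> solutions G T \<phi> \<mu>"
    if C: "\<And>k. C \<in> sets (future_X T k)" and pos: "measure P C \<noteq> 0" for C
  proof -
    have CP: "C \<in> sets P" using C[of 0] future_subset sP by auto
    have m: "measure (uniform_measure P C) D = measure P (C \<inter> D) / measure P C" if "D \<in> sets P" for D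
      using measure_uniform_measure[of P C D] pos that P.emeasure_eq_measure by simp
    have "prob_space (uniform_measure P C)"
      using pos by (intro prob_space_uniform_measure) (simp_all add: P.emeasure_eq_measure)
    then have b: "uniform_measure P C \<in> borel_prob (prod_top T)" using sP by (simp add: borel_prob_def)
    have "ind_at (uniform_measure P C) k" for k unfolding ind_at_def
    proof (intro ballI)
      fix D B assume D: "D \<in> sets (borel_of (T k))" and B: "B \<in> sets (future_X T k)"
      have BP: "B \<in> sets P" using B future_subset sP by auto
      have Zset: "{x \<in> \<Omega>. Z_var G \<phi> k x \<in> D} = Z_var G \<phi> k -` D \<inter> space \<B>" by auto
      have ZP: "{x \<in> \<Omega>. Z_var G \<phi> k x \<in> D} \<inter> B \<in> sets P"
        unfolding Zset using measurable_sets[OF Z_measurable D] BP sP by auto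
      have "C \<inter> ({x \<in> \<Omega>. Z_var G \<phi> k x \<in> D} \<inter> B) = {x \<in> \<Omega>. Z_var G \<phi> k x \<in> D} \<inter> (C \<inter> B)" by blast
      then show "measure (uniform_measure P C) ({x \<in> \<Omega>. Z_var G \<phi> k x \<in> D} \<inter> B) = measure (\<mu> k) D * measure (uniform_measure P C) B"
        unfolding m[OF ZP] m[OF BP]
        using solution_imp_ind_at[OF PS, of k] D sets.Int[OF C[of k] B] by (simp add: ind_at_def)
    qed
    then show ?thesis using b solutions_iff by blast
  qed
  have A': "space P - A \<in> sets (future_X T k)" for k using sets.compl_sets[OF A[of k]] sP by simp
  have mA': "measure P (space P - A) = 1 - measure P A" by (rule P.prob_compl[OF AP])
  let ?Q1 = "uniform_measure P A" and ?Q2 = "uniform_measure P (space P - A)"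
  have Q: "?Q1 \<in> solutions G T \<phi> \<mu>" "?Q2 \<in> solutions G T \<phi> \<mu>" using cond[OF A ne(1)] cond[OF A'] mA' ne(2) by simp_all
  let ?t = "1 - measure P A"
  have t: "0 < ?t" "?t < 1" using ne P.prob_le_1[of A] measure_nonneg[of P A] by linarith+
  have "measure P D = (1 - ?t) * measure ?Q1 D + ?t * measure ?Q2 D" if D: "D \<in> sets P" for D
  proof -
    have "measure ?Q1 D = measure P (A \<inter> D) / measure P A"
      using measure_uniform_measure[of P A D] ne D P.emeasure_eq_measure by simp
    moreover have "measure ?Q2 D = measure P ((space P - A) \<inter> D) / (1 - measure P A)"
      using measure_uniform_measure[of P "space P - A" D] ne mA' D P.emeasure_eq_measure by simp
    moreover have "measure P D = measure P (A \<inter> D) + measure P ((space P - A) \<inter> D)"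
    proof -
      have "D = (A \<inter> D) \<union> ((space P - A) \<inter> D)" using sets.sets_into_space[OF D] by blast
      moreover have "measure P ((A \<inter> D) \<union> ((space P - A) \<inter> D)) = measure P (A \<inter> D) + measure P ((space P - A) \<inter> D)"
        by (rule P.finite_measure_Union) (use AP D in auto)
      ultimately show ?thesis by simp
    qed
    ultimately show ?thesis using ne by simp
  qed
  then have "?Q1 = P" using P Q t unfolding extreme_measures_def by blast
  then have "measure P A = measure ?Q1 A" by simp
  also have "\<dots> = 1" using measure_uniform_measure[of P A A] ne AP P.emeasure_eq_measure by simp
  finally show False using ne by simp
qed

end

section \<open>Contractions and products of square matrices\<close>

lemma mult_entry:
  assumes "A \<in> carrier_mat d d" "B \<in> carrier_mat d d" "i < d" "j < d"
  shows "(A * B) $$ (i, j) = (\<Sum>c<d. A $$ (i, c) * B $$ (c, j))"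
  using assms by (auto simp: scalar_prod_def atLeast0LessThan intro!: sum.cong)

lemma mult_vec_entry:
  assumes "A \<in> carrier_mat d d" "v \<in> carrier_vec d" "i < d"
  shows "vec_index (A *\<^sub>v v) i = (\<Sum>c<d. A $$ (i, c) * vec_index v c)"
  using assms by (auto simp: scalar_prod_def atLeast0LessThan intro!: sum.cong)

lemma mat_adjoint_entry:
  assumes "A \<in> carrier_mat d d" "i < d" "j < d"
  shows "mat_adjoint A $$ (i, j) = cnj (A $$ (j, i))"
  using assms by (simp add: mat_adjoint_def mat_of_rows_def conjugate_complex_def)

lemma unitary_orthogonal:
  assumes U: "U \<in> carrier (unitary_group d)" and ij: "i < d" "j < d"
  shows "(\<Sum>c<d. U $$ (i, c) * cnj (U $$ (j, c))) = (if i = j then 1 else 0)"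
    "(\<Sum>c<d. cnj (U $$ (c, i)) * U $$ (c, j)) = (if i = j then 1 else 0)"
proof -
  have c: "U \<in> carrier_mat d d" and m: "U * mat_adjoint U = 1\<^sub>m d" "mat_adjoint U * U = 1\<^sub>m d"
    using U by (simp_all add: unitary_group_def)
  have ca: "mat_adjoint U \<in> carrier_mat d d" using c by (auto simp: mat_adjoint_def mat_of_rows_def)
  have "(\<Sum>c<d. U $$ (i, c) * cnj (U $$ (j, c))) = (U * mat_adjoint U) $$ (i, j)"
    unfolding mult_entry[OF c ca ij] by (rule sum.cong) (use c ij in \<open>simp_all add: mat_adjoint_entry\<close>)
  then show "(\<Sum>c<d. U $$ (i, c) * cnj (U $$ (j, c))) = (if i = j then 1 else 0)" using ij by (simp add: m)
  have "(\<Sum>c<d. cnj (U $$ (c, i)) * U $$ (c, j)) = (mat_adjoint U * U) $$ (i, j)"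
    unfolding mult_entry[OF ca c ij] by (rule sum.cong) (use c ij in \<open>simp_all add: mat_adjoint_entry\<close>)
  then show "(\<Sum>c<d. cnj (U $$ (c, i)) * U $$ (c, j)) = (if i = j then 1 else 0)" using ij by (simp add: m)
qed

lemma unitary_carrier: "U \<in> carrier (unitary_group d) \<Longrightarrow> U \<in> carrier_mat d d"
  by (simp add: unitary_group_def)

lemma unitary_row_norm:
  assumes "U \<in> carrier (unitary_group d)" "i < d"
  shows "(\<Sum>c<d. (cmod (U $$ (i, c)))\<^sup>2) = 1"
proof -
  have "complex_of_real (\<Sum>c<d. (cmod (U $$ (i, c)))\<^sup>2) = (\<Sum>c<d. U $$ (i, c) * cnj (U $$ (i, c)))"
    unfolding of_real_sum by (rule sum.cong) (simp_all only: complex_norm_square)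
  also have "\<dots> = 1" using unitary_orthogonal(1)[OF assms(1,2,2)] by simp
  finally show ?thesis by (metis of_real_eq_1_iff)
qed

lemma unitary_entry_bound:
  assumes "U \<in> carrier (unitary_group d)" "i < d" "j < d"
  shows "cmod (U $$ (i, j)) \<le> 1"
proof -
  have "(cmod (U $$ (i, j)))\<^sup>2 \<le> (\<Sum>c<d. (cmod (U $$ (i, c)))\<^sup>2)"
    by (rule member_le_sum) (use assms in auto)
  then show ?thesis unfolding unitary_row_norm[OF assms(1,2)] by (metis norm_ge_zero one_power2 power2_le_imp_le zero_le_one)
qed

text \<open>
  Stated through vectors rather than through \<open>op_norm\<close>, so that products are immediate and no supremum has to be handled.
\<close>

definition contraction :: "nat \<Rightarrow> complex mat \<Rightarrow> bool" where
  "contraction d A \<longleftrightarrow> A \<in> carrier_mat d d \<and> (\<forall>v\<in>carrier_vec d. vec_l2_norm (A *\<^sub>v v) \<le> vec_l2_norm v)"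

lemma vec_l2_norm_nonneg: "0 \<le> vec_l2_norm v" by (simp add: vec_l2_norm_def L2_set_nonneg)

lemma vec_l2_norm_entry: "i < dim_vec v \<Longrightarrow> cmod (vec_index v i) \<le> vec_l2_norm v"
  unfolding vec_l2_norm_def by (rule member_le_L2_set) auto

lemma vec_l2_norm_unit:
  assumes "j < d" shows "vec_l2_norm (unit_vec d j) = 1"
proof -
  have "vec_l2_norm (unit_vec d j) = sqrt (\<Sum>i<d. (if i = j then 1 else 0))"
  proof -
    have "(cmod (vec_index (unit_vec d j) i))\<^sup>2 = (if i = j then 1 else 0)" if "i < d" for i using that by (simp add: unit_vec_def)
    then show ?thesis unfolding vec_l2_norm_def L2_set_def by simp
  qed
  then show ?thesis using assms by simp
qed

lemma mult_unit_vec_entry: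
  fixes A :: "complex mat"
  assumes "A \<in> carrier_mat d d" "i < d" "j < d"
  shows "vec_index (A *\<^sub>v unit_vec d j) i = A $$ (i, j)"
proof -
  have "vec_index (A *\<^sub>v unit_vec d j) i = (\<Sum>c<d. A $$ (i, c) * (if c = j then 1 else 0))"
    unfolding mult_vec_entry[OF assms(1) unit_vec_carrier assms(2)] by (rule sum.cong) (auto simp: unit_vec_def)
  also have "\<dots> = A $$ (i, j)" using assms(3) by (simp add: if_distrib[of "\<lambda>x. _ * x"] cong: if_cong)
  finally show ?thesis .
qed

lemma op_norm_bdd:
  assumes "A \<in> carrier_mat d d"
  shows "bdd_above {vec_l2_norm (A *\<^sub>v v) | v. v \<in> carrier_vec (dim_col A) \<and> vec_l2_norm v \<le> 1}"
proof (rule bdd_aboveI[of _ "\<Sum>i<d. \<Sum>c<d. cmod (A $$ (i, c))"], safe)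
  fix v assume v: "v \<in> carrier_vec (dim_col A)" "vec_l2_norm v \<le> 1"
  have vd: "v \<in> carrier_vec d" using v assms by auto
  have "vec_l2_norm (A *\<^sub>v v) \<le> (\<Sum>i<d. cmod (vec_index (A *\<^sub>v v) i))"
    unfolding vec_l2_norm_def using assms by (auto intro: order_trans[OF L2_set_le_sum])
  also have "\<dots> \<le> (\<Sum>i<d. \<Sum>c<d. cmod (A $$ (i, c)))"
  proof (rule sum_mono)
    fix i assume "i \<in> {..<d}"
    then have i: "i < d" by simp
    have "cmod (vec_index (A *\<^sub>v v) i) \<le> (\<Sum>c<d. cmod (A $$ (i, c) * vec_index v c))"
      unfolding mult_vec_entry[OF assms vd i] by (rule norm_sum)
    also have "\<dots> \<le> (\<Sum>c<d. cmod (A $$ (i, c)))"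
    proof (rule sum_mono)
      fix c assume "c \<in> {..<d}"
      then have "cmod (vec_index v c) \<le> 1" using vec_l2_norm_entry[of c v] vd v(2) by auto
      then show "cmod (A $$ (i, c) * vec_index v c) \<le> cmod (A $$ (i, c))" by (simp add: norm_mult mult_left_le)
    qed
    finally show "cmod (vec_index (A *\<^sub>v v) i) \<le> (\<Sum>c<d. cmod (A $$ (i, c)))" .
  qed
  finally show "vec_l2_norm (A *\<^sub>v v) \<le> (\<Sum>i<d. \<Sum>c<d. cmod (A $$ (i, c)))" .
qed

lemma op_norm_upper:
  assumes "A \<in> carrier_mat d d" "v \<in> carrier_vec d" "vec_l2_norm v \<le> 1"
  shows "vec_l2_norm (A *\<^sub>v v) \<le> op_norm A"
  unfolding op_norm_def by (rule cSup_upper[OF _ op_norm_bdd[OF assms(1)]]) (use assms in auto)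

lemma op_norm_least:
  assumes "A \<in> carrier_mat d d" "\<And>v. v \<in> carrier_vec d \<Longrightarrow> vec_l2_norm v \<le> 1 \<Longrightarrow> vec_l2_norm (A *\<^sub>v v) \<le> b"
  shows "op_norm A \<le> b"
  unfolding op_norm_def
proof (rule cSup_least)
  have "vec_l2_norm (0\<^sub>v d) \<le> 1" by (simp add: vec_l2_norm_def L2_set_def)
  then show "{vec_l2_norm (A *\<^sub>v v) | v. v \<in> carrier_vec (dim_col A) \<and> vec_l2_norm v \<le> 1} \<noteq> {}"
    using assms(1) by (auto intro!: exI[of _ "0\<^sub>v d"])
qed (use assms in auto)

lemma entry_le_op_norm:
  assumes "A \<in> carrier_mat d d" "i < d" "j < d"
  shows "cmod (A $$ (i, j)) \<le> op_norm A"
proof -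
  have "cmod (A $$ (i, j)) \<le> vec_l2_norm (A *\<^sub>v unit_vec d j)"
    using vec_l2_norm_entry[of i "A *\<^sub>v unit_vec d j"] assms mult_unit_vec_entry[OF assms] by auto
  also have "\<dots> \<le> op_norm A" by (rule op_norm_upper[OF assms(1)]) (use assms vec_l2_norm_unit in auto)
  finally show ?thesis .
qed

lemma op_norm_nonneg:
  assumes "A \<in> carrier_mat d d" shows "0 \<le> op_norm A"
proof -
  have "vec_l2_norm (0\<^sub>v d) \<le> 1" by (simp add: vec_l2_norm_def L2_set_def)
  from op_norm_upper[OF assms zero_carrier_vec this] show ?thesis
    using vec_l2_norm_nonneg[of "A *\<^sub>v 0\<^sub>v d"] by linarith
qed

lemma contraction_op_norm: "contraction d A \<Longrightarrow> op_norm A \<le> 1"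
  unfolding contraction_def by (elim conjE, erule op_norm_least) force

lemma contraction_mult_le:
  assumes "contraction d A" "B \<in> carrier_mat d d"
  shows "op_norm (A * B) \<le> op_norm B" "op_norm (B * A) \<le> op_norm B"
proof -
  have A: "A \<in> carrier_mat d d" using assms by (simp add: contraction_def)
  show "op_norm (A * B) \<le> op_norm B"
  proof (rule op_norm_least[of _ d])
    fix v :: "complex vec" assume v: "v \<in> carrier_vec d" "vec_l2_norm v \<le> 1"
    have "vec_l2_norm (A *\<^sub>v (B *\<^sub>v v)) \<le> vec_l2_norm (B *\<^sub>v v)" using assms v by (simp add: contraction_def)
    also have "\<dots> \<le> op_norm B" by (rule op_norm_upper[OF assms(2) v])
    finally show "vec_l2_norm (A * B *\<^sub>v v) \<le> op_norm B" using assoc_mult_mat_vec[OF A assms(2) v(1)] by simp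
  qed (use A assms in auto)
  show "op_norm (B * A) \<le> op_norm B"
  proof (rule op_norm_least[of _ d])
    fix v :: "complex vec" assume v: "v \<in> carrier_vec d" "vec_l2_norm v \<le> 1"
    have "vec_l2_norm (A *\<^sub>v v) \<le> 1" using assms v by (force simp: contraction_def)
    then have "vec_l2_norm (B *\<^sub>v (A *\<^sub>v v)) \<le> op_norm B" by (intro op_norm_upper[OF assms(2)]) (use A v in auto)
    then show "vec_l2_norm (B * A *\<^sub>v v) \<le> op_norm B" using assoc_mult_mat_vec[OF assms(2) A v(1)] by simp
  qed (use A assms in auto)
qed

lemma contraction_one: "contraction d (1\<^sub>m d)" by (auto simp: contraction_def)

lemma contraction_mult: "contraction d A \<Longrightarrow> contraction d B \<Longrightarrow> contraction d (A * B)"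
  unfolding contraction_def
proof (intro conjI ballI; elim conjE)
  fix v :: "complex vec"
  assume A: "A \<in> carrier_mat d d" "\<forall>v\<in>carrier_vec d. vec_l2_norm (A *\<^sub>v v) \<le> vec_l2_norm v"
    and B: "B \<in> carrier_mat d d" "\<forall>v\<in>carrier_vec d. vec_l2_norm (B *\<^sub>v v) \<le> vec_l2_norm v" and v: "v \<in> carrier_vec d"
  have "B *\<^sub>v v \<in> carrier_vec d" using B(1) v by simp
  then have "vec_l2_norm (A *\<^sub>v (B *\<^sub>v v)) \<le> vec_l2_norm (B *\<^sub>v v)" using A(2) by blast
  also have "\<dots> \<le> vec_l2_norm v" using B(2) v by blast
  finally show "vec_l2_norm (A * B *\<^sub>v v) \<le> vec_l2_norm v" using assoc_mult_mat_vec[OF A(1) B(1) v] by simp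
qed auto

lemma contraction_entry:
  assumes "contraction d A" "i < d" "j < d" shows "cmod (A $$ (i, j)) \<le> 1"
  using entry_le_op_norm[of A d i j] contraction_op_norm[OF assms(1)] assms by (auto simp: contraction_def)

text \<open>
  The factor with the largest index stands on the left, and the upper bound is exclusive.
\<close>

definition mat_prod :: "nat \<Rightarrow> (nat \<Rightarrow> complex mat) \<Rightarrow> nat \<Rightarrow> nat \<Rightarrow> complex mat" where
  "mat_prod d f m n = foldr (*) (map f (rev [m..<n])) (1\<^sub>m d)"

lemma mat_prod_self [simp]: "mat_prod d f m m = 1\<^sub>m d" by (simp add: mat_prod_def)

lemma mat_prod_Suc: "m \<le> n \<Longrightarrow> mat_prod d f m (Suc n) = f n * mat_prod d f m n" by (simp add: mat_prod_def)

lemma mat_prod_carrier: "(\<And>l. m \<le> l \<Longrightarrow> l < n \<Longrightarrow> f l \<in> carrier_mat d d) \<Longrightarrow> mat_prod d f m n \<in> carrier_mat d d"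
proof (induction n)
  case (Suc n)
  show ?case
  proof (cases "m \<le> n")
    case True
    have "mat_prod d f m n \<in> carrier_mat d d" using Suc by auto
    moreover have "f n \<in> carrier_mat d d" using Suc.prems True by simp
    ultimately show ?thesis unfolding mat_prod_Suc[OF True] by (rule mult_carrier_mat[rotated])
  qed (simp add: mat_prod_def)
qed (simp add: mat_prod_def)

lemma mat_prod_split:
  assumes "\<And>l. m \<le> l \<Longrightarrow> f l \<in> carrier_mat d d" "m \<le> p" "p \<le> n"
  shows "mat_prod d f m n = mat_prod d f p n * mat_prod d f m p"
  using assms(3)
proof (induction rule: dec_induct)
  case base
  have "mat_prod d f m p \<in> carrier_mat d d" by (rule mat_prod_carrier) (use assms in auto)
  then show ?case by simp
next
  case (step n)
  have c: "mat_prod d f p n \<in> carrier_mat d d" "mat_prod d f m p \<in> carrier_mat d d" "f n \<in> carrier_mat d d"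
    using assms step by (auto intro!: mat_prod_carrier)
  show ?case using step assms(2) c by (simp add: mat_prod_Suc assoc_mult_mat[of _ d d _ d _ d])
qed

lemma mat_prod_first:
  assumes "\<And>l. m \<le> l \<Longrightarrow> f l \<in> carrier_mat d d" "m < n"
  shows "mat_prod d f m n = mat_prod d f (Suc m) n * f m"
  using mat_prod_split[of m f d "Suc m" n] assms by (simp add: mat_prod_Suc right_mult_one_mat[of _ d d])

lemma contraction_mat_prod: "(\<And>l. m \<le> l \<Longrightarrow> contraction d (f l)) \<Longrightarrow> contraction d (mat_prod d f m n)"
proof (induction n)
  case (Suc n) then show ?case by (cases "m \<le> n") (auto simp: mat_prod_Suc mat_prod_def intro: contraction_mult contraction_one)
qed (simp add: mat_prod_def contraction_one)

lemma det_bound: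
  fixes A :: "complex mat"
  assumes "A \<in> carrier_mat d d" "\<And>i j. i < d \<Longrightarrow> j < d \<Longrightarrow> cmod (A $$ (i, j)) \<le> 1"
  shows "cmod (Determinant.det A) \<le> fact d"
proof -
  have "cmod (Determinant.det A) \<le> (\<Sum>p\<in>{p. p permutes {0..<d}}. cmod (signof p * (\<Prod>i = 0..<d. A $$ (i, p i))))"
    unfolding det_def'[OF assms(1)] by (rule norm_sum)
  also have "\<dots> \<le> (\<Sum>p\<in>{p. p permutes {0..<d}}. 1)"
  proof (rule sum_mono)
    fix p assume "p \<in> {p. p permutes {0..<d}}"
    then have p: "p permutes {0..<d}" by simp
    have "cmod (\<Prod>i = 0..<d. A $$ (i, p i)) \<le> 1"
      unfolding prod_norm[symmetric] by (rule prod_le_1) (use assms(2) permutes_in_image[OF p] in auto)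
    moreover have "cmod (signof p) = 1" by (simp add: sign_def)
    ultimately show "cmod (signof p * (\<Prod>i = 0..<d. A $$ (i, p i))) \<le> 1" by (simp add: norm_mult)
  qed
  also have "\<dots> = fact d" by (simp add: card_permutations)
  finally show ?thesis .
qed

text \<open>
  The powers of \<open>A\<close> are contractions too, so their entries have modulus at most \<open>1\<close> and their determinants
  are bounded by \<open>fact d\<close>. These determinants are the powers of that of \<open>A\<close>.
\<close>

lemma contraction_det:
  assumes "contraction d A" shows "cmod (Determinant.det A) \<le> 1"
proof (rule ccontr)
  assume "\<not> ?thesis"
  then have gt: "1 < cmod (Determinant.det A)" by simp
  have A: "A \<in> carrier_mat d d" using assms by (simp add: contraction_def)
  have c: "contraction d (mat_prod d (\<lambda>_. A) 0 n)" for n by (rule contraction_mat_prod[OF assms])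
  have "Determinant.det (mat_prod d (\<lambda>_. A) 0 n) = Determinant.det A ^ n" for n
  proof (induction n)
    case (Suc n)
    have "mat_prod d (\<lambda>_. A) 0 n \<in> carrier_mat d d" using c by (simp add: contraction_def)
    then show ?case using Suc by (simp add: mat_prod_Suc Determinant.det_mult[OF A])
  qed simp
  then have "cmod (Determinant.det A) ^ n \<le> fact d" for n
    using det_bound[of "mat_prod d (\<lambda>_. A) 0 n" d] c[of n] contraction_entry[OF c]
    by (simp add: contraction_def norm_power[symmetric])
  moreover obtain n where "fact d < cmod (Determinant.det A) ^ n" using real_arch_pow[OF gt] by blast
  ultimately show False by (meson not_le)
qed

lemma unitary_isometry:
  assumes U: "U \<in> carrier (unitary_group d)" and v: "v \<in> carrier_vec d"
  shows "vec_l2_norm (U *\<^sub>v v) = vec_l2_norm v"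
proof -
  have c: "U \<in> carrier_mat d d" by (rule unitary_carrier[OF U])
  have "complex_of_real (\<Sum>i<d. (cmod (vec_index (U *\<^sub>v v) i))\<^sup>2) =
     (\<Sum>i<d. (\<Sum>j<d. U $$ (i, j) * vec_index v j) * cnj (\<Sum>l<d. U $$ (i, l) * vec_index v l))"
    unfolding of_real_sum
    by (rule sum.cong) (use mult_vec_entry[OF c v] in \<open>simp_all only: lessThan_iff complex_norm_square\<close>)
  also have "\<dots> = (\<Sum>i<d. \<Sum>j<d. \<Sum>l<d. vec_index v j * cnj (vec_index v l) * (cnj (U $$ (i, l)) * U $$ (i, j)))"
    unfolding cnj_sum sum_product by (intro sum.cong refl) (simp add: ac_simps)
  also have "\<dots> = (\<Sum>j<d. \<Sum>l<d. \<Sum>i<d. vec_index v j * cnj (vec_index v l) * (cnj (U $$ (i, l)) * U $$ (i, j)))"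
    by (subst sum.swap) (intro sum.cong refl sum.swap)
  also have "\<dots> = (\<Sum>j<d. \<Sum>l<d. vec_index v j * cnj (vec_index v l) * (if l = j then 1 else 0))"
    unfolding sum_distrib_left[symmetric] by (intro sum.cong refl) (use unitary_orthogonal(2)[OF U] in simp)
  also have "\<dots> = (\<Sum>j<d. vec_index v j * cnj (vec_index v j))"
    by (intro sum.cong refl) (simp add: if_distrib cong: if_cong)
  also have "\<dots> = complex_of_real (\<Sum>j<d. (cmod (vec_index v j))\<^sup>2)"
    unfolding of_real_sum by (rule sum.cong) (simp_all only: complex_norm_square)
  finally have "(\<Sum>i<d. (cmod (vec_index (U *\<^sub>v v) i))\<^sup>2) = (\<Sum>j<d. (cmod (vec_index v j))\<^sup>2)"
    by (simp only: of_real_eq_iff)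
  then show ?thesis using c v by (simp add: vec_l2_norm_def L2_set_def)
qed

text \<open>
  With \<open>w\<close> the image of \<open>v\<close> under the averaged matrix, \<open>\<parallel>w\<parallel>\<^sup>2\<close> is the average of the inner products of \<open>U z v\<close> with
  \<open>w\<close>, each of which is at most \<open>\<parallel>v\<parallel> \<parallel>w\<parallel>\<close>.
\<close>

lemma contraction_integral:
  fixes U :: "'z \<Rightarrow> complex mat"
  assumes M: "prob_space M" and U: "\<And>z. z \<in> space M \<Longrightarrow> U z \<in> carrier (unitary_group d)"
    and m: "\<And>i j. i < d \<Longrightarrow> j < d \<Longrightarrow> (\<lambda>z. U z $$ (i, j)) \<in> borel_measurable M"
  shows "contraction d (mat d d (\<lambda>(i, j). \<integral>z. U z $$ (i, j) \<partial>M))"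
  unfolding contraction_def
proof (intro conjI ballI)
  interpret prob_space M by fact
  let ?R = "mat d d (\<lambda>(i, j). \<integral>z. U z $$ (i, j) \<partial>M)"
  show R: "?R \<in> carrier_mat d d" by simp
  fix v :: "complex vec" assume v: "v \<in> carrier_vec d"
  define w where "w = ?R *\<^sub>v v"
  have w: "w \<in> carrier_vec d" unfolding w_def by (rule mult_mat_vec_carrier[OF R v])
  have int: "integrable M (\<lambda>z. U z $$ (i, j))" if "i < d" "j < d" for i j
    by (rule integrable_const_bound[of _ 1, OF AE_I2 m[OF that]]) (use unitary_entry_bound[OF U] that in auto)
  define F where "F z = (\<Sum>i<d. cnj (vec_index w i) * (\<Sum>j<d. U z $$ (i, j) * vec_index v j))" for z
  have intF: "integrable M F" unfolding F_def
    by (intro Bochner_Integration.integrable_sum integrable_mult_right integrable_mult_left int) auto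
  have "complex_of_real ((vec_l2_norm w)\<^sup>2) = (\<Sum>i<d. cnj (vec_index w i) * vec_index w i)"
  proof -
    have "(vec_l2_norm w)\<^sup>2 = (\<Sum>i<d. (cmod (vec_index w i))\<^sup>2)"
      using w by (simp add: vec_l2_norm_def L2_set_def sum_nonneg)
    then show ?thesis
      by (simp only: of_real_sum complex_norm_square mult.commute)
  qed
  also have "\<dots> = (\<Sum>i<d. cnj (vec_index w i) * (\<Sum>j<d. (\<integral>z. U z $$ (i, j) \<partial>M) * vec_index v j))"
  proof (rule sum.cong[OF refl])
    fix i assume "i \<in> {..<d}"
    then have "vec_index w i = (\<Sum>j<d. (\<integral>z. U z $$ (i, j) \<partial>M) * vec_index v j)"
      unfolding w_def using mult_vec_entry[OF R v, of i] by simp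
    then show "cnj (vec_index w i) * vec_index w i = cnj (vec_index w i) * (\<Sum>j<d. (\<integral>z. U z $$ (i, j) \<partial>M) * vec_index v j)"
      by simp
  qed
  also have "\<dots> = (\<integral>z. F z \<partial>M)"
  proof -
    have "(\<integral>z. (\<Sum>j<d. U z $$ (i, j) * vec_index v j) \<partial>M) = (\<Sum>j<d. (\<integral>z. U z $$ (i, j) \<partial>M) * vec_index v j)" if "i < d" for i
      by (subst Bochner_Integration.integral_sum) (auto intro!: integrable_mult_left int that)
    moreover have "(\<integral>z. F z \<partial>M) = (\<Sum>i<d. cnj (vec_index w i) * (\<integral>z. (\<Sum>j<d. U z $$ (i, j) * vec_index v j) \<partial>M))"
      unfolding F_def
      by (subst Bochner_Integration.integral_sum)
        (auto intro!: integrable_mult_right integrable_mult_left Bochner_Integration.integrable_sum int)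
    ultimately show ?thesis by simp
  qed
  finally have eq: "complex_of_real ((vec_l2_norm w)\<^sup>2) = (\<integral>z. F z \<partial>M)" .
  have Fb: "cmod (F z) \<le> vec_l2_norm w * vec_l2_norm v" if z: "z \<in> space M" for z
  proof -
    have Uc: "U z \<in> carrier_mat d d" by (rule unitary_carrier[OF U[OF z]])
    have "cmod (F z) \<le> (\<Sum>i<d. \<bar>cmod (vec_index w i)\<bar> * \<bar>cmod (vec_index (U z *\<^sub>v v) i)\<bar>)"
      unfolding F_def by (rule order_trans[OF norm_sum sum_mono]) (use mult_vec_entry[OF Uc v] in \<open>simp add: norm_mult\<close>)
    also have "\<dots> \<le> L2_set (\<lambda>i. cmod (vec_index w i)) {..<d} * L2_set (\<lambda>i. cmod (vec_index (U z *\<^sub>v v) i)) {..<d}"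
      by (rule L2_set_mult_ineq)
    also have "\<dots> = vec_l2_norm w * vec_l2_norm (U z *\<^sub>v v)" using w Uc v by (simp add: vec_l2_norm_def)
    finally show ?thesis using unitary_isometry[OF U[OF z] v] by simp
  qed
  have "(vec_l2_norm w)\<^sup>2 = cmod (\<integral>z. F z \<partial>M)" unfolding eq[symmetric] norm_of_real by simp
  also have "\<dots> \<le> (\<integral>z. cmod (F z) \<partial>M)" by (rule integral_norm_bound)
  also have "\<dots> \<le> vec_l2_norm w * vec_l2_norm v"
    by (rule integral_le_const[OF integrable_norm[OF intF]]) (use Fb in auto)
  finally have "vec_l2_norm w * vec_l2_norm w \<le> vec_l2_norm w * vec_l2_norm v" by (simp add: power2_eq_square)
  then show "vec_l2_norm (?R *\<^sub>v v) \<le> vec_l2_norm v"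
    using vec_l2_norm_nonneg[of w] vec_l2_norm_nonneg[of v] unfolding w_def[symmetric]
    by (cases "vec_l2_norm w = 0") auto
qed

section \<open>The random matrices attached to a representation\<close>

lemma foldr_comp_id: "foldr (\<circ>) fs g = foldr (\<circ>) fs id \<circ> g"
  by (induction fs) (simp_all add: comp_assoc)

lemma phi_comp_Suc: "k \<le> l \<Longrightarrow> phi_comp \<phi> k (Suc l) = phi_comp \<phi> k l \<circ> \<phi> l"
  using foldr_comp_id[of "map \<phi> [k..<l]" "\<phi> l"] by (simp add: phi_comp_def)

lemma phi_comp_self: "phi_comp \<phi> k k = id" by (simp add: phi_comp_def)

text \<open>
  The level \<open>k\<close> at which measurability and the limits are studied is a parameter, because the matrices \<open>U l\<close> and \<open>R_mat\<close>
  depend on it.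
\<close>

locale rep_chain = group_chain G T \<phi> \<mu>
  for G :: "nat \<Rightarrow> 'a monoid" and T :: "nat \<Rightarrow> 'a topology" and \<phi> :: "nat \<Rightarrow> 'a \<Rightarrow> 'a" and \<mu> :: "nat \<Rightarrow> 'a measure" +
  fixes \<rho> :: "(nat \<Rightarrow> 'a) \<Rightarrow> complex mat" and d :: nat and k :: nat
  assumes d: "d > 0" and rho_hom: "\<rho> \<in> hom (product_group UNIV G) (unitary_group d)"
    and rho_cont: "\<And>i j. i < d \<Longrightarrow> j < d \<Longrightarrow> continuous_map (prod_top T) euclidean (\<lambda>x. \<rho> x $$ (i, j))"
begin

lemma carrier_product: "carrier (product_group UNIV G) = \<Omega>"
  by (simp add: product_group_def topspace_product_topology carr)

lemma rep_dim: "rep_dim G \<rho> = d"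
proof -
  have "\<one>\<^bsub>product_group UNIV G\<^esub> \<in> \<Omega>"
    using monoid.one_closed[OF group.is_monoid[OF grp]] by (auto simp: product_group_def topspace_product_topology carr)
  then have "\<one>\<^bsub>product_group UNIV G\<^esub> \<in> carrier (product_group UNIV G)" unfolding carrier_product .
  then have "\<rho> \<one>\<^bsub>product_group UNIV G\<^esub> \<in> carrier (unitary_group d)" by (rule hom_in_carrier[OF rho_hom])
  then show ?thesis using unitary_carrier by (auto simp: rep_dim_def)
qed

lemma emb_in: "h \<in> topspace (T k) \<Longrightarrow> emb G k h \<in> \<Omega>"
  using monoid.one_closed[OF group.is_monoid[OF grp]]
  by (auto simp: emb_def topspace_product_topology carr)

lemma emb_mult:
  assumes "g \<in> topspace (T k)" "h \<in> topspace (T k)"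
  shows "emb G k (g \<otimes>\<^bsub>G k\<^esub> h) = emb G k g \<otimes>\<^bsub>product_group UNIV G\<^esub> emb G k h"
proof
  fix j
  show "emb G k (g \<otimes>\<^bsub>G k\<^esub> h) j = (emb G k g \<otimes>\<^bsub>product_group UNIV G\<^esub> emb G k h) j"
    using monoid.l_one[OF group.is_monoid[OF grp[of j]] monoid.one_closed[OF group.is_monoid[OF grp[of j]]]]
    by (simp add: emb_def product_group_def)
qed

lemma emb_cont: "continuous_map (T k) (prod_top T) (emb G k)"
  unfolding continuous_map_componentwise_UNIV
proof
  fix j
  show "continuous_map (T k) (T j) (\<lambda>h. emb G k h j)"
    using monoid.one_closed[OF group.is_monoid[OF grp[of j]]]
    by (cases "j = k") (auto simp: emb_def carr)
qed

lemma phi_comp_cont: "k \<le> l \<Longrightarrow> continuous_map (T l) (T k) (phi_comp \<phi> k l)"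
proof (induction rule: dec_induct)
  case base show ?case by (simp add: phi_comp_self)
next
  case (step l) then show ?case using continuous_map_compose[OF cont_phi[of l] step.IH] by (simp add: phi_comp_Suc comp_def)
qed

lemma phi_comp_mult:
  assumes "k \<le> l" "g \<in> topspace (T l)" "h \<in> topspace (T l)"
  shows "phi_comp \<phi> k l (g \<otimes>\<^bsub>G l\<^esub> h) = phi_comp \<phi> k l g \<otimes>\<^bsub>G k\<^esub> phi_comp \<phi> k l h"
  using assms
proof (induction arbitrary: g h rule: dec_induct)
  case base then show ?case by (simp add: phi_comp_self)
next
  case (step l)
  have "\<phi> l (g \<otimes>\<^bsub>G (Suc l)\<^esub> h) = \<phi> l g \<otimes>\<^bsub>G l\<^esub> \<phi> l h"
    using hom[of l] step.prems by (auto simp: hom_def carr)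
  then show ?case using step phi_in by (simp add: phi_comp_Suc)
qed

definition U :: "nat \<Rightarrow> 'a \<Rightarrow> complex mat" where "U l h = \<rho> (emb G k (phi_comp \<phi> k l h))"

lemma phi_comp_in: "k \<le> l \<Longrightarrow> h \<in> topspace (T l) \<Longrightarrow> phi_comp \<phi> k l h \<in> topspace (T k)"
  using phi_comp_cont[of l] by (auto simp: continuous_map_def)

lemma U_unitary: "k \<le> l \<Longrightarrow> h \<in> topspace (T l) \<Longrightarrow> U l h \<in> carrier (unitary_group d)"
  using rho_hom emb_in[OF phi_comp_in] carrier_product by (auto simp: hom_def U_def)

lemma U_carrier: "k \<le> l \<Longrightarrow> h \<in> topspace (T l) \<Longrightarrow> U l h \<in> carrier_mat d d"
  using U_unitary unitary_carrier by blast

lemma U_mult: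
  assumes "k \<le> l" "g \<in> topspace (T l)" "h \<in> topspace (T l)"
  shows "U l (g \<otimes>\<^bsub>G l\<^esub> h) = U l g * U l h"
proof -
  have "\<rho> (emb G k (phi_comp \<phi> k l g) \<otimes>\<^bsub>product_group UNIV G\<^esub> emb G k (phi_comp \<phi> k l h)) =
      \<rho> (emb G k (phi_comp \<phi> k l g)) \<otimes>\<^bsub>unitary_group d\<^esub> \<rho> (emb G k (phi_comp \<phi> k l h))"
    by (rule hom_mult[OF rho_hom]; unfold carrier_product) (use assms in \<open>simp_all add: emb_in phi_comp_in\<close>)
  then show ?thesis unfolding U_def phi_comp_mult[OF assms]
    using assms by (simp add: emb_mult phi_comp_in unitary_group_def)
qed

lemma U_cont: "k \<le> l \<Longrightarrow> i < d \<Longrightarrow> j < d \<Longrightarrow> continuous_map (T l) euclidean (\<lambda>h. U l h $$ (i, j))"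
  using continuous_map_compose[OF continuous_map_compose[OF phi_comp_cont emb_cont] rho_cont] by (simp add: U_def comp_def)

lemma U_measurable: "k \<le> l \<Longrightarrow> i < d \<Longrightarrow> j < d \<Longrightarrow> (\<lambda>h. U l h $$ (i, j)) \<in> borel_measurable (borel_of (T l))"
  by (intro continuous_map_borel_measurable U_cont)

lemma U_phi: "k \<le> l \<Longrightarrow> U l (\<phi> l h) = U (Suc l) h" by (simp add: U_def phi_comp_Suc)

lemma U_self: "U k h = \<rho> (emb G k h)" by (simp add: U_def phi_comp_self)

lemma U_entry_step:
  assumes "k \<le> l" "x \<in> \<Omega>" "i < d" "j < d"
  shows "U l (x l) $$ (i, j) = (\<Sum>c<d. U (Suc l) (x (Suc l)) $$ (i, c) * U l (Z_var G \<phi> l x) $$ (c, j))"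
proof -
  have "U l (x l) = U (Suc l) (x (Suc l)) * U l (Z_var G \<phi> l x)"
    using U_mult[of l "\<phi> l (x (Suc l))" "Z_var G \<phi> l x"] phi_Z[of x l] phi_in[OF coord_in[of x "Suc l"]] Z_in[of x l] assms
    by (simp add: U_phi)
  then show ?thesis using mult_entry[OF U_carrier U_carrier, of "Suc l" "x (Suc l)" l "Z_var G \<phi> l x" i j] coord_in Z_in assms by simp
qed

lemma U_step: "k \<le> l \<Longrightarrow> x \<in> \<Omega> \<Longrightarrow> U l (x l) = U (Suc l) (x (Suc l)) * U l (Z_var G \<phi> l x)"
  using U_mult[of l "\<phi> l (x (Suc l))" "Z_var G \<phi> l x"] phi_Z[of x l] phi_in[OF coord_in[of x "Suc l"]] Z_in[of x l]
  by (simp add: U_phi)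

lemma unitary_prod:
  assumes "A \<in> carrier (unitary_group d)" "B \<in> carrier (unitary_group d)" shows "A * B \<in> carrier (unitary_group d)"
proof -
  have A: "A \<in> carrier_mat d d" "A * mat_adjoint A = 1\<^sub>m d" "mat_adjoint A * A = 1\<^sub>m d"
    and B: "B \<in> carrier_mat d d" "B * mat_adjoint B = 1\<^sub>m d" "mat_adjoint B * B = 1\<^sub>m d"
    using assms by (simp_all add: unitary_group_def)
  have a: "mat_adjoint A \<in> carrier_mat d d" "mat_adjoint B \<in> carrier_mat d d"
    using A B by (auto simp: mat_adjoint_def mat_of_rows_def)
  have ab: "mat_adjoint (A * B) = mat_adjoint B * mat_adjoint A"
  proof (rule eq_matI)
    show "dim_row (mat_adjoint (A * B)) = dim_row (mat_adjoint B * mat_adjoint A)"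
      "dim_col (mat_adjoint (A * B)) = dim_col (mat_adjoint B * mat_adjoint A)"
      using A B a by (auto simp: mat_adjoint_def mat_of_rows_def)
    fix i j assume "i < dim_row (mat_adjoint B * mat_adjoint A)" "j < dim_col (mat_adjoint B * mat_adjoint A)"
    then have ij: "i < d" "j < d" using a by auto
    show "mat_adjoint (A * B) $$ (i, j) = (mat_adjoint B * mat_adjoint A) $$ (i, j)"
      unfolding mat_adjoint_entry[OF mult_carrier_mat[OF A(1) B(1)] ij] mult_entry[OF A(1) B(1) ij(2,1)] mult_entry[OF a(2,1) ij]
        cnj_sum
      by (rule sum.cong) (use ij A B in \<open>simp_all add: mat_adjoint_entry\<close>)
  qed
  have "A * B * (mat_adjoint B * mat_adjoint A) = A * (B * mat_adjoint B) * mat_adjoint A"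
    using A(1) B(1) a by (simp add: assoc_mult_mat[of _ d d _ d _ d])
  moreover have "mat_adjoint B * mat_adjoint A * (A * B) = mat_adjoint B * (mat_adjoint A * A) * B"
    using A(1) B(1) a by (simp add: assoc_mult_mat[of _ d d _ d _ d])
  ultimately show ?thesis using A B a by (simp add: unitary_group_def ab)
qed

lemma unitary_one: "1\<^sub>m d \<in> carrier (unitary_group d)"
proof -
  have "mat_adjoint (1\<^sub>m d :: complex mat) = 1\<^sub>m d"
    by (rule eq_matI) (auto simp: mat_adjoint_entry[of _ d] mat_adjoint_def mat_of_rows_def conjugate_complex_def)
  then show ?thesis by (simp add: unitary_group_def)
qed

definition V :: "nat \<Rightarrow> nat \<Rightarrow> (nat \<Rightarrow> 'a) \<Rightarrow> complex mat" where
  "V m n x = mat_prod d (\<lambda>l. U l (Z_var G \<phi> l x)) m n"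

lemma UZ_carrier: "x \<in> \<Omega> \<Longrightarrow> k \<le> l \<Longrightarrow> U l (Z_var G \<phi> l x) \<in> carrier_mat d d"
  by (intro U_carrier Z_in)

lemma V_unitary: "x \<in> \<Omega> \<Longrightarrow> k \<le> m \<Longrightarrow> V m n x \<in> carrier (unitary_group d)"
  unfolding V_def
proof (induction n)
  case (Suc n)
  then show ?case by (cases "m \<le> n") (auto simp: mat_prod_Suc mat_prod_def intro!: unitary_prod U_unitary Z_in unitary_one)
qed (simp add: mat_prod_def unitary_one)

lemma V_carrier: "x \<in> \<Omega> \<Longrightarrow> k \<le> m \<Longrightarrow> V m n x \<in> carrier_mat d d"
  using V_unitary unitary_carrier by blast

lemma V_first: "x \<in> \<Omega> \<Longrightarrow> k \<le> m \<Longrightarrow> m < n \<Longrightarrow> V m n x = V (Suc m) n x * U m (Z_var G \<phi> m x)"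
  unfolding V_def by (rule mat_prod_first) (auto intro: UZ_carrier)

lemma V_split: "x \<in> \<Omega> \<Longrightarrow> k \<le> m \<Longrightarrow> m \<le> p \<Longrightarrow> p \<le> n \<Longrightarrow> V m n x = V p n x * V m p x"
  unfolding V_def by (rule mat_prod_split) (auto intro: UZ_carrier)

text \<open>
  The recursion for the coordinates, iterated from \<open>m\<close> to \<open>n\<close> and pushed through the representation. Everything below
  rests on this factorization into a part depending on the far coordinate \<open>x n\<close> and a part depending on \<open>Z m, \<dots>, Z (n - 1)\<close>.
\<close>

lemma U_V:
  assumes "x \<in> \<Omega>" "k \<le> m" "m \<le> n" shows "U m (x m) = U n (x n) * V m n x"
  using assms(3)
proof (induction rule: dec_induct)
  case base then show ?case using U_carrier[OF assms(2) coord_in[OF assms(1)]] by (simp add: V_def)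
next
  case (step n)
  have "k \<le> n" "k \<le> Suc n" using assms step by auto
  then show ?case
    using step.IH step.hyps U_step[OF \<open>k \<le> n\<close> assms(1)] U_carrier[OF _ coord_in[OF assms(1)]] V_carrier[OF assms(1,2), of n] UZ_carrier[OF assms(1)]
    by (simp add: V_def mat_prod_Suc assoc_mult_mat[of _ d d _ d _ d])
qed

lemma V_measurable:
  assumes Z: "\<And>l. m \<le> l \<Longrightarrow> l < n \<Longrightarrow> Z_var G \<phi> l \<in> M \<rightarrow>\<^sub>M borel_of (T l)" and M: "space M = \<Omega>" and km: "k \<le> m" and ij: "i < d" "j < d"
  shows "(\<lambda>x. V m n x $$ (i, j)) \<in> borel_measurable M"
proof (cases "m \<le> n")
  case True
  then show ?thesis using Z ij
  proof (induction arbitrary: i j rule: dec_induct)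
    case base then show ?case by (simp add: V_def)
  next
    case (step n)
    have "k \<le> n" using km step by simp
    have "(\<lambda>x. \<Sum>c<d. U n (Z_var G \<phi> n x) $$ (i, c) * V m n x $$ (c, j)) \<in> borel_measurable M"
      by (intro borel_measurable_sum borel_measurable_times measurable_compose[OF step.prems(1) U_measurable] step.IH)
        (use step \<open>k \<le> n\<close> in auto)
    moreover have "V m (Suc n) x $$ (i, j) = (\<Sum>c<d. U n (Z_var G \<phi> n x) $$ (i, c) * V m n x $$ (c, j))" if "x \<in> space M" for x
      unfolding V_def mat_prod_Suc[OF step.hyps(1)]
      by (rule mult_entry) (use UZ_carrier V_carrier[of x m n] that M km \<open>k \<le> n\<close> step.prems in \<open>auto simp: V_def\<close>)
    ultimately show ?case by (simp cong: measurable_cong)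
  qed
next
  case False
  then show ?thesis by (simp add: V_def mat_prod_def)
qed

abbreviation "R \<equiv> R_mat G \<phi> \<mu> \<rho> k"

lemma R_entry: "i < d \<Longrightarrow> j < d \<Longrightarrow> R l $$ (i, j) = (\<integral>z. U l z $$ (i, j) \<partial>\<mu> l)"
  by (simp add: R_mat_def rep_dim U_def)

lemma R_carrier: "R l \<in> carrier_mat d d" by (simp add: R_mat_def rep_dim)

lemma R_contraction: "k \<le> l \<Longrightarrow> contraction d (R l)"
proof -
  assume l: "k \<le> l"
  note sm = borel_probD(2,3)[OF mu, of l]
  have "contraction d (mat d d (\<lambda>(i, j). \<integral>z. U l z $$ (i, j) \<partial>\<mu> l))"
    using U_unitary[OF l] U_measurable[OF l] sm(2)
    unfolding measurable_cong_sets[OF sm(1) refl, of borel, symmetric]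
    by (intro contraction_integral borel_probD(1)[OF mu]) auto
  then show ?thesis by (simp add: R_mat_def rep_dim U_def)
qed

abbreviation "Rp \<equiv> mat_prod d R"

lemma R_prod_eq: "R_prod G \<phi> \<mu> \<rho> k m n = Rp m (Suc n)" by (simp add: R_prod_def mat_prod_def rep_dim)

lemma Rp_carrier: "Rp m n \<in> carrier_mat d d" by (rule mat_prod_carrier) (rule R_carrier)

lemma Rp_contraction: "k \<le> m \<Longrightarrow> contraction d (Rp m n)"
  by (rule contraction_mat_prod) (auto intro: R_contraction)

text \<open>
  The independence of \<open>Z m\<close> from the coordinates beyond \<open>m\<close>, in the shape in which an inductive proof splits off one factor of a matrix product.
  The extra factor \<open>g\<close> serves to test against functions of \<open>Z m\<close>.
\<close>

lemma product_integral:
  assumes P: "P \<in> solutions G T \<phi> \<mu>" and m: "k \<le> m" and ij: "i < d" "j < d"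
    and H: "\<And>c. c < d \<Longrightarrow> H c \<in> borel_measurable (future_X T m)" "\<And>c x. c < d \<Longrightarrow> x \<in> \<Omega> \<Longrightarrow> cmod (H c x) \<le> 1"
    and g: "g \<in> borel_measurable (borel_of (T m))" "\<And>z. z \<in> topspace (T m) \<Longrightarrow> cmod (g z) \<le> 1"
  shows "(\<integral>x. (\<Sum>c<d. H c x * U m (Z_var G \<phi> m x) $$ (c, j)) * g (Z_var G \<phi> m x) \<partial>P) =
     (\<Sum>c<d. (\<integral>x. H c x \<partial>P) * (\<integral>z. U m z $$ (c, j) * g z \<partial>\<mu> m))"
proof -
  have Pb: "P \<in> borel_prob (prod_top T)" using P solutions_iff by blast
  note sP = borel_probD(2,3)[OF Pb]
  have fb: "cmod (U m z $$ (c, j) * g z) \<le> 1" if "c < d" "z \<in> topspace (T m)" for c z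
    unfolding norm_mult using unitary_entry_bound[OF U_unitary[OF m that(2)] that(1) ij(2)] g(2)[OF that(2)]
    by (intro mult_le_one) auto
  have fm: "(\<lambda>z. U m z $$ (c, j) * g z) \<in> borel_measurable (borel_of (T m))" if "c < d" for c
    by (intro borel_measurable_times U_measurable m g ij that)
  have int: "integrable P (\<lambda>x. H c x * (U m (Z_var G \<phi> m x) $$ (c, j) * g (Z_var G \<phi> m x)))" if c: "c < d" for c
  proof (rule integrable_bounded_prob[OF borel_probD(1)[OF Pb], of _ 1])
    have "(\<lambda>x. H c x * (U m (Z_var G \<phi> m x) $$ (c, j) * g (Z_var G \<phi> m x))) \<in> borel_measurable \<B>"
      by (rule borel_measurable_times[OF measurable_future_all[OF H(1)[OF c]] measurable_compose[OF Z_measurable fm[OF c]]])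
    then show "(\<lambda>x. H c x * (U m (Z_var G \<phi> m x) $$ (c, j) * g (Z_var G \<phi> m x))) \<in> borel_measurable P"
      using measurable_cong_sets[OF sP(1) refl] by blast
    fix x assume "x \<in> space P"
    then have "x \<in> \<Omega>" using sP by simp
    then show "cmod (H c x * (U m (Z_var G \<phi> m x) $$ (c, j) * g (Z_var G \<phi> m x))) \<le> 1"
      unfolding norm_mult[of "H c x"] using H(2)[OF c] fb[OF c Z_in] by (intro mult_le_one) auto
  qed
  have "(\<integral>x. (\<Sum>c<d. H c x * U m (Z_var G \<phi> m x) $$ (c, j)) * g (Z_var G \<phi> m x) \<partial>P) =
     (\<integral>x. (\<Sum>c<d. H c x * (U m (Z_var G \<phi> m x) $$ (c, j) * g (Z_var G \<phi> m x))) \<partial>P)"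
    by (rule Bochner_Integration.integral_cong[OF refl]) (simp add: sum_distrib_right mult.assoc)
  also have "\<dots> = (\<Sum>c<d. \<integral>x. H c x * (U m (Z_var G \<phi> m x) $$ (c, j) * g (Z_var G \<phi> m x)) \<partial>P)"
    by (rule Bochner_Integration.integral_sum) (use int in auto)
  also have "\<dots> = (\<Sum>c<d. (\<integral>x. H c x \<partial>P) * (\<integral>z. U m z $$ (c, j) * g z \<partial>\<mu> m))"
    by (rule sum.cong[OF refl], rule ind_at_product[OF Pb solution_imp_ind_at[OF P] fm _ H(1), of _ 1 _ 1])
      (use fb H(2) in auto)
  finally show ?thesis .
qed

lemma expectation_V:
  assumes P: "P \<in> solutions G T \<phi> \<mu>" and "k \<le> m" "m \<le> n" "i < d" "j < d"
  shows "(\<integral>x. V m n x $$ (i, j) \<partial>P) = Rp m n $$ (i, j)"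
  using assms(3,2,4,5)
proof (induction arbitrary: i j rule: inc_induct)
  case base
  have Pb: "P \<in> borel_prob (prod_top T)" using P solutions_iff by blast
  interpret P: prob_space P by (rule borel_probD[OF Pb])
  show ?case using base by (simp add: V_def P.prob_space)
next
  case (step m)
  have Pb: "P \<in> borel_prob (prod_top T)" using P solutions_iff by blast
  note sP = borel_probD(2,3)[OF Pb]
  have "(\<integral>x. V m n x $$ (i, j) \<partial>P) = (\<integral>x. (\<Sum>c<d. V (Suc m) n x $$ (i, c) * U m (Z_var G \<phi> m x) $$ (c, j)) * 1 \<partial>P)"
    by (rule Bochner_Integration.integral_cong[OF refl])
      (use step sP in \<open>simp add: V_first mult_entry[OF V_carrier UZ_carrier]\<close>)
  also have "\<dots> = (\<Sum>c<d. (\<integral>x. V (Suc m) n x $$ (i, c) \<partial>P) * (\<integral>z. U m z $$ (c, j) * 1 \<partial>\<mu> m))"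
    using step
    by (intro product_integral[OF P, where g = "\<lambda>_. 1"] V_measurable Z_future unitary_entry_bound[OF V_unitary]) auto
  also have "\<dots> = (\<Sum>c<d. Rp (Suc m) n $$ (i, c) * R m $$ (c, j))"
    using step by (intro sum.cong refl) (simp add: R_entry)
  also have "\<dots> = Rp m n $$ (i, j)"
    using step mat_prod_first[of m R d n] by (simp add: R_carrier mult_entry[OF Rp_carrier R_carrier])
  finally show ?case .
qed

end

section \<open>Functions orthogonal to a sigma-algebra\<close>

text \<open>
  The sets over which the integral of \<open>f\<close> vanishes form a Dynkin system; \<open>all\<close> says that it contains the whole space.
\<close>

lemma set_integral_zero_dynkin:
  fixes f :: "'w \<Rightarrow> 'b :: {banach, second_countable_topology}"
  assumes f: "integrable P f" and E: "Int_stable E" "E \<subseteq> sets P" and zero: "\<And>A. A \<in> E \<Longrightarrow> (LINT x:A|P. f x) = 0"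
    and all: "integral\<^sup>L P f = 0" and A: "A \<in> sigma_sets (space P) E"
  shows "(LINT x:A|P. f x) = 0"
proof -
  have EP: "E \<subseteq> Pow (space P)" using E(2) sets.sets_into_space by blast
  have sub: "sigma_sets (space P) E \<subseteq> sets P" by (rule sets.sigma_sets_subset[OF E(2)])
  have si: "set_integrable P B f" if "B \<in> sets P" for B
    unfolding set_integrable_def by (rule integrable_mult_indicator[OF that f])
  show ?thesis using E(1) EP A
  proof (induction rule: sigma_sets_induct_disjoint)
    case (basic A) then show ?case by (rule zero)
  next
    case empty show ?case by (simp add: set_lebesgue_integral_def)
  next
    case (compl A)
    have A: "A \<in> sets P" using compl sub by blast
    have "(LINT x:(A \<union> (space P - A))|P. f x) = (LINT x:A|P. f x) + (LINT x:(space P - A)|P. f x)"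
      by (rule set_integral_Un) (use A in \<open>auto intro: si\<close>)
    moreover have "A \<union> (space P - A) = space P" using sets.sets_into_space[OF A] by blast
    moreover have "(LINT x:space P|P. f x) = integral\<^sup>L P f"
      unfolding set_lebesgue_integral_def by (rule Bochner_Integration.integral_cong) auto
    ultimately show ?case using all compl by simp
  next
    case (union B)
    have B: "B i \<in> sets P" for i using union sub by blast
    have "(LINT x:(\<Union>i. B i)|P. f x) = (\<Sum>i. (LINT x:B i|P. f x))"
      by (rule lebesgue_integral_countable_add) (use B union(1) in \<open>auto simp: disjoint_family_on_def intro!: si\<close>)
    then show ?case using union by simp
  qed
qed

lemma AE_nonpos_of_set_integrals:
  fixes g :: "'w \<Rightarrow> real"
  assumes g: "integrable P g" "g \<in> borel_measurable F" and F: "sets F \<subseteq> sets P" "space F = space P"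
    and zero: "\<And>A. A \<in> sets F \<Longrightarrow> (LINT x:A|P. g x) = 0"
  shows "AE x in P. g x \<le> 0"
proof -
  have A: "{x\<in>space F. g x > 0} \<in> sets F" using g(2) by measurable
  then have AP: "{x\<in>space F. g x > 0} \<in> sets P" using F by blast
  let ?h = "\<lambda>x. indicator {x\<in>space F. g x > 0} x *\<^sub>R g x"
  have i: "integrable P ?h" by (rule integrable_mult_indicator[OF AP g(1)])
  have "integral\<^sup>L P ?h = 0" using zero[OF A] by (simp add: set_lebesgue_integral_def)
  moreover have "AE x in P. 0 \<le> ?h x" by (rule AE_I2) (auto simp: indicator_def)
  ultimately have "AE x in P. ?h x = 0" using integral_nonneg_eq_0_iff_AE[OF i] by simp
  then show ?thesis using AE_space
    by eventually_elim (use F in \<open>auto simp: indicator_def split: if_splits\<close>)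
qed

lemma AE_zero_of_set_integrals:
  fixes f :: "'w \<Rightarrow> complex"
  assumes f: "integrable P f" "f \<in> borel_measurable F" and F: "sets F \<subseteq> sets P" "space F = space P"
    and zero: "\<And>A. A \<in> sets F \<Longrightarrow> (LINT x:A|P. f x) = 0"
  shows "AE x in P. f x = 0"
proof -
  have s: "set_integrable P A f" if "A \<in> sets F" for A
    unfolding set_integrable_def by (rule integrable_mult_indicator) (use that F f in auto)
  have re: "(LINT x:A|P. Re (f x)) = 0" "(LINT x:A|P. Im (f x)) = 0" if "A \<in> sets F" for A
    using zero[OF that] s[OF that] integral_Re[of P "\<lambda>x. indicator A x *\<^sub>R f x"] integral_Im[of P "\<lambda>x. indicator A x *\<^sub>R f x"]
    by (simp_all add: set_lebesgue_integral_def set_integrable_def)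
  have i: "integrable P (\<lambda>x. Re (f x))" "integrable P (\<lambda>x. Im (f x))" using f(1) by (rule integrable_Re, rule integrable_Im)
  have m: "(\<lambda>x. Re (f x)) \<in> borel_measurable F" "(\<lambda>x. Im (f x)) \<in> borel_measurable F" using f(2) by simp_all
  have neg: "(LINT x:A|P. - g x) = 0" if "(LINT x:A|P. g x) = 0" for A and g :: "'w \<Rightarrow> real"
    using that by (simp add: set_lebesgue_integral_def)
  have "AE x in P. Re (f x) \<le> 0" "AE x in P. - Re (f x) \<le> 0" "AE x in P. Im (f x) \<le> 0" "AE x in P. - Im (f x) \<le> 0"
    by (intro AE_nonpos_of_set_integrals[OF _ _ F] i m re neg integrable_minus borel_measurable_uminus; assumption)+
  then show ?thesis by eventually_elim (simp add: complex_eq_iff)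
qed

lemma space_augment [simp]: "space (augment P F) = space P"
  unfolding augment_def by (simp add: space_measure_of_conv)

lemma sets_augment:
  assumes "sets F \<subseteq> sets P"
  shows "sets (augment P F) = sigma_sets (space P) (sets F \<union> null_sets P)" "sets (augment P F) \<subseteq> sets P"
proof -
  have *: "sets F \<union> null_sets P \<subseteq> sets P" using assms by auto
  then have "sets F \<union> null_sets P \<subseteq> Pow (space P)" using sets.sets_into_space by blast
  then show 1: "sets (augment P F) = sigma_sets (space P) (sets F \<union> null_sets P)" by (simp add: augment_def)
  show "sets (augment P F) \<subseteq> sets P" unfolding 1 by (rule sets.sigma_sets_subset[OF *])
qed

text \<open>
  A preimage under \<open>f\<close> differs from the preimage under \<open>g\<close>, which is in \<open>F\<close>, by null sets only.
\<close>

lemma measurable_augment_AE: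
  assumes F: "sets F \<subseteq> sets P" "space F = space P" and f: "f \<in> P \<rightarrow>\<^sub>M N" and g: "g \<in> F \<rightarrow>\<^sub>M N"
    and eq: "AE x in P. f x = g x"
  shows "f \<in> augment P F \<rightarrow>\<^sub>M N"
proof (rule measurableI)
  show "\<And>x. x \<in> space (augment P F) \<Longrightarrow> f x \<in> space N" using measurable_space[OF f] by simp
  fix A assume A: "A \<in> sets N"
  obtain M where M: "M \<in> null_sets P" "\<And>x. x \<in> space P \<Longrightarrow> x \<notin> M \<Longrightarrow> f x = g x"
    using eq by (auto elim!: AE_E3)
  have MP: "M \<subseteq> space P" using M(1) sets.sets_into_space by (auto simp: null_sets_def)
  have fA: "f -` A \<inter> space P \<in> sets P" by (rule measurable_sets[OF f A])
  have "(f -` A \<inter> space P) \<inter> M \<in> null_sets P" using null_set_Int1[OF M(1) fA] by (simp add: Int_commute)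
  then have 1: "(f -` A \<inter> space P) \<inter> M \<in> sets (augment P F)" unfolding sets_augment(1)[OF F(1)] by auto
  have 2: "M \<in> sets (augment P F)" "g -` A \<inter> space F \<in> sets (augment P F)"
    unfolding sets_augment(1)[OF F(1)] using M(1) measurable_sets[OF g A] by auto
  have "f -` A \<inter> space (augment P F) = ((g -` A \<inter> space F) - M) \<union> ((f -` A \<inter> space P) \<inter> M)"
    using M(2) F(2) by auto
  then show "f -` A \<inter> space (augment P F) \<in> sets (augment P F)"
    using sets.Un[OF sets.Diff[OF 2(2,1)] 1] by simp
qed

section \<open>Strong measurability bounds the norms from below\<close>

context group_chain
begin

lemma space_FZ [simp]: "space (F_Z G T \<phi> k) = \<Omega>" by (simp add: F_Z_def)

lemma Z_FZ: "k \<le> l \<Longrightarrow> Z_var G \<phi> l \<in> F_Z G T \<phi> k \<rightarrow>\<^sub>M borel_of (T l)"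
  unfolding F_Z_def by (rule measurable_gen_sigma) (use Z_in in auto)

lemma FZ_subset: "sets (F_Z G T \<phi> k) \<subseteq> sets \<B>"
  unfolding F_Z_def by (rule sets_gen_sigma_subset) (auto intro: Z_measurable)

lemma FZ_cylinders: "sets (F_Z G T \<phi> k) = sigma_sets \<Omega> (cylinders \<Omega> {k..} (Z_var G \<phi>) T)"
  unfolding F_Z_def by (rule sets_gen_sigma_cylinders) (use Z_in in auto)

end

lemma (in rep_chain) coefficient_bound:
  "x \<in> \<Omega> \<Longrightarrow> k \<le> l \<Longrightarrow> i < d \<Longrightarrow> j < d \<Longrightarrow> cmod (U l (x l) $$ (i, j)) \<le> 1"
  using unitary_entry_bound[OF U_unitary[OF _ coord_in]] by blast

lemma (in rep_chain) coefficient_measurable: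
  "k \<le> l \<Longrightarrow> i < d \<Longrightarrow> j < d \<Longrightarrow> (\<lambda>x. U l (x l) $$ (i, j)) \<in> borel_measurable \<B>"
  using measurable_compose[OF coord_measurable U_measurable] by blast

lemma (in rep_chain) coefficient_future:
  "k \<le> l \<Longrightarrow> q < l \<Longrightarrow> i < d \<Longrightarrow> j < d \<Longrightarrow> (\<lambda>x. U l (x l) $$ (i, j)) \<in> borel_measurable (future_X T q)"
  using measurable_compose[OF coord_future U_measurable] by blast

text \<open>
  Downward induction on \<open>m\<close>: the factor \<open>g m (Z m)\<close> and one matrix factor \<open>U m (Z m)\<close> are split off by independence, which
  leaves the statement for \<open>m + 1\<close> with all columns in place of the column \<open>j\<close>.
\<close>

lemma (in rep_chain) expectation_coefficient_zero:
  assumes P: "P \<in> solutions G T \<phi> \<mu>" and zero: "\<And>i j. i < d \<Longrightarrow> j < d \<Longrightarrow> (\<integral>x. U n (x n) $$ (i, j) \<partial>P) = 0"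
    and g: "\<And>l. g l \<in> borel_measurable (borel_of (T l))" "\<And>l z. z \<in> topspace (T l) \<Longrightarrow> cmod (g l z) \<le> 1"
    and "k \<le> m" "m \<le> n" "i < d" "j < d"
  shows "(\<integral>x. U m (x m) $$ (i, j) * (\<Prod>l\<in>{m..<n}. g l (Z_var G \<phi> l x)) \<partial>P) = 0"
  using assms(6,5,7,8)
proof (induction arbitrary: i j rule: inc_induct)
  case base then show ?case using zero by simp
next
  case (step m)
  have Pb: "P \<in> borel_prob (prod_top T)" using P solutions_iff by blast
  note sP = borel_probD(2,3)[OF Pb]
  let ?H = "\<lambda>c x. U (Suc m) (x (Suc m)) $$ (i, c) * (\<Prod>l\<in>{Suc m..<n}. g l (Z_var G \<phi> l x))"
  have km: "k \<le> m" "k \<le> Suc m" using step by auto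
  have gb: "cmod (\<Prod>l\<in>{Suc m..<n}. g l (Z_var G \<phi> l x)) \<le> 1" if "x \<in> \<Omega>" for x
    unfolding prod_norm[symmetric] by (rule prod_le_1) (use g(2)[OF Z_in[OF that]] in auto)
  have "(\<integral>x. U m (x m) $$ (i, j) * (\<Prod>l\<in>{m..<n}. g l (Z_var G \<phi> l x)) \<partial>P) =
     (\<integral>x. (\<Sum>c<d. ?H c x * U m (Z_var G \<phi> m x) $$ (c, j)) * g m (Z_var G \<phi> m x) \<partial>P)"
  proof (rule Bochner_Integration.integral_cong[OF refl])
    fix x assume "x \<in> space P"
    then have x: "x \<in> \<Omega>" using sP by simp
    have "U m (x m) $$ (i, j) = (\<Sum>c<d. U (Suc m) (x (Suc m)) $$ (i, c) * U m (Z_var G \<phi> m x) $$ (c, j))"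
      unfolding U_step[OF km(1) x]
      by (rule mult_entry[OF U_carrier[OF km(2) coord_in[OF x]] UZ_carrier[OF x km(1)]]) (use step in auto)
    then show "U m (x m) $$ (i, j) * (\<Prod>l\<in>{m..<n}. g l (Z_var G \<phi> l x)) = (\<Sum>c<d. ?H c x * U m (Z_var G \<phi> m x) $$ (c, j)) * g m (Z_var G \<phi> m x)"
      using step.hyps by (simp add: prod.atLeast_Suc_lessThan sum_distrib_left sum_distrib_right ac_simps)
  qed
  also have "\<dots> = (\<Sum>c<d. (\<integral>x. ?H c x \<partial>P) * (\<integral>z. U m z $$ (c, j) * g m z \<partial>\<mu> m))"
  proof (rule product_integral[OF P km(1)])
    show "?H c \<in> borel_measurable (future_X T m)" if "c < d" for c
      using step that km by (intro borel_measurable_times borel_measurable_prod coefficient_future measurable_compose[OF Z_future g(1)]) auto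
    show "cmod (?H c x) \<le> 1" if "c < d" "x \<in> \<Omega>" for c x
      unfolding norm_mult using step that km by (intro mult_le_one gb coefficient_bound) auto
  qed (use step g in auto)
  also have "\<dots> = 0" using step km by simp
  finally show ?case .
qed

text \<open>
  By contradiction. If all the limits in \<open>n\<close> vanish, all means of coefficients vanish, and then the coefficients at level \<open>k\<close> are
  orthogonal to the variables \<open>Z k, Z (k + 1), \<dots>\<close>. Being measurable with respect to these, they are zero almost surely.
\<close>

lemma (in rep_chain) strong_imp_norm_pos:
  assumes P: "P \<in> solutions G T \<phi> \<mu>"
    and strong: "\<And>i j. i < d \<Longrightarrow> j < d \<Longrightarrow> (\<lambda>x. \<rho> (emb G k (x k)) $$ (i, j)) \<in> borel_measurable (augment P (F_Z G T \<phi> k))"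
  shows "lim (\<lambda>m. lim (\<lambda>n. op_norm (R_prod G \<phi> \<mu> \<rho> k m n))) > 0"
proof -
  have Pb: "P \<in> borel_prob (prod_top T)" using P solutions_iff by blast
  note sP = borel_probD(2,3)[OF Pb]
  interpret P: prob_space P by (rule borel_probD[OF Pb])
  define L where "L m = lim (\<lambda>n. op_norm (R_prod G \<phi> \<mu> \<rho> k m n))" for m
  have dec: "decseq (\<lambda>n. op_norm (R_prod G \<phi> \<mu> \<rho> k m n))" if m: "k \<le> m" for m
  proof (rule decseq_SucI)
    fix n
    show "op_norm (R_prod G \<phi> \<mu> \<rho> k m (Suc n)) \<le> op_norm (R_prod G \<phi> \<mu> \<rho> k m n)"
    proof (cases "m \<le> Suc n")
      case True
      then show ?thesis unfolding R_prod_eq mat_prod_Suc[OF True]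
        by (intro contraction_mult_le(1)[of d] R_contraction Rp_carrier) (use m True in simp)
    next
      case False then show ?thesis by (simp add: R_prod_eq mat_prod_def)
    qed
  qed
  have op0: "0 \<le> op_norm (R_prod G \<phi> \<mu> \<rho> k m n)" for m n unfolding R_prod_eq by (rule op_norm_nonneg[OF Rp_carrier])
  have op1: "op_norm (R_prod G \<phi> \<mu> \<rho> k m n) \<le> 1" if "k \<le> m" for m n
    unfolding R_prod_eq by (rule contraction_op_norm[OF Rp_contraction[OF that]])
  have Lconv: "(\<lambda>n. op_norm (R_prod G \<phi> \<mu> \<rho> k m n)) \<longlonglongrightarrow> L m" if "k \<le> m" for m
    unfolding L_def convergent_LIMSEQ_iff[symmetric]
    by (rule decseq_convergent[OF dec[OF that], of 0]) (use op0 in \<open>auto simp: convergent_def\<close>)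
  have L01: "0 \<le> L m" "L m \<le> 1" if "k \<le> m" for m
    using LIMSEQ_le_const[OF Lconv[OF that], of 0] LIMSEQ_le_const2[OF Lconv[OF that], of 1] op0 op1[OF that] by auto
  have Linc: "L m \<le> L (Suc m)" if m: "k \<le> m" for m
  proof (rule LIMSEQ_le[OF Lconv[OF m] Lconv])
    show "\<exists>N. \<forall>n\<ge>N. op_norm (R_prod G \<phi> \<mu> \<rho> k m n) \<le> op_norm (R_prod G \<phi> \<mu> \<rho> k (Suc m) n)"
    proof (intro exI[of _ m] allI impI)
      fix n assume "m \<le> n"
      then have "R_prod G \<phi> \<mu> \<rho> k m n = Rp (Suc m) (Suc n) * R m"
        unfolding R_prod_eq by (intro mat_prod_first R_carrier) auto
      then show "op_norm (R_prod G \<phi> \<mu> \<rho> k m n) \<le> op_norm (R_prod G \<phi> \<mu> \<rho> k (Suc m) n)"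
        unfolding R_prod_eq by (simp add: contraction_mult_le(2)[OF R_contraction[OF m] Rp_carrier])
    qed
  qed (use m in simp)
  have inc: "incseq (\<lambda>m. L (m + k))" by (rule incseq_SucI) (simp add: Linc)
  have "(\<lambda>m. L (m + k)) \<longlonglongrightarrow> (SUP m. L (m + k))"
    by (rule LIMSEQ_incseq_SUP[OF _ inc]) (use L01 in \<open>auto intro!: bdd_aboveI[of _ 1]\<close>)
  then have limL: "L \<longlonglongrightarrow> (SUP m. L (m + k))" by (rule LIMSEQ_offset)
  have "\<exists>m\<ge>k. L m > 0"
  proof (rule ccontr)
    assume "\<not> ?thesis"
    then have L0: "L m = 0" if "k \<le> m" for m using L01[OF that] that by force
    \<comment> \<open>The mean of \<open>U m (x m)\<close> is that of \<open>U n (x n)\<close>, which is bounded, times a product of matrices \<open>R\<close> whose norm tends to \<open>0\<close>.\<close>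
    have M0: "(\<integral>x. U m (x m) $$ (i, j) \<partial>P) = 0" if m: "k \<le> m" and ij: "i < d" "j < d" for m i j
    proof -
      have step: "(\<integral>x. U m (x m) $$ (i, j) \<partial>P) = (\<Sum>c<d. (\<integral>x. U n (x n) $$ (i, c) \<partial>P) * Rp m n $$ (c, j))" if "m \<le> n" for n
        using that ij(2)
      proof (induction arbitrary: j rule: dec_induct)
        case base then show ?case by (simp add: if_distrib[of "\<lambda>x. _ * x"] cong: if_cong)
      next
        case (step n)
        have kn: "k \<le> n" "k \<le> Suc n" using m step by auto
        have e: "(\<integral>x. U n (x n) $$ (i, c) \<partial>P) = (\<Sum>e<d. (\<integral>x. U (Suc n) (x (Suc n)) $$ (i, e) \<partial>P) * R n $$ (e, c))" if c: "c < d" for c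
        proof -
          have "(\<integral>x. U n (x n) $$ (i, c) \<partial>P) = (\<integral>x. (\<Sum>e<d. U (Suc n) (x (Suc n)) $$ (i, e) * U n (Z_var G \<phi> n x) $$ (e, c)) * 1 \<partial>P)"
            by (rule Bochner_Integration.integral_cong[OF refl], subst U_entry_step)
              (use kn sP c ij in simp_all)
          also have "\<dots> = (\<Sum>e<d. (\<integral>x. U (Suc n) (x (Suc n)) $$ (i, e) \<partial>P) * (\<integral>z. U n z $$ (e, c) * 1 \<partial>\<mu> n))"
            using kn c ij by (intro product_integral[OF P, where g = "\<lambda>_. 1"] coefficient_future coefficient_bound) auto
          also have "\<dots> = (\<Sum>e<d. (\<integral>x. U (Suc n) (x (Suc n)) $$ (i, e) \<partial>P) * R n $$ (e, c))"
            using c by (intro sum.cong refl) (simp add: R_entry)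
          finally show ?thesis .
        qed
        have "(\<integral>x. U m (x m) $$ (i, j) \<partial>P) = (\<Sum>c<d. (\<Sum>e<d. (\<integral>x. U (Suc n) (x (Suc n)) $$ (i, e) \<partial>P) * R n $$ (e, c)) * Rp m n $$ (c, j))"
          unfolding step.IH[OF step.prems] by (rule sum.cong) (simp_all add: e)
        also have "\<dots> = (\<Sum>e<d. (\<integral>x. U (Suc n) (x (Suc n)) $$ (i, e) \<partial>P) * (\<Sum>c<d. R n $$ (e, c) * Rp m n $$ (c, j)))"
          unfolding sum_distrib_right sum_distrib_left by (subst sum.swap) (simp add: mult.assoc)
        also have "\<dots> = (\<Sum>e<d. (\<integral>x. U (Suc n) (x (Suc n)) $$ (i, e) \<partial>P) * Rp m (Suc n) $$ (e, j))"
          unfolding mat_prod_Suc[OF step.hyps(1)]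
          by (rule sum.cong) (use step.prems in \<open>simp_all add: mult_entry[OF R_carrier Rp_carrier]\<close>)
        finally show ?case .
      qed
      have c1: "cmod (\<integral>x. U n (x n) $$ (i, c) \<partial>P) \<le> 1" if "k \<le> n" "c < d" for n c
      proof -
        have i: "integrable P (\<lambda>x. U n (x n) $$ (i, c))"
          by (rule integrable_bounded_prob[OF P.prob_space_axioms, of _ 1])
            (use coefficient_measurable[OF that(1) ij(1) that(2)] coefficient_bound[OF _ that(1) ij(1) that(2)] sP in
              \<open>auto simp: measurable_cong_sets[OF sP(1) refl]\<close>)
        have "cmod (\<integral>x. U n (x n) $$ (i, c) \<partial>P) \<le> (\<integral>x. cmod (U n (x n) $$ (i, c)) \<partial>P)" by (rule integral_norm_bound)
        also have "\<dots> \<le> 1" by (rule P.integral_le_const[OF integrable_norm[OF i]], rule AE_I2)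
            (use coefficient_bound[OF _ that(1) ij(1) that(2)] sP in auto)
        finally show ?thesis .
      qed
      have bound: "cmod (\<integral>x. U m (x m) $$ (i, j) \<partial>P) \<le> real d * op_norm (R_prod G \<phi> \<mu> \<rho> k m n)" if n: "m \<le> n" for n
      proof -
        have "cmod (\<integral>x. U m (x m) $$ (i, j) \<partial>P) \<le> (\<Sum>c<d. cmod ((\<integral>x. U (Suc n) (x (Suc n)) $$ (i, c) \<partial>P) * Rp m (Suc n) $$ (c, j)))"
          using step[of "Suc n"] n norm_sum by simp
        also have "\<dots> \<le> (\<Sum>c<d. op_norm (Rp m (Suc n)))"
        proof (rule sum_mono)
          fix c assume "c \<in> {..<d}"
          then have c: "c < d" by simp
          show "cmod ((\<integral>x. U (Suc n) (x (Suc n)) $$ (i, c) \<partial>P) * Rp m (Suc n) $$ (c, j)) \<le> op_norm (Rp m (Suc n))"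
            unfolding norm_mult
            using mult_mono[OF c1[of "Suc n" c] entry_le_op_norm[OF Rp_carrier c ij(2), of m "Suc n"]] m n c by simp
        qed
        finally show ?thesis by (simp add: R_prod_eq)
      qed
      have "(\<lambda>n. real d * op_norm (R_prod G \<phi> \<mu> \<rho> k m n)) \<longlonglongrightarrow> real d * 0"
        using Lconv[OF m] L0[OF m] by (intro tendsto_mult tendsto_const) simp
      then have "cmod (\<integral>x. U m (x m) $$ (i, j) \<partial>P) \<le> real d * 0"
        by (rule LIMSEQ_le_const) (use bound in blast)
      then show ?thesis by simp
    qed
    have kk: "k \<le> k" by simp
    have AE0: "AE x in P. U k (x k) $$ (i, j) = 0" if ij: "i < d" "j < d" for i j
    proof -
      let ?f = "\<lambda>x. U k (x k) $$ (i, j)"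
      have int: "integrable P ?f"
        by (rule integrable_bounded_prob[OF P.prob_space_axioms, of _ 1])
          (use coefficient_measurable[OF kk ij] coefficient_bound[OF _ kk ij] sP in
              \<open>auto simp: measurable_cong_sets[OF sP(1) refl]\<close>)
      have FP: "sets (F_Z G T \<phi> k) \<subseteq> sets P" using FZ_subset sP by blast
      have FZ0: "(LINT x:A|P. ?f x) = 0" if A: "A \<in> sets (F_Z G T \<phi> k)" for A
      proof (rule set_integral_zero_dynkin[OF int, of "cylinders \<Omega> {k..} (Z_var G \<phi>) T"])
        show "Int_stable (cylinders \<Omega> {k..} (Z_var G \<phi>) T)" by (rule Int_stable_cylinders) (rule Z_in)
        show "cylinders \<Omega> {k..} (Z_var G \<phi>) T \<subseteq> sets P" using FP unfolding FZ_cylinders by auto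
        show "A \<in> sigma_sets (space P) (cylinders \<Omega> {k..} (Z_var G \<phi>) T)" using A unfolding FZ_cylinders sP(2) .
        show "integral\<^sup>L P ?f = 0" by (rule M0[OF kk ij])
        fix B assume "B \<in> cylinders \<Omega> {k..} (Z_var G \<phi>) T"
        then obtain J W where J: "B = {x \<in> \<Omega>. \<forall>l\<in>J. Z_var G \<phi> l x \<in> W l}" "finite J" "J \<subseteq> {k..}" "\<forall>l\<in>J. openin (T l) (W l)"
          unfolding cylinders_def by (elim CollectE exE conjE)
        \<comment> \<open>A cylinder constrains only \<open>Z l\<close> for \<open>l < n\<close>, so its indicator is a product of factors of the kind treated above.\<close>
        obtain n where n: "J \<subseteq> {..<n}" "k \<le> n"
        proof -
          obtain n0 where "J \<subseteq> {..<n0}" using finite_nat_bounded[OF J(2)] by auto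
          then have "J \<subseteq> {..<max n0 k}" by auto
          then show thesis using that[of "max n0 k"] by simp
        qed
        define g' :: "nat \<Rightarrow> 'a \<Rightarrow> complex" where "g' = (\<lambda>l z. if l \<in> J then indicator (W l) z else 1)"
        have "(\<integral>x. U k (x k) $$ (i, j) * (\<Prod>l\<in>{k..<n}. g' l (Z_var G \<phi> l x)) \<partial>P) = 0"
        proof (rule expectation_coefficient_zero[OF P M0[OF n(2)]])
          show "g' l \<in> borel_measurable (borel_of (T l))" for l
          proof (cases "l \<in> J")
            case True
            then have "W l \<in> sets (borel_of (T l))" using J(4) openin_imp_borel_of by blast
            then show ?thesis using True unfolding g'_def by simp
          next
            case False
            then show ?thesis unfolding g'_def by simp
          qed
          show "cmod (g' l z) \<le> 1" for l z by (simp add: g'_def indicator_def)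
        qed (use n ij in auto)
        moreover have "(LINT x:B|P. ?f x) = (\<integral>x. U k (x k) $$ (i, j) * (\<Prod>l\<in>{k..<n}. g' l (Z_var G \<phi> l x)) \<partial>P)"
          unfolding set_lebesgue_integral_def
        proof (rule Bochner_Integration.integral_cong[OF refl])
          fix x assume "x \<in> space P"
          then have x: "x \<in> \<Omega>" using sP by simp
          have "(\<Prod>l\<in>{k..<n}. g' l (Z_var G \<phi> l x)) = (\<Prod>l\<in>J. indicator (W l) (Z_var G \<phi> l x))"
            by (rule prod.mono_neutral_cong_right) (use n J in \<open>auto simp: g'_def\<close>)
          also have "\<dots> = indicator B x"
            using x J(2) unfolding J(1) by (auto simp: indicator_def prod_eq_1_iff)
          finally show "indicator B x *\<^sub>R U k (x k) $$ (i, j) = U k (x k) $$ (i, j) * (\<Prod>l\<in>{k..<n}. g' l (Z_var G \<phi> l x))"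
            by (simp add: indicator_def)
        qed
        ultimately show "(LINT x:B|P. ?f x) = 0" by simp
      qed
      show ?thesis
      proof (rule AE_zero_of_set_integrals[OF int, of "augment P (F_Z G T \<phi> k)"])
        show "?f \<in> borel_measurable (augment P (F_Z G T \<phi> k))" using strong[OF ij] by (simp add: U_self)
        show "sets (augment P (F_Z G T \<phi> k)) \<subseteq> sets P" by (rule sets_augment(2)[OF FP])
        fix A assume A: "A \<in> sets (augment P (F_Z G T \<phi> k))"
        show "(LINT x:A|P. ?f x) = 0"
        proof (rule set_integral_zero_dynkin[OF int, of "sets (F_Z G T \<phi> k) \<union> null_sets P"])
          \<comment> \<open>Adding the null sets keeps the generator closed under intersections, and integrals over null sets vanish.\<close>
          show "Int_stable (sets (F_Z G T \<phi> k) \<union> null_sets P)"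
          proof (rule Int_stableI)
            fix a b assume ab: "a \<in> sets (F_Z G T \<phi> k) \<union> null_sets P" "b \<in> sets (F_Z G T \<phi> k) \<union> null_sets P"
            then have "a \<in> sets P" "b \<in> sets P" using FP by auto
            then show "a \<inter> b \<in> sets (F_Z G T \<phi> k) \<union> null_sets P"
              using ab null_set_Int1[of a P b] null_set_Int1[of b P a] by (auto simp: Int_commute)
          qed
          show "sets (F_Z G T \<phi> k) \<union> null_sets P \<subseteq> sets P" using FP by auto
          show "integral\<^sup>L P ?f = 0" by (rule M0[OF kk ij])
          show "A \<in> sigma_sets (space P) (sets (F_Z G T \<phi> k) \<union> null_sets P)" using A sets_augment(1)[OF FP] by simp
          fix B assume "B \<in> sets (F_Z G T \<phi> k) \<union> null_sets P"
          then show "(LINT x:B|P. ?f x) = 0"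
          proof
            assume N: "B \<in> null_sets P"
            have "AE x in P. indicator B x *\<^sub>R ?f x = 0" using AE_not_in[OF N] by eventually_elim simp
            then show ?thesis unfolding set_lebesgue_integral_def by (rule integral_eq_zero_AE)
          qed (rule FZ0)
        qed
      qed simp
    qed
    have "AE x in P. \<forall>j\<in>{..<d}. U k (x k) $$ (0, j) = 0"
      by (rule AE_finite_allI) (use AE0 d in auto)
    then have "AE x in P. False"
      using AE_space
    proof eventually_elim
      case (elim x)
      then have x: "x \<in> \<Omega>" using sP by simp
      show False using unitary_row_norm[OF U_unitary[OF kk coord_in[OF x]] d] elim by simp
    qed
    then show False by simp
  qed
  then obtain m where m: "k \<le> m" "L m > 0" by blast
  have "L m \<le> (SUP m. L (m + k))"
  proof -
    have "bdd_above (range (\<lambda>m. L (m + k)))" by (rule bdd_aboveI[of _ 1]) (use L01 in auto)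
    from cSUP_upper[OF UNIV_I[of "m - k"] this] show ?thesis using m(1) by simp
  qed
  then show ?thesis using limI[OF limL] m unfolding L_def by simp
qed

section \<open>Determinants bounded from below force strong measurability\<close>

lemma bounded_pointwise_convergent_subseq:
  fixes f :: "nat \<Rightarrow> 'i :: countable \<Rightarrow> 'b :: heine_borel"
  assumes "\<And>i. bounded (range (\<lambda>n. f n i))"
  obtains r l where "strict_mono (r :: nat \<Rightarrow> nat)" "\<And>i. (\<lambda>n. f (r n) i) \<longlonglongrightarrow> l i"
proof -
  let ?P = "\<lambda>(n :: nat) (s :: nat \<Rightarrow> nat). \<forall>i :: 'i. to_nat i = n \<longrightarrow> convergent (\<lambda>j. f (s j) i)"
  interpret subseqs ?P
  proof
    fix n and s :: "nat \<Rightarrow> nat" assume s: "strict_mono s"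
    show "\<exists>r'. strict_mono r' \<and> ?P n (s \<circ> r')"
    proof (cases "\<exists>i :: 'i. to_nat i = n")
      case True
      then obtain i :: 'i where i: "to_nat i = n" by blast
      have "bounded (range (\<lambda>j. f (s j) i))" by (rule bounded_subset[OF assms[of i]]) auto
      from bounded_imp_convergent_subsequence[OF this]
      obtain l and r :: "nat \<Rightarrow> nat" where r: "strict_mono r" "((\<lambda>j. f (s j) i) \<circ> r) \<longlonglongrightarrow> l" by auto
      have "?P n (s \<circ> r)" using r(2) i by (auto simp: convergent_def comp_def)
      then show ?thesis using r(1) by blast
    next
      case False
      then show ?thesis by (intro exI[of _ id]) (auto simp: strict_mono_id)
    qed
  qed
  have st: "?P n (s \<circ> r)" if r: "strict_mono r" and s: "?P n s" for r s :: "nat \<Rightarrow> nat" and n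
  proof (intro allI impI)
    fix i :: 'i assume "to_nat i = n"
    then have "convergent (\<lambda>j. f (s j) i)" using s by simp
    from convergent_subseq_convergent[OF this r] show "convergent (\<lambda>j. f ((s \<circ> r) j) i)" by (simp add: comp_def)
  qed
  have "convergent (\<lambda>j. f (diagseq j) i)" for i
  proof -
    have "?P (to_nat i) (diagseq \<circ> ((+) (Suc (to_nat i))))" by (rule diagseq_holds) (rule st)
    then have "convergent (\<lambda>j. f (diagseq (Suc (to_nat i) + j)) i)" by (simp add: comp_def)
    then show ?thesis using convergent_ignore_initial_segment[of "\<lambda>j. f (diagseq j) i" "Suc (to_nat i)"] by (simp add: add.commute)
  qed
  then have "(\<lambda>n. f (diagseq n) i) \<longlonglongrightarrow> lim (\<lambda>n. f (diagseq n) i)" for i by (simp add: convergent_LIMSEQ_iff)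
  then show ?thesis by (rule that[OF subseq_diagseq])
qed

text \<open>
  The sum of the increments has finite mean, hence is finite almost everywhere.
\<close>

lemma AE_convergent_of_fast_L1:
  fixes X :: "nat \<Rightarrow> 'w \<Rightarrow> complex"
  assumes X: "\<And>i. integrable P (X i)" and fast: "\<And>i. (\<integral>x. cmod (X (Suc i) x - X i x) \<partial>P) \<le> (1/2)^i"
  shows "AE x in P. convergent (\<lambda>i. X i x)"
proof -
  have [measurable]: "X i \<in> borel_measurable P" for i using X by auto
  have e: "(\<integral>\<^sup>+x. ennreal (cmod (X (Suc i) x - X i x)) \<partial>P) \<le> ennreal ((1/2)^i)" for i
    by (subst nn_integral_eq_integral) (use X fast in \<open>auto intro!: ennreal_leI\<close>)
  have "(\<integral>\<^sup>+x. (\<Sum>i. ennreal (cmod (X (Suc i) x - X i x))) \<partial>P) = (\<Sum>i. \<integral>\<^sup>+x. ennreal (cmod (X (Suc i) x - X i x)) \<partial>P)"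
    by (rule nn_integral_suminf) measurable
  also have "\<dots> \<le> (\<Sum>i. ennreal ((1/2)^i))" by (intro suminf_le e) auto
  also have "\<dots> = ennreal (\<Sum>i. (1/2)^i)" by (rule suminf_ennreal2) (auto intro!: summable_geometric)
  also have "\<dots> < \<infinity>" by simp
  finally have fin: "(\<integral>\<^sup>+x. (\<Sum>i. ennreal (cmod (X (Suc i) x - X i x))) \<partial>P) \<noteq> \<infinity>" by simp
  have "AE x in P. (\<Sum>i. ennreal (cmod (X (Suc i) x - X i x))) \<noteq> \<infinity>"
    by (rule nn_integral_PInf_AE[OF _ fin]) measurable
  then show ?thesis
  proof eventually_elim
    case (elim x)
    then have "summable (\<lambda>i. cmod (X (Suc i) x - X i x))"
      by (intro summable_suminf_not_top) auto
    then have "summable (\<lambda>i. X (Suc i) x - X i x)" by (rule summable_norm_cancel)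
    then have "convergent (\<lambda>n. \<Sum>i<n. X (Suc i) x - X i x)" by (simp add: summable_iff_convergent)
    then have "convergent (\<lambda>n. X n x - X 0 x)" using sum_lessThan_telescope[of "\<lambda>i. X i x"] by simp
    then show ?case using convergent_add[OF _ convergent_const[of "X 0 x"], of "\<lambda>n. X n x - X 0 x"] by simp
  qed
qed

text \<open>
  For a tail function \<open>h\<close> of mean zero the event \<open>h > 0\<close> has probability \<open>0\<close> or \<open>1\<close>, and probability \<open>1\<close> would force a
  positive mean. Apply this to \<open>g\<close> minus its mean and to the negative of this difference.
\<close>

lemma (in group_chain) extreme_tail_const_real:
  fixes g :: "(nat \<Rightarrow> 'a) \<Rightarrow> real"
  assumes P: "P \<in> extreme_measures (solutions G T \<phi> \<mu>)" and g: "\<And>q. g \<in> borel_measurable (future_X T q)"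
    and b: "AE x in P. \<bar>g x\<bar> \<le> b"
  shows "\<exists>c. AE x in P. g x = c"
proof -
  have "P \<in> solutions G T \<phi> \<mu>" using P by (simp add: extreme_measures_def)
  then have Pb: "P \<in> borel_prob (prod_top T)" by (simp add: solutions_iff)
  interpret P: prob_space P by (rule borel_probD[OF Pb])
  note sP = borel_probD(2,3)[OF Pb]
  have gP: "g \<in> borel_measurable P" using measurable_future_all[OF g[of 0]] measurable_cong_sets[OF sP(1) refl] by blast
  have i: "integrable P g" by (rule P.integrable_const_bound[OF _ gP, of b]) (use b in simp)
  let ?c = "\<integral>x. g x \<partial>P"
  have one: "measure P {x\<in>\<Omega>. h x > 0} = 0" if h: "\<And>q. h \<in> borel_measurable (future_X T q)" "integrable P h" "(\<integral>x. h x \<partial>P) = 0" for h :: "_ \<Rightarrow> real"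
  proof (rule ccontr)
    assume ne: "measure P {x\<in>\<Omega>. h x > 0} \<noteq> 0"
    have A: "{x\<in>\<Omega>. h x > 0} \<in> sets (future_X T q)" for q
      using h(1)[of q] borel_measurable_iff_greater[of h "future_X T q"] by simp
    then have "measure P {x\<in>\<Omega>. h x > 0} = 1" using extreme_tail_trivial[OF P A] ne by blast
    moreover have "{x\<in>\<Omega>. h x > 0} \<in> P.events" using A[of 0] future_subset[of 0] sP by blast
    ultimately have AE: "AE x in P. x \<in> {x\<in>\<Omega>. h x > 0}" using P.prob_eq_1 by blast
    then have "AE x in P. 0 \<le> h x" by eventually_elim simp
    then have "AE x in P. h x = 0" using h(2,3) integral_nonneg_eq_0_iff_AE by blast
    then have "AE x in P. False" using AE by eventually_elim simp
    then show False by simp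
  qed
  have null: "AE x in P. h x \<le> 0" if h: "\<And>q. h \<in> borel_measurable (future_X T q)" "integrable P h" "(\<integral>x. h x \<partial>P) = 0" for h :: "_ \<Rightarrow> real"
  proof -
    have "{x\<in>\<Omega>. h x > 0} \<in> sets P"
      using h(1)[of 0] borel_measurable_iff_greater[of h "future_X T 0"] future_subset[of 0] sP by auto
    then have "AE x in P. x \<notin> {x\<in>\<Omega>. h x > 0}" using one[OF h] by (intro AE_not_in) (simp add: null_sets_def P.emeasure_eq_measure)
    then show ?thesis using AE_space by eventually_elim (use sP in auto)
  qed
  have "AE x in P. g x - ?c \<le> 0"
    by (rule null) (use g i in \<open>auto intro!: borel_measurable_diff simp: P.prob_space\<close>)
  moreover have "AE x in P. ?c - g x \<le> 0"
    by (rule null) (use g i in \<open>auto intro!: borel_measurable_diff simp: P.prob_space\<close>)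
  ultimately have "AE x in P. g x = ?c" by eventually_elim simp
  then show ?thesis by blast
qed

lemma (in group_chain) extreme_tail_const:
  fixes h :: "(nat \<Rightarrow> 'a) \<Rightarrow> complex"
  assumes P: "P \<in> extreme_measures (solutions G T \<phi> \<mu>)" and h: "\<And>q. h \<in> borel_measurable (future_X T q)"
    and b: "AE x in P. cmod (h x) \<le> b"
  shows "\<exists>c. AE x in P. h x = c"
proof -
  have "AE x in P. \<bar>Re (h x)\<bar> \<le> b" using b by eventually_elim (meson abs_Re_le_cmod order_trans)
  then obtain c1 where c1: "AE x in P. Re (h x) = c1"
    using extreme_tail_const_real[OF P, of "\<lambda>x. Re (h x)" b] measurable_compose[OF h borel_measurable_Re] by auto
  have "AE x in P. \<bar>Im (h x)\<bar> \<le> b" using b by eventually_elim (meson abs_Im_le_cmod order_trans)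
  then obtain c2 where c2: "AE x in P. Im (h x) = c2"
    using extreme_tail_const_real[OF P, of "\<lambda>x. Im (h x)" b] measurable_compose[OF h borel_measurable_Im] by auto
  have "AE x in P. h x = Complex c1 c2" using c1 c2 by eventually_elim (simp add: complex_eq_iff)
  then show ?thesis by blast
qed

lemma entries_convergent_subseq:
  assumes "\<And>n i j. i < d \<Longrightarrow> j < d \<Longrightarrow> cmod (Q n $$ (i, j)) \<le> 1"
  obtains r Q' where "strict_mono (r :: nat \<Rightarrow> nat)" "Q' \<in> carrier_mat d d"
    "\<And>i j. i < d \<Longrightarrow> j < d \<Longrightarrow> (\<lambda>n. Q (r n) $$ (i, j)) \<longlonglongrightarrow> Q' $$ (i, j)"
proof -
  let ?f = "\<lambda>n (p :: nat \<times> nat). if fst p < d \<and> snd p < d then Q n $$ p else 0"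
  have "cmod (?f n p) \<le> 1" for n p using assms[of "fst p" "snd p" n] by simp
  then have b: "bounded (range (\<lambda>n. ?f n p))" for p by (intro boundedI[of _ 1]) blast
  obtain r l where r: "strict_mono (r :: nat \<Rightarrow> nat)" "\<And>p. (\<lambda>n. ?f (r n) p) \<longlonglongrightarrow> l p"
    by (rule bounded_pointwise_convergent_subseq[of ?f, OF b], rule that)
  show ?thesis
  proof (rule that[OF r(1), of "mat d d l"])
    show "(\<lambda>n. Q (r n) $$ (i, j)) \<longlonglongrightarrow> mat d d l $$ (i, j)" if "i < d" "j < d" for i j
      using r(2)[of "(i, j)"] that by simp
  qed simp
qed

lemma det_tendsto:
  fixes Q :: "nat \<Rightarrow> complex mat"
  assumes "\<And>n. Q n \<in> carrier_mat d d" "Q' \<in> carrier_mat d d"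
    "\<And>i j. i < d \<Longrightarrow> j < d \<Longrightarrow> (\<lambda>n. Q n $$ (i, j)) \<longlonglongrightarrow> Q' $$ (i, j)"
  shows "(\<lambda>n. Determinant.det (Q n)) \<longlonglongrightarrow> Determinant.det Q'"
  unfolding det_def'[OF assms(1)] det_def'[OF assms(2)]
  by (intro tendsto_sum tendsto_mult tendsto_const tendsto_prod assms(3)) (auto simp: permutes_in_image)

text \<open>
  From \<open>Q n = S m n * Q m\<close>, with \<open>Q n\<close> and \<open>Q m\<close> both close to the invertible matrix \<open>Q'\<close>, it follows that \<open>(S m n - 1) * Q'\<close> is small;
  multiplication by the adjugate of \<open>Q'\<close> replaces \<open>Q'\<close> by its determinant. The matrices \<open>S m n\<close> need a bound that does not depend on \<open>m\<close> and \<open>n\<close>,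
  since \<open>Q m\<close> is replaced by \<open>Q'\<close> on the way.
\<close>

lemma increments_tend_to_one:
  fixes Q :: "nat \<Rightarrow> complex mat" and S :: "nat \<Rightarrow> nat \<Rightarrow> complex mat"
  assumes Q: "\<And>n. Q n \<in> carrier_mat d d" and Q': "Q' \<in> carrier_mat d d" and det: "Determinant.det Q' \<noteq> 0"
    and lim: "\<And>i j. i < d \<Longrightarrow> j < d \<Longrightarrow> (\<lambda>n. Q n $$ (i, j)) \<longlonglongrightarrow> Q' $$ (i, j)"
    and S: "\<And>m n. m < n \<Longrightarrow> S m n \<in> carrier_mat d d" "\<And>m n. m < n \<Longrightarrow> Q n = S m n * Q m"
    and Sb: "\<And>m n i j. m < n \<Longrightarrow> i < d \<Longrightarrow> j < d \<Longrightarrow> cmod (S m n $$ (i, j)) \<le> 1"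
    and e: "e > 0"
  obtains N where "\<And>m n i j. N \<le> m \<Longrightarrow> m < n \<Longrightarrow> i < d \<Longrightarrow> j < d \<Longrightarrow> cmod (S m n $$ (i, j) - (if i = j then 1 else 0)) \<le> e"
proof -
  define D where "D = Determinant.det Q'"
  define J where "J = adj_mat Q'"
  have J: "J \<in> carrier_mat d d" "Q' * J = D \<cdot>\<^sub>m 1\<^sub>m d"
    using adj_mat[OF Q'] by (simp_all add: J_def D_def)
  define a where "a = (\<Sum>i<d. \<Sum>j<d. cmod (J $$ (i, j)))"
  have a: "cmod (J $$ (i, j)) \<le> a" if "i < d" "j < d" for i j
  proof -
    have "cmod (J $$ (i, j)) \<le> (\<Sum>j<d. cmod (J $$ (i, j)))" by (rule member_le_sum) (use that in auto)
    also have "\<dots> \<le> a" unfolding a_def by (rule member_le_sum[of i "{..<d}" "\<lambda>i. \<Sum>j<d. cmod (J $$ (i, j))"]) (use that in \<open>auto intro: sum_nonneg\<close>)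
    finally show ?thesis .
  qed
  have a0: "a \<ge> 0" unfolding a_def by (intro sum_nonneg) auto
  define K where "K = real d * (2 * real d + 2) * (a + 1)"
  have D: "cmod D > 0" using det by (simp add: D_def)
  define \<delta> where "\<delta> = e * cmod D / (K + 1)"
  have K0: "K \<ge> 0" using a0 by (simp add: K_def)
  have \<delta>: "\<delta> > 0" using e D K0 by (simp add: \<delta>_def)
  have "\<forall>p\<in>{..<d}\<times>{..<d}. eventually (\<lambda>n. dist (Q n $$ p) (Q' $$ p) < \<delta>) sequentially"
    using lim \<delta> by (auto simp: tendsto_iff)
  then have "eventually (\<lambda>n. \<forall>p\<in>{..<d}\<times>{..<d}. dist (Q n $$ p) (Q' $$ p) < \<delta>) sequentially"
    by (intro eventually_ball_finite) auto
  then obtain N where N: "\<And>n i j. N \<le> n \<Longrightarrow> i < d \<Longrightarrow> j < d \<Longrightarrow> cmod (Q n $$ (i, j) - Q' $$ (i, j)) < \<delta>"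
    unfolding eventually_sequentially dist_norm by fastforce
  show ?thesis
  proof (rule that[of N])
    fix m n i j assume m: "N \<le> m" "m < n" and ij: "i < d" "j < d"
    have n: "N \<le> n" using m by simp
    define w where "w c = S m n $$ (i, c) - (if i = c then 1 else 0)" for c
    have w2: "cmod (w c) \<le> 2" if "c < d" for c
    proof -
      have "cmod (w c) \<le> cmod (S m n $$ (i, c)) + cmod (if i = c then 1 else 0)" unfolding w_def by (rule norm_triangle_ineq4)
      also have "\<dots> \<le> 1 + 1" using Sb[OF m(2) ij(1) that] by (intro add_mono) auto
      finally show ?thesis by simp
    qed
    have wQ: "cmod (\<Sum>c<d. w c * Q' $$ (c, b)) \<le> (2 * real d + 2) * \<delta>" if b: "b < d" for b
    proof -
      have "(\<Sum>c<d. S m n $$ (i, c) * Q m $$ (c, b)) = Q n $$ (i, b)"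
        using S(2)[OF m(2)] mult_entry[OF S(1)[OF m(2)] Q ij(1) b] by simp
      then have 1: "(\<Sum>c<d. w c * Q m $$ (c, b)) = Q n $$ (i, b) - Q m $$ (i, b)"
        using ij by (simp add: w_def left_diff_distrib sum_subtractf if_distrib[of "\<lambda>x. x * _"] cong: if_cong)
      have "(\<Sum>c<d. w c * Q' $$ (c, b)) = (\<Sum>c<d. w c * (Q' $$ (c, b) - Q m $$ (c, b))) + (Q n $$ (i, b) - Q m $$ (i, b))"
        unfolding 1[symmetric] by (simp add: sum.distrib[symmetric] algebra_simps)
      also have "\<dots> = (\<Sum>c<d. w c * (Q' $$ (c, b) - Q m $$ (c, b))) + ((Q n $$ (i, b) - Q' $$ (i, b)) - (Q m $$ (i, b) - Q' $$ (i, b)))" by simp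
      also have "cmod \<dots> \<le> cmod (\<Sum>c<d. w c * (Q' $$ (c, b) - Q m $$ (c, b))) + (cmod (Q n $$ (i, b) - Q' $$ (i, b)) + cmod (Q m $$ (i, b) - Q' $$ (i, b)))"
        by (rule order_trans[OF norm_triangle_ineq add_left_mono[OF norm_triangle_ineq4]])
      also have "\<dots> \<le> (\<Sum>c<d. 2 * \<delta>) + (\<delta> + \<delta>)"
      proof (intro add_mono order_trans[OF norm_sum sum_mono])
        fix c assume "c \<in> {..<d}"
        then have c: "c < d" by simp
        show "cmod (w c * (Q' $$ (c, b) - Q m $$ (c, b))) \<le> 2 * \<delta>"
          unfolding norm_mult using w2[OF c] N[OF m(1) c b] by (intro mult_mono) (auto simp: norm_minus_commute)
      qed (use N[OF n ij(1) b] N[OF m(1) ij(1) b] in auto)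
      also have "\<dots> = (2 * real d + 2) * \<delta>" by (simp add: algebra_simps)
      finally show ?thesis .
    qed
    have QJ: "(\<Sum>b<d. Q' $$ (c, b) * J $$ (b, j)) = (if c = j then D else 0)" if "c < d" for c
      using mult_entry[OF Q' J(1) that ij(2), symmetric] J(2) that ij by simp
    have "(\<Sum>b<d. (\<Sum>c<d. w c * Q' $$ (c, b)) * J $$ (b, j)) = (\<Sum>c<d. w c * (\<Sum>b<d. Q' $$ (c, b) * J $$ (b, j)))"
      unfolding sum_distrib_right sum_distrib_left by (subst sum.swap) (simp add: mult.assoc)
    also have "\<dots> = (\<Sum>c<d. w c * (if c = j then D else 0))" by (rule sum.cong) (use QJ in auto)
    also have "\<dots> = w j * D" using ij by (simp add: if_distrib[of "\<lambda>x. _ * x"] cong: if_cong)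
    finally have "cmod (w j) * cmod D = cmod (\<Sum>b<d. (\<Sum>c<d. w c * Q' $$ (c, b)) * J $$ (b, j))" by (simp add: norm_mult)
    also have "\<dots> \<le> (\<Sum>b<d. ((2 * real d + 2) * \<delta>) * a)"
    proof (intro order_trans[OF norm_sum sum_mono])
      fix b assume "b \<in> {..<d}"
      then show "cmod ((\<Sum>c<d. w c * Q' $$ (c, b)) * J $$ (b, j)) \<le> ((2 * real d + 2) * \<delta>) * a"
        unfolding norm_mult using wQ a ij \<delta> by (intro mult_mono) auto
    qed
    also have "\<dots> = (real d * (2 * real d + 2) * a) * \<delta>" by (simp add: algebra_simps)
    also have "\<dots> \<le> (K + 1) * \<delta>"
    proof (rule mult_right_mono)
      have "real d * (2 * real d + 2) * a \<le> real d * (2 * real d + 2) * (a + 1)" by (rule mult_left_mono) auto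
      then show "real d * (2 * real d + 2) * a \<le> K + 1" by (simp add: K_def)
    qed (use \<delta> in simp)
    also have "\<dots> = e * cmod D" using K0 by (simp add: \<delta>_def)
    finally have "cmod (w j) \<le> e" using D by simp
    then show "cmod (S m n $$ (i, j) - (if i = j then 1 else 0)) \<le> e" by (simp add: w_def)
  qed
qed

lemma fast_subsequence:
  assumes "\<And>e :: real. e > 0 \<Longrightarrow> \<exists>N. \<forall>m n. N \<le> m \<longrightarrow> m < n \<longrightarrow> D m n \<le> e"
  obtains s where "strict_mono (s :: nat \<Rightarrow> nat)" "\<And>i. D (s i) (s (Suc i)) \<le> (1/2)^i"
proof -
  have "\<forall>i. \<exists>N. \<forall>m n. N \<le> m \<longrightarrow> m < n \<longrightarrow> D m n \<le> (1/2)^i" using assms by simp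
  from choice[OF this] obtain N :: "nat \<Rightarrow> nat" where N: "\<forall>i m n. N i \<le> m \<longrightarrow> m < n \<longrightarrow> D m n \<le> (1/2)^i" ..
  define s where "s i = i + (\<Sum>l\<le>i. N l)" for i
  have sm: "strict_mono s" by (rule strict_mono_Suc_iff[THEN iffD2]) (simp add: s_def)
  have "N i \<le> s i" for i using member_le_sum[of i "{..i}" N] by (simp add: s_def)
  then have "D (s i) (s (Suc i)) \<le> (1/2)^i" for i using N sm by (simp add: strict_mono_Suc_iff)
  then show ?thesis using that sm by blast
qed

text \<open>
  The squared Hilbert-Schmidt distance of a unitary matrix to the identity is \<open>2 * d\<close> minus twice the real part of its
  trace, an affine function of the entries, so that its mean is controlled by the matrix of means.
\<close>

lemma (in rep_chain) mean_square_distance_to_one: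
  assumes P: "P \<in> solutions G T \<phi> \<mu>" and mn: "k \<le> m" "m \<le> n"
    and e: "\<And>i j. i < d \<Longrightarrow> j < d \<Longrightarrow> cmod (Rp m n $$ (i, j) - (if i = j then 1 else 0)) \<le> e"
  shows "(\<integral>x. (\<Sum>i<d. \<Sum>j<d. (cmod (V m n x $$ (i, j) - (if i = j then 1 else 0)))\<^sup>2) \<partial>P) \<le> 2 * real d * e"
proof -
  have Pb: "P \<in> borel_prob (prod_top T)" using P solutions_iff by blast
  note sP = borel_probD(2,3)[OF Pb]
  interpret P: prob_space P by (rule borel_probD[OF Pb])
  have Vm: "(\<lambda>x. V m n x $$ (i, j)) \<in> borel_measurable P" if "i < d" "j < d" for i j
    using V_measurable[of m n \<B> i j] Z_measurable that mn unfolding measurable_cong_sets[OF sP(1) refl] by simp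
  have Vb: "cmod (V m n x $$ (i, j)) \<le> 1" if "x \<in> \<Omega>" "i < d" "j < d" for x i j
    using unitary_entry_bound[OF V_unitary] that mn by blast
  have Vi: "integrable P (\<lambda>x. V m n x $$ (i, j))" if "i < d" "j < d" for i j
    by (rule integrable_bounded_prob[OF P.prob_space_axioms Vm[OF that], of 1]) (use Vb that sP in auto)
  have pw: "(\<Sum>i<d. \<Sum>j<d. (cmod (V m n x $$ (i, j) - (if i = j then 1 else 0)))\<^sup>2) = 2 * real d - 2 * Re (\<Sum>i<d. V m n x $$ (i, i))"
    if x: "x \<in> \<Omega>" for x
  proof -
    have "(\<Sum>j<d. (cmod (V m n x $$ (i, j) - (if i = j then 1 else 0)))\<^sup>2) = 2 - 2 * Re (V m n x $$ (i, i))" if i: "i < d" for i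
    proof -
      have "(cmod (v - (if b then 1 else 0)))\<^sup>2 = (cmod v)\<^sup>2 + (if b then 1 - 2 * Re v else 0)" for v b
        by (simp add: cmod_power2) (simp add: power2_eq_square algebra_simps)
      then have "(\<Sum>j<d. (cmod (V m n x $$ (i, j) - (if i = j then 1 else 0)))\<^sup>2) =
         (\<Sum>j<d. (cmod (V m n x $$ (i, j)))\<^sup>2) + (\<Sum>j<d. if i = j then 1 - 2 * Re (V m n x $$ (i, j)) else 0)"
        by (simp add: sum.distrib)
      then show ?thesis using unitary_row_norm[OF V_unitary[OF x mn(1)] i] i by simp
    qed
    then have "(\<Sum>i<d. \<Sum>j<d. (cmod (V m n x $$ (i, j) - (if i = j then 1 else 0)))\<^sup>2) = (\<Sum>i<d. 2 - 2 * Re (V m n x $$ (i, i)))"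
      by (intro sum.cong) auto
    then show ?thesis by (simp add: sum_subtractf sum_distrib_left[symmetric] mult.commute)
  qed
  have "(\<integral>x. (\<Sum>i<d. \<Sum>j<d. (cmod (V m n x $$ (i, j) - (if i = j then 1 else 0)))\<^sup>2) \<partial>P) =
     (\<integral>x. 2 * real d - 2 * Re (\<Sum>i<d. V m n x $$ (i, i)) \<partial>P)"
    by (rule Bochner_Integration.integral_cong[OF refl]) (use pw sP in simp)
  also have "\<dots> = 2 * real d - 2 * Re (\<integral>x. (\<Sum>i<d. V m n x $$ (i, i)) \<partial>P)"
  proof -
    define S where "S x = (\<Sum>i<d. V m n x $$ (i, i))" for x
    have S: "integrable P S" unfolding S_def by (intro Bochner_Integration.integrable_sum Vi) auto
    then have "(\<integral>x. 2 * real d - 2 * Re (S x) \<partial>P) = 2 * real d - 2 * Re (\<integral>x. S x \<partial>P)"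
      using integrable_Re[OF S] integral_Re[OF S] by (simp add: P.prob_space)
    then show ?thesis by (simp only: S_def)
  qed
  also have "(\<integral>x. (\<Sum>i<d. V m n x $$ (i, i)) \<partial>P) = (\<Sum>i<d. Rp m n $$ (i, i))"
    using Vi expectation_V[OF P mn] by (subst Bochner_Integration.integral_sum) auto
  also have "2 * real d - 2 * Re (\<Sum>i<d. Rp m n $$ (i, i)) = 2 * (\<Sum>i<d. Re (1 - Rp m n $$ (i, i)))"
    by (simp add: sum_subtractf)
  also have "\<dots> \<le> 2 * (\<Sum>i<d. e)"
  proof (intro mult_left_mono sum_mono)
    fix i assume "i \<in> {..<d}"
    then have "cmod (1 - Rp m n $$ (i, i)) \<le> e" using e[of i i] by (simp add: norm_minus_commute)
    then show "Re (1 - Rp m n $$ (i, i)) \<le> e" using complex_Re_le_cmod order_trans by blast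
  qed simp
  finally show ?thesis by simp
qed

text \<open>
  Some limit in \<open>n\<close> is positive, for an index \<open>m \<ge> k\<close>. The matrices \<open>V m n\<close> then converge along a subsequence to a matrix \<open>Y\<close>
  that is a function of \<open>Z k, Z (k + 1), \<dots>\<close>, and \<open>U n (x n)\<close> converges to a tail measurable matrix, which is constant
  because \<open>P\<close> is extreme. Passing to the limit in \<open>U m (x m) = U n (x n) * V m n x\<close> expresses \<open>U m (x m)\<close> through \<open>Y\<close>.
\<close>

lemma (in rep_chain) det_pos_imp_strong:
  assumes ext: "P \<in> extreme_measures (solutions G T \<phi> \<mu>)"
    and det: "lim (\<lambda>m. lim (\<lambda>n. cmod (Determinant.det (R_prod G \<phi> \<mu> \<rho> k m n)))) > 0"
    and ab: "a0 < d" "b0 < d"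
  shows "(\<lambda>x. \<rho> (emb G k (x k)) $$ (a0, b0)) \<in> borel_measurable (augment P (F_Z G T \<phi> k))"
proof -
  have P: "P \<in> solutions G T \<phi> \<mu>" using ext by (simp add: extreme_measures_def)
  then have Pb: "P \<in> borel_prob (prod_top T)" using solutions_iff by blast
  note sP = borel_probD(2,3)[OF Pb]
  interpret P: prob_space P by (rule borel_probD[OF Pb])
  define L where "L m = lim (\<lambda>n. cmod (Determinant.det (R_prod G \<phi> \<mu> \<rho> k m n)))" for m
  have dec: "decseq (\<lambda>n. cmod (Determinant.det (R_prod G \<phi> \<mu> \<rho> k m n)))" if m: "k \<le> m" for m
  proof (rule decseq_SucI)
    fix n
    show "cmod (Determinant.det (R_prod G \<phi> \<mu> \<rho> k m (Suc n))) \<le> cmod (Determinant.det (R_prod G \<phi> \<mu> \<rho> k m n))"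
    proof (cases "m \<le> Suc n")
      case True
      then have "k \<le> Suc n" using m by simp
      then show ?thesis unfolding R_prod_eq mat_prod_Suc[OF True] Determinant.det_mult[OF R_carrier Rp_carrier] norm_mult
        by (intro mult_left_le_one_le contraction_det[OF R_contraction]) auto
    next
      case False then show ?thesis by (simp add: R_prod_eq mat_prod_def)
    qed
  qed
  have Lconv: "(\<lambda>n. cmod (Determinant.det (R_prod G \<phi> \<mu> \<rho> k m n))) \<longlonglongrightarrow> L m" if "k \<le> m" for m
    unfolding L_def convergent_LIMSEQ_iff[symmetric]
    by (rule decseq_convergent[OF dec[OF that], of 0]) (auto simp: convergent_def)
  have L0: "0 \<le> L m" if "k \<le> m" for m using LIMSEQ_le_const[OF Lconv[OF that], of 0] by auto
  have "\<exists>m\<ge>k. L m > 0"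
  proof (rule ccontr)
    assume "\<not> ?thesis"
    then have "L m = 0" if "k \<le> m" for m using L0[OF that] that by force
    then have "eventually (\<lambda>m. L m = 0) sequentially" by (auto simp: eventually_sequentially)
    then have "L \<longlonglongrightarrow> 0" by (rule tendsto_eventually)
    then show False using limI det unfolding L_def by force
  qed
  then obtain m where m: "k \<le> m" "L m > 0" by blast
  define Q where "Q n = Rp m (Suc n)" for n
  have Qdet: "cmod (Determinant.det (Q n)) \<ge> L m" for n
    using decseq_ge[OF dec[OF m(1)] Lconv[OF m(1)], of n] by (simp add: Q_def R_prod_eq)
  have Qb: "cmod (Q n $$ (i, j)) \<le> 1" if "i < d" "j < d" for n i j
    unfolding Q_def by (rule contraction_entry[OF Rp_contraction[OF m(1)] that])
  obtain r Q' where r: "strict_mono (r :: nat \<Rightarrow> nat)" and Q': "Q' \<in> carrier_mat d d"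
    "\<And>i j. i < d \<Longrightarrow> j < d \<Longrightarrow> (\<lambda>n. Q (r n) $$ (i, j)) \<longlonglongrightarrow> Q' $$ (i, j)"
    by (rule entries_convergent_subseq[of d Q, OF Qb], assumption, assumption) (rule that)
  \<comment> \<open>The shift by \<open>m\<close> makes every index exceed \<open>m\<close>, and the successor converts to the exclusive upper bound of \<open>mat_prod\<close>.\<close>
  define q where "q n = Suc (r (n + m))" for n
  have qm: "m \<le> q n" for n using seq_suble[OF r, of "n + m"] by (simp add: q_def)
  have qmono: "strict_mono q" unfolding q_def strict_mono_def using r by (auto simp: strict_mono_def)
  have qn: "n < q n" for n using seq_suble[OF r, of "n + m"] by (simp add: q_def)
  have Q'2: "(\<lambda>n. Rp m (q n) $$ (i, j)) \<longlonglongrightarrow> Q' $$ (i, j)" if "i < d" "j < d" for i j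
    using LIMSEQ_ignore_initial_segment[OF Q'(2)[OF that], of m] by (simp add: Q_def q_def)
  have "(\<lambda>n. Determinant.det (Rp m (q n))) \<longlonglongrightarrow> Determinant.det Q'"
    by (rule det_tendsto[OF Rp_carrier Q'(1) Q'2])
  then have "(\<lambda>n. cmod (Determinant.det (Rp m (q n)))) \<longlonglongrightarrow> cmod (Determinant.det Q')" by (rule tendsto_norm)
  then have "L m \<le> cmod (Determinant.det Q')"
    by (rule LIMSEQ_le_const) (use Qdet in \<open>auto simp: Q_def q_def\<close>)
  then have detQ': "Determinant.det Q' \<noteq> 0" using m by auto
  have qle: "k \<le> q n" for n using qm[of n] m(1) by linarith
  have qlt: "q i < q j" if "i < j" for i j using qmono that by (simp add: strict_mono_def)
  have close: "\<exists>N. \<forall>i j. N \<le> i \<longrightarrow> i < j \<longrightarrow> (\<forall>a<d. \<forall>b<d. cmod (Rp (q i) (q j) $$ (a, b) - (if a = b then 1 else 0)) \<le> e)" if e: "e > 0" for e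
  proof -
    obtain N where "\<And>i j a b. N \<le> i \<Longrightarrow> i < j \<Longrightarrow> a < d \<Longrightarrow> b < d \<Longrightarrow> cmod (Rp (q i) (q j) $$ (a, b) - (if a = b then 1 else 0)) \<le> e"
    proof (rule increments_tend_to_one[OF Rp_carrier Q'(1) detQ' Q'2 _ _ _ e])
      show "Rp m (q j) = Rp (q i) (q j) * Rp m (q i)" if "i < j" for i j
        using qlt[OF that] qm[of i] by (intro mat_prod_split R_carrier) auto
      show "cmod (Rp (q i) (q j) $$ (a, b)) \<le> 1" if "i < j" "a < d" "b < d" for i j a b
        by (rule contraction_entry[OF Rp_contraction[OF qle] that(2,3)])
    qed (auto intro: Rp_carrier)
    then show ?thesis by blast
  qed
  have Vm: "(\<lambda>x. V p n x $$ (i, j)) \<in> borel_measurable P" if "i < d" "j < d" "k \<le> p" for i j p n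
    using V_measurable[of p n \<B> i j] Z_measurable that unfolding measurable_cong_sets[OF sP(1) refl] by simp
  have Vb: "cmod (V p n x $$ (i, j)) \<le> 1" if "x \<in> \<Omega>" "i < d" "j < d" "k \<le> p" for x i j p n
    using unitary_entry_bound[OF V_unitary] that by blast
  have Vi: "integrable P (\<lambda>x. V p n x $$ (i, j))" if "i < d" "j < d" "k \<le> p" for i j p n
    by (rule integrable_bounded_prob[OF P.prob_space_axioms Vm[OF that], where b = 1]) (use Vb that sP in auto)
  define D where "D i j = (\<Sum>a<d. \<Sum>b<d. \<integral>x. cmod (V m (q j) x $$ (a, b) - V m (q i) x $$ (a, b)) \<partial>P)" for i j
  \<comment> \<open>A mean-square estimate gives an L1 estimate through \<open>t \<le> (\<eta> + t\<^sup>2 / \<eta>) / 2\<close>.\<close>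
  have D: "\<exists>N. \<forall>i j. N \<le> i \<longrightarrow> i < j \<longrightarrow> D i j \<le> e" if e: "e > 0" for e
  proof -
    \<comment> \<open>Each of the \<open>d\<^sup>2\<close> entries will contribute at most \<open>(d + 1) * \<eta>\<close>.\<close>
    define \<eta> where "\<eta> = e / (real d ^ 3 + real d ^ 2)"
    have dd: "real d ^ 3 + real d ^ 2 > 0" using d by (intro add_pos_pos) auto
    have \<eta>: "\<eta> > 0" using e dd by (simp add: \<eta>_def)
    have "\<eta>\<^sup>2 / (2 * real d) > 0" using \<eta> d by simp
    from close[OF this] obtain N where
      N: "\<forall>i j. N \<le> i \<longrightarrow> i < j \<longrightarrow> (\<forall>a<d. \<forall>b<d. cmod (Rp (q i) (q j) $$ (a, b) - (if a = b then 1 else 0)) \<le> \<eta>\<^sup>2 / (2 * real d))" ..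
    show ?thesis
    proof (intro exI[of _ N] allI impI)
      fix i j assume ij: "N \<le> i" "i < j"
      define W where "W x a c = V (q i) (q j) x $$ (a, c) - (if a = c then 1 else 0)" for x a c
      have Wi: "integrable P (\<lambda>x. W x a c)" if "a < d" "c < d" for a c
        unfolding W_def by (intro Bochner_Integration.integrable_diff Vi that qle P.integrable_const)
      have Wb: "cmod (W x a c) \<le> 2" if "a < d" "c < d" "x \<in> \<Omega>" for x a c
        unfolding W_def using norm_triangle_ineq4[of "V (q i) (q j) x $$ (a, c)" "if a = c then 1 else 0"] Vb[OF that(3,1,2) qle, of i "q j"]
        by (cases "a = c") auto
      have W2i: "integrable P (\<lambda>x. (cmod (W x a c))\<^sup>2)" if "a < d" "c < d" for a c
        by (rule integrable_bounded_prob[OF P.prob_space_axioms, of _ 4])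
          (use Wi[OF that] Wb[OF that] sP in \<open>auto intro!: borel_measurable_power simp: power_mono[of _ 2 2, simplified]\<close>)
      have sq: "(\<integral>x. (\<Sum>a<d. \<Sum>c<d. (cmod (W x a c))\<^sup>2) \<partial>P) \<le> \<eta>\<^sup>2"
      proof -
        have "q i \<le> q j" using qlt[OF ij(2)] by simp
        from mean_square_distance_to_one[OF P qle[of i] this, of "\<eta>\<^sup>2 / (2 * real d)"] show ?thesis
          using N ij d unfolding W_def by simp
      qed
      have one: "(\<integral>x. cmod (V m (q j) x $$ (a, b) - V m (q i) x $$ (a, b)) \<partial>P) \<le> (real d + 1) * \<eta>" if a: "a < d" and b: "b < d" for a b
      proof -
        have pw: "cmod (V m (q j) x $$ (a, b) - V m (q i) x $$ (a, b)) \<le> real d * \<eta> / 2 + (\<Sum>a<d. \<Sum>c<d. (cmod (W x a c))\<^sup>2) / (2 * \<eta>)"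
          if x: "x \<in> \<Omega>" for x
        proof -
          have "V m (q j) x = V (q i) (q j) x * V m (q i) x" by (rule V_split[OF x m(1) qm]) (use qlt[OF ij(2)] in simp)
          then have "V m (q j) x $$ (a, b) = (\<Sum>c<d. V (q i) (q j) x $$ (a, c) * V m (q i) x $$ (c, b))"
            using mult_entry[OF V_carrier[OF x qle] V_carrier[OF x m(1)] a b] by simp
          then have "V m (q j) x $$ (a, b) - V m (q i) x $$ (a, b) = (\<Sum>c<d. W x a c * V m (q i) x $$ (c, b))"
            using a by (simp add: W_def left_diff_distrib sum_subtractf if_distrib[of "\<lambda>x. x * _"] cong: if_cong)
          also have "cmod \<dots> \<le> (\<Sum>c<d. \<eta> / 2 + (cmod (W x a c))\<^sup>2 / (2 * \<eta>))"
          proof (rule order_trans[OF norm_sum sum_mono])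
            fix c assume "c \<in> {..<d}"
            then have c: "c < d" by simp
            have "cmod (W x a c * V m (q i) x $$ (c, b)) \<le> cmod (W x a c)"
              unfolding norm_mult using Vb[OF x c b m(1), of "q i"] by (intro mult_right_le_one_le) auto
            also have "\<dots> \<le> \<eta> / 2 + (cmod (W x a c))\<^sup>2 / (2 * \<eta>)"
            proof -
              have "0 \<le> (cmod (W x a c) - \<eta>)\<^sup>2" by simp
              then have "2 * \<eta> * cmod (W x a c) \<le> \<eta>\<^sup>2 + (cmod (W x a c))\<^sup>2" by (simp add: power2_diff algebra_simps)
              then show ?thesis using \<eta> by (simp add: field_simps power2_eq_square)
            qed
            finally show "cmod (W x a c * V m (q i) x $$ (c, b)) \<le> \<eta> / 2 + (cmod (W x a c))\<^sup>2 / (2 * \<eta>)" .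
          qed
          also have "\<dots> = real d * \<eta> / 2 + (\<Sum>c<d. (cmod (W x a c))\<^sup>2) / (2 * \<eta>)"
            by (simp add: sum.distrib sum_divide_distrib)
          also have "\<dots> \<le> real d * \<eta> / 2 + (\<Sum>a<d. \<Sum>c<d. (cmod (W x a c))\<^sup>2) / (2 * \<eta>)"
            using \<eta> a member_le_sum[of a "{..<d}" "\<lambda>a. \<Sum>c<d. (cmod (W x a c))\<^sup>2"]
            by (intro add_left_mono divide_right_mono) (auto simp: sum_nonneg)
          finally show ?thesis .
        qed
        have i2: "integrable P (\<lambda>x. real d * \<eta> / 2 + (\<Sum>a<d. \<Sum>c<d. (cmod (W x a c))\<^sup>2) / (2 * \<eta>))"
          by (intro Bochner_Integration.integrable_add integrable_divide_zero Bochner_Integration.integrable_sum W2i) auto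
        have "(\<integral>x. cmod (V m (q j) x $$ (a, b) - V m (q i) x $$ (a, b)) \<partial>P) \<le>
           (\<integral>x. real d * \<eta> / 2 + (\<Sum>a<d. \<Sum>c<d. (cmod (W x a c))\<^sup>2) / (2 * \<eta>) \<partial>P)"
          by (rule integral_mono[OF _ i2]) (use pw sP a b m(1) in \<open>auto intro!: integrable_norm Bochner_Integration.integrable_diff Vi\<close>)
        also have "\<dots> = real d * \<eta> / 2 + (\<integral>x. (\<Sum>a<d. \<Sum>c<d. (cmod (W x a c))\<^sup>2) \<partial>P) / (2 * \<eta>)"
        proof -
          have "integrable P (\<lambda>x. \<Sum>a<d. \<Sum>c<d. (cmod (W x a c))\<^sup>2)"
            by (intro Bochner_Integration.integrable_sum W2i) auto
          then show ?thesis by (simp add: P.prob_space)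
        qed
        also have "\<dots> \<le> real d * \<eta> / 2 + \<eta>\<^sup>2 / (2 * \<eta>)"
          using \<eta> sq by (intro add_left_mono divide_right_mono) auto
        also have "\<dots> \<le> (real d + 1) * \<eta>"
        proof -
          have "\<eta>\<^sup>2 / (2 * \<eta>) = \<eta> / 2" using \<eta> by (simp add: power2_eq_square)
          moreover have "0 \<le> real d * \<eta>" using \<eta> by simp
          ultimately show ?thesis using \<eta> by (simp only: distrib_right)
        qed
        finally show ?thesis .
      qed
      have "D i j \<le> (\<Sum>a<d. \<Sum>b<d. (real d + 1) * \<eta>)" unfolding D_def by (intro sum_mono one) auto
      also have "\<dots> = e" using dd unfolding \<eta>_def by (simp add: power3_eq_cube power2_eq_square field_simps)
      finally show "D i j \<le> e" .
    qed
  qed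
  obtain s where s: "strict_mono (s :: nat \<Rightarrow> nat)" and Ds: "\<And>i. D (s i) (s (Suc i)) \<le> (1/2)^i"
    by (rule fast_subsequence[of D, OF D], assumption) (rule that)
  define p where "p i = q (s i)" for i
  have pk: "k \<le> p i" and pm: "m \<le> p i" and pi: "i < p i" for i
    using qle[of "s i"] qm[of "s i"] qn[of "s i"] seq_suble[OF s, of i] by (simp_all add: p_def)
  have kk: "k \<le> k" by simp
  have Vconv: "AE x in P. convergent (\<lambda>i. V m (p i) x $$ (a, b))" if a: "a < d" and b: "b < d" for a b
  proof (rule AE_convergent_of_fast_L1)
    show "integrable P (\<lambda>x. V m (p i) x $$ (a, b))" for i by (rule Vi[OF a b m(1)])
    fix i
    have "(\<integral>x. cmod (V m (p (Suc i)) x $$ (a, b) - V m (p i) x $$ (a, b)) \<partial>P) \<le> D (s i) (s (Suc i))"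
    proof -
      have "(\<integral>x. cmod (V m (p (Suc i)) x $$ (a, b) - V m (p i) x $$ (a, b)) \<partial>P) \<le>
         (\<Sum>b<d. \<integral>x. cmod (V m (p (Suc i)) x $$ (a, b) - V m (p i) x $$ (a, b)) \<partial>P)"
        by (rule member_le_sum[of b "{..<d}" "\<lambda>b. \<integral>x. cmod (V m (p (Suc i)) x $$ (a, b) - V m (p i) x $$ (a, b)) \<partial>P"])
           (use b in \<open>auto intro!: integral_nonneg_AE\<close>)
      also have "\<dots> \<le> D (s i) (s (Suc i))" unfolding D_def p_def
        by (rule member_le_sum[of a "{..<d}" "\<lambda>a. \<Sum>b<d. \<integral>x. cmod (V m (q (s (Suc i))) x $$ (a, b) - V m (q (s i)) x $$ (a, b)) \<partial>P"])
           (use a in \<open>auto intro!: sum_nonneg integral_nonneg_AE\<close>)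
      finally show ?thesis .
    qed
    then show "(\<integral>x. cmod (V m (p (Suc i)) x $$ (a, b) - V m (p i) x $$ (a, b)) \<partial>P) \<le> (1/2)^i" using Ds[of i] by linarith
  qed
  define Y where "Y x a b = lim (\<lambda>i. V m (p i) x $$ (a, b))" for x a b
  define h where "h x a b = lim (\<lambda>i. U (p i) (x (p i)) $$ (a, b))" for x a b
  have Ym: "(\<lambda>x. Y x a b) \<in> borel_measurable (F_Z G T \<phi> k)" if "a < d" "b < d" for a b
    unfolding Y_def by (intro borel_measurable_lim_metric V_measurable Z_FZ) (use that m in auto)
  \<comment> \<open>A limit does not change when initial terms are dropped, so it depends only on the coordinates beyond any given \<open>l\<close>.\<close>
  have hm: "(\<lambda>x. h x a b) \<in> borel_measurable (future_X T l)" if "a < d" "b < d" for a b l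
  proof -
    have "((\<lambda>i. f (i + l)) \<longlonglongrightarrow> y) = (f \<longlonglongrightarrow> y)" for f :: "nat \<Rightarrow> complex" and y
      by (rule iffI, erule LIMSEQ_offset, erule LIMSEQ_ignore_initial_segment)
    note shift = this[of "\<lambda>i. U (p i) (x (p i)) $$ (a, b)" for x]
    have "h x a b = lim (\<lambda>i. U (p (i + l)) (x (p (i + l))) $$ (a, b))" for x
      unfolding h_def lim_def shift ..
    moreover have "l < p (i + l)" for i using pi[of "i + l"] by simp
    then have "(\<lambda>x. lim (\<lambda>i. U (p (i + l)) (x (p (i + l))) $$ (a, b))) \<in> borel_measurable (future_X T l)"
      by (intro borel_measurable_lim_metric coefficient_future pk that)
    ultimately show ?thesis by simp
  qed
  have "AE x in P. \<forall>c\<in>{..<d}\<times>{..<d}. convergent (\<lambda>i. V m (p i) x $$ c)"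
    by (rule AE_finite_allI) (use Vconv in auto)
  then have good: "AE x in P. x \<in> \<Omega> \<and> (\<forall>a<d. \<forall>b<d. (\<lambda>i. V m (p i) x $$ (a, b)) \<longlonglongrightarrow> Y x a b)"
    using AE_space by eventually_elim (use sP in \<open>auto simp: Y_def convergent_LIMSEQ_iff\<close>)
  have hconv: "(\<lambda>i. U (p i) (x (p i)) $$ (a, b)) \<longlonglongrightarrow> h x a b"
    if x: "x \<in> \<Omega>" "\<forall>a<d. \<forall>b<d. (\<lambda>i. V m (p i) x $$ (a, b)) \<longlonglongrightarrow> Y x a b" and a: "a < d" and b: "b < d" for x a b
  proof -
    \<comment> \<open>Solve \<open>U m (x m) = U n (x n) * V m n x\<close> for \<open>U n (x n)\<close>, the inverse of \<open>V m n x\<close> being its adjoint.\<close>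
    have eq: "U (p i) (x (p i)) $$ (a, b) = (\<Sum>c<d. U m (x m) $$ (a, c) * cnj (V m (p i) x $$ (b, c)))" for i
    proof -
      have "(\<Sum>c<d. U m (x m) $$ (a, c) * cnj (V m (p i) x $$ (b, c))) =
         (\<Sum>c<d. (\<Sum>e<d. U (p i) (x (p i)) $$ (a, e) * V m (p i) x $$ (e, c)) * cnj (V m (p i) x $$ (b, c)))"
        using U_V[OF x(1) m(1) pm[of i]] mult_entry[OF U_carrier[OF pk[of i] coord_in[OF x(1)]] V_carrier[OF x(1) m(1)] a]
        by (intro sum.cong refl) simp
      also have "\<dots> = (\<Sum>e<d. U (p i) (x (p i)) $$ (a, e) * (\<Sum>c<d. V m (p i) x $$ (e, c) * cnj (V m (p i) x $$ (b, c))))"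
        unfolding sum_distrib_right sum_distrib_left by (subst sum.swap) (simp add: mult.assoc)
      also have "\<dots> = (\<Sum>e<d. U (p i) (x (p i)) $$ (a, e) * (if e = b then 1 else 0))"
        by (rule sum.cong[OF refl]) (use unitary_orthogonal(1)[OF V_unitary[OF x(1) m(1)] _ b] in simp)
      also have "\<dots> = U (p i) (x (p i)) $$ (a, b)" using b by (simp add: if_distrib[of "\<lambda>x. _ * x"] cong: if_cong)
      finally show ?thesis by simp
    qed
    have "(\<lambda>i. \<Sum>c<d. U m (x m) $$ (a, c) * cnj (V m (p i) x $$ (b, c))) \<longlonglongrightarrow> (\<Sum>c<d. U m (x m) $$ (a, c) * cnj (Y x b c))"
      by (intro tendsto_sum tendsto_mult tendsto_const tendsto_cnj) (use x b in simp)
    then have "convergent (\<lambda>i. U (p i) (x (p i)) $$ (a, b))" unfolding eq by (auto simp: convergent_def)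
    then show ?thesis by (simp add: h_def convergent_LIMSEQ_iff)
  qed
  have "\<exists>c. AE x in P. h x a b = c" if a: "a < d" and b: "b < d" for a b
  proof (rule extreme_tail_const[OF ext hm[OF a b]])
    show "AE x in P. cmod (h x a b) \<le> 1"
      using good
    proof eventually_elim
      case (elim x)
      have "(\<lambda>i. cmod (U (p i) (x (p i)) $$ (a, b))) \<longlonglongrightarrow> cmod (h x a b)" using hconv[of x a b] elim a b by (intro tendsto_norm) blast
      then show ?case by (rule LIMSEQ_le_const2) (use coefficient_bound[OF _ pk a b] elim in auto)
    qed
  qed
  then obtain C where C: "\<And>a b. a < d \<Longrightarrow> b < d \<Longrightarrow> AE x in P. h x a b = C a b" by metis
  have "AE x in P. \<forall>c\<in>{..<d}\<times>{..<d}. h x (fst c) (snd c) = C (fst c) (snd c)"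
    by (rule AE_finite_allI) (use C in auto)
  then have eqAE: "AE x in P. \<rho> (emb G k (x k)) $$ (a0, b0) = (\<Sum>e<d. (\<Sum>c<d. C a0 c * Y x c e) * V k m x $$ (e, b0))"
    using good
  proof eventually_elim
    case (elim x)
    then have x: "x \<in> \<Omega>" "\<forall>a<d. \<forall>b<d. (\<lambda>i. V m (p i) x $$ (a, b)) \<longlonglongrightarrow> Y x a b" and hC: "\<And>a b. a < d \<Longrightarrow> b < d \<Longrightarrow> h x a b = C a b"
      by auto
    have Um: "U m (x m) $$ (a0, e) = (\<Sum>c<d. C a0 c * Y x c e)" if e: "e < d" for e
    proof -
      have "(\<lambda>i. \<Sum>c<d. U (p i) (x (p i)) $$ (a0, c) * V m (p i) x $$ (c, e)) \<longlonglongrightarrow> (\<Sum>c<d. h x a0 c * Y x c e)"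
        by (intro tendsto_sum tendsto_mult hconv[OF x ab(1)]) (use x(2) e in auto)
      moreover have "(\<Sum>c<d. U (p i) (x (p i)) $$ (a0, c) * V m (p i) x $$ (c, e)) = U m (x m) $$ (a0, e)" for i
        using U_V[OF x(1) m(1) pm, of i] mult_entry[OF U_carrier[OF pk coord_in[OF x(1)]] V_carrier[OF x(1) m(1)] ab(1) e] by simp
      ultimately have "U m (x m) $$ (a0, e) = (\<Sum>c<d. h x a0 c * Y x c e)" by (simp add: LIMSEQ_const_iff)
      then show ?thesis using hC ab by simp
    qed
    have "U k (x k) $$ (a0, b0) = (\<Sum>e<d. U m (x m) $$ (a0, e) * V k m x $$ (e, b0))"
      using U_V[OF x(1) kk m(1)] mult_entry[OF U_carrier[OF m(1) coord_in[OF x(1)]] V_carrier[OF x(1) kk] ab] by simp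
    then show ?case using Um by (simp add: U_self)
  qed
  show ?thesis
  proof (rule measurable_augment_AE[OF _ _ _ _ eqAE])
    show "sets (F_Z G T \<phi> k) \<subseteq> sets P" using FZ_subset sP by blast
    show "space (F_Z G T \<phi> k) = space P" using sP by simp
    show "(\<lambda>x. \<rho> (emb G k (x k)) $$ (a0, b0)) \<in> borel_measurable P"
      using coefficient_measurable[OF kk ab] unfolding measurable_cong_sets[OF sP(1) refl] U_self .
    show "(\<lambda>x. \<Sum>e<d. (\<Sum>c<d. C a0 c * Y x c e) * V k m x $$ (e, b0)) \<in> borel_measurable (F_Z G T \<phi> k)"
      by (intro borel_measurable_sum borel_measurable_times borel_measurable_const Ym V_measurable Z_FZ) (use ab in auto)
  qed
qed

section \<open>Haar measure on a compact group with a countable base\<close>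

lemma continuous_map_realI:
  fixes f :: "'a \<Rightarrow> real"
  assumes "\<And>x e. x \<in> topspace T \<Longrightarrow> e > 0 \<Longrightarrow> \<exists>V. openin T V \<and> x \<in> V \<and> (\<forall>y\<in>V. \<bar>f y - f x\<bar> \<le> e)"
  shows "continuous_map T euclideanreal f"
  unfolding continuous_map_def
proof (intro conjI allI impI)
  fix U :: "real set" assume "openin euclideanreal U"
  then have U: "open U" by simp
  show "openin T {x \<in> topspace T. f x \<in> U}"
  proof (subst openin_subopen, intro ballI)
    fix x assume "x \<in> {x \<in> topspace T. f x \<in> U}"
    then have x: "x \<in> topspace T" "f x \<in> U" by auto
    then obtain e where e: "e > 0" "cball (f x) e \<subseteq> U" using U open_contains_cball by blast
    obtain V where V: "openin T V" "x \<in> V" "\<forall>y\<in>V. \<bar>f y - f x\<bar> \<le> e" using assms[OF x(1) e(1)] by blast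
    have "V \<subseteq> {x \<in> topspace T. f x \<in> U}"
    proof
      fix y assume y: "y \<in> V"
      have "f y \<in> cball (f x) e" using V(3) y by (auto simp: dist_real_def abs_minus_commute)
      then show "y \<in> {x \<in> topspace T. f x \<in> U}" using e(2) openin_subset[OF V(1)] y by auto
    qed
    then show "\<exists>V. openin T V \<and> x \<in> V \<and> V \<subseteq> {x \<in> topspace T. f x \<in> U}" using V by blast
  qed
qed simp

context compact_sc
begin

text \<open>
  The tube lemma: the set where \<open>F\<close> differs by less than \<open>e\<close> from its value over \<open>x\<close> is a neighbourhood of the compact fibre over \<open>x\<close>.
\<close>

lemma uniform_neighbourhood:
  fixes F :: "'a \<times> 'b \<Rightarrow> real"
  assumes F: "continuous_map (prod_topology T S) euclideanreal F" and x: "x \<in> topspace S" and e: "e > 0"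
  shows "\<exists>V. openin S V \<and> x \<in> V \<and> (\<forall>y\<in>V. \<forall>w\<in>topspace T. \<bar>F (w, y) - F (w, x)\<bar> \<le> e)"
proof -
  have "continuous_map (prod_topology T S) (prod_topology T S) (\<lambda>p. (fst p, x))"
    using x by (intro continuous_map_pairedI continuous_map_fst) simp
  from continuous_map_compose[OF this F] have F': "continuous_map (prod_topology T S) euclideanreal (\<lambda>p. F (fst p, x))"
    by (simp add: comp_def)
  let ?W = "{p \<in> topspace (prod_topology T S). F p - F (fst p, x) \<in> {-e<..<e}}"
  have W: "openin (prod_topology T S) ?W"
    by (rule openin_continuous_map_preimage[OF continuous_map_diff[OF F F']]) simp
  have "topspace T \<times> {x} \<subseteq> ?W" using x e by auto
  then obtain U V where UV: "openin T U" "openin S V" "topspace T \<subseteq> U" "{x} \<subseteq> V" "U \<times> V \<subseteq> ?W"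
    using tube_lemma_left[OF W, of "topspace T" x] compact unfolding compact_space_def using x by auto
  have "\<bar>F (w, y) - F (w, x)\<bar> \<le> e" if "y \<in> V" "w \<in> topspace T" for y w
  proof -
    have "(w, y) \<in> ?W" using UV(3,5) that by blast
    then show ?thesis by (simp add: abs_le_iff)
  qed
  then show ?thesis using UV by (intro exI[of _ V]) auto
qed

lemma continuous_integral:
  fixes F :: "'a \<times> 'b \<Rightarrow> real"
  assumes F: "continuous_map (prod_topology T S) euclideanreal F" and M: "M \<in> borel_prob T"
  shows "continuous_map S euclideanreal (\<lambda>x. \<integral>w. F (w, x) \<partial>M)"
proof (rule continuous_map_realI)
  fix x :: 'b and e :: real assume x: "x \<in> topspace S" and e: "e > 0"
  interpret M: prob_space M by (rule borel_probD[OF M])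
  obtain V where V: "openin S V" "x \<in> V" "\<forall>y\<in>V. \<forall>w\<in>topspace T. \<bar>F (w, y) - F (w, x)\<bar> \<le> e"
    using uniform_neighbourhood[OF F x e] by blast
  have i: "integrable M (\<lambda>w. F (w, y))" if "y \<in> topspace S" for y
  proof (rule continuous_integrable[OF M])
    have "continuous_map T (prod_topology T S) (\<lambda>w. (w, y))" using that by (intro continuous_map_pairedI) simp_all
    from continuous_map_compose[OF this F] show "continuous_map T euclideanreal (\<lambda>w. F (w, y))" by (simp add: comp_def)
  qed
  have "\<bar>(\<integral>w. F (w, y) \<partial>M) - (\<integral>w. F (w, x) \<partial>M)\<bar> \<le> e" if y: "y \<in> V" for y
  proof -
    have yS: "y \<in> topspace S" using openin_subset[OF V(1)] y by blast
    have d: "(\<integral>w. F (w, y) \<partial>M) - (\<integral>w. F (w, x) \<partial>M) = (\<integral>w. F (w, y) - F (w, x) \<partial>M)"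
      using i[OF yS] i[OF x] by simp
    have id: "integrable M (\<lambda>w. F (w, y) - F (w, x))" using i[OF yS] i[OF x] by (rule Bochner_Integration.integrable_diff)
    have b: "\<bar>F (w, y) - F (w, x)\<bar> \<le> e" if "w \<in> space M" for w using V(3) y that borel_probD(3)[OF M] by simp
    have "(\<integral>w. F (w, y) - F (w, x) \<partial>M) \<le> e" by (rule M.integral_le_const[OF id], rule AE_I2) (use b in force)
    moreover have "- e \<le> (\<integral>w. F (w, y) - F (w, x) \<partial>M)" by (rule M.integral_ge_const[OF id], rule AE_I2) (use b in force)
    ultimately show ?thesis unfolding d by linarith
  qed
  then show "\<exists>V. openin S V \<and> x \<in> V \<and> (\<forall>y\<in>V. \<bar>(\<integral>w. F (w, y) \<partial>M) - (\<integral>w. F (w, x) \<partial>M)\<bar> \<le> e)"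
    using V by blast
qed

lemma integral_swap:
  fixes F :: "'a \<times> 'a \<Rightarrow> real"
  assumes F: "continuous_map (prod_topology T T) euclideanreal F" and M: "M \<in> borel_prob T" and N: "N \<in> borel_prob T"
  shows "(\<integral>x. (\<integral>y. F (x, y) \<partial>N) \<partial>M) = (\<integral>y. (\<integral>x. F (x, y) \<partial>M) \<partial>N)"
    "(\<integral>p. F p \<partial>(M \<Otimes>\<^sub>M N)) = (\<integral>y. (\<integral>x. F (x, y) \<partial>M) \<partial>N)"
proof -
  interpret M: prob_space M by (rule borel_probD[OF M])
  interpret N: prob_space N by (rule borel_probD[OF N])
  interpret MN: pair_prob_space M N ..
  note sM = borel_probD(2,3)[OF M] and sN = borel_probD(2,3)[OF N]
  have "F \<in> borel_of T \<Otimes>\<^sub>M borel_of T \<rightarrow>\<^sub>M borel_of euclideanreal"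
    by (rule continuous_map_pair_borel[OF second_countable second_countable F])
  then have Fm: "F \<in> borel_measurable (M \<Otimes>\<^sub>M N)"
    unfolding measurable_cong_sets[OF sets_pair_measure_cong[OF sM(1) sN(1)] sets_borel_of_euclidean[symmetric]] .
  have "compactin euclideanreal (F ` topspace (prod_topology T T))"
    using compact F image_compactin[of "prod_topology T T" "topspace (prod_topology T T)" euclideanreal F]
      compact_space_prod_topology[of T T] unfolding compact_space_def by auto
  then have "bounded (F ` topspace (prod_topology T T))" by (simp add: compact_imp_bounded)
  then obtain b where b: "\<And>p. p \<in> topspace (prod_topology T T) \<Longrightarrow> norm (F p) \<le> b" unfolding bounded_iff by auto
  have i: "integrable (M \<Otimes>\<^sub>M N) F"
    by (rule integrable_bounded_prob[OF MN.prob_space_axioms Fm, of b]) (use b sM sN in \<open>auto simp: space_pair_measure\<close>)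
  show "(\<integral>p. F p \<partial>(M \<Otimes>\<^sub>M N)) = (\<integral>y. (\<integral>x. F (x, y) \<partial>M) \<partial>N)"
    using MN.integral_snd[of "\<lambda>x y. F (x, y)"] i by simp
  show "(\<integral>x. (\<integral>y. F (x, y) \<partial>N) \<partial>M) = (\<integral>y. (\<integral>x. F (x, y) \<partial>M) \<partial>N)"
    using MN.Fubini_integral[of "\<lambda>x y. F (x, y)"] i by simp
qed

lemma ex_dense_sequence:
  assumes "topspace T \<noteq> {}"
  shows "\<exists>z :: nat \<Rightarrow> 'a. (\<forall>i. z i \<in> topspace T) \<and> (\<forall>V. openin T V \<longrightarrow> V \<noteq> {} \<longrightarrow> (\<exists>i. z i \<in> V))"
proof -
  obtain B where "enum_base T B" using ex_enum_base[OF second_countable] ..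
  note B = enum_baseD[OF this]
  obtain x0 where x0: "x0 \<in> topspace T" using assms by blast
  define z where "z i = (if B i = {} then x0 else (SOME y. y \<in> B i))" for i
  have zB: "z i \<in> B i" if "B i \<noteq> {}" for i using that by (auto simp: z_def some_in_eq)
  have "z i \<in> topspace T" for i using zB[of i] openin_subset[OF B(1)[of i]] x0 by (cases "B i = {}") (auto simp: z_def)
  moreover have "\<exists>i. z i \<in> V" if V: "openin T V" "V \<noteq> {}" for V
  proof -
    obtain x where "x \<in> V" using V(2) by blast
    then obtain i where "x \<in> B i" "B i \<subseteq> V" using B(2)[OF V(1)] by blast
    then show ?thesis using zB[of i] by blast
  qed
  ultimately show ?thesis by blast
qed

lemma continuous_eq_zero_of_dense:
  fixes h :: "'a \<Rightarrow> real"
  assumes h: "continuous_map T euclideanreal h" and z: "\<And>V. openin T V \<Longrightarrow> V \<noteq> {} \<Longrightarrow> \<exists>i. z i \<in> V"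
    and zero: "\<And>i :: nat. h (z i) = 0" and x: "x \<in> topspace T"
  shows "h x = 0"
proof (rule ccontr)
  assume "h x \<noteq> 0"
  then have "x \<in> {y \<in> topspace T. h y \<in> - {0}}" using x by simp
  moreover have "openin T {y \<in> topspace T. h y \<in> - {0}}" by (rule openin_continuous_map_preimage[OF h]) auto
  ultimately obtain i where "z i \<in> {y \<in> topspace T. h y \<in> - {0}}" using z by blast
  then show False using zero by simp
qed

text \<open>
  A sum of point masses with positive weights at the points of a dense sequence.
\<close>

lemma ex_full_support:
  assumes ne: "topspace T \<noteq> {}"
  shows "\<exists>\<nu>\<in>borel_prob T. \<forall>h :: 'a \<Rightarrow> real. continuous_map T euclideanreal h \<longrightarrow> (\<forall>x\<in>topspace T. 0 \<le> h x) \<longrightarrow>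
     (\<integral>x. h x \<partial>\<nu>) = 0 \<longrightarrow> (\<forall>x\<in>topspace T. h x = 0)"
proof -
  obtain z :: "nat \<Rightarrow> 'a" where z: "\<And>i. z i \<in> topspace T" "\<And>V. openin T V \<Longrightarrow> V \<noteq> {} \<Longrightarrow> \<exists>i. z i \<in> V"
    using ex_dense_sequence[OF ne] by blast
  let ?g = "measure_pmf (geometric_pmf (1/2))"
  have zm: "z \<in> ?g \<rightarrow>\<^sub>M borel_of T" using z(1) by simp
  define \<nu> where "\<nu> = distr ?g (borel_of T) z"
  have \<nu>: "\<nu> \<in> borel_prob T" unfolding \<nu>_def borel_prob_def using measure_pmf.prob_space_distr[OF zm] by simp
  have "h x = 0" if h: "continuous_map T euclideanreal h" "\<forall>x\<in>topspace T. 0 \<le> h x" "(\<integral>x. h x \<partial>\<nu>) = 0" and x: "x \<in> topspace T"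
    for h :: "'a \<Rightarrow> real" and x
  proof (rule continuous_eq_zero_of_dense[OF h(1) z(2) _ x])
    fix i
    have hm: "h \<in> borel_measurable (borel_of T)" by (rule continuous_map_borel_measurable[OF h(1)])
    have "(\<integral>i. h (z i) \<partial>?g) = 0" using h(3) integral_distr[OF zm hm] by (simp add: \<nu>_def)
    moreover have "integrable ?g (\<lambda>i. h (z i))"
      using continuous_integrable[OF \<nu> h(1)] integrable_distr_eq[OF zm hm] by (simp add: \<nu>_def)
    moreover have "AE i in ?g. 0 \<le> h (z i)" by (rule AE_I2) (use h(2) z(1) in simp)
    ultimately have "AE i in ?g. h (z i) = 0" using integral_nonneg_eq_0_iff_AE by blast
    then show "h (z i) = 0" by (simp add: AE_measure_pmf_iff set_pmf_geometric)
  qed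
  then show ?thesis using \<nu> by blast
qed

end

locale compact_group = compact_sc T for T :: "'a topology" +
  fixes \<Gamma> :: "'a monoid"
  assumes tgroup: "topological_group \<Gamma> T"
begin

sublocale group \<Gamma> using tgroup by (simp add: topological_group_def)

lemma carrier_eq: "carrier \<Gamma> = topspace T" using tgroup by (simp add: topological_group_def)

lemma mult_in [simp]: "x \<in> topspace T \<Longrightarrow> y \<in> topspace T \<Longrightarrow> x \<otimes>\<^bsub>\<Gamma>\<^esub> y \<in> topspace T"
  and inv_in [simp]: "x \<in> topspace T \<Longrightarrow> inv\<^bsub>\<Gamma>\<^esub> x \<in> topspace T"
  and one_in [simp]: "\<one>\<^bsub>\<Gamma>\<^esub> \<in> topspace T"
  using m_closed inv_closed one_closed by (simp_all add: carrier_eq)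

lemma nonempty: "topspace T \<noteq> {}" using one_in by blast

lemma cmult: "continuous_map S T f \<Longrightarrow> continuous_map S T g \<Longrightarrow> continuous_map S T (\<lambda>x. f x \<otimes>\<^bsub>\<Gamma>\<^esub> g x)"
  using continuous_map_compose[OF continuous_map_pairedI, of S T f T g T "\<lambda>(x, y). x \<otimes>\<^bsub>\<Gamma>\<^esub> y"] tgroup
  by (simp add: topological_group_def comp_def)

lemma cinv: "continuous_map S T f \<Longrightarrow> continuous_map S T (\<lambda>x. inv\<^bsub>\<Gamma>\<^esub> (f x))"
  using continuous_map_compose[of S T f T "\<lambda>x. inv\<^bsub>\<Gamma>\<^esub> x"] tgroup by (simp add: topological_group_def comp_def)

lemma ccomp: "continuous_map T euclideanreal f \<Longrightarrow> continuous_map S T g \<Longrightarrow> continuous_map S euclideanreal (\<lambda>x. f (g x))"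
  using continuous_map_compose[of S T g euclideanreal f] by (simp add: comp_def)

lemma cfst: "continuous_map (prod_topology T T) T fst" and csnd: "continuous_map (prod_topology T T) T snd"
  by (rule continuous_map_fst, rule continuous_map_snd)

lemma cid: "continuous_map T T (\<lambda>x. x)" using continuous_map_id by (simp add: id_def)

lemma cconst: "c \<in> topspace T \<Longrightarrow> continuous_map S T (\<lambda>_. c)" by simp

lemma attains_max:
  fixes f :: "'a \<Rightarrow> real"
  assumes f: "continuous_map T euclideanreal f"
  shows "\<exists>x\<in>topspace T. \<forall>y\<in>topspace T. f y \<le> f x"
proof -
  have "compactin euclideanreal (f ` topspace T)"
    using compact f image_compactin compact_space_def by blast
  then have "compact (f ` topspace T)" by simp
  from compact_attains_sup[OF this] nonempty show ?thesis by auto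
qed

text \<open>
  Let \<open>\<nu>\<close> have full support, let \<open>A f y\<close> be the \<open>\<nu>\<close>-average of \<open>w \<mapsto> f (y \<cdot> w)\<close>, and let \<open>\<eta>\<close> be a weak limit of the Cesaro means of the
  convolution powers of \<open>\<nu>\<close>, so that \<open>f\<close> and \<open>A f\<close> have the same \<open>\<eta>\<close>-integral. Then the continuous function
  \<open>F x = (\<integral>y. f (y \<cdot> x) \<partial>\<eta>)\<close> is its own average over \<open>\<nu>\<close>-translates, which makes it constant, and this is the invariance of \<open>\<eta>\<close>.
  For the full support of \<open>\<eta>\<close> observe that \<open>A f\<close> is positive everywhere if \<open>f\<close> is nonnegative and nonzero.
\<close>

lemma ex_Haar:
  "\<exists>\<eta>\<in>borel_prob T. (\<forall>f :: 'a \<Rightarrow> real. continuous_map T euclideanreal f \<longrightarrow>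
     (\<forall>a\<in>topspace T. (\<integral>y. f (y \<otimes>\<^bsub>\<Gamma>\<^esub> a) \<partial>\<eta>) = (\<integral>y. f y \<partial>\<eta>))) \<and>
     (\<forall>f :: 'a \<Rightarrow> real. continuous_map T euclideanreal f \<longrightarrow> (\<forall>x\<in>topspace T. 0 \<le> f x) \<longrightarrow> (\<integral>y. f y \<partial>\<eta>) = 0 \<longrightarrow> (\<forall>x\<in>topspace T. f x = 0))"
proof -
  obtain \<nu> where \<nu>: "\<nu> \<in> borel_prob T" and full: "\<And>h :: 'a \<Rightarrow> real. continuous_map T euclideanreal h \<Longrightarrow> (\<forall>x\<in>topspace T. 0 \<le> h x) \<Longrightarrow>
     (\<integral>x. h x \<partial>\<nu>) = 0 \<Longrightarrow> \<forall>x\<in>topspace T. h x = 0"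
    using ex_full_support[OF nonempty] by blast
  interpret nu: prob_space \<nu> by (rule borel_probD[OF \<nu>])
  define A where "A f y = (\<integral>w. f (y \<otimes>\<^bsub>\<Gamma>\<^esub> w) \<partial>\<nu>)" for f :: "'a \<Rightarrow> real" and y
  have cF: "continuous_map (prod_topology T T) euclideanreal (\<lambda>p. f (snd p \<otimes>\<^bsub>\<Gamma>\<^esub> fst p))" if "continuous_map T euclideanreal f" for f
    by (intro ccomp[OF that] cmult cfst csnd)
  have cA: "continuous_map T euclideanreal (A f)" if f: "continuous_map T euclideanreal f" for f
    unfolding A_def using continuous_integral[OF cF[OF f] \<nu>] by simp
  define step where "step P = distr (\<nu> \<Otimes>\<^sub>M P) (borel_of T) (\<lambda>p. snd p \<otimes>\<^bsub>\<Gamma>\<^esub> fst p)" for P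
  have step: "step P \<in> borel_prob T" "continuous_map T euclideanreal f \<Longrightarrow> (\<integral>y. f y \<partial>step P) = (\<integral>y. A f y \<partial>P)"
    if P: "P \<in> borel_prob T" for P and f :: "'a \<Rightarrow> real"
  proof -
    interpret P: prob_space P by (rule borel_probD[OF P])
    interpret nuP: pair_prob_space \<nu> P ..
    have "(\<lambda>p. snd p \<otimes>\<^bsub>\<Gamma>\<^esub> fst p) \<in> borel_of T \<Otimes>\<^sub>M borel_of T \<rightarrow>\<^sub>M borel_of T"
      by (intro continuous_map_pair_borel second_countable cmult cfst csnd)
    then have m: "(\<lambda>p. snd p \<otimes>\<^bsub>\<Gamma>\<^esub> fst p) \<in> \<nu> \<Otimes>\<^sub>M P \<rightarrow>\<^sub>M borel_of T"
      unfolding measurable_cong_sets[OF sets_pair_measure_cong[OF borel_probD(2)[OF \<nu>] borel_probD(2)[OF P]] refl] .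
    show "step P \<in> borel_prob T" unfolding step_def borel_prob_def using nuP.prob_space_distr[OF m] by simp
    assume f: "continuous_map T euclideanreal f"
    have "(\<integral>y. f y \<partial>step P) = (\<integral>p. f (snd p \<otimes>\<^bsub>\<Gamma>\<^esub> fst p) \<partial>(\<nu> \<Otimes>\<^sub>M P))"
      unfolding step_def by (rule integral_distr[OF m continuous_map_borel_measurable[OF f]])
    also have "\<dots> = (\<integral>y. A f y \<partial>P)" unfolding integral_swap(2)[OF cF[OF f] \<nu> P] by (simp add: A_def)
    finally show "(\<integral>y. f y \<partial>step P) = (\<integral>y. A f y \<partial>P)" .
  qed
  define W where "W n = (step ^^ n) \<nu>" for n
  have W: "W n \<in> borel_prob T" for n by (induction n) (simp_all add: W_def \<nu> step(1))
  have Wf: "(\<integral>y. f y \<partial>W (Suc n)) = (\<integral>y. A f y \<partial>W n)" if "continuous_map T euclideanreal f" for f n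
    using step(2)[OF W that, of n] by (simp add: W_def)
  define C where "C n = measure_pmf (pmf_of_set {..n}) \<bind> W" for n :: nat
  have C: "C n \<in> borel_prob T" for n unfolding C_def by (rule mixture(1)[OF W])
  have Cf: "(\<integral>y. f y \<partial>C n) = (\<Sum>i\<le>n. \<integral>y. f y \<partial>W i) / real (Suc n)" if f: "continuous_map T euclideanreal f" for f n
  proof -
    obtain b where b: "\<And>x. x \<in> topspace T \<Longrightarrow> norm (f x) \<le> b" using continuous_bounded[OF f] by blast
    have "(\<integral>y. f y \<partial>C n) = (\<integral>i. (\<integral>y. f y \<partial>W i) \<partial>measure_pmf (pmf_of_set {..n}))"
      unfolding C_def by (rule mixture(3)[OF W continuous_map_borel_measurable[OF f], of b]) (use b in simp)
    then show ?thesis by (simp add: integral_pmf_of_set)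
  qed
  obtain r \<eta> where r: "strict_mono (r :: nat \<Rightarrow> nat)" and \<eta>: "\<eta> \<in> borel_prob T" and
    lim: "\<And>f :: 'a \<Rightarrow> real. continuous_map T euclideanreal f \<Longrightarrow> (\<lambda>n. \<integral>x. f x \<partial>C (r n)) \<longlonglongrightarrow> (\<integral>x. f x \<partial>\<eta>)"
    by (rule weak_sequential_compactness[of C, OF C], rule that)
  interpret eta: prob_space \<eta> by (rule borel_probD[OF \<eta>])
  have inv: "(\<integral>y. A f y \<partial>\<eta>) = (\<integral>y. f y \<partial>\<eta>)" if f: "continuous_map T euclideanreal f" for f
  proof -
    obtain b where b: "\<And>x. x \<in> topspace T \<Longrightarrow> norm (f x) \<le> b" "b > 0" using continuous_bounded[OF f] by blast
    have Wb: "\<bar>\<integral>y. f y \<partial>W n\<bar> \<le> b" for n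
    proof -
      interpret Wn: prob_space "W n" by (rule borel_probD[OF W])
      have i: "integrable (W n) f" by (rule continuous_integrable[OF W f])
      have fb: "\<bar>f y\<bar> \<le> b" if "y \<in> space (W n)" for y using b that borel_probD(3)[OF W, of n] by simp
      have "(\<integral>y. f y \<partial>W n) \<le> b" by (rule Wn.integral_le_const[OF i], rule AE_I2) (use fb in force)
      moreover have "- b \<le> (\<integral>y. f y \<partial>W n)" by (rule Wn.integral_ge_const[OF i], rule AE_I2) (use fb in force)
      ultimately show ?thesis by linarith
    qed
    \<comment> \<open>In a Cesaro mean the shift by one step changes only the two end terms.\<close>
    have diff: "(\<integral>y. A f y \<partial>C n) - (\<integral>y. f y \<partial>C n) = ((\<integral>y. f y \<partial>W (Suc n)) - (\<integral>y. f y \<partial>W 0)) / real (Suc n)" for n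
    proof -
      have "(\<Sum>i\<le>n. \<integral>y. A f y \<partial>W i) - (\<Sum>i\<le>n. \<integral>y. f y \<partial>W i) = (\<integral>y. f y \<partial>W (Suc n)) - (\<integral>y. f y \<partial>W 0)"
        unfolding sum_subtractf[symmetric] Wf[OF f, symmetric] by (rule sum_Suc_diff'[of 0 "Suc n" "\<lambda>i. \<integral>y. f y \<partial>W i", unfolded atLeast0LessThan lessThan_Suc_atMost]) simp
      then show ?thesis unfolding Cf[OF f] Cf[OF cA[OF f]] by (simp add: diff_divide_distrib[symmetric])
    qed
    have "(\<lambda>n. (\<integral>y. A f y \<partial>C (r n)) - (\<integral>y. f y \<partial>C (r n))) \<longlonglongrightarrow> 0"
    proof (rule Lim_null_comparison)
      show "eventually (\<lambda>n. norm ((\<integral>y. A f y \<partial>C (r n)) - (\<integral>y. f y \<partial>C (r n))) \<le> 2 * b / real (Suc n)) sequentially"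
      proof (intro always_eventually allI)
        fix n
        have "norm ((\<integral>y. A f y \<partial>C (r n)) - (\<integral>y. f y \<partial>C (r n))) \<le> 2 * b / real (Suc (r n))"
          unfolding diff real_norm_def abs_divide using Wb[of "Suc (r n)"] Wb[of 0]
          by (intro frac_le) (auto simp: abs_le_iff)
        also have "\<dots> \<le> 2 * b / real (Suc n)" using seq_suble[OF r, of n] b(2) by (intro divide_left_mono) auto
        finally show "norm ((\<integral>y. A f y \<partial>C (r n)) - (\<integral>y. f y \<partial>C (r n))) \<le> 2 * b / real (Suc n)" .
      qed
      show "(\<lambda>n. 2 * b / real (Suc n)) \<longlonglongrightarrow> 0" by (rule LIMSEQ_Suc[OF lim_const_over_n])
    qed
    moreover have "(\<lambda>n. (\<integral>y. A f y \<partial>C (r n)) - (\<integral>y. f y \<partial>C (r n))) \<longlonglongrightarrow> (\<integral>y. A f y \<partial>\<eta>) - (\<integral>y. f y \<partial>\<eta>)"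
      by (intro tendsto_diff lim f cA)
    ultimately show ?thesis using LIMSEQ_unique by fastforce
  qed
  \<comment> \<open>A continuous function that is its own average over translates by a measure of full support is constant:
    compare with a maximum.\<close>
  have right: "(\<integral>y. f (y \<otimes>\<^bsub>\<Gamma>\<^esub> a) \<partial>\<eta>) = (\<integral>y. f y \<partial>\<eta>)" if f: "continuous_map T euclideanreal f" and a: "a \<in> topspace T" for f a
  proof -
    define F where "F x = (\<integral>y. f (y \<otimes>\<^bsub>\<Gamma>\<^esub> x) \<partial>\<eta>)" for x
    have cG: "continuous_map (prod_topology T T) euclideanreal (\<lambda>p. f (fst p \<otimes>\<^bsub>\<Gamma>\<^esub> snd p))"
      by (intro ccomp[OF f] cmult cfst csnd)
    have cFF: "continuous_map T euclideanreal F" unfolding F_def using continuous_integral[OF cG \<eta>] by simp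
    \<comment> \<open>Average over \<open>w\<close> inside the \<open>\<eta>\<close>-integral, which \<open>inv\<close> allows, and interchange the integrals.\<close>
    have mean: "F x = (\<integral>w. F (w \<otimes>\<^bsub>\<Gamma>\<^esub> x) \<partial>\<nu>)" if x: "x \<in> topspace T" for x
    proof -
      have cfx: "continuous_map T euclideanreal (\<lambda>y. f (y \<otimes>\<^bsub>\<Gamma>\<^esub> x))" by (intro ccomp[OF f] cmult cid cconst x)
      have "F x = (\<integral>y. A (\<lambda>y. f (y \<otimes>\<^bsub>\<Gamma>\<^esub> x)) y \<partial>\<eta>)" unfolding F_def by (rule inv[OF cfx, symmetric])
      also have "\<dots> = (\<integral>y. (\<integral>w. f (y \<otimes>\<^bsub>\<Gamma>\<^esub> w \<otimes>\<^bsub>\<Gamma>\<^esub> x) \<partial>\<nu>) \<partial>\<eta>)" by (simp add: A_def)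
      also have "\<dots> = (\<integral>w. (\<integral>y. f (y \<otimes>\<^bsub>\<Gamma>\<^esub> w \<otimes>\<^bsub>\<Gamma>\<^esub> x) \<partial>\<eta>) \<partial>\<nu>)"
      proof -
        have "continuous_map (prod_topology T T) euclideanreal (\<lambda>p. f (fst p \<otimes>\<^bsub>\<Gamma>\<^esub> snd p \<otimes>\<^bsub>\<Gamma>\<^esub> x))"
          by (intro ccomp[OF f] cmult cfst csnd cconst x)
        from integral_swap(1)[OF this \<eta> \<nu>] show ?thesis by simp
      qed
      also have "\<dots> = (\<integral>w. F (w \<otimes>\<^bsub>\<Gamma>\<^esub> x) \<partial>\<nu>)" unfolding F_def
        using x borel_probD(3)[OF \<eta>] borel_probD(3)[OF \<nu>]
        by (intro Bochner_Integration.integral_cong refl) (simp add: m_assoc carrier_eq)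
      finally show ?thesis .
    qed
    obtain x where x: "x \<in> topspace T" "\<forall>y\<in>topspace T. F y \<le> F x" using attains_max[OF cFF] by blast
    have cFx: "continuous_map T euclideanreal (\<lambda>w. F (w \<otimes>\<^bsub>\<Gamma>\<^esub> x))" by (intro ccomp[OF cFF] cmult cid cconst x)
    have "\<forall>w\<in>topspace T. F x - F (w \<otimes>\<^bsub>\<Gamma>\<^esub> x) = 0"
    proof (rule full)
      show "continuous_map T euclideanreal (\<lambda>w. F x - F (w \<otimes>\<^bsub>\<Gamma>\<^esub> x))" by (intro continuous_map_diff cFx) simp
      show "\<forall>w\<in>topspace T. 0 \<le> F x - F (w \<otimes>\<^bsub>\<Gamma>\<^esub> x)" using x by simp
      show "(\<integral>w. F x - F (w \<otimes>\<^bsub>\<Gamma>\<^esub> x) \<partial>\<nu>) = 0"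
        using mean[OF x(1)] continuous_integrable[OF \<nu> cFx] by (simp add: nu.prob_space)
    qed
    then have const: "F y = F x" if y: "y \<in> topspace T" for y
    proof -
      have "y \<otimes>\<^bsub>\<Gamma>\<^esub> inv\<^bsub>\<Gamma>\<^esub> x \<otimes>\<^bsub>\<Gamma>\<^esub> x = y" using x(1) y by (simp add: m_assoc carrier_eq)
      moreover have "y \<otimes>\<^bsub>\<Gamma>\<^esub> inv\<^bsub>\<Gamma>\<^esub> x \<in> topspace T" using x(1) y by simp
      ultimately show ?thesis using bspec[OF \<open>\<forall>w\<in>topspace T. F x - F (w \<otimes>\<^bsub>\<Gamma>\<^esub> x) = 0\<close>, of "y \<otimes>\<^bsub>\<Gamma>\<^esub> inv\<^bsub>\<Gamma>\<^esub> x"] by simp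
    qed
    have "F \<one>\<^bsub>\<Gamma>\<^esub> = (\<integral>y. f y \<partial>\<eta>)" unfolding F_def
      using borel_probD(3)[OF \<eta>] by (intro Bochner_Integration.integral_cong refl) (simp add: carrier_eq)
    then show ?thesis using const[OF a] const[OF one_in] by (simp add: F_def)
  qed
  have full_eta: "\<forall>x\<in>topspace T. f x = 0"
    if f: "continuous_map T euclideanreal f" "\<forall>x\<in>topspace T. 0 \<le> f x" "(\<integral>y. f y \<partial>\<eta>) = 0" for f
  proof (rule ccontr)
    assume "\<not> ?thesis"
    then obtain x where x: "x \<in> topspace T" "f x \<noteq> 0" by blast
    have pos: "A f y > 0" if y: "y \<in> topspace T" for y
    proof -
      have c: "continuous_map T euclideanreal (\<lambda>w. f (y \<otimes>\<^bsub>\<Gamma>\<^esub> w))" by (intro ccomp[OF f(1)] cmult cid cconst y)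
      have "A f y \<noteq> 0"
      proof
        assume "A f y = 0"
        then have "(\<integral>w. f (y \<otimes>\<^bsub>\<Gamma>\<^esub> w) \<partial>\<nu>) = 0" by (simp add: A_def)
        with f(2) y have "\<forall>w\<in>topspace T. f (y \<otimes>\<^bsub>\<Gamma>\<^esub> w) = 0" by (intro full[OF c]) auto
        then have "f (y \<otimes>\<^bsub>\<Gamma>\<^esub> (inv\<^bsub>\<Gamma>\<^esub> y \<otimes>\<^bsub>\<Gamma>\<^esub> x)) = 0" by (rule bspec) (use x(1) y in simp)
        moreover have "y \<otimes>\<^bsub>\<Gamma>\<^esub> (inv\<^bsub>\<Gamma>\<^esub> y \<otimes>\<^bsub>\<Gamma>\<^esub> x) = y \<otimes>\<^bsub>\<Gamma>\<^esub> inv\<^bsub>\<Gamma>\<^esub> y \<otimes>\<^bsub>\<Gamma>\<^esub> x"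
          by (rule m_assoc[symmetric]) (use x(1) y in \<open>simp_all add: carrier_eq\<close>)
        ultimately show False using x y by (simp add: carrier_eq)
      qed
      moreover have "A f y \<ge> 0" unfolding A_def
        by (rule integral_nonneg_AE, rule AE_I2) (use f(2) y borel_probD(3)[OF \<nu>] in simp)
      ultimately show ?thesis by simp
    qed
    have "(\<integral>y. A f y \<partial>\<eta>) = 0" using inv[OF f(1)] f(3) by simp
    moreover have "integrable \<eta> (A f)" by (rule continuous_integrable[OF \<eta> cA[OF f(1)]])
    moreover have "AE y in \<eta>. 0 \<le> A f y" by (rule AE_I2) (use pos borel_probD(3)[OF \<eta>] in force)
    ultimately have "AE y in \<eta>. A f y = 0" using integral_nonneg_eq_0_iff_AE by blast
    then have "AE y in \<eta>. False" using AE_space by eventually_elim (use pos borel_probD(3)[OF \<eta>] in force)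
    then show False by simp
  qed
  show ?thesis using \<eta> right full_eta by blast
qed

end

section \<open>Convolution operators and their eigenfunctions\<close>

text \<open>
  Invariance is assumed only for integrals of continuous functions. Full support makes \<open>ip\<close> below an inner product on
  continuous functions, so that the spectral argument runs inside this incomplete space and no space of
  square integrable functions has to be formed.
\<close>

locale Haar_group = compact_group T \<Gamma> for T :: "'a topology" and \<Gamma> :: "'a monoid" +
  fixes \<eta> :: "'a measure"
  assumes eta: "\<eta> \<in> borel_prob T"
    and right_invariant: "\<And>f a. continuous_map T euclideanreal f \<Longrightarrow> a \<in> topspace T \<Longrightarrow> (\<integral>y. f (y \<otimes>\<^bsub>\<Gamma>\<^esub> a) \<partial>\<eta>) = (\<integral>y. f y \<partial>\<eta>)"
    and full_support: "\<And>f :: 'a \<Rightarrow> real. continuous_map T euclideanreal f \<Longrightarrow> \<forall>x\<in>topspace T. 0 \<le> f x \<Longrightarrow> (\<integral>y. f y \<partial>\<eta>) = 0 \<Longrightarrow> \<forall>x\<in>topspace T. f x = 0"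
begin

sublocale eta: prob_space \<eta> by (rule borel_probD[OF eta])

lemma space_eta: "space \<eta> = topspace T" by (rule borel_probD[OF eta])

abbreviation "cfun f \<equiv> continuous_map T euclideanreal f"

definition ip :: "('a \<Rightarrow> real) \<Rightarrow> ('a \<Rightarrow> real) \<Rightarrow> real" where "ip f g = (\<integral>x. f x * g x \<partial>\<eta>)"

lemma cont_int: "cfun f \<Longrightarrow> integrable \<eta> f" by (rule continuous_integrable[OF eta])

lemma cont_mult: "cfun f \<Longrightarrow> cfun g \<Longrightarrow> cfun (\<lambda>x. f x * g x)" by (rule continuous_map_real_mult)

lemma cont_scale: "cfun f \<Longrightarrow> cfun (\<lambda>x. c * f x)" by (intro cont_mult) auto

lemma cont_lin: "cfun f \<Longrightarrow> cfun g \<Longrightarrow> cfun (\<lambda>x. f x - c * g x)" by (intro continuous_map_diff cont_scale)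

lemma cont_sum: "(\<And>i. i \<in> I \<Longrightarrow> cfun (f i)) \<Longrightarrow> finite I \<Longrightarrow> cfun (\<lambda>x. \<Sum>i\<in>I. f i x)" by (rule continuous_map_sum)

lemma ip_cong: "(\<And>x. x \<in> topspace T \<Longrightarrow> f x = f' x) \<Longrightarrow> (\<And>x. x \<in> topspace T \<Longrightarrow> g x = g' x) \<Longrightarrow> ip f g = ip f' g'"
  unfolding ip_def by (rule Bochner_Integration.integral_cong) (auto simp: space_eta)

lemma ip_commute: "ip f g = ip g f" by (simp add: ip_def mult.commute)

lemma ip_diff_scale: "cfun f \<Longrightarrow> cfun g \<Longrightarrow> cfun h \<Longrightarrow> ip (\<lambda>x. f x - c * g x) h = ip f h - c * ip g h"
  using cont_int[OF cont_mult, of f h] cont_int[OF cont_mult, of g h]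
  by (simp add: ip_def left_diff_distrib mult.assoc)

lemma ip_scale: "ip (\<lambda>x. c * f x) h = c * ip f h" by (simp add: ip_def mult.assoc)

lemma ip_scale2: "ip h (\<lambda>x. c * f x) = c * ip h f" by (simp add: ip_def mult.left_commute)

lemma ip_sum: "(\<And>i. i \<in> I \<Longrightarrow> cfun (f i)) \<Longrightarrow> cfun h \<Longrightarrow> ip (\<lambda>x. \<Sum>i\<in>I. c i * f i x) h = (\<Sum>i\<in>I. c i * ip (f i) h)"
proof -
  assume f: "\<And>i. i \<in> I \<Longrightarrow> cfun (f i)" and h: "cfun h"
  have "ip (\<lambda>x. \<Sum>i\<in>I. c i * f i x) h = (\<integral>x. (\<Sum>i\<in>I. c i * (f i x * h x)) \<partial>\<eta>)"
    by (simp add: ip_def sum_distrib_right mult.assoc)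
  also have "\<dots> = (\<Sum>i\<in>I. c i * (\<integral>x. f i x * h x \<partial>\<eta>))"
    by (subst Bochner_Integration.integral_sum) (auto intro!: integrable_mult_right cont_int cont_mult f h)
  finally show ?thesis by (simp add: ip_def)
qed

lemma ip_nonneg: "0 \<le> ip f f" unfolding ip_def by (rule integral_nonneg_AE) simp

lemma ip_zero: "cfun f \<Longrightarrow> ip f f = 0 \<Longrightarrow> x \<in> topspace T \<Longrightarrow> f x = 0"
proof -
  assume f: "cfun f" and z: "ip f f = 0" and x: "x \<in> topspace T"
  have "\<forall>x\<in>topspace T. f x * f x = 0"
  proof (rule full_support[OF cont_mult[OF f f]])
    show "\<forall>x\<in>topspace T. 0 \<le> f x * f x" by simp
    show "(\<integral>x. f x * f x \<partial>\<eta>) = 0" using z by (simp only: ip_def)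
  qed
  then show "f x = 0" using x by fastforce
qed

lemma ip_self_diff: "cfun f \<Longrightarrow> cfun g \<Longrightarrow> ip (\<lambda>x. f x - c * g x) (\<lambda>x. f x - c * g x) = ip f f - 2 * c * ip f g + c\<^sup>2 * ip g g"
proof -
  assume f: "cfun f" and g: "cfun g"
  note l = cont_lin[OF f g, of c]
  have "ip (\<lambda>x. f x - c * g x) (\<lambda>x. f x - c * g x) = ip f (\<lambda>x. f x - c * g x) - c * ip g (\<lambda>x. f x - c * g x)"
    by (rule ip_diff_scale[OF f g l])
  also have "ip f (\<lambda>x. f x - c * g x) = ip f f - c * ip g f"
    using ip_diff_scale[OF f g f, of c] ip_commute[of f "\<lambda>x. f x - c * g x"] by simp
  also have "ip g (\<lambda>x. f x - c * g x) = ip f g - c * ip g g"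
    using ip_diff_scale[OF f g g, of c] ip_commute[of g "\<lambda>x. f x - c * g x"] by simp
  finally show ?thesis using ip_commute[of g f] by (simp add: algebra_simps power2_eq_square)
qed

lemma Cauchy_Schwarz:
  assumes f: "cfun f" and g: "cfun g" shows "(ip f g)\<^sup>2 \<le> ip f f * ip g g"
proof (cases "ip g g = 0")
  case True
  have "ip f g = ip f (\<lambda>_. 0)" by (rule ip_cong) (use ip_zero[OF g True] in auto)
  then show ?thesis using True by (simp add: ip_def)
next
  case False
  then have pos: "ip g g > 0" using ip_nonneg[of g] by simp
  have "0 \<le> ip f f - 2 * (ip f g / ip g g) * ip f g + (ip f g / ip g g)\<^sup>2 * ip g g"
    using ip_nonneg[of "\<lambda>x. f x - ip f g / ip g g * g x"] ip_self_diff[OF f g, of "ip f g / ip g g"] by linarith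
  also have "\<dots> = ip f f - (ip f g)\<^sup>2 / ip g g" using pos by (simp add: power2_eq_square)
  finally show ?thesis using pos by (simp add: field_simps)
qed

definition translate :: "'a \<Rightarrow> ('a \<Rightarrow> real) \<Rightarrow> 'a \<Rightarrow> real" where "translate a f x = f (x \<otimes>\<^bsub>\<Gamma>\<^esub> a)"

lemma cont_trans: "cfun f \<Longrightarrow> a \<in> topspace T \<Longrightarrow> cfun (translate a f)"
  unfolding translate_def by (rule ccomp[OF _ cmult[OF cid cconst]])

lemma ip_trans: "cfun f \<Longrightarrow> cfun g \<Longrightarrow> a \<in> topspace T \<Longrightarrow> ip (translate a f) (translate a g) = ip f g"
  unfolding ip_def translate_def using right_invariant[OF cont_mult] by simp

end

text \<open>
  Convolution with \<open>\<kappa>\<close> commutes with right translations, and it is symmetric since \<open>\<kappa>\<close> is invariant under inversion. Its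
  eigenspaces are therefore invariant under translations.
\<close>

locale convolution = Haar_group T \<Gamma> \<eta> for T :: "'a topology" and \<Gamma> :: "'a monoid" and \<eta> :: "'a measure" +
  fixes \<kappa> :: "'a \<Rightarrow> real"
  assumes kappa: "continuous_map T euclideanreal \<kappa>" and kappa_inv: "\<And>x. x \<in> topspace T \<Longrightarrow> \<kappa> (inv\<^bsub>\<Gamma>\<^esub> x) = \<kappa> x"
begin

definition cop :: "('a \<Rightarrow> real) \<Rightarrow> 'a \<Rightarrow> real" where "cop f x = (\<integral>y. \<kappa> (x \<otimes>\<^bsub>\<Gamma>\<^esub> inv\<^bsub>\<Gamma>\<^esub> y) * f y \<partial>\<eta>)"

definition ker :: "'a \<Rightarrow> 'a \<Rightarrow> real" where "ker x y = \<kappa> (x \<otimes>\<^bsub>\<Gamma>\<^esub> inv\<^bsub>\<Gamma>\<^esub> y)"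

lemma op_ker: "cop f x = ip (ker x) f" by (simp add: cop_def ip_def ker_def)

lemma cont_ker: "x \<in> topspace T \<Longrightarrow> cfun (ker x)" unfolding ker_def by (intro ccomp[OF kappa] cmult cinv cid cconst)

lemma ker_sym: "x \<in> topspace T \<Longrightarrow> y \<in> topspace T \<Longrightarrow> ker x y = ker y x"
  using kappa_inv[of "x \<otimes>\<^bsub>\<Gamma>\<^esub> inv\<^bsub>\<Gamma>\<^esub> y"] by (simp add: ker_def inv_mult_group carrier_eq)

lemma cont_ker2: "continuous_map (prod_topology T T) euclideanreal (\<lambda>p. ker (snd p) (fst p))"
  unfolding ker_def by (intro ccomp[OF kappa] cmult cinv cfst csnd)

lemma cont_op: "cfun f \<Longrightarrow> cfun (cop f)"
proof -
  assume f: "cfun f"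
  have "continuous_map (prod_topology T T) euclideanreal (\<lambda>p. ker (snd p) (fst p) * f (fst p))"
    by (intro continuous_map_real_mult cont_ker2 ccomp[OF f] cfst)
  from continuous_integral[OF this eta] show ?thesis by (simp add: cop_def[abs_def] ker_def)
qed

lemma op_cong: "(\<And>x. x \<in> topspace T \<Longrightarrow> f x = g x) \<Longrightarrow> cop f x = cop g x"
  unfolding op_ker by (rule ip_cong) auto

lemma op_diff_scale: "cfun f \<Longrightarrow> cfun g \<Longrightarrow> x \<in> topspace T \<Longrightarrow> cop (\<lambda>x. f x - c * g x) x = cop f x - c * cop g x"
  using ip_diff_scale[of f g "ker x" c] cont_ker[of x] ip_commute[of f "ker x"] ip_commute[of g "ker x"]
    ip_commute[of "\<lambda>x. f x - c * g x" "ker x"] by (simp only: op_ker)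

lemma op_sym: "cfun f \<Longrightarrow> cfun g \<Longrightarrow> ip (cop f) g = ip f (cop g)"
proof -
  assume f: "cfun f" and g: "cfun g"
  let ?F = "\<lambda>p. f (fst p) * (ker (snd p) (fst p) * g (snd p))"
  have F: "continuous_map (prod_topology T T) euclideanreal ?F"
    by (intro continuous_map_real_mult cont_ker2 ccomp[OF f] ccomp[OF g] cfst csnd)
  have "ip (cop f) g = (\<integral>y. (\<integral>x. ?F (x, y) \<partial>\<eta>) \<partial>\<eta>)"
    unfolding ip_def op_ker
  proof (rule Bochner_Integration.integral_cong[OF refl])
    fix y
    have "(\<integral>x. ?F (x, y) \<partial>\<eta>) = (\<integral>x. ker y x * f x * g y \<partial>\<eta>)"
      by (rule Bochner_Integration.integral_cong[OF refl]) (simp add: ac_simps)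
    then show "(\<integral>x. ker y x * f x \<partial>\<eta>) * g y = (\<integral>x. ?F (x, y) \<partial>\<eta>)" by simp
  qed
  also have "\<dots> = (\<integral>x. (\<integral>y. ?F (x, y) \<partial>\<eta>) \<partial>\<eta>)" by (rule integral_swap(1)[OF F eta eta, symmetric])
  also have "\<dots> = ip f (cop g)" unfolding ip_def op_ker
  proof (rule Bochner_Integration.integral_cong[OF refl])
    fix x assume "x \<in> space \<eta>"
    then have x: "x \<in> topspace T" by (simp add: space_eta)
    have "(\<integral>y. ?F (x, y) \<partial>\<eta>) = f x * (\<integral>y. ker y x * g y \<partial>\<eta>)" by simp
    also have "(\<integral>y. ker y x * g y \<partial>\<eta>) = (\<integral>y. ker x y * g y \<partial>\<eta>)"
      by (rule Bochner_Integration.integral_cong[OF refl]) (use ker_sym x in \<open>simp add: space_eta\<close>)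
    finally show "(\<integral>y. ?F (x, y) \<partial>\<eta>) = f x * (\<integral>y. ker x y * g y \<partial>\<eta>)" .
  qed
  finally show ?thesis .
qed

lemma op_trans:
  assumes f: "cfun f" and a: "a \<in> topspace T" and x: "x \<in> topspace T"
  shows "cop (translate a f) x = translate a (cop f) x"
proof -
  have "translate a (cop f) x = (\<integral>y. ker (x \<otimes>\<^bsub>\<Gamma>\<^esub> a) y * f y \<partial>\<eta>)" by (simp add: translate_def op_ker ip_def)
  also have "\<dots> = (\<integral>y. ker (x \<otimes>\<^bsub>\<Gamma>\<^esub> a) (y \<otimes>\<^bsub>\<Gamma>\<^esub> a) * f (y \<otimes>\<^bsub>\<Gamma>\<^esub> a) \<partial>\<eta>)"
    using right_invariant[OF cont_mult[OF cont_ker f] a, of "x \<otimes>\<^bsub>\<Gamma>\<^esub> a"] a x by simp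
  also have "\<dots> = (\<integral>y. ker x y * f (y \<otimes>\<^bsub>\<Gamma>\<^esub> a) \<partial>\<eta>)"
  proof (rule Bochner_Integration.integral_cong[OF refl])
    fix y assume "y \<in> space \<eta>"
    then have y: "y \<in> topspace T" by (simp add: space_eta)
    have "x \<otimes>\<^bsub>\<Gamma>\<^esub> a \<otimes>\<^bsub>\<Gamma>\<^esub> inv\<^bsub>\<Gamma>\<^esub> (y \<otimes>\<^bsub>\<Gamma>\<^esub> a) = x \<otimes>\<^bsub>\<Gamma>\<^esub> (a \<otimes>\<^bsub>\<Gamma>\<^esub> inv\<^bsub>\<Gamma>\<^esub> a) \<otimes>\<^bsub>\<Gamma>\<^esub> inv\<^bsub>\<Gamma>\<^esub> y"
      using x y a by (simp only: inv_mult_group carrier_eq m_assoc m_closed inv_closed mult_in inv_in)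
    also have "\<dots> = x \<otimes>\<^bsub>\<Gamma>\<^esub> inv\<^bsub>\<Gamma>\<^esub> y" using x y a by (simp add: carrier_eq)
    finally show "ker (x \<otimes>\<^bsub>\<Gamma>\<^esub> a) (y \<otimes>\<^bsub>\<Gamma>\<^esub> a) * f (y \<otimes>\<^bsub>\<Gamma>\<^esub> a) = ker x y * f (y \<otimes>\<^bsub>\<Gamma>\<^esub> a)" by (simp add: ker_def)
  qed
  also have "\<dots> = cop (translate a f) x" by (simp add: translate_def op_ker ip_def)
  finally show ?thesis by simp
qed

lemma ex_bound: "\<exists>c>0. \<forall>x\<in>topspace T. ip (ker x) (ker x) \<le> c"
proof -
  obtain b where b: "\<And>x. x \<in> topspace T \<Longrightarrow> norm (\<kappa> x) \<le> b" "b > 0" using continuous_bounded[OF kappa] by blast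
  have "ip (ker x) (ker x) \<le> b * b" if x: "x \<in> topspace T" for x
  proof -
    have "ker x y * ker x y \<le> b * b" if y: "y \<in> topspace T" for y
    proof -
      have "\<bar>ker x y\<bar> \<le> b" using b(1)[of "x \<otimes>\<^bsub>\<Gamma>\<^esub> inv\<^bsub>\<Gamma>\<^esub> y"] x y by (simp add: ker_def)
      then have "\<bar>ker x y\<bar> * \<bar>ker x y\<bar> \<le> b * b" by (intro mult_mono) (use b in auto)
      then show ?thesis by simp
    qed
    then show ?thesis unfolding ip_def
      by (intro eta.integral_le_const cont_int cont_mult cont_ker x AE_I2) (simp add: space_eta)
  qed
  then show ?thesis using b(2) by (intro exI[of _ "b * b"]) simp
qed

definition bnd :: real where "bnd = (SOME c. c > 0 \<and> (\<forall>x\<in>topspace T. ip (ker x) (ker x) \<le> c))"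

lemma bnd: "bnd > 0" "x \<in> topspace T \<Longrightarrow> ip (ker x) (ker x) \<le> bnd"
  using someI_ex[OF ex_bound] unfolding bnd_def by auto

lemma op_bound: "cfun f \<Longrightarrow> x \<in> topspace T \<Longrightarrow> (cop f x)\<^sup>2 \<le> bnd * ip f f"
  unfolding op_ker
  by (rule order_trans[OF Cauchy_Schwarz[OF cont_ker] mult_right_mono[OF bnd(2) ip_nonneg]])

lemma op_norm_bound: "cfun f \<Longrightarrow> ip (cop f) (cop f) \<le> bnd * ip f f"
  using op_bound[of f] unfolding ip_def[of "cop f"]
  by (intro eta.integral_le_const cont_int cont_mult cont_op AE_I2) (simp_all add: space_eta power2_eq_square)

text \<open>
  The Cauchy-Schwarz inequality bounds \<open>cop f y - cop f x\<close> by the distance of the kernels at \<open>y\<close> and \<open>x\<close>, uniformly over the unit ball.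
\<close>

lemma op_equicontinuous:
  assumes x: "x \<in> topspace T" and e: "e > 0"
  shows "\<exists>V. openin T V \<and> x \<in> V \<and> (\<forall>f. cfun f \<longrightarrow> ip f f \<le> 1 \<longrightarrow> (\<forall>y\<in>V. \<bar>cop f y - cop f x\<bar> \<le> e))"
proof -
  obtain V where V: "openin T V" "x \<in> V" "\<forall>y\<in>V. \<forall>w\<in>topspace T. \<bar>ker y w - ker x w\<bar> \<le> e"
    using uniform_neighbourhood[OF cont_ker2 x e] by auto
  have "\<bar>cop f y - cop f x\<bar> \<le> e" if f: "cfun f" "ip f f \<le> 1" and y: "y \<in> V" for f y
  proof -
    have yT: "y \<in> topspace T" using openin_subset[OF V(1)] y by blast
    let ?d = "\<lambda>w. ker y w - 1 * ker x w"
    have cd: "cfun ?d" by (intro cont_lin cont_ker yT x)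
    have "cop f y - cop f x = ip ?d f" unfolding op_ker using ip_diff_scale[OF cont_ker[OF yT] cont_ker[OF x] f(1), of 1] by simp
    moreover have "ip ?d ?d \<le> e * e" unfolding ip_def
    proof (intro eta.integral_le_const cont_int cont_mult cd AE_I2)
      fix w assume "w \<in> space \<eta>"
      then have "\<bar>ker y w - ker x w\<bar> \<le> e" using V(3) y by (simp add: space_eta)
      then have "\<bar>ker y w - ker x w\<bar> * \<bar>ker y w - ker x w\<bar> \<le> e * e" by (intro mult_mono) (use e in auto)
      then show "?d w * ?d w \<le> e * e" by simp
    qed
    then have "(ip ?d f)\<^sup>2 \<le> (e * e) * 1"
      using e f(2) ip_nonneg[of f] by (intro order_trans[OF Cauchy_Schwarz[OF cd f(1)]] mult_mono) auto
    ultimately have "(cop f y - cop f x)\<^sup>2 \<le> e\<^sup>2" by (simp add: power2_eq_square)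
    then show ?thesis using e abs_le_square_iff[of "cop f y - cop f x" e] by simp
  qed
  then show ?thesis using V by blast
qed

text \<open>
  The argument of Arzela and Ascoli: a subsequence converges on a countable dense set, and equicontinuity extends the
  convergence and the continuity of the limit to all points.
\<close>

lemma op_relatively_compact:
  assumes f: "\<And>n. cfun (f n)" "\<And>n. ip (f n) (f n) \<le> 1"
  obtains r h where "strict_mono (r :: nat \<Rightarrow> nat)" "cfun h" "\<And>x. x \<in> topspace T \<Longrightarrow> (\<lambda>n. cop (f (r n)) x) \<longlonglongrightarrow> h x"
proof -
  obtain z :: "nat \<Rightarrow> 'a" where z: "\<And>i. z i \<in> topspace T" "\<And>V. openin T V \<Longrightarrow> V \<noteq> {} \<Longrightarrow> \<exists>i. z i \<in> V"
    using ex_dense_sequence[OF nonempty] by blast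
  have ob: "(cop (f n) x)\<^sup>2 \<le> bnd" if "x \<in> topspace T" for n x
  proof -
    have "(cop (f n) x)\<^sup>2 \<le> bnd * ip (f n) (f n)" by (rule op_bound[OF f(1) that])
    also have "\<dots> \<le> bnd * 1" using f(2) bnd(1) by (intro mult_left_mono) auto
    finally show ?thesis by simp
  qed
  have "\<bar>cop (f n) x\<bar> \<le> sqrt bnd" if "x \<in> topspace T" for n x
    using ob[OF that, of n] real_le_rsqrt[of "\<bar>cop (f n) x\<bar>" bnd] by simp
  then have "bounded (range (\<lambda>n. cop (f n) (z i)))" for i by (intro boundedI[of _ "sqrt bnd"]) (use z(1) in auto)
  then have bz: "bounded (range (\<lambda>n. (\<lambda>n i. cop (f n) (z i)) n i))" for i by simp
  obtain r l where r: "strict_mono (r :: nat \<Rightarrow> nat)" and l: "\<And>i. (\<lambda>n. cop (f (r n)) (z i)) \<longlonglongrightarrow> l i"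
    by (rule bounded_pointwise_convergent_subseq[of "\<lambda>n i. cop (f n) (z i)", OF bz], rule that)
  have "Cauchy (\<lambda>n. cop (f (r n)) x)" if x: "x \<in> topspace T" for x
  proof (rule metric_CauchyI)
    fix e :: real assume e: "e > 0"
    obtain V where V: "openin T V" "x \<in> V" "\<forall>f. cfun f \<longrightarrow> ip f f \<le> 1 \<longrightarrow> (\<forall>y\<in>V. \<bar>cop f y - cop f x\<bar> \<le> e/4)"
      using op_equicontinuous[OF x, of "e/4"] e by auto
    obtain i where i: "z i \<in> V" using z(2)[OF V(1)] V(2) by blast
    have "Cauchy (\<lambda>n. cop (f (r n)) (z i))" using l by (rule LIMSEQ_imp_Cauchy)
    from metric_CauchyD[OF this, of "e/4"] e obtain N where
      N: "\<forall>m\<ge>N. \<forall>n\<ge>N. dist (cop (f (r m)) (z i)) (cop (f (r n)) (z i)) < e/4" by auto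
    have close: "\<bar>cop (f (r n)) (z i) - cop (f (r n)) x\<bar> \<le> e/4" for n using V(3) f i by blast
    show "\<exists>M. \<forall>m\<ge>M. \<forall>n\<ge>M. dist (cop (f (r m)) x) (cop (f (r n)) x) < e"
    proof (intro exI[of _ N] allI impI)
      fix m n assume "N \<le> m" "N \<le> n"
      then have "\<bar>cop (f (r m)) (z i) - cop (f (r n)) (z i)\<bar> < e/4" using N by (simp add: dist_real_def)
      then show "dist (cop (f (r m)) x) (cop (f (r n)) x) < e" using close[of m] close[of n] e unfolding dist_real_def by linarith
    qed
  qed
  then have conv: "(\<lambda>n. cop (f (r n)) x) \<longlonglongrightarrow> lim (\<lambda>n. cop (f (r n)) x)" if "x \<in> topspace T" for x
    using that by (simp add: convergent_LIMSEQ_iff[symmetric] Cauchy_convergent_iff)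
  have "cfun (\<lambda>x. lim (\<lambda>n. cop (f (r n)) x))"
  proof (rule continuous_map_realI)
    fix x and e :: real assume x: "x \<in> topspace T" and e: "e > 0"
    obtain V where V: "openin T V" "x \<in> V" "\<forall>f. cfun f \<longrightarrow> ip f f \<le> 1 \<longrightarrow> (\<forall>y\<in>V. \<bar>cop f y - cop f x\<bar> \<le> e)"
      using op_equicontinuous[OF x e] by blast
    have "\<bar>lim (\<lambda>n. cop (f (r n)) y) - lim (\<lambda>n. cop (f (r n)) x)\<bar> \<le> e" if y: "y \<in> V" for y
    proof (rule LIMSEQ_le_const2)
      have "y \<in> topspace T" using openin_subset[OF V(1)] y by blast
      then show "(\<lambda>n. \<bar>cop (f (r n)) y - cop (f (r n)) x\<bar>) \<longlonglongrightarrow> \<bar>lim (\<lambda>n. cop (f (r n)) y) - lim (\<lambda>n. cop (f (r n)) x)\<bar>"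
        by (intro tendsto_rabs tendsto_diff conv x)
      show "\<exists>N. \<forall>n\<ge>N. \<bar>cop (f (r n)) y - cop (f (r n)) x\<bar> \<le> e" using V(3) f y by blast
    qed
    then show "\<exists>V. openin T V \<and> x \<in> V \<and> (\<forall>y\<in>V. \<bar>lim (\<lambda>n. cop (f (r n)) y) - lim (\<lambda>n. cop (f (r n)) x)\<bar> \<le> e)"
      using V by blast
  qed
  then show ?thesis by (rule that[OF r _ conv])
qed

lemma ip_limit:
  assumes f: "\<And>n. cfun (f n)" "\<And>x. x \<in> topspace T \<Longrightarrow> (\<lambda>n. f n x) \<longlonglongrightarrow> f' x" "cfun f'"
    and g: "\<And>n. cfun (g n)" "\<And>x. x \<in> topspace T \<Longrightarrow> (\<lambda>n. g n x) \<longlonglongrightarrow> g' x" "cfun g'"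
    and b: "\<And>n x. x \<in> topspace T \<Longrightarrow> \<bar>f n x\<bar> \<le> b" "\<And>n x. x \<in> topspace T \<Longrightarrow> \<bar>g n x\<bar> \<le> c"
  shows "(\<lambda>n. ip (f n) (g n)) \<longlonglongrightarrow> ip f' g'"
  unfolding ip_def
proof (rule integral_dominated_convergence[where w = "\<lambda>_. b * c"])
  show "(\<lambda>x. f' x * g' x) \<in> borel_measurable \<eta>" using cont_int[OF cont_mult[OF f(3) g(3)]] by auto
  show "(\<lambda>x. f n x * g n x) \<in> borel_measurable \<eta>" for n using cont_int[OF cont_mult[OF f(1) g(1)]] by auto
  show "AE x in \<eta>. (\<lambda>n. f n x * g n x) \<longlonglongrightarrow> f' x * g' x" by (rule AE_I2) (intro tendsto_mult f(2) g(2); simp add: space_eta)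
  show "AE x in \<eta>. norm (f n x * g n x) \<le> b * c" for n
    by (rule AE_I2) (use b in \<open>auto simp: space_eta abs_mult intro!: mult_mono' \<close>)
qed simp

text \<open>
  The spectral theorem for one eigenvalue of the compact symmetric operator \<open>cop\<close>, restricted to the orthogonal complement \<open>N\<close> of the
  functions fixed by translation with \<open>x0\<close>. The operator preserves \<open>N\<close> and is nonzero on it, so the supremum \<open>L\<close> of
  \<open>ip (cop f) (cop f)\<close> over the unit ball of \<open>N\<close> is positive. A limit \<open>h\<close> of \<open>cop f\<close> along a
  maximizing sequence satisfies \<open>cop (cop h) = L * h\<close>. It is not fixed, since it is orthogonal to all fixed
  functions and has norm \<open>sqrt L\<close>. Working with the square of the operator avoids the sign of the eigenvalue.
\<close>

lemma ex_eigenfunction: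
  assumes x0: "x0 \<in> topspace T" and f0: "cfun f0" and moved: "\<exists>x\<in>topspace T. cop f0 (x \<otimes>\<^bsub>\<Gamma>\<^esub> x0) \<noteq> cop f0 x"
  shows "\<exists>L h. L > 0 \<and> cfun h \<and> (\<forall>x\<in>topspace T. cop (cop h) x = L * h x) \<and> (\<exists>x\<in>topspace T. h (x \<otimes>\<^bsub>\<Gamma>\<^esub> x0) \<noteq> h x)"
proof -
  define fixd where "fixd v \<longleftrightarrow> cfun v \<and> (\<forall>x\<in>topspace T. translate x0 v x = v x)" for v
  define N where "N f \<longleftrightarrow> cfun f \<and> (\<forall>v. fixd v \<longrightarrow> ip f v = 0)" for f
  have Nc: "cfun f" if "N f" for f using that by (simp add: N_def)
  have fix_op: "fixd (cop v)" if "fixd v" for v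
  proof -
    have v: "cfun v" "\<And>x. x \<in> topspace T \<Longrightarrow> translate x0 v x = v x" using that by (simp_all add: fixd_def)
    have "translate x0 (cop v) x = cop v x" if "x \<in> topspace T" for x
      using op_trans[OF v(1) x0 that] op_cong[of "translate x0 v" v x] v(2) by simp
    then show ?thesis using cont_op[OF v(1)] by (simp add: fixd_def)
  qed
  have N_op: "N (cop f)" if "N f" for f
    using that fix_op unfolding N_def by (auto simp: cont_op op_sym fixd_def)
  have N_scale: "N (\<lambda>x. c * f x)" if "N f" for f c using that by (simp add: N_def cont_scale ip_scale)
  define f1 where "f1 = (\<lambda>x. f0 x - 1 * translate x0 f0 x)"
  have N1: "N f1" unfolding N_def
  proof (intro conjI allI impI)
    show "cfun f1" unfolding f1_def by (intro cont_lin f0 cont_trans x0)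
    fix v assume v: "fixd v"
    have "ip f1 v = ip f0 v - ip (translate x0 f0) v"
      unfolding f1_def using ip_diff_scale[OF f0 cont_trans[OF f0 x0], of v 1] v by (simp add: fixd_def)
    also have "ip (translate x0 f0) v = ip (translate x0 f0) (translate x0 v)" by (rule ip_cong) (use v in \<open>auto simp: fixd_def\<close>)
    also have "\<dots> = ip f0 v" using v by (intro ip_trans f0 x0) (simp add: fixd_def)
    finally show "ip f1 v = 0" by simp
  qed
  have op1: "ip (cop f1) (cop f1) > 0"
  proof (rule ccontr)
    assume "\<not> ?thesis"
    then have "ip (cop f1) (cop f1) = 0" using ip_nonneg[of "cop f1"] by simp
    then have "cop f1 x = 0" if "x \<in> topspace T" for x using ip_zero[OF cont_op[OF Nc[OF N1]]] that by blast
    moreover have "cop f1 x = cop f0 x - cop f0 (x \<otimes>\<^bsub>\<Gamma>\<^esub> x0)" if x: "x \<in> topspace T" for x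
      unfolding f1_def using op_diff_scale[OF f0 cont_trans[OF f0 x0] x, of 1] op_trans[OF f0 x0 x] by (simp add: translate_def)
    ultimately show False using moved by auto
  qed
  let ?S = "{ip (cop f) (cop f) | f. N f \<and> ip f f \<le> 1}"
  define L where "L = Sup ?S"
  have Sb: "bdd_above ?S"
  proof (rule bdd_aboveI[of _ bnd], safe)
    fix f assume f: "N f" "ip f f \<le> 1"
    have "ip (cop f) (cop f) \<le> bnd * ip f f" by (rule op_norm_bound[OF Nc[OF f(1)]])
    also have "\<dots> \<le> bnd * 1" using f(2) bnd(1) by (intro mult_left_mono) auto
    finally show "ip (cop f) (cop f) \<le> bnd" by simp
  qed
  \<comment> \<open>By homogeneity the bound on the unit ball extends to all of \<open>N\<close>.\<close>
  have opL: "ip (cop f) (cop f) \<le> L * ip f f" if f: "N f" for f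
  proof (cases "ip f f = 0")
    case True
    then show ?thesis using op_norm_bound[OF Nc[OF f]] by simp
  next
    case False
    then have pos: "ip f f > 0" using ip_nonneg[of f] by simp
    let ?c = "1 / sqrt (ip f f)"
    have s1: "ip (\<lambda>x. ?c * f x) (\<lambda>x. ?c * f x) = 1" using pos unfolding ip_scale ip_scale2 by simp
    have o: "cop (\<lambda>x. ?c * f x) = (\<lambda>x. ?c * cop f x)" unfolding op_ker ip_scale2 ..
    have "ip (cop (\<lambda>x. ?c * f x)) (cop (\<lambda>x. ?c * f x)) \<in> ?S" by (intro CollectI exI[of _ "\<lambda>x. ?c * f x"] conjI refl N_scale[OF f] eq_refl[OF s1])
    then have "ip (cop (\<lambda>x. ?c * f x)) (cop (\<lambda>x. ?c * f x)) \<le> L" unfolding L_def by (rule cSup_upper[OF _ Sb])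
    moreover have "ip (cop (\<lambda>x. ?c * f x)) (cop (\<lambda>x. ?c * f x)) = ip (cop f) (cop f) / ip f f"
      unfolding o ip_scale ip_scale2 using pos by (simp add: real_sqrt_mult[symmetric])
    ultimately show ?thesis using pos by (simp add: pos_divide_le_eq)
  qed
  have Lpos: "L > 0"
  proof (rule ccontr)
    assume "\<not> L > 0"
    then have "L * ip f1 f1 \<le> 0" using ip_nonneg[of f1] by (simp add: mult_nonpos_nonneg)
    then show False using opL[OF N1] op1 by linarith
  qed
  have Sne: "?S \<noteq> {}" using N_scale[OF N1, of 0] by (auto intro!: exI[of _ "\<lambda>x. 0 * f1 x"] simp: ip_def)
  have "\<forall>n. \<exists>f. N f \<and> ip f f \<le> 1 \<and> L - 1 / real (Suc n) < ip (cop f) (cop f)"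
  proof
    fix n
    have "L - 1 / real (Suc n) < Sup ?S" by (simp add: L_def)
    then show "\<exists>f. N f \<and> ip f f \<le> 1 \<and> L - 1 / real (Suc n) < ip (cop f) (cop f)"
      unfolding less_cSup_iff[OF Sne Sb] by blast
  qed
  from choice[OF this] obtain f where f: "\<And>n :: nat. N (f n)" "\<And>n. ip (f n) (f n) \<le> 1" "\<And>n. L - 1 / real (Suc n) < ip (cop (f n)) (cop (f n))"
    by blast
  obtain r h where r: "strict_mono (r :: nat \<Rightarrow> nat)" and h: "cfun h" and
     lim: "\<And>x. x \<in> topspace T \<Longrightarrow> (\<lambda>n. cop (f (r n)) x) \<longlonglongrightarrow> h x"
    by (rule op_relatively_compact[of f, OF Nc[OF f(1)] f(2)], rule that)
  define u where "u n = cop (f (r n))" for n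
  have u: "cfun (u n)" "N (u n)" for n unfolding u_def using N_op f(1) Nc by blast+
  have ub: "\<bar>u n x\<bar> \<le> sqrt bnd" if x: "x \<in> topspace T" for n x
  proof -
    have "(u n x)\<^sup>2 \<le> bnd * ip (f (r n)) (f (r n))" unfolding u_def by (rule op_bound[OF Nc[OF f(1)] x])
    also have "\<dots> \<le> bnd * 1" using f(2) bnd(1) by (intro mult_left_mono) auto
    finally show ?thesis using real_le_rsqrt[of "\<bar>u n x\<bar>" bnd] by simp
  qed
  have ulim: "(\<lambda>n. u n x) \<longlonglongrightarrow> h x" if "x \<in> topspace T" for x unfolding u_def by (rule lim[OF that])
  have uu: "(\<lambda>n. ip (u n) (u n)) \<longlonglongrightarrow> ip h h" by (rule ip_limit[OF u(1) ulim h u(1) ulim h ub ub])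
  have uL: "(\<lambda>n. ip (u n) (u n)) \<longlonglongrightarrow> L"
  proof (rule tendsto_sandwich)
    show "eventually (\<lambda>n. L - 1 / real (Suc n) \<le> ip (u n) (u n)) sequentially"
    proof (intro always_eventually allI)
      fix n
      have "1 / real (Suc (r n)) \<le> 1 / real (Suc n)" using seq_suble[OF r, of n] by (intro divide_left_mono) auto
      then show "L - 1 / real (Suc n) \<le> ip (u n) (u n)" using f(3)[of "r n"] unfolding u_def by linarith
    qed
    show "eventually (\<lambda>n. ip (u n) (u n) \<le> L) sequentially"
      unfolding u_def L_def by (intro always_eventually allI cSup_upper Sb) (use f in blast)
    have "(\<lambda>n. L - 1 / real (Suc n)) \<longlonglongrightarrow> L - 0" by (intro tendsto_diff tendsto_const LIMSEQ_Suc[OF lim_1_over_n])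
    then show "(\<lambda>n. L - 1 / real (Suc n)) \<longlonglongrightarrow> L" by simp
  qed simp
  have hh: "ip h h = L" using LIMSEQ_unique[OF uu uL] .
  have uop: "(\<lambda>n. cop (u n) x) \<longlonglongrightarrow> cop h x" if x: "x \<in> topspace T" for x
  proof -
    obtain b where b: "\<And>y. y \<in> topspace T \<Longrightarrow> norm (ker x y) \<le> b" using continuous_bounded[OF cont_ker[OF x]] by blast
    show ?thesis unfolding op_ker
      by (rule ip_limit[of "\<lambda>_. ker x" "ker x" u h b "sqrt bnd"]) (use cont_ker[OF x] u(1) ulim h ub b in auto)
  qed
  have opb: "\<bar>cop (u n) x\<bar> \<le> sqrt (bnd * bnd)" if x: "x \<in> topspace T" for n x
  proof -
    have "ip (u n) (u n) \<le> bnd * ip (f (r n)) (f (r n))" unfolding u_def by (rule op_norm_bound[OF Nc[OF f(1)]])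
    also have "\<dots> \<le> bnd * 1" using f(2) bnd(1) by (intro mult_left_mono) auto
    finally have "bnd * ip (u n) (u n) \<le> bnd * bnd" using bnd(1) by simp
    then have "(cop (u n) x)\<^sup>2 \<le> bnd * bnd" using op_bound[OF u(1) x, of n] by linarith
    then show ?thesis using real_le_rsqrt[of "\<bar>cop (u n) x\<bar>" "bnd * bnd"] by simp
  qed
  have uopop: "(\<lambda>n. cop (cop (u n)) x) \<longlonglongrightarrow> cop (cop h) x" if x: "x \<in> topspace T" for x
  proof -
    obtain b where b: "\<And>y. y \<in> topspace T \<Longrightarrow> norm (ker x y) \<le> b" using continuous_bounded[OF cont_ker[OF x]] by blast
    show ?thesis unfolding op_ker[of _ x]
      by (rule ip_limit[of "\<lambda>_. ker x" "ker x" "\<lambda>n. cop (u n)" "cop h" b "sqrt (bnd * bnd)"])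
        (use cont_ker[OF x] cont_op u(1) uop h opb b in auto)
  qed
  \<comment> \<open>The defect of \<open>f (r n)\<close> as an eigenfunction of the squared operator. Its norm tends to \<open>0\<close> because expanding the square and using
    the symmetry of \<open>cop\<close> and \<open>opL\<close> gives \<open>L\<^sup>2 - L * ip (u n) (u n)\<close> as an upper bound.\<close>
  define w where "w n = (\<lambda>x. cop (u n) x - L * f (r n) x)" for n
  have cw: "cfun (w n)" for n unfolding w_def by (intro cont_lin cont_op u Nc f)
  have ww: "ip (w n) (w n) \<le> L\<^sup>2 - L * ip (u n) (u n)" for n
  proof -
    have "ip (w n) (w n) = ip (cop (u n)) (cop (u n)) - 2 * L * ip (cop (u n)) (f (r n)) + L\<^sup>2 * ip (f (r n)) (f (r n))"
      unfolding w_def by (rule ip_self_diff) (intro cont_op u Nc f)+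
    also have "ip (cop (u n)) (f (r n)) = ip (u n) (u n)" using op_sym[OF u(1) Nc[OF f(1)], of n "r n"] by (simp add: u_def)
    also have "ip (cop (u n)) (cop (u n)) \<le> L * ip (u n) (u n)" by (rule opL[OF u(2)])
    also have "L\<^sup>2 * ip (f (r n)) (f (r n)) \<le> L\<^sup>2 * 1" using f(2) by (intro mult_left_mono) auto
    finally show ?thesis by (simp add: algebra_simps)
  qed
  have eig: "cop (cop h) x = L * h x" if x: "x \<in> topspace T" for x
  proof -
    have "(\<lambda>n. cop (w n) x) \<longlonglongrightarrow> 0"
    proof -
      have "(\<lambda>n. bnd * (L\<^sup>2 - L * ip (u n) (u n))) \<longlonglongrightarrow> bnd * (L\<^sup>2 - L * L)"
        by (intro tendsto_mult tendsto_diff tendsto_const uL)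
      then have z: "(\<lambda>n. bnd * (L\<^sup>2 - L * ip (u n) (u n))) \<longlonglongrightarrow> 0" by (simp add: power2_eq_square)
      have "(\<lambda>n. (cop (w n) x)\<^sup>2) \<longlonglongrightarrow> 0"
      proof (rule Lim_null_comparison[OF _ z], intro always_eventually allI)
        fix n
        have "(cop (w n) x)\<^sup>2 \<le> bnd * ip (w n) (w n)" by (rule op_bound[OF cw x])
        also have "\<dots> \<le> bnd * (L\<^sup>2 - L * ip (u n) (u n))" using ww bnd(1) by (intro mult_left_mono) auto
        finally show "norm ((cop (w n) x)\<^sup>2) \<le> bnd * (L\<^sup>2 - L * ip (u n) (u n))" by simp
      qed
      then show ?thesis by (simp add: power_tendsto_0_iff)
    qed
    moreover have "cop (w n) x = cop (cop (u n)) x - L * u n x" for n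
      unfolding w_def using op_diff_scale[OF cont_op[OF u(1)] Nc[OF f(1)] x, of n L "r n"] by (simp add: u_def)
    ultimately have "(\<lambda>n. cop (cop (u n)) x - L * u n x) \<longlonglongrightarrow> 0" by simp
    moreover have "(\<lambda>n. cop (cop (u n)) x - L * u n x) \<longlonglongrightarrow> cop (cop h) x - L * h x"
      by (intro tendsto_diff tendsto_mult tendsto_const uopop ulim x)
    ultimately show ?thesis using LIMSEQ_unique by fastforce
  qed
  have "\<exists>x\<in>topspace T. h (x \<otimes>\<^bsub>\<Gamma>\<^esub> x0) \<noteq> h x"
  proof (rule ccontr)
    assume "\<not> ?thesis"
    then have fh: "fixd h" using h by (simp add: fixd_def translate_def)
    obtain b where b: "\<And>y. y \<in> topspace T \<Longrightarrow> norm (h y) \<le> b" using continuous_bounded[OF h] by blast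
    have "(\<lambda>n. ip (u n) h) \<longlonglongrightarrow> ip h h"
      by (rule ip_limit[of u h "\<lambda>_. h" h "sqrt bnd" b]) (use u(1) ulim h ub b in auto)
    moreover have "ip (u n) h = 0" for n using u(2) fh by (simp add: N_def)
    ultimately have "ip h h = 0" by (simp add: LIMSEQ_const_iff)
    then show False using hh Lpos by simp
  qed
  then show ?thesis using Lpos h eig by blast
qed

end

section \<open>Finite-dimensional representations separate the points of a compact group\<close>

context Haar_group
begin

definition orthonormal :: "nat \<Rightarrow> (nat \<Rightarrow> 'a \<Rightarrow> real) \<Rightarrow> bool" where
  "orthonormal n e \<longleftrightarrow> (\<forall>i<n. cfun (e i)) \<and> (\<forall>i<n. \<forall>j<n. ip (e i) (e j) = (if i = j then 1 else 0))"

lemma ip_orthonormal_combination: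
  assumes e: "orthonormal n e" and j: "j < n" shows "ip (\<lambda>x. \<Sum>i<n. c i * e i x) (e j) = c j"
proof -
  have "ip (\<lambda>x. \<Sum>i<n. c i * e i x) (e j) = (\<Sum>i<n. c i * ip (e i) (e j))"
    by (rule ip_sum) (use e j in \<open>simp_all add: orthonormal_def\<close>)
  also have "\<dots> = (\<Sum>i<n. if i = j then c i else 0)" by (rule sum.cong) (use e j in \<open>simp_all add: orthonormal_def\<close>)
  also have "\<dots> = c j" using j by simp
  finally show ?thesis .
qed

lemma cont_combination: "orthonormal n e \<Longrightarrow> cfun (\<lambda>x. \<Sum>i<n. c i * e i x)"
  by (intro cont_sum cont_scale) (simp_all add: orthonormal_def)

lemma ip_combination:
  assumes e: "orthonormal n e" and g: "cfun g" shows "ip (\<lambda>x. \<Sum>i<n. c i * e i x) g = (\<Sum>i<n. c i * ip (e i) g)"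
  by (rule ip_sum) (use e g in \<open>simp_all add: orthonormal_def\<close>)

text \<open>
  The distance of \<open>g\<close> to the combination with coefficients \<open>ip g (e i)\<close> is nonnegative.
\<close>

lemma Bessel:
  assumes e: "orthonormal n e" and g: "cfun g" shows "(\<Sum>i<n. (ip g (e i))\<^sup>2) \<le> ip g g"
proof -
  define s where "s = (\<lambda>x. \<Sum>i<n. ip g (e i) * e i x)"
  have s: "cfun s" unfolding s_def by (rule cont_combination[OF e])
  have gs: "ip g s = (\<Sum>i<n. (ip g (e i))\<^sup>2)"
    using ip_commute[of g s] ip_combination[OF e g, of "\<lambda>i. ip g (e i)"] ip_commute[of g]
    by (simp add: s_def power2_eq_square)
  have es: "ip (e i) s = ip g (e i)" if "i < n" for i
    using ip_orthonormal_combination[OF e that, of "\<lambda>i. ip g (e i)"] ip_commute[of "e i" s] by (simp add: s_def)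
  have ss: "ip s s = (\<Sum>i<n. (ip g (e i))\<^sup>2)"
    using ip_combination[OF e s, of "\<lambda>i. ip g (e i)"] es by (simp add: s_def[symmetric] power2_eq_square)
  have "0 \<le> ip (\<lambda>x. g x - 1 * s x) (\<lambda>x. g x - 1 * s x)" by (rule ip_nonneg)
  then show ?thesis using ip_self_diff[OF g s, of 1] gs ss by simp
qed

lemma orthonormal_extend:
  assumes e: "orthonormal n e" and r: "cfun r" and ortho: "\<And>i. i < n \<Longrightarrow> ip r (e i) = 0" and pos: "ip r r > 0"
  shows "orthonormal (Suc n) (e(n := (\<lambda>x. (1 / sqrt (ip r r)) * r x)))"
proof -
  let ?c = "1 / sqrt (ip r r)"
  let ?e = "e(n := (\<lambda>x. ?c * r x))"
  have one: "ip (\<lambda>x. ?c * r x) (\<lambda>x. ?c * r x) = 1" using pos unfolding ip_scale ip_scale2 by simp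
  have o: "ip (\<lambda>x. ?c * r x) (e i) = 0" "ip (e i) (\<lambda>x. ?c * r x) = 0" if "i < n" for i
    using ortho[OF that] ip_commute[of "e i" r] unfolding ip_scale ip_scale2 by simp_all
  have "cfun (?e i)" if "i < Suc n" for i
  proof (cases "i = n")
    case True then show ?thesis using cont_scale[OF r, of ?c] by simp
  next
    case False then show ?thesis using that e by (simp add: orthonormal_def)
  qed
  moreover have "ip (?e i) (?e j) = (if i = j then 1 else 0)" if "i < Suc n" "j < Suc n" for i j
  proof (cases "i = n"; cases "j = n")
    assume "i = n" "j = n" then show ?thesis using one by simp
  next
    assume "i = n" "j \<noteq> n" then show ?thesis using o(1)[of j] that by simp
  next
    assume "i \<noteq> n" "j = n" then show ?thesis using o(2)[of i] that by simp
  next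
    assume "i \<noteq> n" "j \<noteq> n" then show ?thesis using e that by (simp add: orthonormal_def)
  qed
  ultimately show ?thesis unfolding orthonormal_def by blast
qed

end

context convolution
begin

definition eigen :: "real \<Rightarrow> ('a \<Rightarrow> real) \<Rightarrow> bool" where
  "eigen L f \<longleftrightarrow> cfun f \<and> (\<forall>x\<in>topspace T. cop (cop f) x = L * f x)"

lemma op_sum:
  assumes f: "\<And>i. i \<in> I \<Longrightarrow> cfun (f i)" and x: "x \<in> topspace T"
  shows "cop (\<lambda>x. \<Sum>i\<in>I. c i * f i x) x = (\<Sum>i\<in>I. c i * cop (f i) x)"
proof -
  have "cop (\<lambda>x. \<Sum>i\<in>I. c i * f i x) x = ip (\<lambda>x. \<Sum>i\<in>I. c i * f i x) (ker x)" using ip_commute by (simp add: op_ker)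
  also have "\<dots> = (\<Sum>i\<in>I. c i * ip (f i) (ker x))" by (rule ip_sum[OF f cont_ker[OF x]])
  also have "\<dots> = (\<Sum>i\<in>I. c i * cop (f i) x)" by (rule sum.cong[OF refl]) (use ip_commute in \<open>simp add: op_ker\<close>)
  finally show ?thesis .
qed

lemma eigen_combination:
  fixes n :: nat
  assumes f: "\<And>i. i < n \<Longrightarrow> eigen L (e i)" shows "eigen L (\<lambda>x. \<Sum>i<n. c i * e i x)"
proof -
  have ce: "cfun (e i)" if "i \<in> {..<n}" for i using f that by (simp add: eigen_def)
  have "cop (cop (\<lambda>x. \<Sum>i<n. c i * e i x)) x = L * (\<Sum>i<n. c i * e i x)" if x: "x \<in> topspace T" for x
  proof -
    have "cop (cop (\<lambda>x. \<Sum>i<n. c i * e i x)) x = cop (\<lambda>x. \<Sum>i<n. c i * cop (e i) x) x" by (rule op_cong) (rule op_sum[OF ce])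
    also have "\<dots> = (\<Sum>i<n. c i * cop (cop (e i)) x)" by (rule op_sum[OF cont_op[OF ce] x])
    also have "\<dots> = (\<Sum>i<n. L * (c i * e i x))" by (rule sum.cong[OF refl]) (use f x in \<open>simp add: eigen_def\<close>)
    finally show ?thesis by (simp only: sum_distrib_left)
  qed
  moreover have "cfun (\<lambda>x. \<Sum>i<n. c i * e i x)"
  proof (rule cont_sum)
    show "cfun (\<lambda>x. c i * e i x)" if "i \<in> {..<n}" for i by (rule cont_scale[OF ce[OF that]])
  qed (rule finite_lessThan)
  ultimately show ?thesis by (simp add: eigen_def)
qed

lemma eigen_diff: "eigen L f \<Longrightarrow> eigen L g \<Longrightarrow> eigen L (\<lambda>x. f x - c * g x)"
proof -
  assume f: "eigen L f" and g: "eigen L g"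
  have cc: "cfun f" "cfun g" using f g by (simp_all add: eigen_def)
  have "cop (cop (\<lambda>x. f x - c * g x)) x = L * (f x - c * g x)" if x: "x \<in> topspace T" for x
  proof -
    have "cop (cop (\<lambda>x. f x - c * g x)) x = cop (\<lambda>x. cop f x - c * cop g x) x"
      by (rule op_cong) (rule op_diff_scale[OF cc])
    also have "\<dots> = cop (cop f) x - c * cop (cop g) x" by (rule op_diff_scale[OF cont_op[OF cc(1)] cont_op[OF cc(2)] x])
    also have "\<dots> = L * (f x - c * g x)" using f g x by (simp add: eigen_def algebra_simps)
    finally show ?thesis .
  qed
  then show ?thesis using cont_lin[OF cc, of c] by (simp add: eigen_def)
qed

lemma eigen_scale: "eigen L f \<Longrightarrow> eigen L (\<lambda>x. c * f x)"
  using eigen_combination[of "Suc 0" L "\<lambda>_. f" "\<lambda>_. c"] by (simp add: lessThan_Suc del: sum_constant)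

lemma eigen_trans:
  assumes f: "eigen L f" and a: "a \<in> topspace T" shows "eigen L (translate a f)"
proof -
  have c: "cfun f" using f by (simp add: eigen_def)
  have "cop (cop (translate a f)) x = L * translate a f x" if x: "x \<in> topspace T" for x
  proof -
    have "cop (cop (translate a f)) x = cop (translate a (cop f)) x" by (rule op_cong) (rule op_trans[OF c a])
    also have "\<dots> = translate a (cop (cop f)) x" by (rule op_trans[OF cont_op[OF c] a x])
    also have "\<dots> = L * translate a f x" using f x a by (simp add: eigen_def translate_def)
    finally show ?thesis .
  qed
  then show ?thesis using cont_trans[OF c a] by (simp add: eigen_def)
qed

text \<open>
  For fixed \<open>x\<close> the number \<open>L * e i x\<close> is the inner product of \<open>e i\<close> with \<open>cop (ker x)\<close>, so Bessel's inequality bounds the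
  sum of the squares of these numbers independently of \<open>n\<close>; integrate over \<open>x\<close>.
\<close>

lemma eigen_dimension_bound:
  assumes e: "orthonormal n e" and E: "\<And>i. i < n \<Longrightarrow> eigen L (e i)" shows "L\<^sup>2 * real n \<le> bnd * bnd"
proof -
  have c: "cfun (e i)" if "i < n" for i using e that by (simp add: orthonormal_def)
  have pt: "(\<Sum>i<n. L\<^sup>2 * (e i x * e i x)) \<le> bnd * bnd" if x: "x \<in> topspace T" for x
  proof -
    have "L * e i x = ip (cop (ker x)) (e i)" if i: "i < n" for i
    proof -
      have "L * e i x = cop (cop (e i)) x" using E[OF i] x by (simp add: eigen_def)
      also have "\<dots> = ip (ker x) (cop (e i))" by (rule op_ker)
      also have "\<dots> = ip (cop (ker x)) (e i)" by (rule op_sym[OF cont_ker[OF x] c[OF i], symmetric])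
      finally show ?thesis .
    qed
    then have "(\<Sum>i<n. L\<^sup>2 * (e i x * e i x)) = (\<Sum>i<n. (ip (cop (ker x)) (e i))\<^sup>2)"
      by (intro sum.cong refl) (simp add: power_mult_distrib[symmetric] power2_eq_square[symmetric])
    also have "\<dots> \<le> ip (cop (ker x)) (cop (ker x))" by (rule Bessel[OF e cont_op[OF cont_ker[OF x]]])
    also have "\<dots> \<le> bnd * ip (ker x) (ker x)" by (rule op_norm_bound[OF cont_ker[OF x]])
    also have "\<dots> \<le> bnd * bnd" using bnd(2)[OF x] bnd(1) by (intro mult_left_mono) simp_all
    finally show ?thesis .
  qed
  have i: "integrable \<eta> (\<lambda>x. L\<^sup>2 * (e i x * e i x))" if "i < n" for i
    by (rule cont_int[OF cont_scale[OF cont_mult[OF c[OF that] c[OF that]]]])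
  have "L\<^sup>2 * real n = (\<Sum>i<n. L\<^sup>2 * ip (e i) (e i))" using e by (simp add: orthonormal_def)
  also have "\<dots> = (\<integral>x. (\<Sum>i<n. L\<^sup>2 * (e i x * e i x)) \<partial>\<eta>)"
    by (subst Bochner_Integration.integral_sum) (use i in \<open>simp_all add: ip_def\<close>)
  also have "\<dots> \<le> bnd * bnd"
    by (rule eta.integral_le_const[OF Bochner_Integration.integrable_sum]) (use i pt in \<open>auto simp: space_eta\<close>)
  finally show ?thesis .
qed

text \<open>
  An orthonormal family of maximal size spans: otherwise the normalized remainder of some eigenfunction would extend it.
\<close>

lemma ex_eigen_basis:
  assumes L: "L > 0"
  shows "\<exists>n e. orthonormal n e \<and> (\<forall>i<n. eigen L (e i)) \<and> (\<forall>f. eigen L f \<longrightarrow> (\<forall>x\<in>topspace T. f x = (\<Sum>i<n. ip f (e i) * e i x)))"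
proof -
  let ?P = "\<lambda>n. \<exists>e. orthonormal n e \<and> (\<forall>i<n. eigen L (e i))"
  have P0: "?P 0" by (simp add: orthonormal_def)
  have Pb: "n \<le> nat \<lceil>bnd * bnd / L\<^sup>2\<rceil>" if "?P n" for n
  proof -
    obtain e where "orthonormal n e" "\<forall>i<n. eigen L (e i)" using \<open>?P n\<close> by blast
    from eigen_dimension_bound[OF this(1), of L] this(2) have "L\<^sup>2 * real n \<le> bnd * bnd" by simp
    then have "real n \<le> bnd * bnd / L\<^sup>2" using L by (simp add: pos_le_divide_eq mult.commute)
    then show ?thesis by linarith
  qed
  define n where "n = (GREATEST n. ?P n)"
  have Pn: "?P n" unfolding n_def by (rule GreatestI_nat[of ?P, OF P0 Pb])
  have max: "\<not> ?P (Suc n)"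
  proof
    assume "?P (Suc n)"
    then have "Suc n \<le> n" unfolding n_def by (rule Greatest_le_nat) (rule Pb)
    then show False by simp
  qed
  obtain e where e: "orthonormal n e" and E: "\<And>i. i < n \<Longrightarrow> eigen L (e i)" using Pn by blast
  have "f x = (\<Sum>i<n. ip f (e i) * e i x)" if f: "eigen L f" and x: "x \<in> topspace T" for f x
  proof -
    have c: "cfun f" using f by (simp add: eigen_def)
    define s where "s = (\<lambda>x. \<Sum>i<n. ip f (e i) * e i x)"
    define r where "r = (\<lambda>x. f x - 1 * s x)"
    have s: "eigen L s" "cfun s" unfolding s_def by (rule eigen_combination[OF E], assumption, rule cont_combination[OF e])
    have r: "eigen L r" "cfun r" unfolding r_def by (rule eigen_diff[OF f s(1)], rule cont_lin[OF c s(2)])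
    have ortho: "ip r (e i) = 0" if i: "i < n" for i
    proof -
      have "cfun (e i)" using e i by (simp add: orthonormal_def)
      from ip_diff_scale[OF c s(2) this, of 1] show ?thesis
        using ip_orthonormal_combination[OF e i, of "\<lambda>i. ip f (e i)"] by (simp add: r_def s_def)
    qed
    have "ip r r = 0"
    proof (rule ccontr)
      assume "ip r r \<noteq> 0"
      then have pos: "ip r r > 0" using ip_nonneg[of r] by simp
      have "orthonormal (Suc n) (e(n := (\<lambda>x. (1 / sqrt (ip r r)) * r x)))" by (rule orthonormal_extend[OF e r(2) ortho pos])
      moreover have "\<forall>i<Suc n. eigen L ((e(n := (\<lambda>x. (1 / sqrt (ip r r)) * r x))) i)"
        using E eigen_scale[OF r(1), of "1 / sqrt (ip r r)"] less_Suc_eq by simp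
      ultimately show False using max by blast
    qed
    then have "r x = 0" by (rule ip_zero[OF r(2) _ x])
    then show ?thesis by (simp add: r_def s_def)
  qed
  then show ?thesis using e E by blast
qed

text \<open>
  Right translations act on the eigenspace of \<open>h\<close>, which has finite dimension and an invariant inner product. Their matrices with respect to an
  orthonormal basis form a unitary representation, and translation by \<open>x0\<close> acts nontrivially because it moves \<open>h\<close>.
\<close>

lemma ex_representation_moving:
  assumes L: "L > 0" and h: "eigen L h" and x0: "x0 \<in> topspace T"
    and moved: "\<exists>x\<in>topspace T. h (x \<otimes>\<^bsub>\<Gamma>\<^esub> x0) \<noteq> h x"
  shows "\<exists>n>0. \<exists>\<sigma>. \<sigma> \<in> hom \<Gamma> (unitary_group n) \<and> (\<forall>i<n. \<forall>j<n. continuous_map T euclidean (\<lambda>x. \<sigma> x $$ (i, j))) \<and> \<sigma> x0 \<noteq> 1\<^sub>m n"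
proof -
  obtain n e where e: "orthonormal n e" and E: "\<And>i. i < n \<Longrightarrow> eigen L (e i)"
    and span: "\<And>f x. eigen L f \<Longrightarrow> x \<in> topspace T \<Longrightarrow> f x = (\<Sum>i<n. ip f (e i) * e i x)"
    using ex_eigen_basis[OF L] by blast
  have c: "cfun (e i)" if "i < n" for i using e that by (simp add: orthonormal_def)
  have n: "n > 0"
  proof (rule ccontr)
    assume "\<not> n > 0"
    then have "h x = 0" if "x \<in> topspace T" for x using span[OF h that] by simp
    then show False using moved x0 by auto
  qed
  \<comment> \<open>The matrix of the translation by \<open>a\<close>. Translation is on the right in the argument, so \<open>a \<mapsto> translate a\<close> preserves the order of
    products and \<open>M\<close> is a homomorphism.\<close>
  define M where "M a i j = ip (e i) (translate a (e j))" for a i j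
  have tr: "translate a (e j) x = (\<Sum>i<n. M a i j * e i x)" if "a \<in> topspace T" "j < n" "x \<in> topspace T" for a j x
    using span[OF eigen_trans[OF E[OF that(2)] that(1)] that(3)] ip_commute[of "translate a (e j)"] by (simp add: M_def)
  have M_mult: "M (a \<otimes>\<^bsub>\<Gamma>\<^esub> b) l j = (\<Sum>i<n. M a l i * M b i j)" if ab: "a \<in> topspace T" "b \<in> topspace T" and lj: "l < n" "j < n" for a b l j
  proof -
    have "translate (a \<otimes>\<^bsub>\<Gamma>\<^esub> b) (e j) x = (\<Sum>i<n. M b i j * translate a (e i) x)" if x: "x \<in> topspace T" for x
    proof -
      have "translate (a \<otimes>\<^bsub>\<Gamma>\<^esub> b) (e j) x = translate b (e j) (x \<otimes>\<^bsub>\<Gamma>\<^esub> a)"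
        using x ab by (simp add: translate_def m_assoc carrier_eq)
      also have "\<dots> = (\<Sum>i<n. M b i j * e i (x \<otimes>\<^bsub>\<Gamma>\<^esub> a))" using tr[OF ab(2) lj(2), of "x \<otimes>\<^bsub>\<Gamma>\<^esub> a"] x ab(1) by simp
      finally show ?thesis by (simp add: translate_def)
    qed
    then have "M (a \<otimes>\<^bsub>\<Gamma>\<^esub> b) l j = ip (e l) (\<lambda>x. \<Sum>i<n. M b i j * translate a (e i) x)" unfolding M_def[of "a \<otimes>\<^bsub>\<Gamma>\<^esub> b"]
      by (intro ip_cong) simp_all
    also have "\<dots> = ip (\<lambda>x. \<Sum>i<n. M b i j * translate a (e i) x) (e l)" by (rule ip_commute)
    also have "\<dots> = (\<Sum>i<n. M b i j * ip (translate a (e i)) (e l))"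
      by (rule ip_sum) (use c cont_trans ab lj in simp_all)
    also have "\<dots> = (\<Sum>i<n. M a l i * M b i j)"
      by (rule sum.cong[OF refl]) (use ip_commute[of "e l"] in \<open>simp add: M_def mult.commute\<close>)
    finally show ?thesis .
  qed
  have M_ortho: "(\<Sum>l<n. M a l i * M a l j) = (if i = j then 1 else 0)" if a: "a \<in> topspace T" and ij: "i < n" "j < n" for a i j
  proof -
    have ct: "cfun (translate a (e j))" by (rule cont_trans[OF c[OF ij(2)] a])
    have "(if i = j then 1 else 0) = ip (e i) (e j)" using e ij by (simp add: orthonormal_def)
    also have "\<dots> = ip (translate a (e i)) (translate a (e j))" by (rule ip_trans[OF c[OF ij(1)] c[OF ij(2)] a, symmetric])
    also have "\<dots> = ip (\<lambda>x. \<Sum>l<n. M a l i * e l x) (translate a (e j))" by (rule ip_cong) (use tr[OF a ij(1)] in simp_all)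
    also have "\<dots> = (\<Sum>l<n. M a l i * ip (e l) (translate a (e j)))" by (rule ip_combination[OF e ct])
    finally show ?thesis by (simp add: M_def)
  qed
  define \<sigma> where "\<sigma> a = mat n n (\<lambda>(i, j). complex_of_real (M a i j))" for a
  have \<sigma>c: "\<sigma> a \<in> carrier_mat n n" for a by (simp add: \<sigma>_def)
  have \<sigma>e: "\<sigma> a $$ (i, j) = complex_of_real (M a i j)" if "i < n" "j < n" for a i j using that by (simp add: \<sigma>_def)
  have \<sigma>adj: "mat_adjoint (\<sigma> a) \<in> carrier_mat n n" for a using \<sigma>c[of a] by (auto simp: mat_adjoint_def mat_of_rows_def)
  have left: "mat_adjoint (\<sigma> a) * \<sigma> a = 1\<^sub>m n" if a: "a \<in> topspace T" for a
  proof (rule eq_matI)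
    fix i j assume "i < dim_row (1\<^sub>m n)" "j < dim_col (1\<^sub>m n)"
    then have ij: "i < n" "j < n" by simp_all
    have "(mat_adjoint (\<sigma> a) * \<sigma> a) $$ (i, j) = (\<Sum>l<n. complex_of_real (M a l i * M a l j))"
      unfolding mult_entry[OF \<sigma>adj \<sigma>c ij] by (rule sum.cong[OF refl]) (use ij in \<open>simp add: mat_adjoint_entry[OF \<sigma>c] \<sigma>e\<close>)
    also have "\<dots> = complex_of_real (if i = j then 1 else 0)" unfolding of_real_sum[symmetric] M_ortho[OF a ij] ..
    finally show "(mat_adjoint (\<sigma> a) * \<sigma> a) $$ (i, j) = 1\<^sub>m n $$ (i, j)" using ij by simp
  qed (use \<sigma>adj[of a] \<sigma>c[of a] in simp_all)
  have unit: "\<sigma> a \<in> carrier (unitary_group n)" if a: "a \<in> topspace T" for a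
    using left[OF a] mat_mult_left_right_inverse[OF \<sigma>adj \<sigma>c left[OF a]] \<sigma>c[of a] by (simp add: unitary_group_def)
  have mult: "\<sigma> (a \<otimes>\<^bsub>\<Gamma>\<^esub> b) = \<sigma> a * \<sigma> b" if ab: "a \<in> topspace T" "b \<in> topspace T" for a b
  proof (rule eq_matI)
    fix i j assume "i < dim_row (\<sigma> a * \<sigma> b)" "j < dim_col (\<sigma> a * \<sigma> b)"
    then have ij: "i < n" "j < n" by (simp_all add: \<sigma>_def)
    show "\<sigma> (a \<otimes>\<^bsub>\<Gamma>\<^esub> b) $$ (i, j) = (\<sigma> a * \<sigma> b) $$ (i, j)"
      unfolding mult_entry[OF \<sigma>c \<sigma>c ij] \<sigma>e[OF ij] M_mult[OF ab ij] using ij by (simp add: \<sigma>e)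
  qed (simp_all add: \<sigma>_def)
  have hom: "\<sigma> \<in> hom \<Gamma> (unitary_group n)"
    by (rule homI) (use unit mult in \<open>simp_all add: carrier_eq, simp add: unitary_group_def\<close>)
  have cont: "continuous_map T euclidean (\<lambda>x. \<sigma> x $$ (i, j))" if ij: "i < n" "j < n" for i j
  proof -
    have "continuous_map (prod_topology T T) euclideanreal (\<lambda>p. e i (fst p) * e j (fst p \<otimes>\<^bsub>\<Gamma>\<^esub> snd p))"
      by (intro continuous_map_real_mult ccomp[OF c[OF ij(1)]] ccomp[OF c[OF ij(2)]] cmult cfst csnd)
    from continuous_integral[OF this eta] have "continuous_map T euclideanreal (\<lambda>x. M x i j)"
      by (simp add: M_def ip_def translate_def)
    then have "continuous_map T euclidean (complex_of_real \<circ> (\<lambda>x. M x i j))"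
      by (rule continuous_map_compose) (simp add: continuous_on_of_real)
    then show ?thesis using \<sigma>e[OF ij] by (simp add: comp_def)
  qed
  have "\<sigma> x0 \<noteq> 1\<^sub>m n"
  proof
    assume one: "\<sigma> x0 = 1\<^sub>m n"
    have M1: "M x0 i j = (if i = j then 1 else 0)" if "i < n" "j < n" for i j
    proof -
      have "complex_of_real (M x0 i j) = (if i = j then 1 else 0)" unfolding \<sigma>e[OF that, symmetric] one using that by simp
      then show ?thesis by (cases "i = j") simp_all
    qed
    have fixe: "e j (x \<otimes>\<^bsub>\<Gamma>\<^esub> x0) = e j x" if j: "j < n" and x: "x \<in> topspace T" for j x
    proof -
      have "e j (x \<otimes>\<^bsub>\<Gamma>\<^esub> x0) = (\<Sum>i<n. M x0 i j * e i x)" using tr[OF x0 j x] by (simp add: translate_def)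
      also have "\<dots> = (\<Sum>i<n. if i = j then e i x else 0)" by (rule sum.cong[OF refl]) (use M1 j in simp)
      also have "\<dots> = e j x" using j by simp
      finally show ?thesis .
    qed
    obtain x where x: "x \<in> topspace T" "h (x \<otimes>\<^bsub>\<Gamma>\<^esub> x0) \<noteq> h x" using moved by blast
    have "h (x \<otimes>\<^bsub>\<Gamma>\<^esub> x0) = (\<Sum>i<n. ip h (e i) * e i (x \<otimes>\<^bsub>\<Gamma>\<^esub> x0))" by (rule span[OF h]) (use x x0 in simp)
    also have "\<dots> = (\<Sum>i<n. ip h (e i) * e i x)" by (rule sum.cong[OF refl]) (use fixe x in simp)
    also have "\<dots> = h x" by (rule span[OF h x(1), symmetric])
    finally show False using x(2) by simp
  qed
  then show ?thesis using n hom cont by blast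
qed

end

text \<open>
  Choose a neighbourhood \<open>V\<close> of the identity such that \<open>x0\<close> is not a product of two elements of \<open>V\<close>, and a function \<open>u\<close>
  supported on \<open>V\<close> with value \<open>1\<close> at the identity; then symmetrize.
\<close>

lemma (in Haar_group) ex_symmetric_bump:
  assumes x0: "x0 \<in> topspace T" and ne: "x0 \<noteq> \<one>\<^bsub>\<Gamma>\<^esub>"
  shows "\<exists>\<kappa>. cfun \<kappa> \<and> (\<forall>x\<in>topspace T. \<kappa> (inv\<^bsub>\<Gamma>\<^esub> x) = \<kappa> x) \<and> \<kappa> \<one>\<^bsub>\<Gamma>\<^esub> = 1 \<and>
    (\<forall>x\<in>topspace T. \<forall>y\<in>topspace T. x \<otimes>\<^bsub>\<Gamma>\<^esub> y = x0 \<longrightarrow> \<kappa> x * \<kappa> y = 0)"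
proof -
  have cm: "continuous_map (prod_topology T T) T (\<lambda>p. fst p \<otimes>\<^bsub>\<Gamma>\<^esub> snd p)" by (intro cmult cfst csnd)
  have cl: "closedin T {x0}" by (rule closedin_Hausdorff_singleton[OF Hausdorff x0])
  have op: "openin (prod_topology T T) {p \<in> topspace (prod_topology T T). fst p \<otimes>\<^bsub>\<Gamma>\<^esub> snd p \<in> topspace T - {x0}}" (is "openin _ ?O")
    by (rule openin_continuous_map_preimage[OF cm]) (rule openin_diff[OF openin_topspace cl])
  have "(\<one>\<^bsub>\<Gamma>\<^esub>, \<one>\<^bsub>\<Gamma>\<^esub>) \<in> ?O" using ne by simp
  then obtain U W where UW: "openin T U" "openin T W" "\<one>\<^bsub>\<Gamma>\<^esub> \<in> U" "\<one>\<^bsub>\<Gamma>\<^esub> \<in> W" "U \<times> W \<subseteq> ?O"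
    using openin_prod_topology_alt[THEN iffD1, OF op, rule_format, of "\<one>\<^bsub>\<Gamma>\<^esub>" "\<one>\<^bsub>\<Gamma>\<^esub>"] by (elim meta_impE exE conjE) (assumption, rule that)
  define V where "V = U \<inter> W"
  have V: "openin T V" "\<one>\<^bsub>\<Gamma>\<^esub> \<in> V" using UW by (auto simp: V_def)
  have VV: "x \<otimes>\<^bsub>\<Gamma>\<^esub> y \<noteq> x0" if "x \<in> V" "y \<in> V" for x y
  proof -
    have "(x, y) \<in> ?O" using UW(5) that unfolding V_def by blast
    then show ?thesis by simp
  qed
  have cV: "closedin T (topspace T - V)" by (rule closedin_diff[OF closedin_topspace V(1)])
  have c1: "closedin T {\<one>\<^bsub>\<Gamma>\<^esub>}" by (rule closedin_Hausdorff_singleton[OF Hausdorff one_in])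
  have "normal_space T" using compact Hausdorff compact_Hausdorff_or_regular_imp_normal_space by blast
  moreover have "disjnt (topspace T - V) {\<one>\<^bsub>\<Gamma>\<^esub>}" using V(2) by (simp add: disjnt_def)
  ultimately obtain u where u: "cfun u" "u ` (topspace T - V) \<subseteq> {0}" "u ` {\<one>\<^bsub>\<Gamma>\<^esub>} \<subseteq> {1 :: real}"
    using Urysohn_lemma_alt[OF _ cV c1] by blast
  define \<kappa> where "\<kappa> x = u x * u (inv\<^bsub>\<Gamma>\<^esub> x)" for x
  have "cfun \<kappa>" unfolding \<kappa>_def by (rule cont_mult[OF u(1) ccomp[OF u(1) cinv[OF cid]]])
  moreover have "\<forall>x\<in>topspace T. \<kappa> (inv\<^bsub>\<Gamma>\<^esub> x) = \<kappa> x" by (simp add: \<kappa>_def carrier_eq)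
  moreover have "\<kappa> \<one>\<^bsub>\<Gamma>\<^esub> = 1" using u(3) by (simp add: \<kappa>_def)
  moreover have "\<kappa> x * \<kappa> y = 0" if xy: "x \<in> topspace T" "y \<in> topspace T" "x \<otimes>\<^bsub>\<Gamma>\<^esub> y = x0" for x y
  proof -
    have "x \<notin> V \<or> y \<notin> V" using VV xy(3) by blast
    then have "u x = 0 \<or> u y = 0" using u(2) xy by blast
    then show ?thesis by (auto simp: \<kappa>_def)
  qed
  ultimately show ?thesis by blast
qed

text \<open>
  Convolving the bump \<open>\<kappa>\<close> with itself gives the positive value \<open>ip \<kappa> \<kappa>\<close> at the identity and \<open>0\<close> at \<open>x0\<close>. So translation by \<open>x0\<close>
  moves a function in the range of the convolution operator, and hence also an eigenfunction.
\<close>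

lemma (in compact_group) ex_nontrivial_representation:
  assumes x0: "x0 \<in> topspace T" and ne: "x0 \<noteq> \<one>\<^bsub>\<Gamma>\<^esub>"
  shows "\<exists>n>0. \<exists>\<sigma>. \<sigma> \<in> hom \<Gamma> (unitary_group n) \<and> (\<forall>i<n. \<forall>j<n. continuous_map T euclidean (\<lambda>x. \<sigma> x $$ (i, j))) \<and> \<sigma> x0 \<noteq> 1\<^sub>m n"
proof -
  obtain \<eta> where \<eta>: "Haar_group T \<Gamma> \<eta>"
  proof -
    obtain \<eta> where \<eta>: "\<eta> \<in> borel_prob T"
      "\<forall>f :: 'a \<Rightarrow> real. continuous_map T euclideanreal f \<longrightarrow> (\<forall>a\<in>topspace T. (\<integral>y. f (y \<otimes>\<^bsub>\<Gamma>\<^esub> a) \<partial>\<eta>) = (\<integral>y. f y \<partial>\<eta>))"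
      "\<forall>f :: 'a \<Rightarrow> real. continuous_map T euclideanreal f \<longrightarrow> (\<forall>x\<in>topspace T. 0 \<le> f x) \<longrightarrow> (\<integral>y. f y \<partial>\<eta>) = 0 \<longrightarrow> (\<forall>x\<in>topspace T. f x = 0)"
      using ex_Haar by (elim bexE conjE) (rule that)
    have "Haar_group T \<Gamma> \<eta>"
    proof unfold_locales
      show "(\<integral>y. f (y \<otimes>\<^bsub>\<Gamma>\<^esub> a) \<partial>\<eta>) = (\<integral>y. f y \<partial>\<eta>)" if "continuous_map T euclideanreal f" "a \<in> topspace T" for f :: "'a \<Rightarrow> real" and a
        using \<eta>(2) that by blast
      show "\<forall>x\<in>topspace T. f x = 0" if "continuous_map T euclideanreal f" "\<forall>x\<in>topspace T. 0 \<le> f x" "(\<integral>y. f y \<partial>\<eta>) = 0" for f :: "'a \<Rightarrow> real"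
        using \<eta>(3) that by blast
    qed (rule \<eta>(1))
    then show ?thesis by (rule that)
  qed
  interpret H: Haar_group T \<Gamma> \<eta> by (rule \<eta>)
  obtain \<kappa> where \<kappa>: "continuous_map T euclideanreal \<kappa>" "\<forall>x\<in>topspace T. \<kappa> (inv\<^bsub>\<Gamma>\<^esub> x) = \<kappa> x" "\<kappa> \<one>\<^bsub>\<Gamma>\<^esub> = 1"
    "\<forall>x\<in>topspace T. \<forall>y\<in>topspace T. x \<otimes>\<^bsub>\<Gamma>\<^esub> y = x0 \<longrightarrow> \<kappa> x * \<kappa> y = 0"
    using H.ex_symmetric_bump[OF x0 ne] by blast
  interpret C: convolution T \<Gamma> \<eta> \<kappa> by unfold_locales (use \<kappa> in simp_all)
  have "C.cop \<kappa> (\<one>\<^bsub>\<Gamma>\<^esub> \<otimes>\<^bsub>\<Gamma>\<^esub> x0) = (\<integral>y. 0 \<partial>\<eta>)" unfolding C.cop_def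
  proof (rule Bochner_Integration.integral_cong[OF refl])
    fix y assume "y \<in> space \<eta>"
    then have y: "y \<in> topspace T" by (simp add: H.space_eta)
    have "x0 \<otimes>\<^bsub>\<Gamma>\<^esub> inv\<^bsub>\<Gamma>\<^esub> y \<otimes>\<^bsub>\<Gamma>\<^esub> y = x0" using x0 y by (simp add: m_assoc carrier_eq)
    then show "\<kappa> (\<one>\<^bsub>\<Gamma>\<^esub> \<otimes>\<^bsub>\<Gamma>\<^esub> x0 \<otimes>\<^bsub>\<Gamma>\<^esub> inv\<^bsub>\<Gamma>\<^esub> y) * \<kappa> y = 0"
      using \<kappa>(4)[rule_format, of "x0 \<otimes>\<^bsub>\<Gamma>\<^esub> inv\<^bsub>\<Gamma>\<^esub> y" y] x0 y by (simp add: carrier_eq)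
  qed
  then have z: "C.cop \<kappa> (\<one>\<^bsub>\<Gamma>\<^esub> \<otimes>\<^bsub>\<Gamma>\<^esub> x0) = 0" by simp
  have "C.cop \<kappa> \<one>\<^bsub>\<Gamma>\<^esub> = H.ip \<kappa> \<kappa>" unfolding C.cop_def H.ip_def
  proof (rule Bochner_Integration.integral_cong[OF refl])
    fix y assume "y \<in> space \<eta>"
    then have y: "y \<in> topspace T" by (simp add: H.space_eta)
    then show "\<kappa> (\<one>\<^bsub>\<Gamma>\<^esub> \<otimes>\<^bsub>\<Gamma>\<^esub> inv\<^bsub>\<Gamma>\<^esub> y) * \<kappa> y = \<kappa> y * \<kappa> y" using \<kappa>(2) by (simp add: carrier_eq)
  qed
  moreover have "H.ip \<kappa> \<kappa> \<noteq> 0"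
  proof
    assume "H.ip \<kappa> \<kappa> = 0"
    from H.ip_zero[OF \<kappa>(1) this one_in] show False using \<kappa>(3) by simp
  qed
  ultimately have "\<exists>x\<in>topspace T. C.cop \<kappa> (x \<otimes>\<^bsub>\<Gamma>\<^esub> x0) \<noteq> C.cop \<kappa> x" using z by (intro bexI[of _ "\<one>\<^bsub>\<Gamma>\<^esub>"]) simp_all
  from C.ex_eigenfunction[OF x0 \<kappa>(1) this] obtain L h where "L > 0" "C.eigen L h" "\<exists>x\<in>topspace T. h (x \<otimes>\<^bsub>\<Gamma>\<^esub> x0) \<noteq> h x"
    unfolding C.eigen_def by blast
  from C.ex_representation_moving[OF this(1,2) x0 this(3)] show ?thesis .
qed

theorem (in compact_group) representations_separate_points:
  assumes a: "a \<in> topspace T" and b: "b \<in> topspace T" and ne: "a \<noteq> b"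
  shows "\<exists>n>0. \<exists>\<sigma>. \<sigma> \<in> hom \<Gamma> (unitary_group n) \<and> (\<forall>i<n. \<forall>j<n. continuous_map T euclidean (\<lambda>x. \<sigma> x $$ (i, j))) \<and>
    (\<exists>i<n. \<exists>j<n. \<sigma> a $$ (i, j) \<noteq> \<sigma> b $$ (i, j))"
proof -
  have "inv\<^bsub>\<Gamma>\<^esub> a \<otimes>\<^bsub>\<Gamma>\<^esub> b \<noteq> \<one>\<^bsub>\<Gamma>\<^esub>"
  proof
    assume "inv\<^bsub>\<Gamma>\<^esub> a \<otimes>\<^bsub>\<Gamma>\<^esub> b = \<one>\<^bsub>\<Gamma>\<^esub>"
    then have "a \<otimes>\<^bsub>\<Gamma>\<^esub> (inv\<^bsub>\<Gamma>\<^esub> a \<otimes>\<^bsub>\<Gamma>\<^esub> b) = a" using a by (simp add: carrier_eq)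
    moreover have "a \<otimes>\<^bsub>\<Gamma>\<^esub> (inv\<^bsub>\<Gamma>\<^esub> a \<otimes>\<^bsub>\<Gamma>\<^esub> b) = b" using a b by (simp add: carrier_eq m_assoc[symmetric])
    ultimately show False using ne by simp
  qed
  with a b obtain n \<sigma> where n: "n > 0" and hom: "\<sigma> \<in> hom \<Gamma> (unitary_group n)"
    and cont: "\<forall>i<n. \<forall>j<n. continuous_map T euclidean (\<lambda>x. \<sigma> x $$ (i, j))" and one: "\<sigma> (inv\<^bsub>\<Gamma>\<^esub> a \<otimes>\<^bsub>\<Gamma>\<^esub> b) \<noteq> 1\<^sub>m n"
    using ex_nontrivial_representation[of "inv\<^bsub>\<Gamma>\<^esub> a \<otimes>\<^bsub>\<Gamma>\<^esub> b"] by auto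
  have mult: "\<sigma> (x \<otimes>\<^bsub>\<Gamma>\<^esub> y) = \<sigma> x * \<sigma> y" if "x \<in> topspace T" "y \<in> topspace T" for x y
    using hom_mult[OF hom, of x y] that by (simp add: carrier_eq unitary_group_def)
  have c: "\<sigma> x \<in> carrier_mat n n" "mat_adjoint (\<sigma> x) * \<sigma> x = 1\<^sub>m n" "mat_adjoint (\<sigma> x) \<in> carrier_mat n n" if "x \<in> topspace T" for x
    using hom_in_carrier[OF hom, of x] that by (auto simp: carrier_eq unitary_group_def mat_adjoint_def mat_of_rows_def)
  have "\<sigma> a \<noteq> \<sigma> b"
  proof
    assume eq: "\<sigma> a = \<sigma> b"
    have "\<sigma> \<one>\<^bsub>\<Gamma>\<^esub> = \<sigma> (inv\<^bsub>\<Gamma>\<^esub> a) * \<sigma> a" using mult[of "inv\<^bsub>\<Gamma>\<^esub> a" a] a by (simp add: carrier_eq)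
    also have "\<dots> = \<sigma> (inv\<^bsub>\<Gamma>\<^esub> a \<otimes>\<^bsub>\<Gamma>\<^esub> b)" using mult[of "inv\<^bsub>\<Gamma>\<^esub> a" b] a b eq by simp
    finally have 1: "\<sigma> (inv\<^bsub>\<Gamma>\<^esub> a \<otimes>\<^bsub>\<Gamma>\<^esub> b) = \<sigma> \<one>\<^bsub>\<Gamma>\<^esub>" by simp
    have idem: "\<sigma> \<one>\<^bsub>\<Gamma>\<^esub> = \<sigma> \<one>\<^bsub>\<Gamma>\<^esub> * \<sigma> \<one>\<^bsub>\<Gamma>\<^esub>" using mult[OF one_in one_in] by (simp add: carrier_eq)
    have "1\<^sub>m n = mat_adjoint (\<sigma> \<one>\<^bsub>\<Gamma>\<^esub>) * (\<sigma> \<one>\<^bsub>\<Gamma>\<^esub> * \<sigma> \<one>\<^bsub>\<Gamma>\<^esub>)" using c(2)[OF one_in] idem by simp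
    also have "\<dots> = (mat_adjoint (\<sigma> \<one>\<^bsub>\<Gamma>\<^esub>) * \<sigma> \<one>\<^bsub>\<Gamma>\<^esub>) * \<sigma> \<one>\<^bsub>\<Gamma>\<^esub>"
      by (rule assoc_mult_mat[OF c(3) c(1) c(1), symmetric]) simp_all
    also have "\<dots> = \<sigma> \<one>\<^bsub>\<Gamma>\<^esub>" using c(2)[OF one_in] c(1)[OF one_in] by simp
    finally show False using one 1 by simp
  qed
  then have "\<exists>i<n. \<exists>j<n. \<sigma> a $$ (i, j) \<noteq> \<sigma> b $$ (i, j)"
    using eq_matI[of "\<sigma> a" "\<sigma> b"] c(1)[OF a] c(1)[OF b] by auto
  then show ?thesis using n hom cont by blast
qed

section \<open>Strong solutions and coefficients of representations\<close>

text \<open>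
  Let \<open>\<S>\<close> consist of the open sets with measurable preimage. By compactness of the complement of an open set \<open>W\<close>, each point of \<open>W\<close> has a neighbourhood
  in \<open>\<S>\<close> that is contained in \<open>W\<close>, a finite intersection of separating sets. A countable base reduces the union of these neighbourhoods to a countable one.
\<close>

lemma (in compact_sc) measurable_of_separating_open_sets:
  assumes X: "\<And>w. w \<in> space F \<Longrightarrow> X w \<in> topspace T"
    and sep: "\<And>x y. x \<in> topspace T \<Longrightarrow> y \<in> topspace T \<Longrightarrow> x \<noteq> y \<Longrightarrow>
      \<exists>U V. openin T U \<and> openin T V \<and> x \<in> U \<and> y \<in> V \<and> U \<inter> V = {} \<and> X -` U \<inter> space F \<in> sets F"
  shows "X \<in> F \<rightarrow>\<^sub>M borel_of T"
proof (rule measurable_into_borel_of[OF X])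
  define \<S> where "\<S> = {U. openin T U \<and> X -` U \<inter> space F \<in> sets F}"
  obtain B where B: "enum_base T B" using ex_enum_base[OF second_countable] by blast
  fix W assume W: "openin T W"
  have nbhd: "\<exists>D\<in>\<S>. x \<in> D \<and> D \<subseteq> W" if x: "x \<in> W" for x
  proof -
    have xT: "x \<in> topspace T" using openin_subset[OF W] x by blast
    have "compactin T (topspace T - W)"
      by (rule closedin_compact_space[OF compact]) (rule closedin_diff[OF closedin_topspace W])
    have "\<forall>y\<in>topspace T - W. \<exists>U V. U \<in> \<S> \<and> openin T V \<and> x \<in> U \<and> y \<in> V \<and> U \<inter> V = {}"
    proof
      fix y assume "y \<in> topspace T - W"
      then have "y \<in> topspace T" "x \<noteq> y" using x by auto
      from sep[OF xT this] show "\<exists>U V. U \<in> \<S> \<and> openin T V \<and> x \<in> U \<and> y \<in> V \<and> U \<inter> V = {}" unfolding \<S>_def by blast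
    qed
    then obtain U V where UV: "\<And>y. y \<in> topspace T - W \<Longrightarrow> U y \<in> \<S> \<and> openin T (V y) \<and> x \<in> U y \<and> y \<in> V y \<and> U y \<inter> V y = {}"
      by metis
    have "\<exists>\<F>. finite \<F> \<and> \<F> \<subseteq> V ` (topspace T - W) \<and> topspace T - W \<subseteq> \<Union>\<F>"
    proof (rule compactinD[OF \<open>compactin T (topspace T - W)\<close>])
      show "openin T C" if "C \<in> V ` (topspace T - W)" for C using that UV by blast
      show "topspace T - W \<subseteq> \<Union> (V ` (topspace T - W))" using UV by blast
    qed
    then obtain Y where Y: "finite Y" "Y \<subseteq> topspace T - W" "topspace T - W \<subseteq> (\<Union>y\<in>Y. V y)"
      by (metis finite_subset_image)
    define D where "D = topspace T \<inter> (\<Inter>y\<in>Y. U y)"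
    have "D \<in> \<S>"
      unfolding D_def using Y(1,2)
    proof (induction Y rule: finite_induct)
      case empty
      have "X -` topspace T \<inter> space F = space F" using X by auto
      then show ?case by (simp add: \<S>_def)
    next
      case (insert y Y)
      have 1: "topspace T \<inter> (\<Inter>y\<in>insert y Y. U y) = U y \<inter> (topspace T \<inter> (\<Inter>y\<in>Y. U y))" by auto
      have "U y \<in> \<S>" "topspace T \<inter> (\<Inter>y\<in>Y. U y) \<in> \<S>" using insert UV by auto
      then have "openin T (U y \<inter> (topspace T \<inter> (\<Inter>y\<in>Y. U y)))"
        "(X -` U y \<inter> space F) \<inter> (X -` (topspace T \<inter> (\<Inter>y\<in>Y. U y)) \<inter> space F) \<in> sets F"
        unfolding \<S>_def by (blast intro: openin_Int sets.Int)+
      moreover have "(X -` U y \<inter> space F) \<inter> (X -` (topspace T \<inter> (\<Inter>y\<in>Y. U y)) \<inter> space F) = X -` (U y \<inter> (topspace T \<inter> (\<Inter>y\<in>Y. U y))) \<inter> space F"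
        by blast
      ultimately show ?case unfolding 1 \<S>_def by simp
    qed
    moreover have "x \<in> D" using xT UV Y(2) unfolding D_def by blast
    moreover have "D \<subseteq> W"
    proof
      fix z assume z: "z \<in> D"
      show "z \<in> W"
      proof (rule ccontr)
        assume "z \<notin> W"
        then obtain y where "y \<in> Y" "z \<in> V y" using z Y(3) unfolding D_def by blast
        then show False using z UV Y(2) unfolding D_def by blast
      qed
    qed
    ultimately show ?thesis by blast
  qed
  define I where "I = {n. \<exists>D\<in>\<S>. B n \<subseteq> D \<and> D \<subseteq> W}"
  have "\<forall>n\<in>I. \<exists>D. D \<in> \<S> \<and> B n \<subseteq> D \<and> D \<subseteq> W" unfolding I_def by blast
  then obtain D where D: "\<And>n. n \<in> I \<Longrightarrow> D n \<in> \<S> \<and> B n \<subseteq> D n \<and> D n \<subseteq> W" by metis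
  have "W = (\<Union>n\<in>I. D n)"
  proof
    show "W \<subseteq> (\<Union>n\<in>I. D n)"
    proof
      fix x assume "x \<in> W"
      then obtain D' where D': "D' \<in> \<S>" "x \<in> D'" "D' \<subseteq> W" using nbhd by blast
      then obtain n where n: "x \<in> B n" "B n \<subseteq> D'" using enum_baseD(2)[OF B] unfolding \<S>_def by blast
      then have "n \<in> I" unfolding I_def using D' by blast
      then show "x \<in> (\<Union>n\<in>I. D n)" using D n by blast
    qed
  qed (use D in blast)
  then have "X -` W \<inter> space F = (\<Union>n\<in>I. X -` D n \<inter> space F)" by blast
  also have "\<dots> \<in> sets F" by (intro sets.countable_UN' countableI_type) (use D in \<open>auto simp: \<S>_def\<close>)
  finally show "X -` W \<inter> space F \<in> sets F" .
qed

context group_chain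
begin

lemma rep_chainI:
  assumes "\<rho> \<in> unitary_reps G T"
  obtains d where "rep_chain G T \<phi> \<mu> \<rho> d"
  using assms group_chain_axioms unfolding unitary_reps_def rep_chain_def rep_chain_axioms_def by blast

text \<open>
  Representations of the single group \<open>G k\<close> are among those of the product.
\<close>

lemma coordinate_representation:
  assumes n: "n > 0" and hom: "\<sigma> \<in> hom (G k) (unitary_group n)"
    and cont: "\<And>i j. i < n \<Longrightarrow> j < n \<Longrightarrow> continuous_map (T k) euclidean (\<lambda>x. \<sigma> x $$ (i, j))"
  shows "(\<lambda>x. \<sigma> (x k)) \<in> unitary_reps G T"
proof -
  have "(\<lambda>x. \<sigma> (x k)) \<in> hom (product_group UNIV G) (unitary_group n)"
  proof (rule homI)
    fix x y assume "x \<in> carrier (product_group UNIV G)" "y \<in> carrier (product_group UNIV G)"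
    then have xy: "x k \<in> carrier (G k)" "y k \<in> carrier (G k)" by (auto simp: product_group_def)
    then show "\<sigma> (x k) \<in> carrier (unitary_group n)" by (intro hom_in_carrier[OF hom])
    show "\<sigma> ((x \<otimes>\<^bsub>product_group UNIV G\<^esub> y) k) = \<sigma> (x k) \<otimes>\<^bsub>unitary_group n\<^esub> \<sigma> (y k)"
      using hom_mult[OF hom xy] by (simp add: product_group_def)
  qed
  moreover have "continuous_map (prod_top T) euclidean (\<lambda>x. \<sigma> (x k) $$ (i, j))" if "i < n" "j < n" for i j
    using continuous_map_compose[OF cont_coord[of k] cont[OF that]] by (simp add: comp_def)
  ultimately show ?thesis using n unfolding unitary_reps_def by blast
qed

lemma H_strong_subset_H_norm: "H_strong G T \<phi> \<mu> \<subseteq> H_norm G T \<phi> \<mu>"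
proof
  fix \<rho> assume r: "\<rho> \<in> H_strong G T \<phi> \<mu>"
  then have rep: "\<rho> \<in> unitary_reps G T" by (simp add: H_strong_def)
  obtain P where P: "P \<in> extreme_measures (solutions G T \<phi> \<mu>)" and
    m: "\<And>k i j. i < rep_dim G \<rho> \<Longrightarrow> j < rep_dim G \<rho> \<Longrightarrow> (\<lambda>x. \<rho> (emb G k (x k)) $$ (i, j)) \<in> borel_measurable (augment P (F_Z G T \<phi> k))"
    using r unfolding H_strong_def by blast
  have S: "P \<in> solutions G T \<phi> \<mu>" using P by (simp add: extreme_measures_def)
  obtain d where "rep_chain G T \<phi> \<mu> \<rho> d" using rep by (rule rep_chainI)
  then interpret rep_chain G T \<phi> \<mu> \<rho> d k for k .
  show "\<rho> \<in> H_norm G T \<phi> \<mu>"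
    unfolding H_norm_def using rep strong_imp_norm_pos[OF S m] by (simp add: rep_dim)
qed

text \<open>
  The same extreme solution works for all representations and all levels, which is what turns \<open>H_det = unitary_reps\<close> into
  the existence of one strong solution.
\<close>

lemma extreme_coefficient_measurable:
  assumes P: "P \<in> extreme_measures (solutions G T \<phi> \<mu>)" and r: "\<rho> \<in> H_det G T \<phi> \<mu>"
    and ij: "i < rep_dim G \<rho>" "j < rep_dim G \<rho>"
  shows "(\<lambda>x. \<rho> (emb G k (x k)) $$ (i, j)) \<in> borel_measurable (augment P (F_Z G T \<phi> k))"
proof -
  have rep: "\<rho> \<in> unitary_reps G T" using r by (simp add: H_det_def)
  obtain d where "rep_chain G T \<phi> \<mu> \<rho> d" using rep by (rule rep_chainI)
  then interpret rep_chain G T \<phi> \<mu> \<rho> d k .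
  show ?thesis by (rule det_pos_imp_strong[OF P]) (use r ij in \<open>simp_all add: H_det_def rep_dim\<close>)
qed

lemma H_det_subset_H_strong: "H_det G T \<phi> \<mu> \<subseteq> H_strong G T \<phi> \<mu>"
proof
  fix \<rho> assume r: "\<rho> \<in> H_det G T \<phi> \<mu>"
  obtain P where P: "P \<in> extreme_measures (solutions G T \<phi> \<mu>)" using ex_extreme_solution by blast
  show "\<rho> \<in> H_strong G T \<phi> \<mu>" unfolding H_strong_def
    using r P extreme_coefficient_measurable[OF P r] by (auto simp: H_det_def)
qed

text \<open>
  Two points of \<open>G k\<close> are distinguished by a coefficient of a representation of \<open>G k\<close>. Pulling back disjoint
  neighbourhoods of its two values separates the points by open sets with measurable preimage.
\<close>

lemma coordinate_measurable:
  assumes P: "P \<in> extreme_measures (solutions G T \<phi> \<mu>)" and all: "H_det G T \<phi> \<mu> = unitary_reps G T"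
  shows "(\<lambda>x. x k) \<in> augment P (F_Z G T \<phi> k) \<rightarrow>\<^sub>M borel_of (T k)"
proof -
  have S: "P \<in> solutions G T \<phi> \<mu>" using P by (simp add: extreme_measures_def)
  then have Pb: "P \<in> borel_prob (prod_top T)" using solutions_iff by blast
  note sP = borel_probD(2,3)[OF Pb]
  interpret K: compact_sc "T k" by (rule csc)
  interpret C: compact_group "T k" "G k" by unfold_locales (rule tg)
  show ?thesis
  proof (rule K.measurable_of_separating_open_sets)
    show "x k \<in> topspace (T k)" if "x \<in> space (augment P (F_Z G T \<phi> k))" for x
      using coord_in[of x k] that by (simp add: sP)
    fix a b assume "a \<in> topspace (T k)" "b \<in> topspace (T k)" "a \<noteq> b"
    from C.representations_separate_points[OF this] obtain n \<sigma> i j where n: "n > 0" and hom: "\<sigma> \<in> hom (G k) (unitary_group n)"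
      and cont: "\<And>i j. i < n \<Longrightarrow> j < n \<Longrightarrow> continuous_map (T k) euclidean (\<lambda>x. \<sigma> x $$ (i, j))"
      and ij: "i < n" "j < n" and ne: "\<sigma> a $$ (i, j) \<noteq> \<sigma> b $$ (i, j)"
      by blast
    let ?r = "\<lambda>x. \<sigma> (x k)"
    have r: "?r \<in> unitary_reps G T" by (rule coordinate_representation[OF n hom cont])
    have "dim_row (\<sigma> \<one>\<^bsub>G k\<^esub>) = n"
      using unitary_carrier[OF hom_in_carrier[OF hom monoid.one_closed[OF group.is_monoid[OF grp]]]] by auto
    then have dim: "rep_dim G ?r = n" by (simp add: rep_dim_def product_group_def)
    have m: "(\<lambda>x. \<sigma> (x k) $$ (i, j)) \<in> borel_measurable (augment P (F_Z G T \<phi> k))"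
      using extreme_coefficient_measurable[OF P, of ?r i j k] r ij unfolding all dim by (simp add: emb_def)
    obtain U V where UV: "open U" "open V" "\<sigma> a $$ (i, j) \<in> U" "\<sigma> b $$ (i, j) \<in> V" "U \<inter> V = {}"
      using hausdorff[OF ne] by blast
    let ?U = "{x \<in> topspace (T k). \<sigma> x $$ (i, j) \<in> U}" and ?V = "{x \<in> topspace (T k). \<sigma> x $$ (i, j) \<in> V}"
    have "openin (T k) ?U" "openin (T k) ?V"
      using openin_continuous_map_preimage[OF cont[OF ij]] UV(1,2) by simp_all
    moreover have "(\<lambda>x. x k) -` ?U \<inter> space (augment P (F_Z G T \<phi> k)) \<in> sets (augment P (F_Z G T \<phi> k))"
    proof -
      have "(\<lambda>x. x k) -` ?U \<inter> space (augment P (F_Z G T \<phi> k)) = (\<lambda>x. \<sigma> (x k) $$ (i, j)) -` U \<inter> space (augment P (F_Z G T \<phi> k))"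
        using coord_in by (auto simp: sP)
      then show ?thesis using measurable_sets[OF m] UV(1) by simp
    qed
    moreover have "a \<in> ?U" "b \<in> ?V" "?U \<inter> ?V = {}"
      using UV \<open>a \<in> topspace (T k)\<close> \<open>b \<in> topspace (T k)\<close> by auto
    ultimately show "\<exists>U V. openin (T k) U \<and> openin (T k) V \<and> a \<in> U \<and> b \<in> V \<and> U \<inter> V = {} \<and>
        (\<lambda>x. x k) -` U \<inter> space (augment P (F_Z G T \<phi> k)) \<in> sets (augment P (F_Z G T \<phi> k))" by blast
  qed
qed

lemma strong_solution_exists:
  assumes "H_det G T \<phi> \<mu> = unitary_reps G T" shows "strong_solutions G T \<phi> \<mu> \<noteq> {}"
proof -
  obtain P where P: "P \<in> extreme_measures (solutions G T \<phi> \<mu>)" using ex_extreme_solution by blast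
  then have "P \<in> strong_solutions G T \<phi> \<mu>"
    using coordinate_measurable[OF P assms] by (simp add: strong_solutions_def extreme_measures_def)
  then show ?thesis by blast
qed

lemma unitary_reps_subset_H_norm:
  assumes P: "P \<in> strong_solutions G T \<phi> \<mu>" shows "unitary_reps G T \<subseteq> H_norm G T \<phi> \<mu>"
proof
  fix \<rho> assume rep: "\<rho> \<in> unitary_reps G T"
  have S: "P \<in> solutions G T \<phi> \<mu>" and m: "\<And>k. (\<lambda>x. x k) \<in> augment P (F_Z G T \<phi> k) \<rightarrow>\<^sub>M borel_of (T k)"
    using P by (simp_all add: strong_solutions_def)
  obtain d where "rep_chain G T \<phi> \<mu> \<rho> d" using rep by (rule rep_chainI)
  then interpret rep_chain G T \<phi> \<mu> \<rho> d k for k .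
  have "(\<lambda>x. \<rho> (emb G k (x k)) $$ (i, j)) \<in> borel_measurable (augment P (F_Z G T \<phi> k))" if ij: "i < d" "j < d" for k i j
  proof -
    have "continuous_map (T k) euclidean (\<lambda>h. \<rho> (emb G k h) $$ (i, j))"
      using continuous_map_compose[OF emb_cont rho_cont[OF ij], of k] by (simp add: comp_def)
    from measurable_compose[OF m continuous_map_borel_measurable[OF this]] show ?thesis .
  qed
  then show "\<rho> \<in> H_norm G T \<phi> \<mu>" unfolding H_norm_def using rep strong_imp_norm_pos[OF S] by simp
qed

end

theorem theorem3p7:
  fixes G :: "nat \<Rightarrow> 'a monoid"
    and T :: "nat \<Rightarrow> 'a topology"
    and \<phi> :: "nat \<Rightarrow> 'a \<Rightarrow> 'a"
    and \<mu> :: "nat \<Rightarrow> 'a measure"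
  assumes "\<And>k. topological_group (G k) (T k)"
    and "\<And>k. compact_space (T k)"
    and "\<And>k. Hausdorff_space (T k)"
    and "\<And>k. second_countable (T k)"
    and "\<And>k. \<phi> k \<in> hom (G (Suc k)) (G k)"
    and "\<And>k. continuous_map (T (Suc k)) (T k) (\<phi> k)"
    and "\<And>k. \<mu> k \<in> borel_prob (T k)"
  shows "H_strong G T \<phi> \<mu> \<subseteq> H_norm G T \<phi> \<mu>
    \<and> H_det G T \<phi> \<mu> \<subseteq> H_strong G T \<phi> \<mu>
    \<and> (H_det G T \<phi> \<mu> = unitary_reps G T \<longrightarrow> strong_solutions G T \<phi> \<mu> \<noteq> {})
    \<and> (H_norm G T \<phi> \<mu> \<noteq> unitary_reps G T \<longrightarrow> strong_solutions G T \<phi> \<mu> = {})"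
proof -
  interpret group_chain G T \<phi> \<mu>
    by unfold_locales (use assms in \<open>simp_all add: compact_sc_def\<close>)
  have "H_norm G T \<phi> \<mu> = unitary_reps G T" if "strong_solutions G T \<phi> \<mu> \<noteq> {}"
    using that unitary_reps_subset_H_norm unfolding H_norm_def by blast
  then show ?thesis
    using H_strong_subset_H_norm H_det_subset_H_strong strong_solution_exists by blast
qed

end
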